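(* Let $R$ be a local ring of Krull dimension one with regular maximal ideal $M$, let $m\in M$ be a nonzerodivisor, let $J=\bigcap_{i>0}m^iR$, and let $\widetilde{R}$ be the $mR$-adic completion of $R$. The following are equivalent: (1) $R$ is a stable ring without finite integral closure. (2) $R/J$ is a stable ring without finite integral closure. (3) There exists a nonzero prime ideal $P$ of $\widetilde{R}$ such that $P^2=0$ and $\widetilde{R}/P$ is a DVR.
   Context: All rings are commutative with identity; a local ring is a ring with a unique maximal ideal (not necessarily Noetherian). $Q(R)$ is the total ring of quotients and $\overline{R}$ the integral closure of $R$ in $Q(R)$; $R$ has finite integral closure if $\overline R$ is a finitely generated $R$-module. An ideal is regular if it contains a nonzerodivisor. For a regular fractional ideal $I$ (an $R$-submodule of $Q(R)$ containing a nonzerodivisor with $bI\subseteq R$ for some nonzerodivisor $b\in R$), $E(I)=\{q\in Q(R):qI\subseteq I\}$, and $I$ is stable if it is projective as an $E(I)$-module; $R$ is stable if every regular ideal is stable. DVR means rank one discrete valuation ring. ($J$ and $\widetilde R$ do not depend on the choice of $m$.) *)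

theory Defs
  imports "HOL-Algebra.QuotRing" "HOL-Algebra.Ideal_Product"
begin

definition nzd :: "('a, 'b) ring_scheme \<Rightarrow> 'a set" where
  "nzd R = {s \<in> carrier R. \<forall>x\<in>carrier R. s \<otimes>\<^bsub>R\<^esub> x = \<zero>\<^bsub>R\<^esub> \<longrightarrow> x = \<zero>\<^bsub>R\<^esub>}"

definition regular_ideal :: "('a, 'b) ring_scheme \<Rightarrow> 'a set \<Rightarrow> bool" where
  "regular_ideal R I \<longleftrightarrow> ideal I R \<and> I \<inter> nzd R \<noteq> {}"

definition local_ring :: "('a, 'b) ring_scheme \<Rightarrow> bool" where
  "local_ring R \<longleftrightarrow> cring R \<and> (\<exists>!M. maximalideal M R)"

definition krull_dim_one :: "('a, 'b) ring_scheme \<Rightarrow> bool" where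
  "krull_dim_one R \<longleftrightarrow>
     (\<exists>P0 P1. primeideal P0 R \<and> primeideal P1 R \<and> P0 \<subset> P1) \<and>
     \<not> (\<exists>P0 P1 P2. primeideal P0 R \<and> primeideal P1 R \<and> primeideal P2 R \<and> P0 \<subset> P1 \<and> P1 \<subset> P2)"

definition frac_rel :: "('a, 'b) ring_scheme \<Rightarrow> (('a \<times> 'a) \<times> ('a \<times> 'a)) set" where
  "frac_rel R = {((a, s), (b, t)). a \<in> carrier R \<and> b \<in> carrier R \<and> s \<in> nzd R \<and> t \<in> nzd R \<and>
                   a \<otimes>\<^bsub>R\<^esub> t = b \<otimes>\<^bsub>R\<^esub> s}"

definition frac_class :: "('a, 'b) ring_scheme \<Rightarrow> 'a \<Rightarrow> 'a \<Rightarrow> ('a \<times> 'a) set" where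
  "frac_class R a s = frac_rel R `` {(a, s)}"

definition qmult :: "('a, 'b) ring_scheme \<Rightarrow> ('a \<times> 'a) set \<Rightarrow> ('a \<times> 'a) set \<Rightarrow> ('a \<times> 'a) set" where
  "qmult R A B = \<Union>{frac_class R (a \<otimes>\<^bsub>R\<^esub> b) (s \<otimes>\<^bsub>R\<^esub> t) | a s b t. (a, s) \<in> A \<and> (b, t) \<in> B}"

definition qadd :: "('a, 'b) ring_scheme \<Rightarrow> ('a \<times> 'a) set \<Rightarrow> ('a \<times> 'a) set \<Rightarrow> ('a \<times> 'a) set" where
  "qadd R A B = \<Union>{frac_class R (a \<otimes>\<^bsub>R\<^esub> t \<oplus>\<^bsub>R\<^esub> b \<otimes>\<^bsub>R\<^esub> s) (s \<otimes>\<^bsub>R\<^esub> t)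
                       | a s b t. (a, s) \<in> A \<and> (b, t) \<in> B}"

definition qcarrier :: "('a, 'b) ring_scheme \<Rightarrow> ('a \<times> 'a) set set" where
  "qcarrier R = (carrier R \<times> nzd R) // frac_rel R"

definition Qring :: "('a, 'b) ring_scheme \<Rightarrow> ('a \<times> 'a) set ring" where
  "Qring R = \<lparr> carrier = qcarrier R,
     mult = qmult R,
     one = frac_class R (\<one>\<^bsub>R\<^esub>) (\<one>\<^bsub>R\<^esub>),
     zero = frac_class R (\<zero>\<^bsub>R\<^esub>) (\<one>\<^bsub>R\<^esub>),
     add = qadd R \<rparr>"

definition qemb :: "('a, 'b) ring_scheme \<Rightarrow> 'a \<Rightarrow> ('a \<times> 'a) set" where
  "qemb R a = frac_class R a (\<one>\<^bsub>R\<^esub>)"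

definition integral_over :: "('a, 'b) ring_scheme \<Rightarrow> ('a \<times> 'a) set \<Rightarrow> bool" where
  "integral_over R x \<longleftrightarrow> x \<in> carrier (Qring R) \<and>
     (\<exists>n::nat. \<exists>c::nat \<Rightarrow> 'a. (\<forall>i<n. c i \<in> carrier R) \<and>
        x [^]\<^bsub>Qring R\<^esub> n \<oplus>\<^bsub>Qring R\<^esub>
          (\<Oplus>\<^bsub>Qring R\<^esub> i\<in>{..<n}. qemb R (c i) \<otimes>\<^bsub>Qring R\<^esub> x [^]\<^bsub>Qring R\<^esub> i) = \<zero>\<^bsub>Qring R\<^esub>)"

definition int_closure :: "('a, 'b) ring_scheme \<Rightarrow> ('a \<times> 'a) set set" where
  "int_closure R = {x. integral_over R x}"

definition finite_int_closure :: "('a, 'b) ring_scheme \<Rightarrow> bool" where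
  "finite_int_closure R \<longleftrightarrow>
     (\<exists>G. finite G \<and> G \<subseteq> int_closure R \<and>
        (\<forall>x\<in>int_closure R. \<exists>r\<in>G \<rightarrow> carrier R.
            x = (\<Oplus>\<^bsub>Qring R\<^esub> g\<in>G. qemb R (r g) \<otimes>\<^bsub>Qring R\<^esub> g)))"

definition endo_ring :: "('c, 'd) ring_scheme \<Rightarrow> 'c set \<Rightarrow> 'c set" where
  "endo_ring Q I = {q \<in> carrier Q. \<forall>y\<in>I. q \<otimes>\<^bsub>Q\<^esub> y \<in> I}"

text \<open>\<open>I \<subseteq> Q\<close> is projective as a module over the subring \<open>E \<subseteq> Q\<close> (module structure given by
  multiplication of \<open>Q\<close>): the canonical surjection from the free \<open>E\<close>-module on the set \<open>I\<close>
  (finitely supported functions \<open>I \<rightarrow> E\<close>) onto \<open>I\<close>, \<open>\<phi> \<mapsto> \<Sum>\<^sub>x \<phi>(x) x\<close>, has an \<open>E\<close>-linear section,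
  i.e. \<open>I\<close> is a direct summand of a free \<open>E\<close>-module.\<close>
definition projective_over :: "('c, 'd) ring_scheme \<Rightarrow> 'c set \<Rightarrow> 'c set \<Rightarrow> bool" where
  "projective_over Q E I \<longleftrightarrow>
     (\<exists>s :: 'c \<Rightarrow> 'c \<Rightarrow> 'c.
        (\<forall>y\<in>I. (\<forall>x\<in>I. s y x \<in> E) \<and> finite {x\<in>I. s y x \<noteq> \<zero>\<^bsub>Q\<^esub>}) \<and>
        (\<forall>y\<in>I. \<forall>z\<in>I. \<forall>x\<in>I. s (y \<oplus>\<^bsub>Q\<^esub> z) x = s y x \<oplus>\<^bsub>Q\<^esub> s z x) \<and>
        (\<forall>e\<in>E. \<forall>y\<in>I. \<forall>x\<in>I. s (e \<otimes>\<^bsub>Q\<^esub> y) x = e \<otimes>\<^bsub>Q\<^esub> s y x) \<and>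
        (\<forall>y\<in>I. y = (\<Oplus>\<^bsub>Q\<^esub> x\<in>{x\<in>I. s y x \<noteq> \<zero>\<^bsub>Q\<^esub>}. s y x \<otimes>\<^bsub>Q\<^esub> x)))"

definition stable_frac :: "('c, 'd) ring_scheme \<Rightarrow> 'c set \<Rightarrow> bool" where
  "stable_frac Q I \<longleftrightarrow> projective_over Q (endo_ring Q I) I"

definition stable_ring :: "('a, 'b) ring_scheme \<Rightarrow> bool" where
  "stable_ring R \<longleftrightarrow> (\<forall>I. regular_ideal R I \<longrightarrow> stable_frac (Qring R) (qemb R ` I))"

text \<open>The \<open>mR\<close>-adic completion \<open>lim\<^sub>\<leftarrow> R/m\<^sup>iR\<close>, realised as compatible sequences of cosets.\<close>
definition adic_completion :: "('a, 'b) ring_scheme \<Rightarrow> 'a \<Rightarrow> (nat \<Rightarrow> 'a set) ring" where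
  "adic_completion R m =
     \<lparr> carrier = {f. \<forall>i. f i \<in> carrier (R Quot (PIdl\<^bsub>R\<^esub> (m [^]\<^bsub>R\<^esub> i))) \<and> f (Suc i) \<subseteq> f i},
       mult = (\<lambda>f g i. f i \<otimes>\<^bsub>R Quot (PIdl\<^bsub>R\<^esub> (m [^]\<^bsub>R\<^esub> i))\<^esub> g i),
       one = (\<lambda>i. \<one>\<^bsub>R Quot (PIdl\<^bsub>R\<^esub> (m [^]\<^bsub>R\<^esub> i))\<^esub>),
       zero = (\<lambda>i. \<zero>\<^bsub>R Quot (PIdl\<^bsub>R\<^esub> (m [^]\<^bsub>R\<^esub> i))\<^esub>),
       add = (\<lambda>f g i. f i \<oplus>\<^bsub>R Quot (PIdl\<^bsub>R\<^esub> (m [^]\<^bsub>R\<^esub> i))\<^esub> g i) \<rparr>"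

text \<open>Rank one discrete valuation ring: a domain that is the valuation ring of a discrete
  valuation with value group \<open>\<int>\<close>; the valuation \<open>v\<close> is recorded on nonzero elements of the
  ring (it extends to the fraction field by \<open>v(a/b) = v a - v b\<close>), and \<open>a/b\<close> lies in the ring
  iff \<open>v a \<ge> v b\<close>.\<close>
definition DVR :: "('a, 'b) ring_scheme \<Rightarrow> bool" where
  "DVR S \<longleftrightarrow> domain S \<and>
     (\<exists>v :: 'a \<Rightarrow> nat.
        (\<forall>a\<in>carrier S - {\<zero>\<^bsub>S\<^esub>}. \<forall>b\<in>carrier S - {\<zero>\<^bsub>S\<^esub>}. v (a \<otimes>\<^bsub>S\<^esub> b) = v a + v b) \<and>
        (\<forall>a\<in>carrier S - {\<zero>\<^bsub>S\<^esub>}. \<forall>b\<in>carrier S - {\<zero>\<^bsub>S\<^esub>}.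
            a \<oplus>\<^bsub>S\<^esub> b \<noteq> \<zero>\<^bsub>S\<^esub> \<longrightarrow> min (v a) (v b) \<le> v (a \<oplus>\<^bsub>S\<^esub> b)) \<and>
        (\<exists>t\<in>carrier S - {\<zero>\<^bsub>S\<^esub>}. v t = 1) \<and>
        (\<forall>a\<in>carrier S - {\<zero>\<^bsub>S\<^esub>}. \<forall>b\<in>carrier S - {\<zero>\<^bsub>S\<^esub>}. (\<exists>c\<in>carrier S. b = a \<otimes>\<^bsub>S\<^esub> c) \<longleftrightarrow> v a \<le> v b))"

end

theory Submission
  imports Defs "HOL-Algebra.Subrings"
begin

text \<open>Condition (3) implies (1): let \<open>I\<close> be a regular ideal and choose \<open>i \<in> I\<close> of least value in the DVR
  \<open>C/P\<close>, where \<open>C\<close> is the completion. For \<open>x = ai + p\<close> and \<open>y = bi + q\<close> with \<open>p, q \<in> P\<close>, the equation \<open>pq = 0\<close>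
  becomes \<open>xy = i(bx + ay - abi)\<close>, hence \<open>I\<^sup>2 = iI\<close> and \<open>I = iE(I)\<close>. If \<open>r \<in> R\<close> approximates an element of \<open>P\<close>
  modulo a high power \<open>m\<^sup>k\<close>, then \<open>r/m\<^sup>k\<close> satisfies a monic quadratic equation over \<open>R\<close>; these elements
  have unbounded denominators.

  Condition (1) implies (3): put \<open>R\<^sub>0 = R\<close> and let \<open>R\<^sub>i\<^sub>+\<^sub>1\<close> be the endomorphism ring of the maximal ideal of
  \<open>R\<^sub>i\<close>. Stability makes every intermediate subspace of the residue algebra of \<open>R\<^sub>i\<^sub>+\<^sub>1\<close> over the residue field of
  \<open>R\<^sub>i\<close> a ring, so this algebra is either an extension by a square-zero ideal or reduced of dimension at most two,
  and the second case would yield a finite integral closure. Hence all the maximal ideals are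
  \<open>xR\<^sub>i\<^sub>+\<^sub>1\<close> for a single \<open>x\<close>, the union \<open>B\<close> of the chain satisfies \<open>B = R + xB\<close>, and \<open>yz \<in> R + Ry + Rz\<close>
  for all \<open>y, z \<in> B\<close>. The kernel of the map from the completion of \<open>R\<close> to that of \<open>B\<close> is the required prime.

  The rings \<open>R\<close> and \<open>R/J\<close> have the same completion, which gives the equivalence with (2).\<close>

text \<open>Nothing here is Noetherian, so projectivity is turned into a statement free of
  finiteness: for a regular fractional ideal \<open>W\<close>, 1 is a sum of products
  \<open>qx\<close> with \<open>x\<close> in \<open>W\<close> and \<open>qW\<close> inside
  \<open>E(W)\<close>. Testing this against an additively closed set \<open>N\<close> that omits 1
  yields one product outside \<open>N\<close>; the choice of \<open>N\<close> (a maximal ideal, the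
  elements with square in it, a component of an idempotent splitting) makes that product a unit or
  gives it a nonzero component. Infinite integral closure enters as the absence of an overring
  \<open>R + Rz\<close> whose quotient by some regular element is reduced. This excludes the reduced
  case at each stage of the chain and lets one \<open>x\<close> serve all stages. The completion of
  \<open>B\<close> is never formed. Because \<open>B = R + x^j B\<close>, the quotient
  \<open>B/x^j B\<close> is \<open>R\<close> modulo \<open>R \<inter> x^j B\<close>, so a filtration
  of \<open>R\<close> by ideals carries the argument. The element \<open>x\<close> found on the way
  may differ from \<open>m\<close>, but each divides a power of the other.\<close>

lemma (in cring) exists_prime_avoiding:
  assumes I: "ideal I R" and S: "S \<subseteq> carrier R" "\<one> \<in> S" "\<And>a b. a \<in> S \<Longrightarrow> b \<in> S \<Longrightarrow> a \<otimes> b \<in> S"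
    and disj: "I \<inter> S = {}"
  obtains P where "primeideal P R" "I \<subseteq> P" "P \<inter> S = {}"
    "\<And>J. ideal J R \<Longrightarrow> P \<subseteq> J \<Longrightarrow> J \<inter> S = {} \<Longrightarrow> J = P"
proof -
  let ?F = "{J. ideal J R \<and> I \<subseteq> J \<and> J \<inter> S = {}}"
  have ne: "?F \<noteq> {}" using I disj by blast
  have ub: "\<Union>C \<in> ?F" if C: "C \<noteq> {}" "subset.chain ?F C" for C
  proof -
    have "ideal (\<Union>C) R"
    proof -
      have sub: "\<And>J. J \<in> C \<Longrightarrow> ideal J R" using C(2) by (auto simp: subset.chain_def)
      have tot: "\<And>J K. J \<in> C \<Longrightarrow> K \<in> C \<Longrightarrow> J \<subseteq> K \<or> K \<subseteq> J" using C(2) unfolding subset.chain_def by blast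
      show ?thesis
      proof (rule idealI[OF ring_axioms])
        show "subgroup (\<Union>C) (add_monoid R)"
        proof (rule subgroup.intro)
          show "\<Union>C \<subseteq> carrier (add_monoid R)" using ideal.Icarr[OF sub] by auto
          show "\<one>\<^bsub>add_monoid R\<^esub> \<in> \<Union>C" using C(1) additive_subgroup.zero_closed[OF ideal.axioms(1)[OF sub]]
            by auto
          show "x \<otimes>\<^bsub>add_monoid R\<^esub> y \<in> \<Union>C" if xy: "x \<in> \<Union>C" "y \<in> \<Union>C" for x y
          proof -
            obtain J K where J: "J \<in> C" "x \<in> J" "K \<in> C" "y \<in> K" using xy by blast
            then obtain L where "L \<in> C" "x \<in> L" "y \<in> L" using tot by blast
            then show ?thesis using additive_subgroup.a_closed[OF ideal.axioms(1)[OF sub]] by auto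
          qed
          show "inv\<^bsub>add_monoid R\<^esub> x \<in> \<Union>C" if x: "x \<in> \<Union>C" for x
          proof -
            obtain J where J: "J \<in> C" "x \<in> J" using x by blast
            then have "\<ominus> x \<in> J" using additive_subgroup.a_inv_closed[OF ideal.axioms(1)[OF sub]] by auto
            then show ?thesis using J by (auto simp: a_inv_def)
          qed
        qed
      next
        fix a x assume a: "a \<in> \<Union>C" "x \<in> carrier R"
        then obtain J where J: "J \<in> C" "a \<in> J" by blast
        then show "x \<otimes> a \<in> \<Union>C" "a \<otimes> x \<in> \<Union>C"
          using ideal.I_l_closed[OF sub[OF J(1)] J(2) a(2)] ideal.I_r_closed[OF sub[OF J(1)] J(2) a(2)]
          by blast+
      qed
    qed
    moreover have "C \<subseteq> ?F" using C(2) unfolding subset.chain_def by blast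
    ultimately show ?thesis using C(1) by blast
  qed
  have "\<exists>M\<in>?F. \<forall>X\<in>?F. M \<subseteq> X \<longrightarrow> X = M"
    by (rule subset_Zorn_nonempty[OF ne ub])
  then obtain P where P: "P \<in> ?F" and max: "\<And>J. J \<in> ?F \<Longrightarrow> P \<subseteq> J \<Longrightarrow> J = P"
    by auto
  interpret P: ideal P R using P by simp
  have "primeideal P R"
  proof (rule primeidealI[OF P.ideal_axioms cring_axioms])
    show "carrier R \<noteq> P" using P S by auto
    fix a b assume ab: "a \<in> carrier R" "b \<in> carrier R" "a \<otimes> b \<in> P"
    show "a \<in> P \<or> b \<in> P"
    proof (rule ccontr)
      assume "\<not> ?thesis"
      then have n: "a \<notin> P" "b \<notin> P" by auto
      have key: "\<exists>p\<in>P. \<exists>c\<in>carrier R. p \<oplus> c \<otimes> d \<in> S" if d: "d \<in> carrier R" "d \<notin> P" for d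
      proof -
        have i: "ideal (P <+>\<^bsub>R\<^esub> PIdl d) R" using add_ideals[OF P.ideal_axioms cgenideal_ideal[OF d(1)]] .
        have "d \<in> P <+>\<^bsub>R\<^esub> PIdl d" "P \<subseteq> P <+>\<^bsub>R\<^esub> PIdl d"
        proof -
          have "d = \<zero> \<oplus> d" using d by simp
          then show "d \<in> P <+>\<^bsub>R\<^esub> PIdl d" using cgenideal_self[OF d(1)] P.zero_closed
            by (auto simp: set_add_def')
          show "P \<subseteq> P <+>\<^bsub>R\<^esub> PIdl d"
          proof
            fix p assume p: "p \<in> P"
            then have "p = p \<oplus> \<zero> \<otimes> d" using d P.Icarr by simp
            then show "p \<in> P <+>\<^bsub>R\<^esub> PIdl d" using p zero_closed unfolding set_add_def' cgenideal_def by blast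
          qed
        qed
        then have "P <+>\<^bsub>R\<^esub> PIdl d \<notin> ?F" using max d by blast
        then have "(P <+>\<^bsub>R\<^esub> PIdl d) \<inter> S \<noteq> {}" using i P \<open>P \<subseteq> P <+>\<^bsub>R\<^esub> PIdl d\<close> by blast
        then show ?thesis by (auto simp: set_add_def' cgenideal_def)
      qed
      obtain p c where p: "p \<in> P" "c \<in> carrier R" "p \<oplus> c \<otimes> a \<in> S" using key[OF ab(1) n(1)] by blast
      obtain q d where q: "q \<in> P" "d \<in> carrier R" "q \<oplus> d \<otimes> b \<in> S" using key[OF ab(2) n(2)] by blast
      have pc: "p \<in> carrier R" "q \<in> carrier R" using p q P.Icarr by auto
      have "(p \<oplus> c \<otimes> a) \<otimes> (q \<oplus> d \<otimes> b) = (q \<oplus> d \<otimes> b) \<otimes> p \<oplus> (c \<otimes> a) \<otimes> q \<oplus> (c \<otimes> d) \<otimes> (a \<otimes> b)"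
        using p(2) q(2) pc ab(1,2) by algebra
      moreover have "\<dots> \<in> P" using p q pc ab by (auto intro!: P.a_closed P.I_l_closed)
      ultimately show False using S(3)[OF p(3) q(3)] P by auto
    qed
  qed
  \<comment> \<open>Maximality is recorded besides primeness: for \<open>S = {\<one>}\<close> it
    says that \<open>P\<close> is a maximal ideal of the ring.\<close>
  moreover have "J = P" if "ideal J R" "P \<subseteq> J" "J \<inter> S = {}" for J
    using max[of J] that P by auto
  ultimately show ?thesis using that P by blast
qed

section \<open>Algebras whose subspaces containing one are rings\<close>

text \<open>With \<open>T = {}\<close> this is only an additive submonoid, the kind of set against
  which \<open>invertible_frac\<close> tests; over a subring \<open>T\<close>, negatives come from
  \<open>\<ominus> \<one>\<close> in \<open>T\<close>. One predicate thus covers ideals and modules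
  of all subrings of a fixed ring.\<close>

definition smod :: "('a, 'b) ring_scheme \<Rightarrow> 'a set \<Rightarrow> 'a set \<Rightarrow> bool" where
  "smod R T W \<longleftrightarrow> W \<subseteq> carrier R \<and> \<zero>\<^bsub>R\<^esub> \<in> W \<and> (\<forall>a\<in>W. \<forall>b\<in>W. a \<oplus>\<^bsub>R\<^esub> b \<in> W) \<and>
     (\<forall>t\<in>T. \<forall>a\<in>W. t \<otimes>\<^bsub>R\<^esub> a \<in> W)"

lemma smodD:
  assumes "smod R T W"
  shows "a \<in> W \<Longrightarrow> a \<in> carrier R" "\<zero>\<^bsub>R\<^esub> \<in> W" "a \<in> W \<Longrightarrow> b \<in> W \<Longrightarrow> a \<oplus>\<^bsub>R\<^esub> b \<in> W"
    "t \<in> T \<Longrightarrow> a \<in> W \<Longrightarrow> t \<otimes>\<^bsub>R\<^esub> a \<in> W"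
  using assms by (auto simp: smod_def)

lemma (in cring) smod_minus:
  assumes "smod R T W" "subring T R" "a \<in> W"
  shows "\<ominus> a \<in> W" "b \<in> W \<Longrightarrow> b \<ominus> a \<in> W"
proof -
  have c: "a \<in> carrier R" using smodD(1)[OF assms(1,3)] .
  have "\<ominus> \<one> \<in> T" using assms(2) by (simp add: subringE)
  then have "(\<ominus> \<one>) \<otimes> a \<in> W" using smodD(4)[OF assms(1)] assms(3) by blast
  then show m: "\<ominus> a \<in> W" using c by (simp add: l_minus)
  show "b \<ominus> a \<in> W" if "b \<in> W" using smodD(3)[OF assms(1) that m] by (simp add: minus_eq)
qed

lemma (in cring) smod_span2:
  assumes T: "subring T R" and y: "y \<in> carrier R" "z \<in> carrier R"
  shows "smod R T {p \<otimes> y \<oplus> q \<otimes> z | p q. p \<in> T \<and> q \<in> T}"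
proof -
  have Tc: "\<And>a. a \<in> T \<Longrightarrow> a \<in> carrier R" using subringE(1)[OF T] by auto
  have 1: "\<exists>p q. \<zero> = p \<otimes> y \<oplus> q \<otimes> z \<and> p \<in> T \<and> q \<in> T"
    by (rule exI[of _ \<zero>], rule exI[of _ \<zero>]) (use y subringE(2)[OF T] in simp)
  have 2: "\<exists>p'' q''. p \<otimes> y \<oplus> q \<otimes> z \<oplus> (p' \<otimes> y \<oplus> q' \<otimes> z) = p'' \<otimes> y \<oplus> q'' \<otimes> z \<and> p'' \<in> T \<and> q'' \<in> T"
    if "p \<in> T" "q \<in> T" "p' \<in> T" "q' \<in> T" for p q p' q'
  proof -
    note c = Tc[OF that(1)] Tc[OF that(2)] Tc[OF that(3)] Tc[OF that(4)]
    have "p \<otimes> y \<oplus> q \<otimes> z \<oplus> (p' \<otimes> y \<oplus> q' \<otimes> z) = (p \<oplus> p') \<otimes> y \<oplus> (q \<oplus> q') \<otimes> z"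
      using c y by algebra
    then show ?thesis using subringE(7)[OF T] that by blast
  qed
  have 3: "\<exists>p'' q''. t \<otimes> (p \<otimes> y \<oplus> q \<otimes> z) = p'' \<otimes> y \<oplus> q'' \<otimes> z \<and> p'' \<in> T \<and> q'' \<in> T"
    if "p \<in> T" "q \<in> T" "t \<in> T" for p q t
  proof -
    note c = Tc[OF that(1)] Tc[OF that(2)] Tc[OF that(3)]
    have "t \<otimes> (p \<otimes> y \<oplus> q \<otimes> z) = (t \<otimes> p) \<otimes> y \<oplus> (t \<otimes> q) \<otimes> z"
      using c y by algebra
    then show ?thesis using subringE(6)[OF T] that by blast
  qed
  show ?thesis unfolding smod_def using 1 2 3 Tc y by (auto simp del: Product_Type.split_paired_Ex)
qed

lemma (in cring) smod_span3:
  assumes T: "subring T R" and y: "y \<in> carrier R" "z \<in> carrier R"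
  shows "smod R T {r \<oplus> p \<otimes> y \<oplus> q \<otimes> z | r p q. r \<in> T \<and> p \<in> T \<and> q \<in> T}"
proof -
  have Tc: "\<And>a. a \<in> T \<Longrightarrow> a \<in> carrier R" using subringE(1)[OF T] by auto
  have 1: "\<exists>r p q. \<zero> = r \<oplus> p \<otimes> y \<oplus> q \<otimes> z \<and> r \<in> T \<and> p \<in> T \<and> q \<in> T"
    by (rule exI[of _ \<zero>], rule exI[of _ \<zero>], rule exI[of _ \<zero>]) (use y subringE(2)[OF T] in simp)
  have 2: "\<exists>r'' p'' q''. r \<oplus> p \<otimes> y \<oplus> q \<otimes> z \<oplus> (r' \<oplus> p' \<otimes> y \<oplus> q' \<otimes> z) = r'' \<oplus> p'' \<otimes> y \<oplus> q'' \<otimes> z \<and> r'' \<in> T \<and>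
    p'' \<in> T \<and> q'' \<in> T"
    if "p \<in> T" "q \<in> T" "p' \<in> T" "q' \<in> T" "r \<in> T" "r' \<in> T" for p q p' q' r r'
  proof -
    note c = Tc[OF that(1)] Tc[OF that(2)] Tc[OF that(3)] Tc[OF that(4)] Tc[OF that(5)] Tc[OF that(6)]
    have "r \<oplus> p \<otimes> y \<oplus> q \<otimes> z \<oplus> (r' \<oplus> p' \<otimes> y \<oplus> q' \<otimes> z) = (r \<oplus> r') \<oplus> (p \<oplus> p') \<otimes> y \<oplus> (q \<oplus> q') \<otimes> z"
      using c y by algebra
    then show ?thesis using subringE(7)[OF T] that by blast
  qed
  have 3: "\<exists>r'' p'' q''. t \<otimes> (r \<oplus> p \<otimes> y \<oplus> q \<otimes> z) = r'' \<oplus> p'' \<otimes> y \<oplus> q'' \<otimes> z \<and> r'' \<in> T \<and> p'' \<in> T \<and> q'' \<in> T"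
    if "p \<in> T" "q \<in> T" "t \<in> T" "r \<in> T" for p q t r
  proof -
    note c = Tc[OF that(1)] Tc[OF that(2)] Tc[OF that(3)] Tc[OF that(4)]
    have "t \<otimes> (r \<oplus> p \<otimes> y \<oplus> q \<otimes> z) = t \<otimes> r \<oplus> (t \<otimes> p) \<otimes> y \<oplus> (t \<otimes> q) \<otimes> z"
      using c y by algebra
    then show ?thesis using subringE(6)[OF T] that by blast
  qed
  show ?thesis unfolding smod_def using 1 2 3 Tc y by (auto simp del: Product_Type.split_paired_Ex)
qed

lemma (in cring) span3_mem:
  assumes T: "subring T R" and y: "y \<in> carrier R" "z \<in> carrier R"
  shows "r \<in> T \<Longrightarrow> r \<in> {r \<oplus> p \<otimes> y \<oplus> q \<otimes> z | r p q. r \<in> T \<and> p \<in> T \<and> q \<in> T}"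
    "y \<in> {r \<oplus> p \<otimes> y \<oplus> q \<otimes> z | r p q. r \<in> T \<and> p \<in> T \<and> q \<in> T}"
    "z \<in> {r \<oplus> p \<otimes> y \<oplus> q \<otimes> z | r p q. r \<in> T \<and> p \<in> T \<and> q \<in> T}"
proof -
  have Tc: "\<And>a. a \<in> T \<Longrightarrow> a \<in> carrier R" using subringE(1)[OF T] by auto
  have "r = r \<oplus> \<zero> \<otimes> y \<oplus> \<zero> \<otimes> z" if "r \<in> T" using Tc[OF that] y by simp
  moreover have "y = \<zero> \<oplus> \<one> \<otimes> y \<oplus> \<zero> \<otimes> z" "z = \<zero> \<oplus> \<zero> \<otimes> y \<oplus> \<one> \<otimes> z" using y by simp_all
  ultimately show "r \<in> T \<Longrightarrow> r \<in> {r \<oplus> p \<otimes> y \<oplus> q \<otimes> z | r p q. r \<in> T \<and> p \<in> T \<and> q \<in> T}"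
    "y \<in> {r \<oplus> p \<otimes> y \<oplus> q \<otimes> z | r p q. r \<in> T \<and> p \<in> T \<and> q \<in> T}"
    "z \<in> {r \<oplus> p \<otimes> y \<oplus> q \<otimes> z | r p q. r \<in> T \<and> p \<in> T \<and> q \<in> T}"
    using subringE(2,3)[OF T] by blast+
qed

text \<open>Models the residue algebra of the endomorphism ring of a maximal ideal over the residue field \<open>k\<close>; the
  last two assumptions are what stability says about the modules between a ring and this endomorphism ring.\<close>
locale quadratic_algebra = cring A for A (structure) +
  fixes k
  assumes subr: "subring k A" and nontriv: "\<one> \<noteq> \<zero>"
    and field: "\<And>a. a \<in> k \<Longrightarrow> a \<noteq> \<zero> \<Longrightarrow> \<exists>b\<in>k. a \<otimes> b = \<one>"
    and subspace_mult: "\<And>W u v. smod A k W \<Longrightarrow> \<one> \<in> W \<Longrightarrow> u \<in> W \<Longrightarrow> v \<in> W \<Longrightarrow> u \<otimes> v \<in> W"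
    and unimodular_principal: "\<And>W a b c d. smod A k W \<Longrightarrow> c \<in> W \<Longrightarrow> d \<in> W \<Longrightarrow> a \<in> carrier A \<Longrightarrow> b \<in> carrier A \<Longrightarrow>
       \<one> = a \<otimes> c \<oplus> b \<otimes> d \<Longrightarrow>
       (\<And>q. q \<in> carrier A \<Longrightarrow> (\<And>w. w \<in> W \<Longrightarrow> q \<otimes> w \<in> W) \<Longrightarrow> q \<in> k) \<Longrightarrow>
       \<exists>x\<in>W. \<forall>w\<in>W. \<exists>a\<in>k. w = a \<otimes> x"
begin

lemma kc [simp]: "a \<in> k \<Longrightarrow> a \<in> carrier A" using subringE(1)[OF subr] by auto
lemmas k_ops [simp] = subringE(2,3)[OF subr] subringE(5,6,7)[OF subr]
lemma k_diff [simp]: "a \<in> k \<Longrightarrow> b \<in> k \<Longrightarrow> a \<ominus> b \<in> k" by (simp add: minus_eq)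

lemma cancel_k: "a \<in> k \<Longrightarrow> a \<noteq> \<zero> \<Longrightarrow> y \<in> carrier A \<Longrightarrow> a \<otimes> y = \<zero> \<Longrightarrow> y = \<zero>"
proof -
  assume a: "a \<in> k" "a \<noteq> \<zero>" "y \<in> carrier A" "a \<otimes> y = \<zero>"
  then obtain b where b: "b \<in> k" "a \<otimes> b = \<one>" using field by blast
  have "y = b \<otimes> (a \<otimes> y)" using a(1,3) b by (metis kc l_one m_assoc m_comm)
  then show ?thesis using a b by simp
qed

text \<open>\<open>k + ky + kz\<close> contains 1 and is therefore closed under multiplication. All
  quadratic relations used below are instances of this one.\<close>

lemma quad3:
  assumes y: "y \<in> carrier A" "z \<in> carrier A"
  obtains r p q where "r \<in> k" "p \<in> k" "q \<in> k" "y \<otimes> z = r \<oplus> p \<otimes> y \<oplus> q \<otimes> z"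
  using subspace_mult[OF smod_span3[OF subr y] span3_mem(1)[OF subr y k_ops(2)] span3_mem(2,3)[OF subr y]]
  by blast

lemma quad2:
  assumes y: "y \<in> carrier A"
  obtains p q where "p \<in> k" "q \<in> k" "y \<otimes> y = p \<oplus> q \<otimes> y"
proof -
  obtain r p q where r: "r \<in> k" "p \<in> k" "q \<in> k" "y \<otimes> y = r \<oplus> p \<otimes> y \<oplus> q \<otimes> y" using quad3[OF y y] by blast
  have "r \<oplus> p \<otimes> y \<oplus> q \<otimes> y = r \<oplus> (p \<oplus> q) \<otimes> y" using kc[OF r(1)] kc[OF r(2)] kc[OF r(3)] y by algebra
  then show ?thesis using that[OF r(1) k_ops(5)[OF r(2,3)]] r(4) by simp
qed

text \<open>Squaring \<open>z + w\<close> would only control \<open>2zw\<close>, which says nothing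
  in characteristic two. Instead the relation \<open>zw = a + bz + dw\<close> is multiplied by
  \<open>zw\<close>, and for \<open>a = 0\<close> by \<open>z\<close> and by \<open>w\<close>: this
  kills \<open>a zw\<close>, \<open>d zw\<close> and \<open>b zw\<close>.\<close>

lemma square_zero_prod:
  assumes z: "z \<in> carrier A" "w \<in> carrier A" "z \<otimes> z = \<zero>" "w \<otimes> w = \<zero>"
  shows "z \<otimes> w = \<zero>"
proof -
  obtain a b d where r: "a \<in> k" "b \<in> k" "d \<in> k" "z \<otimes> w = a \<oplus> b \<otimes> z \<oplus> d \<otimes> w" using quad3[OF z(1,2)] by blast
  note c = z(1,2) kc[OF r(1)] kc[OF r(2)] kc[OF r(3)]
  have 0: "(z \<otimes> w) \<otimes> (z \<otimes> w) = \<zero>"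
  proof -
    have "(z \<otimes> w) \<otimes> (z \<otimes> w) = (z \<otimes> z) \<otimes> (w \<otimes> w)" using c by algebra
    then show ?thesis using z by simp
  qed
  have "a \<otimes> (z \<otimes> w) = (z \<otimes> w) \<otimes> (z \<otimes> w) \<ominus> b \<otimes> (z \<otimes> z) \<otimes> w \<ominus> d \<otimes> (w \<otimes> w) \<otimes> z"
  proof -
    have "(z \<otimes> w) \<otimes> (z \<otimes> w) = (z \<otimes> w) \<otimes> (a \<oplus> b \<otimes> z \<oplus> d \<otimes> w)" using r(4) by simp
    also have "\<dots> = a \<otimes> (z \<otimes> w) \<oplus> b \<otimes> (z \<otimes> z) \<otimes> w \<oplus> d \<otimes> (w \<otimes> w) \<otimes> z" using c by algebra
    finally show ?thesis using c by algebra
  qed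
  then have A: "a \<otimes> (z \<otimes> w) = \<zero>" unfolding 0 z(3,4) using c by algebra
  show ?thesis
  proof (cases "a = \<zero>")
    case False then show ?thesis using cancel_k[OF r(1) False _ A] c by simp
  next
    case True
    have "d \<otimes> (z \<otimes> w) = \<zero>"
    proof -
      have "z \<otimes> (z \<otimes> w) = z \<otimes> (b \<otimes> z \<oplus> d \<otimes> w)" using r(4) True c by simp
      also have "\<dots> = b \<otimes> (z \<otimes> z) \<oplus> d \<otimes> (z \<otimes> w)" using c by algebra
      finally have "d \<otimes> (z \<otimes> w) = z \<otimes> (z \<otimes> w) " using z c by simp
      also have "\<dots> = (z \<otimes> z) \<otimes> w" using c by algebra
      finally show ?thesis using z c by simp
    qed
    moreover have "b \<otimes> (z \<otimes> w) = \<zero>"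
    proof -
      have "(z \<otimes> w) \<otimes> w = (b \<otimes> z \<oplus> d \<otimes> w) \<otimes> w" using r(4) True c by simp
      also have "\<dots> = d \<otimes> (w \<otimes> w) \<oplus> b \<otimes> (z \<otimes> w)" using c by algebra
      finally have "b \<otimes> (z \<otimes> w) = (z \<otimes> w) \<otimes> w" using z c by simp
      also have "\<dots> = z \<otimes> (w \<otimes> w)" using c by algebra
      finally show ?thesis using z c by simp
    qed
    ultimately have "d = \<zero> \<and> b = \<zero> \<or> z \<otimes> w = \<zero>" using cancel_k r c by (metis m_closed)
    then show ?thesis using r(4) True c by auto
  qed
qed

text \<open>Over the field with two elements every subspace of \<open>k^3\<close> containing 1 is a
  ring, so \<open>subspace_mult\<close> alone does not exclude this case. The plane spanned by
  (1,1,0) and (0,1,1) does: only scalars map it into itself and its generators generate the unit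
  ideal, so \<open>unimodular_principal\<close> would make it cyclic over \<open>k\<close>.\<close>

lemma no_triple_idempotents:
  assumes e: "e \<in> carrier A" "f \<in> carrier A" "e \<otimes> e = e" "f \<otimes> f = f" "e \<otimes> f = \<zero>"
    and ne: "e \<noteq> \<zero>" "f \<noteq> \<zero>" "\<one> \<ominus> e \<ominus> f \<noteq> \<zero>"
  shows False
proof -
  define g where "g = \<one> \<ominus> e \<ominus> f"
  have g: "g \<in> carrier A" "g \<noteq> \<zero>" using e ne by (auto simp: g_def)
  have fe: "f \<otimes> e = \<zero>" using e m_comm by simp
  have ge: "g \<otimes> e = \<zero>"
  proof -
    have "g \<otimes> e = e \<ominus> e \<otimes> e \<ominus> e \<otimes> f" unfolding g_def using e(1,2) by algebra
    then show ?thesis unfolding e(3,5) using e(1) by algebra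
  qed
  have gf: "g \<otimes> f = \<zero>"
  proof -
    have "g \<otimes> f = f \<ominus> e \<otimes> f \<ominus> f \<otimes> f" unfolding g_def using e(1,2) by algebra
    then show ?thesis unfolding e(4,5) using e(2) by algebra
  qed
  have gg: "g \<otimes> g = g"
  proof -
    have "g \<otimes> g = g \<ominus> g \<otimes> e \<ominus> g \<otimes> f" unfolding g_def[of] using e(1,2) by algebra
    then show ?thesis unfolding ge gf using g(1) by algebra
  qed
  have sum: "\<one> = e \<oplus> f \<oplus> g" unfolding g_def using e(1,2) by algebra
  let ?u = "e \<oplus> f" and ?v = "f \<oplus> g"
  have uv: "?u \<in> carrier A" "?v \<in> carrier A" using e g by auto
  let ?W = "{p \<otimes> ?u \<oplus> q \<otimes> ?v | p q. p \<in> k \<and> q \<in> k}"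
  have uW: "?u \<in> ?W" "?v \<in> ?W"
  proof -
    have "?u = \<one> \<otimes> ?u \<oplus> \<zero> \<otimes> ?v" "?v = \<zero> \<otimes> ?u \<oplus> \<one> \<otimes> ?v" using uv by simp_all
    then have "\<exists>p q. ?u = p \<otimes> ?u \<oplus> q \<otimes> ?v \<and> p \<in> k \<and> q \<in> k"
      "\<exists>p q. ?v = p \<otimes> ?u \<oplus> q \<otimes> ?v \<and> p \<in> k \<and> q \<in> k"
      using k_ops(1,2) by metis+
    then show "?u \<in> ?W" "?v \<in> ?W" by simp_all
  qed
  \<comment> \<open>Multiplying by \<open>e\<close>, \<open>f\<close>, \<open>g\<close> reads off
    the coordinates \<open>p\<close>, \<open>p + q\<close>, \<open>q\<close>. An endomorphism of the
    plane maps (1,1,0) to a vector without \<open>g\<close>-coordinate and (0,1,1) to one without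
    \<open>e\<close>-coordinate, and the common \<open>f\<close>-coordinate then forces one
    scalar.\<close>
  have coef: "e \<otimes> (p \<otimes> ?u \<oplus> q \<otimes> ?v) = p \<otimes> e" "f \<otimes> (p \<otimes> ?u \<oplus> q \<otimes> ?v) = (p \<oplus> q) \<otimes> f"
     "g \<otimes> (p \<otimes> ?u \<oplus> q \<otimes> ?v) = q \<otimes> g" if "p \<in> k" "q \<in> k" for p q
  proof -
    note c = e(1,2) g(1) kc[OF that(1)] kc[OF that(2)]
    have "e \<otimes> (p \<otimes> ?u \<oplus> q \<otimes> ?v) = p \<otimes> (e \<otimes> e) \<oplus> (p \<oplus> q) \<otimes> (e \<otimes> f) \<oplus> q \<otimes> (g \<otimes> e)" using c by algebra
    then show "e \<otimes> (p \<otimes> ?u \<oplus> q \<otimes> ?v) = p \<otimes> e" using e ge c by simp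
    have "f \<otimes> (p \<otimes> ?u \<oplus> q \<otimes> ?v) = p \<otimes> (e \<otimes> f) \<oplus> (p \<oplus> q) \<otimes> (f \<otimes> f) \<oplus> q \<otimes> (g \<otimes> f)" using c by algebra
    then show "f \<otimes> (p \<otimes> ?u \<oplus> q \<otimes> ?v) = (p \<oplus> q) \<otimes> f" using e gf c by simp
    have "g \<otimes> (p \<otimes> ?u \<oplus> q \<otimes> ?v) = p \<otimes> (g \<otimes> e) \<oplus> (p \<oplus> q) \<otimes> (g \<otimes> f) \<oplus> q \<otimes> (g \<otimes> g)" using c by algebra
    then show "g \<otimes> (p \<otimes> ?u \<oplus> q \<otimes> ?v) = q \<otimes> g" using gg ge gf c by simp
  qed
  have annih: "a = \<zero>" if "a \<in> k" "a \<otimes> d = \<zero>" "d \<in> carrier A" "d \<noteq> \<zero>" for a d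
    using cancel_k that by blast
  have E: "q \<in> k" if q: "q \<in> carrier A" "\<And>w. w \<in> ?W \<Longrightarrow> q \<otimes> w \<in> ?W" for q
  proof -
    obtain a b where ab: "q \<otimes> ?u = a \<otimes> ?u \<oplus> b \<otimes> ?v" "a \<in> k" "b \<in> k" using q(2)[OF uW(1)] by blast
    obtain a' b' where ab': "q \<otimes> ?v = a' \<otimes> ?u \<oplus> b' \<otimes> ?v" "a' \<in> k" "b' \<in> k" using q(2)[OF uW(2)] by blast
    note c = e(1,2) g(1) q(1) kc[OF ab(2)] kc[OF ab(3)] kc[OF ab'(2)] kc[OF ab'(3)]
    have "b \<otimes> g = g \<otimes> (q \<otimes> ?u)" using ab coef by simp
    also have "\<dots> = q \<otimes> (g \<otimes> e) \<oplus> q \<otimes> (g \<otimes> f)" using c by algebra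
    finally have "b = \<zero>" using annih ab g ge gf c by simp
    have "a' \<otimes> e = e \<otimes> (q \<otimes> ?v)" using ab' coef by simp
    also have "\<dots> = q \<otimes> (g \<otimes> e) \<oplus> q \<otimes> (e \<otimes> f)" using c by algebra
    finally have "a' = \<zero>" using annih ab' e ne ge c by simp
    have 1: "q \<otimes> f = a \<otimes> f"
    proof -
      have "f \<otimes> (q \<otimes> ?u) = q \<otimes> (e \<otimes> f) \<oplus> q \<otimes> (f \<otimes> f)" using c by algebra
      then show ?thesis using ab(1) coef(2)[OF ab(2,3)] \<open>b = \<zero>\<close> e c by simp
    qed
    have 2: "q \<otimes> f = b' \<otimes> f"
    proof -
      have "f \<otimes> (q \<otimes> ?v) = q \<otimes> (f \<otimes> f) \<oplus> q \<otimes> (g \<otimes> f)" using c by algebra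
      then show ?thesis using ab'(1) coef(2)[OF ab'(2,3)] \<open>a' = \<zero>\<close> e gf c by simp
    qed
    have "(a \<ominus> b') \<otimes> f = a \<otimes> f \<ominus> b' \<otimes> f" using c by algebra
    then have "(a \<ominus> b') \<otimes> f = \<zero>" unfolding 1[symmetric] 2[symmetric] using c by simp
    then have "a \<ominus> b' = \<zero>" using annih ab ab' e ne by simp
    then have "a = b'" using c by simp
    have "q = q \<otimes> ?u \<oplus> q \<otimes> ?v \<ominus> q \<otimes> f"
    proof -
      have "q = q \<otimes> (e \<oplus> f \<oplus> g)" unfolding sum[symmetric] using c by simp
      also have "\<dots> = q \<otimes> ?u \<oplus> q \<otimes> ?v \<ominus> q \<otimes> f" using c by algebra
      finally show ?thesis .
    qed
    also have "\<dots> = a \<otimes> ?u \<oplus> a \<otimes> ?v \<ominus> a \<otimes> f"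
      using ab(1) ab'(1) 1 \<open>b = \<zero>\<close> \<open>a' = \<zero>\<close> \<open>a = b'\<close> c by simp
    also have "\<dots> = a \<otimes> (e \<oplus> f \<oplus> g)" using c by algebra
    also have "\<dots> = a" unfolding sum[symmetric] using c by simp
    finally show ?thesis using ab by simp
  qed
  have one: "\<one> = e \<otimes> ?u \<oplus> \<one> \<otimes> ?v"
  proof -
    have "e \<otimes> ?u \<oplus> \<one> \<otimes> ?v = e \<otimes> e \<oplus> e \<otimes> f \<oplus> f \<oplus> g" using e(1,2) g(1) by algebra
    also have "\<dots> = \<one>" unfolding e(3,5) sum using e g by simp
    finally show ?thesis by simp
  qed
  obtain x where x: "x \<in> ?W" "\<And>w. w \<in> ?W \<Longrightarrow> \<exists>a\<in>k. w = a \<otimes> x"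
    using unimodular_principal[OF smod_span2[OF subr uv] uW e(1) one_closed one E] by blast
  obtain a b where ab: "a \<in> k" "?u = a \<otimes> x" "b \<in> k" "?v = b \<otimes> x" using x(2) uW by blast
  have xc: "x \<in> carrier A" using smodD(1)[OF smod_span2[OF subr uv] x(1)] .
  note c = e(1,2) g(1) kc[OF ab(1)] kc[OF ab(3)] xc
  have bu: "b \<otimes> ?u = a \<otimes> ?v" unfolding ab(2,4) using c by algebra
  have "g \<otimes> (a \<otimes> ?v) = a \<otimes> (g \<otimes> f) \<oplus> a \<otimes> (g \<otimes> g)" using c by algebra
  moreover have "g \<otimes> (b \<otimes> ?u) = b \<otimes> (g \<otimes> e) \<oplus> b \<otimes> (g \<otimes> f)" using c by algebra
  ultimately have "a \<otimes> g = \<zero>" using bu gg ge gf c by simp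
  then have "a = \<zero>" using annih ab g by blast
  then have "?u = \<zero>" using ab c by simp
  moreover have "e \<otimes> ?u = e" using e by (simp add: r_distr)
  ultimately show False using ne e by simp
qed

text \<open>If \<open>z\<close> were outside \<open>k + ky\<close>, suitable translates of
  \<open>y\<close> and \<open>z\<close> would multiply to a scalar \<open>c1\<close>; comparing
  \<open>(y1 z1) y1\<close> with \<open>(y1 y1) z1\<close> forces \<open>c1 = 0\<close> and makes
  \<open>y1\<close> proportional to an idempotent \<open>e\<close>. Then \<open>z1\<close> becomes a
  second idempotent orthogonal to \<open>e\<close>, and 1 is not their sum, contrary to
  \<open>no_triple_idempotents\<close>.\<close>

lemma generated_by_one:
  assumes y: "y \<in> carrier A" "\<And>r. r \<in> k \<Longrightarrow> (y \<ominus> r) \<otimes> (y \<ominus> r) \<noteq> \<zero>" and z: "z \<in> carrier A"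
  shows "\<exists>p\<in>k. \<exists>q\<in>k. z = p \<oplus> q \<otimes> y"
proof (rule ccontr)
  assume nz: "\<not> ?thesis"
  obtain c s t where r: "c \<in> k" "s \<in> k" "t \<in> k" "y \<otimes> z = c \<oplus> s \<otimes> y \<oplus> t \<otimes> z" using quad3[OF y(1) z] by blast
  \<comment> \<open>These translates complete the product:
    \<open>(y - t)(z - s) = yz - sy - tz + st\<close> leaves only \<open>c + st\<close>.\<close>
  define y1 where "y1 = y \<ominus> t"
  define z1 where "z1 = z \<ominus> s"
  note cc = y(1) z kc[OF r(1)] kc[OF r(2)] kc[OF r(3)]
  have y1: "y1 \<in> carrier A" "z1 \<in> carrier A" using cc by (auto simp: y1_def z1_def)
  have y1n: "(y1 \<ominus> p) \<otimes> (y1 \<ominus> p) \<noteq> \<zero>" if "p \<in> k" for p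
  proof -
    have "y1 \<ominus> p = y \<ominus> (t \<oplus> p)" unfolding y1_def using cc kc[OF that] by algebra
    then show ?thesis using y(2)[of "t \<oplus> p"] that r by simp
  qed
  have y1k: "y1 \<notin> k"
  proof
    assume a: "y1 \<in> k"
    have "(y1 \<ominus> y1) \<otimes> (y1 \<ominus> y1) = \<zero>" using y1(1) by algebra
    then show False using y1n[OF a] by simp
  qed
  have nz1: "z1 \<noteq> p \<oplus> q \<otimes> y1" if "p \<in> k" "q \<in> k" for p q
  proof
    assume a: "z1 = p \<oplus> q \<otimes> y1"
    have "z = (p \<oplus> s \<ominus> q \<otimes> t) \<oplus> q \<otimes> y"
    proof -
      have "z = z1 \<oplus> s" unfolding z1_def using cc by algebra
      also have "\<dots> = p \<oplus> q \<otimes> (y \<ominus> t) \<oplus> s" using a y1_def by simp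
      also have "\<dots> = (p \<oplus> s \<ominus> q \<otimes> t) \<oplus> q \<otimes> y" using cc kc[OF that(1)] kc[OF that(2)] by algebra
      finally show ?thesis .
    qed
    moreover have "p \<oplus> s \<ominus> q \<otimes> t \<in> k" using that r by simp
    ultimately show False using nz that by blast
  qed
  define c1 where "c1 = c \<oplus> s \<otimes> t"
  have c1: "c1 \<in> k" using r by (simp add: c1_def)
  have yz: "y1 \<otimes> z1 = c1"
  proof -
    have "y1 \<otimes> z1 = y \<otimes> z \<ominus> s \<otimes> y \<ominus> t \<otimes> z \<oplus> s \<otimes> t" unfolding y1_def z1_def using cc by algebra
    also have "\<dots> = c1" unfolding r(4) c1_def using cc by algebra
    finally show ?thesis .
  qed
  obtain \<beta> \<alpha> where ab: "\<beta> \<in> k" "\<alpha> \<in> k" "y1 \<otimes> y1 = \<beta> \<oplus> \<alpha> \<otimes> y1" using quad2[OF y1(1)] by blast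
  note cc1 = y1 kc[OF c1] kc[OF ab(1)] kc[OF ab(2)]
  have rel: "c1 \<otimes> y1 = \<beta> \<otimes> z1 \<oplus> \<alpha> \<otimes> c1"
  proof -
    have "c1 \<otimes> y1 = (y1 \<otimes> z1) \<otimes> y1" using yz by simp
    also have "\<dots> = (y1 \<otimes> y1) \<otimes> z1" using y1 by algebra
    also have "\<dots> = \<beta> \<otimes> z1 \<oplus> \<alpha> \<otimes> (y1 \<otimes> z1)" unfolding ab(3) using cc1 by algebra
    finally show ?thesis using yz by simp
  qed
  have b0: "\<beta> = \<zero>"
  proof (rule ccontr)
    assume "\<beta> \<noteq> \<zero>"
    then obtain b where b: "b \<in> k" "\<beta> \<otimes> b = \<one>" using field ab by blast
    have "z1 = b \<otimes> (\<beta> \<otimes> z1 \<oplus> \<alpha> \<otimes> c1) \<ominus> b \<otimes> (\<alpha> \<otimes> c1)"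
    proof -
      have "b \<otimes> (\<beta> \<otimes> z1 \<oplus> \<alpha> \<otimes> c1) \<ominus> b \<otimes> (\<alpha> \<otimes> c1) = (\<beta> \<otimes> b) \<otimes> z1" using cc1 kc[OF b(1)] by algebra
      then show ?thesis using b y1 by simp
    qed
    also have "\<dots> = \<ominus> (b \<otimes> (\<alpha> \<otimes> c1)) \<oplus> (b \<otimes> c1) \<otimes> y1"
      unfolding rel[symmetric] using cc1 kc[OF b(1)] by algebra
    finally show False using nz1[of "\<ominus> (b \<otimes> (\<alpha> \<otimes> c1))" "b \<otimes> c1"] b c1 ab by simp
  qed
  have c0: "c1 = \<zero>"
  proof (rule ccontr)
    assume n: "c1 \<noteq> \<zero>"
    have "c1 \<otimes> (y1 \<ominus> \<alpha>) = c1 \<otimes> y1 \<ominus> \<alpha> \<otimes> c1" using cc1 by algebra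
    also have "\<dots> = \<zero>" unfolding rel b0 using cc1 by algebra
    finally have "y1 \<ominus> \<alpha> = \<zero>" using cancel_k[OF c1 n] cc1 by simp
    then have "y1 = \<alpha>" using cc1 by simp
    then show False using y1k ab by simp
  qed
  have y1sq: "y1 \<otimes> y1 = \<alpha> \<otimes> y1" using ab(3) b0 cc1 by simp
  have "y1 \<ominus> \<zero> = y1" using y1 by algebra
  then have "y1 \<otimes> y1 \<noteq> \<zero>" using y1n[of \<zero>] by simp
  then have "\<alpha> \<noteq> \<zero>" using y1sq y1 by auto
  then obtain a where a: "a \<in> k" "\<alpha> \<otimes> a = \<one>" using field ab by blast
  define e where "e = a \<otimes> y1"
  note ac = kc[OF a(1)]
  have ec: "e \<in> carrier A" using ac y1 by (simp add: e_def)
  have ee: "e \<otimes> e = e"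
  proof -
    have "e \<otimes> e = a \<otimes> a \<otimes> (y1 \<otimes> y1)" unfolding e_def using ac y1 by algebra
    also have "\<dots> = (\<alpha> \<otimes> a) \<otimes> e" unfolding y1sq e_def using ac cc1 by algebra
    finally show ?thesis using a ec by simp
  qed
  have ez: "e \<otimes> z1 = \<zero>"
  proof -
    have "e \<otimes> z1 = a \<otimes> (y1 \<otimes> z1)" unfolding e_def using ac y1 by algebra
    then show ?thesis using yz c0 ac by simp
  qed
  have ye: "y1 = \<alpha> \<otimes> e"
  proof -
    have "\<alpha> \<otimes> e = (\<alpha> \<otimes> a) \<otimes> y1" unfolding e_def using ac cc1 by algebra
    then show ?thesis using a y1 by simp
  qed
  have ek: "e \<notin> k" using y1k ye ab by auto
  have nze: "z1 \<noteq> p \<oplus> q \<otimes> e" if "p \<in> k" "q \<in> k" for p q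
  proof
    assume A: "z1 = p \<oplus> q \<otimes> e"
    have "z1 = p \<oplus> (q \<otimes> a) \<otimes> y1" using A kc[OF that(2)] ac y1 by (simp add: e_def m_assoc)
    then show False using nz1 that a by simp
  qed
  obtain \<delta> \<gamma> where g: "\<delta> \<in> k" "\<gamma> \<in> k" "z1 \<otimes> z1 = \<delta> \<oplus> \<gamma> \<otimes> z1" using quad2[OF y1(2)] by blast
  note gc = kc[OF g(1)] kc[OF g(2)]
  have "\<delta> \<otimes> e = \<zero>"
  proof -
    have "e \<otimes> (z1 \<otimes> z1) = \<delta> \<otimes> e \<oplus> \<gamma> \<otimes> (e \<otimes> z1)" unfolding g(3) using gc ec y1 by algebra
    moreover have "e \<otimes> (z1 \<otimes> z1) = (e \<otimes> z1) \<otimes> z1" using ec y1 by algebra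
    ultimately show ?thesis using ez gc y1 ec by simp
  qed
  then have "\<delta> = \<zero>" using cancel_k[OF g(1) _ ec] ek k_ops(1) by metis
  then have z1sq: "z1 \<otimes> z1 = \<gamma> \<otimes> z1" using g gc y1 by simp
  \<comment> \<open>The relations of \<open>e\<close> and of \<open>z1\<close> are independent of
    each other; the quadratic relation of their sum ties them together, and comparing coefficients
    gives \<open>\<gamma> = q = 1\<close>.\<close>
  obtain p q where pq: "p \<in> k" "q \<in> k" "(e \<oplus> z1) \<otimes> (e \<oplus> z1) = p \<oplus> q \<otimes> (e \<oplus> z1)"
    using quad2[of "e \<oplus> z1"] ec y1 by auto
  note pc = kc[OF pq(1)] kc[OF pq(2)]
  have eq: "e \<oplus> \<gamma> \<otimes> z1 = p \<oplus> q \<otimes> (e \<oplus> z1)"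
  proof -
    have "(e \<oplus> z1) \<otimes> (e \<oplus> z1) = e \<otimes> e \<oplus> z1 \<otimes> z1 \<oplus> e \<otimes> z1 \<oplus> e \<otimes> z1" using ec y1 by algebra
    also have "\<dots> = e \<oplus> \<gamma> \<otimes> z1" unfolding ez ee z1sq using ec gc y1 by simp
    finally show ?thesis using pq by simp
  qed
  have eq2: "(\<gamma> \<ominus> q) \<otimes> z1 = p \<oplus> (q \<ominus> \<one>) \<otimes> e"
  proof -
    have "(\<gamma> \<ominus> q) \<otimes> z1 = (e \<oplus> \<gamma> \<otimes> z1) \<ominus> e \<ominus> q \<otimes> z1" using gc pc ec y1 by algebra
    also have "\<dots> = p \<oplus> (q \<ominus> \<one>) \<otimes> e" unfolding eq using gc pc ec y1 by algebra
    finally show ?thesis .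
  qed
  have "\<gamma> \<ominus> q = \<zero>"
  proof (rule ccontr)
    assume "\<gamma> \<ominus> q \<noteq> \<zero>"
    then obtain b where b: "b \<in> k" "(\<gamma> \<ominus> q) \<otimes> b = \<one>" using field[of "\<gamma> \<ominus> q"] g pq by auto
    note bc = kc[OF b(1)]
    have "z1 = ((\<gamma> \<ominus> q) \<otimes> b) \<otimes> z1" using b y1 by simp
    also have "\<dots> = b \<otimes> ((\<gamma> \<ominus> q) \<otimes> z1)" using bc gc pc y1 by algebra
    also have "\<dots> = b \<otimes> p \<oplus> (b \<otimes> (q \<ominus> \<one>)) \<otimes> e" unfolding eq2 using bc pc ec by algebra
    finally show False using nze b pq by simp
  qed
  then have gq: "\<gamma> = q" using gc pc by simp
  have "p \<oplus> (q \<ominus> \<one>) \<otimes> e = \<zero>" using eq2 \<open>\<gamma> \<ominus> q = \<zero>\<close> y1 by simp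
  have "q \<ominus> \<one> = \<zero>"
  proof (rule ccontr)
    assume "q \<ominus> \<one> \<noteq> \<zero>"
    then obtain b where b: "b \<in> k" "(q \<ominus> \<one>) \<otimes> b = \<one>" using field[of "q \<ominus> \<one>"] pq by auto
    note bc = kc[OF b(1)]
    have "e = ((q \<ominus> \<one>) \<otimes> b) \<otimes> e" using b ec by simp
    also have "\<dots> = b \<otimes> (p \<oplus> (q \<ominus> \<one>) \<otimes> e) \<ominus> b \<otimes> p" using bc pc ec by algebra
    also have "\<dots> = \<ominus> (b \<otimes> p)" unfolding \<open>p \<oplus> (q \<ominus> \<one>) \<otimes> e = \<zero>\<close> using bc pc by algebra
    finally show False using ek b pq by simp
  qed
  then have "q = \<one>" using pc by simp
  then have zz: "z1 \<otimes> z1 = z1" using z1sq gq y1 by simp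
  show False
  proof (rule no_triple_idempotents[OF ec y1(2) ee zz ez])
    show "e \<noteq> \<zero>" using ek by auto
    show "z1 \<noteq> \<zero>" using nze[of \<zero> \<zero>] ec by auto
    show "\<one> \<ominus> e \<ominus> z1 \<noteq> \<zero>"
    proof
      assume a: "\<one> \<ominus> e \<ominus> z1 = \<zero>"
      have "z1 = \<one> \<ominus> e \<ominus> (\<one> \<ominus> e \<ominus> z1)" using ec y1 by algebra
      also have "\<dots> = \<one> \<oplus> (\<ominus> \<one>) \<otimes> e" unfolding a using ec by algebra
      finally show False using nze[of \<one> "\<ominus> \<one>"] by simp
    qed
  qed
qed

text \<open>The element is the residue class of a product \<open>(f q1 + e q2)(f x1 + e x2)\<close>
  with \<open>f = 1 - e\<close>, expanded in the form in which \<open>idempotent_principal\<close>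
  meets it. Its components are the scalar \<open>p\<close> along \<open>1 - e\<close> and
  \<open>p' + r'\<close> along \<open>e\<close>, both nonzero by assumption, so an element
  \<open>b (1 - e) + b' e\<close> inverts it.\<close>

lemma idempotent_unit:
  assumes e: "e \<in> carrier A" "e \<otimes> e = e" and k: "p \<in> k" "r \<in> k" "p' \<in> k" "r' \<in> k"
    and w: "w \<in> carrier A"
    and ne: "(p \<oplus> r \<otimes> e) \<otimes> (\<one> \<ominus> e) \<noteq> \<zero>" "(p' \<oplus> r' \<otimes> e) \<otimes> e \<noteq> \<zero>"
  shows "\<exists>s\<in>carrier A. ((p \<oplus> r \<otimes> e) \<otimes> ((\<one> \<ominus> e) \<otimes> (\<one> \<ominus> e)) \<oplus> (p' \<oplus> r' \<otimes> e) \<otimes> (e \<otimes> e) \<oplus>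
    w \<otimes> (e \<otimes> (\<one> \<ominus> e))) \<otimes> s = \<one>"
proof -
  define f where "f = \<one> \<ominus> e"
  have f: "f \<in> carrier A" using e by (simp add: f_def)
  note c = e(1) f w kc[OF k(1)] kc[OF k(2)] kc[OF k(3)] kc[OF k(4)]
  have ef: "e \<otimes> f = \<zero>"
  proof -
    have "e \<otimes> f = e \<ominus> e \<otimes> e" unfolding f_def using e(1) by algebra
    then show ?thesis unfolding e(2) using e(1) by algebra
  qed
  have ff: "f \<otimes> f = f"
  proof -
    have "f \<otimes> f = f \<ominus> e \<otimes> f" unfolding f_def using e(1) by algebra
    then show ?thesis unfolding ef using f by algebra
  qed
  have u: "(p \<oplus> r \<otimes> e) \<otimes> f = p \<otimes> f"
  proof -
    have "(p \<oplus> r \<otimes> e) \<otimes> f = p \<otimes> f \<oplus> r \<otimes> (e \<otimes> f)" using c by algebra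
    then show ?thesis unfolding ef using c by simp
  qed
  have v: "(p' \<oplus> r' \<otimes> e) \<otimes> e = (p' \<oplus> r') \<otimes> e"
  proof -
    have "(p' \<oplus> r' \<otimes> e) \<otimes> e = p' \<otimes> e \<oplus> r' \<otimes> (e \<otimes> e)" using c by algebra
    also have "\<dots> = (p' \<oplus> r') \<otimes> e" unfolding e(2) using c by algebra
    finally show ?thesis .
  qed
  have "p \<noteq> \<zero>" using ne(1) u f unfolding f_def[symmetric] by auto
  then obtain b where b: "b \<in> k" "p \<otimes> b = \<one>" using field k by blast
  have "p' \<oplus> r' \<noteq> \<zero>" using ne(2) v e by auto
  then obtain b' where b': "b' \<in> k" "(p' \<oplus> r') \<otimes> b' = \<one>" using field[of "p' \<oplus> r'"] k by auto
  note c' = c kc[OF b(1)] kc[OF b'(1)]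
  have "(p \<oplus> r \<otimes> e) \<otimes> (f \<otimes> f) \<oplus> (p' \<oplus> r' \<otimes> e) \<otimes> (e \<otimes> e) \<oplus> w \<otimes> (e \<otimes> f) = p \<otimes> f \<oplus> (p' \<oplus> r') \<otimes> e"
    unfolding ff ef e(2) u v using c by simp
  moreover have "(p \<otimes> f \<oplus> (p' \<oplus> r') \<otimes> e) \<otimes> (b \<otimes> f \<oplus> b' \<otimes> e) = \<one>"
  proof -
    have "(p \<otimes> f \<oplus> (p' \<oplus> r') \<otimes> e) \<otimes> (b \<otimes> f \<oplus> b' \<otimes> e) =
       (p \<otimes> b) \<otimes> (f \<otimes> f) \<oplus> ((p' \<oplus> r') \<otimes> b') \<otimes> (e \<otimes> e) \<oplus> (p \<otimes> b' \<oplus> (p' \<oplus> r') \<otimes> b) \<otimes> (e \<otimes> f)" using c' by algebra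
    also have "\<dots> = f \<oplus> e" unfolding ff e(2) ef b(2) b'(2) using c' by simp
    also have "\<dots> = \<one>" unfolding f_def using e(1) by algebra
    finally show ?thesis .
  qed
  ultimately show ?thesis unfolding f_def[symmetric] using c' by (intro bexI[of _ "b \<otimes> f \<oplus> b' \<otimes> e"]) auto
qed

text \<open>A \<open>y\<close> none of whose translates by scalars squares to zero generates the
  algebra, and then there are no nilpotents. If the algebra is not a field, a nonzero nonunit
  \<open>w\<close> satisfies \<open>w w = b w\<close> with \<open>b\<close> nonzero, so
  \<open>w\<close> scales to an idempotent, which replaces \<open>y\<close>. Whether the algebra is
  a field or splits decides later how a generator of the maximal ideal is found.\<close>

lemma square_zero_or_reduced:
  obtains (nilp) "\<And>t. t \<in> carrier A \<Longrightarrow> \<exists>r\<in>k. (t \<ominus> r) \<otimes> (t \<ominus> r) = \<zero>"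
  | (red) y where "y \<in> carrier A" "\<And>t. t \<in> carrier A \<Longrightarrow> \<exists>p\<in>k. \<exists>q\<in>k. t = p \<oplus> q \<otimes> y"
      "\<And>a. a \<in> carrier A \<Longrightarrow> a \<otimes> a = \<zero> \<Longrightarrow> a = \<zero>"
      "(\<forall>a\<in>carrier A. a \<noteq> \<zero> \<longrightarrow> (\<exists>b\<in>carrier A. a \<otimes> b = \<one>)) \<or> (y \<otimes> y = y \<and> y \<notin> k)"
proof (cases "\<forall>t\<in>carrier A. \<exists>r\<in>k. (t \<ominus> r) \<otimes> (t \<ominus> r) = \<zero>")
  case True
  then show ?thesis using nilp by blast
next
  case False
  then obtain y where y: "y \<in> carrier A" "\<And>r. r \<in> k \<Longrightarrow> (y \<ominus> r) \<otimes> (y \<ominus> r) \<noteq> \<zero>" by blast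
  have gen: "\<And>z. z \<in> carrier A \<Longrightarrow> \<exists>p\<in>k. \<exists>q\<in>k. z = p \<oplus> q \<otimes> y" using generated_by_one[OF y] by blast
  have reduced: "a = \<zero>" if a: "a \<in> carrier A" "a \<otimes> a = \<zero>" for a
  proof -
    obtain p q where pq: "p \<in> k" "q \<in> k" "a = p \<oplus> q \<otimes> y" using gen a by blast
    show ?thesis
    proof (cases "q = \<zero>")
      case True
      then have "a \<in> k" using pq y by simp
      then show ?thesis using cancel_k a by blast
    next
      case False
      then obtain b where b: "b \<in> k" "q \<otimes> b = \<one>" using field pq by blast
      note c = kc[OF pq(1)] kc[OF pq(2)] kc[OF b(1)] y(1)
      have "y \<ominus> (\<ominus> (b \<otimes> p)) = b \<otimes> a"
      proof -
        have "b \<otimes> a = b \<otimes> p \<oplus> (q \<otimes> b) \<otimes> y" unfolding pq(3) using c by algebra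
        also have "\<dots> = y \<ominus> (\<ominus> (b \<otimes> p))" unfolding b(2) using c by algebra
        finally show ?thesis by simp
      qed
      moreover have "(b \<otimes> a) \<otimes> (b \<otimes> a) = b \<otimes> b \<otimes> (a \<otimes> a)" using c a(1) by algebra
      ultimately show ?thesis using y(2)[of "\<ominus> (b \<otimes> p)"] a b pq by simp
    qed
  qed
  show ?thesis
  proof (cases "\<forall>a\<in>carrier A. a \<noteq> \<zero> \<longrightarrow> (\<exists>b\<in>carrier A. a \<otimes> b = \<one>)")
    case True
    show ?thesis by (rule red[OF y(1) gen reduced disjI1[OF True]])
  next
    case nf: False
    then obtain w where w: "w \<in> carrier A" "w \<noteq> \<zero>" "\<And>b. b \<in> carrier A \<Longrightarrow> w \<otimes> b \<noteq> \<one>" by blast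
    have wk: "w \<notin> k" using field w by (meson kc)
    obtain a b where ab: "a \<in> k" "b \<in> k" "w \<otimes> w = a \<oplus> b \<otimes> w" using quad2[OF w(1)] by blast
    note c = w(1) kc[OF ab(1)] kc[OF ab(2)]
    have "a = \<zero>"
    proof (rule ccontr)
      assume "a \<noteq> \<zero>"
      then obtain a' where a': "a' \<in> k" "a \<otimes> a' = \<one>" using field ab by blast
      have "w \<otimes> ((w \<ominus> b) \<otimes> a') = (w \<otimes> w \<ominus> b \<otimes> w) \<otimes> a'" using c kc[OF a'(1)] by algebra
      also have "\<dots> = a \<otimes> a'" unfolding ab(3) using c kc[OF a'(1)] by algebra
      finally show False using w(3)[of "(w \<ominus> b) \<otimes> a'"] a' c by simp
    qed
    then have wb: "w \<otimes> w = b \<otimes> w" using ab c by simp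
    have "b \<noteq> \<zero>" using reduced[OF w(1)] w(2) wb c by auto
    then obtain b' where b': "b' \<in> k" "b \<otimes> b' = \<one>" using field ab by blast
    note c' = c kc[OF b'(1)]
    define e where "e = b' \<otimes> w"
    have e: "e \<in> carrier A" using c' by (simp add: e_def)
    have "w = b \<otimes> e"
    proof -
      have "b \<otimes> e = (b \<otimes> b') \<otimes> w" unfolding e_def using c' by algebra
      then show ?thesis using b' c by simp
    qed
    have ee: "e \<otimes> e = e"
    proof -
      have "e \<otimes> e = b' \<otimes> b' \<otimes> (w \<otimes> w)" unfolding e_def using c' by algebra
      also have "\<dots> = (b \<otimes> b') \<otimes> e" unfolding wb e_def using c' by algebra
      finally show ?thesis using b' e by simp
    qed
    have en: "(e \<ominus> r) \<otimes> (e \<ominus> r) \<noteq> \<zero>" if "r \<in> k" for r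
    proof
      assume "(e \<ominus> r) \<otimes> (e \<ominus> r) = \<zero>"
      then have "e \<ominus> r = \<zero>" using reduced[OF minus_closed[OF e kc[OF that]]] by blast
      then have "e = r" using e that by simp
      then show False using \<open>w = b \<otimes> e\<close> wk ab that by simp
    qed
    have ek: "e \<notin> k" using \<open>w = b \<otimes> e\<close> wk ab by auto
    show ?thesis by (rule red[OF e generated_by_one[OF e en] reduced disjI2[OF conjI[OF ee ek]]])
  qed
qed

end

section \<open>Endomorphism rings of local overrings\<close>

text \<open>Units are tested inside \<open>T\<close>, since \<open>m\<close> is invertible in the
  ambient ring of fractions. Locality of \<open>T\<close> is expressed as closure of this set under
  addition.\<close>

definition nonunits :: "('a, 'b) ring_scheme \<Rightarrow> 'a set \<Rightarrow> 'a set" where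
  "nonunits R T = {t \<in> T. \<forall>s\<in>T. t \<otimes>\<^bsub>R\<^esub> s \<noteq> \<one>\<^bsub>R\<^esub>}"

text \<open>The relation \<open>1 \<in> W(E(W) : W)\<close>: a finite sum of products lies in every additive subgroup \<open>N\<close>
  that contains the products.\<close>
definition invertible_frac :: "('a, 'b) ring_scheme \<Rightarrow> 'a set \<Rightarrow> bool" where
  "invertible_frac R W \<longleftrightarrow> (\<forall>N. smod R {} N \<longrightarrow>
     (\<forall>x\<in>W. \<forall>q\<in>carrier R. (\<forall>y\<in>W. q \<otimes>\<^bsub>R\<^esub> y \<in> endo_ring R W) \<longrightarrow> q \<otimes>\<^bsub>R\<^esub> x \<in> N) \<longrightarrow> \<one>\<^bsub>R\<^esub> \<in> N)"

lemma endo_ringD: "q \<in> endo_ring R W \<Longrightarrow> q \<in> carrier R" "q \<in> endo_ring R W \<Longrightarrow> y \<in> W \<Longrightarrow> q \<otimes>\<^bsub>R\<^esub> y \<in> W"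
  by (auto simp: endo_ring_def)

lemma smod_subset: "smod R T W \<Longrightarrow> S \<subseteq> T \<Longrightarrow> smod R S W"
  by (auto simp: smod_def)

lemma (in cring) endo_subring:
  assumes T: "subring T R" and W: "smod R T W"
  shows "subring (endo_ring R W) R" "T \<subseteq> endo_ring R W" "smod R (endo_ring R W) W"
proof -
  note Wc = smodD(1)[OF W] and Wm = smod_minus[OF W T]
  show "subring (endo_ring R W) R"
  proof (rule ring.subringI[OF ring_axioms])
    show "endo_ring R W \<subseteq> carrier R" by (auto simp: endo_ring_def)
    show "\<one> \<in> endo_ring R W" using Wc by (auto simp: endo_ring_def)
    show "\<ominus> h \<in> endo_ring R W" if "h \<in> endo_ring R W" for h
      using that Wc Wm by (auto simp: endo_ring_def l_minus)
    show "a \<otimes> b \<in> endo_ring R W" "a \<oplus> b \<in> endo_ring R W" if "a \<in> endo_ring R W" "b \<in> endo_ring R W" for a b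
      using that Wc smodD(3)[OF W] by (auto simp: endo_ring_def m_assoc l_distr)
  qed
  show "T \<subseteq> endo_ring R W" using subringE(1)[OF T] smodD(4)[OF W] by (auto simp: endo_ring_def)
  show "smod R (endo_ring R W) W" using W by (auto simp: smod_def endo_ring_def)
qed

lemma (in cring) nonunits_absorb:
  assumes T: "subring T R" and a: "a \<in> nonunits R T" "t \<in> T"
  shows "t \<otimes> a \<in> nonunits R T"
proof -
  have c: "a \<in> carrier R" "t \<in> carrier R" "a \<in> T" using subringE(1)[OF T] a by (auto simp: nonunits_def)
  have "t \<otimes> a \<otimes> s \<noteq> \<one>" if s: "s \<in> T" for s
  proof -
    have sc: "s \<in> carrier R" using subringE(1)[OF T] s by auto
    have "t \<otimes> a \<otimes> s = a \<otimes> (t \<otimes> s)" using c sc by algebra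
    moreover have "t \<otimes> s \<in> T" using subringE(6)[OF T a(2) s] .
    ultimately show ?thesis using a(1) by (auto simp: nonunits_def)
  qed
  moreover have "t \<otimes> a \<in> T" using subringE(6)[OF T a(2) c(3)] .
  ultimately show ?thesis by (auto simp: nonunits_def)
qed

lemma (in cring) subring_pow: "subring T R \<Longrightarrow> a \<in> T \<Longrightarrow> a [^] (n::nat) \<in> T"
  by (induction n) (auto simp: subringE)

section \<open>Ideals and primes of a subring, seen as submodules of the ambient ring\<close>

lemma (in cring) subring_cring:
  assumes "subring F R" shows "cring (R\<lparr>carrier := F\<rparr>)"
  using subcring_iff[OF subringE(1)[OF assms]] subcringI'[OF assms] by blast

lemma (in cring) smod_ideal:
  assumes F: "subring F R" and I: "smod R F I" "I \<subseteq> F"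
  shows "ideal I (R\<lparr>carrier := F\<rparr>)"
proof -
  interpret F: cring "R\<lparr>carrier := F\<rparr>" by (rule subring_cring[OF F])
  have inv: "\<ominus>\<^bsub>R\<lparr>carrier := F\<rparr>\<^esub> a \<in> I" if a: "a \<in> I" for a
  proof -
    have "\<ominus>\<^bsub>R\<lparr>carrier := F\<rparr>\<^esub> \<one> \<in> F" using F.a_inv_closed[OF F.one_closed] by simp
    then have "(\<ominus>\<^bsub>R\<lparr>carrier := F\<rparr>\<^esub> \<one>) \<otimes> a \<in> I" using smodD(4)[OF I(1)] a by blast
    moreover have "(\<ominus>\<^bsub>R\<lparr>carrier := F\<rparr>\<^esub> \<one>) \<otimes> a = \<ominus>\<^bsub>R\<lparr>carrier := F\<rparr>\<^esub> a"
      using F.l_minus[of \<one> a] F.l_one[of a] I(2) a F.one_closed by auto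
    ultimately show ?thesis by simp
  qed
  show ?thesis
  proof (rule idealI[OF F.ring_axioms])
    show "subgroup I (add_monoid (R\<lparr>carrier := F\<rparr>))"
      using I inv smodD(2,3)[OF I(1)] by (intro F.add.subgroupI) (auto simp: a_inv_def)
    fix a x assume a: "a \<in> I" "x \<in> carrier (R\<lparr>carrier := F\<rparr>)"
    then have "x \<otimes> a \<in> I" using smodD(4)[OF I(1)] by simp
    then show "x \<otimes>\<^bsub>R\<lparr>carrier := F\<rparr>\<^esub> a \<in> I" "a \<otimes>\<^bsub>R\<lparr>carrier := F\<rparr>\<^esub> x \<in> I"
      using m_comm[of a x] smodD(1)[OF I(1) a(1)] a(2) subringE(1)[OF F] by auto
  qed
qed

lemma (in cring) ideal_smod:
  assumes F: "subring F R" and I: "ideal I (R\<lparr>carrier := F\<rparr>)"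
  shows "smod R F I" "I \<subseteq> F"
proof -
  interpret I: ideal I "R\<lparr>carrier := F\<rparr>" by (rule I)
  show 1: "I \<subseteq> F" using I.a_subset by simp
  have "\<zero>\<^bsub>R\<lparr>carrier := F\<rparr>\<^esub> = \<zero>" by simp
  then have "\<zero> \<in> I" using additive_subgroup.zero_closed[OF I.is_additive_subgroup] by metis
  moreover have "a \<oplus> b \<in> I" if "a \<in> I" "b \<in> I" for a b
    using additive_subgroup.a_closed[OF I.is_additive_subgroup that] by simp
  moreover have "t \<otimes> a \<in> I" if "a \<in> I" "t \<in> F" for a t using I.I_l_closed[of a t] that by simp
  moreover have "I \<subseteq> carrier R" using 1 subringE(1)[OF F] by (rule subset_trans)
  ultimately show "smod R F I" unfolding smod_def by simp
qed

lemma (in cring) exists_prime_subring: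
  assumes F: "subring F R" and I: "smod R F I" "I \<subseteq> F"
    and S: "S \<subseteq> F" "\<one> \<in> S" "\<And>a b. a \<in> S \<Longrightarrow> b \<in> S \<Longrightarrow> a \<otimes> b \<in> S" "I \<inter> S = {}"
  obtains P where "smod R F P" "I \<subseteq> P" "P \<subseteq> F" "P \<inter> S = {}"
    "\<And>a b. a \<in> F \<Longrightarrow> b \<in> F \<Longrightarrow> a \<otimes> b \<in> P \<Longrightarrow> a \<in> P \<or> b \<in> P"
proof -
  interpret F: cring "R\<lparr>carrier := F\<rparr>" by (rule subring_cring[OF F])
  obtain P where P: "primeideal P (R\<lparr>carrier := F\<rparr>)" "I \<subseteq> P" "P \<inter> S = {}"
  proof (rule F.exists_prime_avoiding[OF smod_ideal[OF F I], of S])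
    show "S \<subseteq> carrier (R\<lparr>carrier := F\<rparr>)" "\<one>\<^bsub>R\<lparr>carrier := F\<rparr>\<^esub> \<in> S" "I \<inter> S = {}" using S by simp_all
    show "a \<otimes>\<^bsub>R\<lparr>carrier := F\<rparr>\<^esub> b \<in> S" if "a \<in> S" "b \<in> S" for a b using S(3)[OF that] by simp
  qed (rule that)
  show ?thesis
    using that[OF ideal_smod(1)[OF F] P(2) ideal_smod(2)[OF F] P(3)] primeideal.axioms(1)[OF P(1)]
      primeideal.I_prime[OF P(1)] by simp
qed

text \<open>\<open>Q\<close> plays the total ring of quotients of the local ring \<open>R\<close>.
  Dimension one is condensed into \<open>frac\<close> and \<open>rad\<close>: powers of
  \<open>m\<close> clear every denominator, and every nonunit has a power divisible by
  \<open>m\<close>. In \<open>stable\<close>, regular fractional ideals are recognised by containing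
  a power of \<open>m\<close> and having a power of \<open>m\<close> as denominator.\<close>

locale fraction_setting = cring Q for Q (structure) +
  fixes R m
  assumes R: "subring R Q" and m: "m \<in> nonunits Q R"
    and m_unit: "\<exists>w\<in>carrier Q. m \<otimes> w = \<one>"
    and frac: "\<And>q. q \<in> carrier Q \<Longrightarrow> \<exists>n::nat. m [^] n \<otimes> q \<in> R"
    and R_local: "\<And>a b. a \<in> nonunits Q R \<Longrightarrow> b \<in> nonunits Q R \<Longrightarrow> a \<oplus> b \<in> nonunits Q R"
    and rad: "\<And>a. a \<in> nonunits Q R \<Longrightarrow> \<exists>k::nat. \<exists>b\<in>R. a [^] k = m \<otimes> b"
    and stable: "\<And>W a b. smod Q R W \<Longrightarrow> m [^] (a::nat) \<in> W \<Longrightarrow> (\<And>w. w \<in> W \<Longrightarrow> m [^] (b::nat) \<otimes> w \<in> R) \<Longrightarrow>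
        invertible_frac Q W"
begin

text \<open>The common denominator makes \<open>T\<close> a fractional ideal of \<open>R\<close>, so
  that \<open>stable\<close> applies to the modules inside it that contain a power of
  \<open>m\<close>. The union of the chain will not have one.\<close>

definition bounded_overring :: "'a set \<Rightarrow> bool" where
  "bounded_overring T \<longleftrightarrow> subring T Q \<and> R \<subseteq> T \<and> (\<exists>b::nat. \<forall>t\<in>T. m [^] b \<otimes> t \<in> R)"

lemma mR: "m \<in> R" using m by (auto simp: nonunits_def)
lemma Rc: "a \<in> R \<Longrightarrow> a \<in> carrier Q" using subringE(1)[OF R] by auto
lemma mc [simp]: "m \<in> carrier Q" using mR Rc by blast

end

locale local_overring = fraction_setting +
  fixes T
  assumes bT: "bounded_overring T"
    and T_local: "\<And>a b. a \<in> nonunits Q T \<Longrightarrow> b \<in> nonunits Q T \<Longrightarrow> a \<oplus> b \<in> nonunits Q T"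
    and mT: "m \<in> nonunits Q T"
begin

abbreviation "n \<equiv> nonunits Q T"
abbreviation "E \<equiv> endo_ring Q n"

lemma T: "subring T Q" and RT: "R \<subseteq> T" using bT by (auto simp: bounded_overring_def)
lemma Tc: "a \<in> T \<Longrightarrow> a \<in> carrier Q" using subringE(1)[OF T] by auto
lemmas T_ops = subringE(2,3)[OF T] subringE(5,6,7)[OF T]
lemma nT: "a \<in> n \<Longrightarrow> a \<in> T" by (auto simp: nonunits_def)
lemma unitT: "a \<in> T \<Longrightarrow> a \<notin> n \<Longrightarrow> \<exists>b\<in>T. a \<otimes> b = \<one>" by (auto simp: nonunits_def)

lemma one_notin: "\<one> \<notin> n"
  using T_ops(2) by (auto simp: nonunits_def intro!: bexI[of _ \<one>])

lemma one_neq_zero: "\<one> \<noteq> \<zero>"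
proof
  assume "\<one> = \<zero>"
  then have "m \<otimes> \<one> = \<one>" using one_zeroD[OF \<open>\<one> = \<zero>\<close>] m_closed[OF mc one_closed] by (metis singletonD)
  then show False using mT T_ops by (auto simp: nonunits_def)
qed

lemma n_smod: "smod Q T n"
proof -
  have "\<zero> \<otimes> s \<noteq> \<one>" if "s \<in> T" for s using Tc[OF that] one_neq_zero by simp
  then have "\<zero> \<in> n" using T_ops by (auto simp: nonunits_def)
  then show ?thesis unfolding smod_def using nT Tc T_local nonunits_absorb[OF T] by blast
qed

lemmas E = endo_subring[OF T n_smod]
lemma Ec: "a \<in> E \<Longrightarrow> a \<in> carrier Q" using subringE(1)[OF E(1)] by auto
lemmas E_ops = subringE(2,3)[OF E(1)] subringE(5,6,7)[OF E(1)]
lemma E_diff: "a \<in> E \<Longrightarrow> b \<in> E \<Longrightarrow> a \<ominus> b \<in> E" using E_ops by (simp add: minus_eq)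
lemma TE: "a \<in> T \<Longrightarrow> a \<in> E" using E(2) by blast
lemma nE: "a \<in> n \<Longrightarrow> a \<in> E" using TE nT by blast
lemmas n_ops = smodD(2,3)[OF n_smod] smod_minus[OF n_smod T] smodD(4)[OF E(3)]
lemma nc: "a \<in> n \<Longrightarrow> a \<in> carrier Q" using nT Tc by blast

lemma one_plus_unit:
  assumes "a \<in> n" shows "\<exists>b\<in>T. (\<one> \<oplus> a) \<otimes> b = \<one>"
proof (rule unitT)
  show "\<one> \<oplus> a \<in> T" using T_ops nT[OF assms] by simp
  show "\<one> \<oplus> a \<notin> n"
  proof
    assume "\<one> \<oplus> a \<in> n"
    then have "\<one> \<oplus> a \<ominus> a \<in> n" using n_ops(4) assms by blast
    moreover have "\<one> \<oplus> a \<ominus> a = \<one>" using nc[OF assms] by algebra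
    ultimately show False using one_notin by simp
  qed
qed

text \<open>An endomorphism \<open>t\<close> of \<open>n\<close> sends \<open>m\<close> into
  \<open>n\<close>, hence \<open>tm\<close> lies in \<open>T\<close>: one further factor
  \<open>m\<close> clears the denominator.\<close>

lemma E_bounded: "bounded_overring E"
proof -
  obtain b :: nat where b: "\<And>t. t \<in> T \<Longrightarrow> m [^] b \<otimes> t \<in> R" using bT by (auto simp: bounded_overring_def)
  have "m [^] (Suc b) \<otimes> t \<in> R" if "t \<in> E" for t
  proof -
    have "t \<otimes> m \<in> T" using endo_ringD(2)[OF that mT] nT by blast
    moreover have "m [^] (Suc b) \<otimes> t = m [^] b \<otimes> (t \<otimes> m)" using Ec[OF that] by (simp add: m_ac)
    ultimately show ?thesis using b by simp
  qed
  then show ?thesis using E(1,2) RT unfolding bounded_overring_def by blast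
qed

lemma invertible_between:
  assumes "smod Q T W" "n \<subseteq> W" "W \<subseteq> E"
  shows "invertible_frac Q W"
proof -
  obtain b :: nat where b: "\<And>t. t \<in> E \<Longrightarrow> m [^] b \<otimes> t \<in> R" using E_bounded
    by (auto simp: bounded_overring_def)
  have "m [^] (1::nat) \<in> W" using assms(2) mT by auto
  then show ?thesis using stable[OF smod_subset[OF assms(1) RT], of 1 b] b assms(3) by blast
qed

lemma invertibleE:
  assumes "invertible_frac Q W" "smod Q {} N" "\<one> \<notin> N"
  obtains x q where "x \<in> W" "q \<in> carrier Q" "\<And>y. y \<in> W \<Longrightarrow> q \<otimes> y \<in> endo_ring Q W" "q \<otimes> x \<notin> N"
  using assms unfolding invertible_frac_def by blast

text \<open>For \<open>W = T + Ty\<close> it suffices that \<open>y\<close> maps \<open>W\<close>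
  into itself. Otherwise \<open>E(W)\<close> shrinks to \<open>T\<close>, and invertibility gives
  \<open>q\<close> with \<open>qW\<close> inside \<open>T\<close> and \<open>qx\<close> outside
  \<open>n\<close> for some \<open>x\<close> in \<open>W\<close>. Such a \<open>q\<close> is a unit
  of \<open>T\<close>, so \<open>y = q^-1 (qy)\<close> lies in \<open>T\<close> after all.\<close>

lemma quadratic_E:
  assumes y: "y \<in> E"
  obtains p q where "p \<in> T" "q \<in> T" "y \<otimes> y = p \<oplus> q \<otimes> y"
proof -
  note yc = Ec[OF y]
  let ?W = "{p \<otimes> \<one> \<oplus> q \<otimes> y | p q. p \<in> T \<and> q \<in> T}"
  have W: "smod Q T ?W" by (rule smod_span2[OF T one_closed yc])
  have memW: "p \<oplus> q \<otimes> y \<in> ?W" if "p \<in> T" "q \<in> T" for p q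
  proof -
    have "p \<oplus> q \<otimes> y = p \<otimes> \<one> \<oplus> q \<otimes> y" using Tc[OF that(1)] by simp
    then show ?thesis using that by blast
  qed
  have Wmem: "\<exists>p\<in>T. \<exists>q\<in>T. w = p \<oplus> q \<otimes> y" if "w \<in> ?W" for w using that Tc by auto
  have TW: "T \<subseteq> ?W"
  proof
    fix t assume "t \<in> T"
    then show "t \<in> ?W" using memW[of t \<zero>] Tc[of t] T_ops(1) yc by simp
  qed
  have yW: "y \<in> ?W" using memW[OF T_ops(1,2)] yc by simp
  have WE: "?W \<subseteq> E"
  proof
    fix w assume "w \<in> ?W"
    then show "w \<in> E" using Wmem[of w] TE y E_ops by auto
  qed
  note F = endo_subring[OF T W]
  let ?F = "endo_ring Q ?W"
  have "y \<in> ?F"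
  proof (rule ccontr)
    assume yF: "y \<notin> ?F"
    have FT: "e \<in> T" if e: "e \<in> ?F" for e
    proof -
      have "e \<otimes> \<one> \<in> ?W" using endo_ringD(2)[OF e] TW T_ops(2) by blast
      then have "e \<in> ?W" using r_one[OF endo_ringD(1)[OF e]] by simp
      then obtain p q where pq: "p \<in> T" "q \<in> T" "e = p \<oplus> q \<otimes> y" using Wmem by blast
      note c = Tc[OF pq(1)] Tc[OF pq(2)] yc
      \<comment> \<open>An endomorphism \<open>p + qy\<close> with \<open>q\<close> a unit of
        \<open>T\<close> would put \<open>y\<close> into \<open>E(W)\<close>; and once
        \<open>q\<close> is in \<open>n\<close>, so is \<open>qy\<close>, because \<open>y\<close>
        is an endomorphism of \<open>n\<close>.\<close>
      have qn: "q \<in> n"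
      proof (rule ccontr)
        assume "q \<notin> n"
        then obtain b where b: "b \<in> T" "q \<otimes> b = \<one>" using unitT pq by blast
        note bc = Tc[OF b(1)]
        have "e \<ominus> p \<in> ?F" using e F(2) pq(1) subringE(5,7)[OF F(1)] by (auto simp: minus_eq)
        then have "b \<otimes> (e \<ominus> p) \<in> ?F" using subringE(6)[OF F(1)] F(2) b(1) by blast
        moreover have "b \<otimes> (e \<ominus> p) = (q \<otimes> b) \<otimes> y" unfolding pq(3) using c bc by algebra
        ultimately show False using yF b yc by simp
      qed
      have "y \<otimes> q \<in> n" using endo_ringD(2)[OF y qn] .
      then have "q \<otimes> y \<in> T" using nT m_comm[of q y] c by simp
      then show ?thesis using pq T_ops by simp
    qed
    obtain x q where xq: "x \<in> ?W" "q \<in> carrier Q" "\<And>y. y \<in> ?W \<Longrightarrow> q \<otimes> y \<in> ?F" "q \<otimes> x \<notin> n"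
      using invertibleE[OF invertible_between[OF W _ WE] smod_subset[OF n_smod] one_notin] TW nT by blast
    have "q \<otimes> \<one> \<in> ?F" using xq(3) TW T_ops(2) by blast
    then have "q \<otimes> \<one> \<in> T" by (rule FT)
    then have qT: "q \<in> T" unfolding r_one[OF xq(2)] .
    have qn: "q \<notin> n"
    proof
      assume "q \<in> n"
      then have "x \<otimes> q \<in> n" using n_ops(5) xq(1) WE by blast
      moreover have "x \<in> carrier Q" using xq(1) WE Ec by blast
      ultimately show False using xq(4) m_comm[OF _ xq(2)] by metis
    qed
    then obtain b where b: "b \<in> T" "q \<otimes> b = \<one>" using unitT qT by blast
    have "q \<otimes> y \<in> T" using FT xq(3) yW by blast
    then have "b \<otimes> (q \<otimes> y) \<in> T" using T_ops b by blast
    moreover have "b \<otimes> (q \<otimes> y) = (q \<otimes> b) \<otimes> y" using xq(2) Tc[OF b(1)] yc by algebra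
    ultimately have "y \<in> T" using b yc by simp
    then show False using yF F(2) by blast
  qed
  from Wmem[OF endo_ringD(2)[OF this yW]] show ?thesis using that by blast
qed

end

context local_overring
begin

text \<open>A proper ideal of an intermediate ring stays proper in \<open>E\<close>, because \<open>E\<close> is integral over it;
  applied to the ideal of \<open>q\<close> with \<open>qW \<subseteq> E(W)\<close>, it forces \<open>W\<close> to equal its ring of endomorphisms.\<close>
lemma intermediate_module_closed:
  assumes W: "smod Q T W" "\<one> \<in> W" "W \<subseteq> E" and uv: "u \<in> W" "v \<in> W"
  shows "u \<otimes> v \<in> W"
proof -
  let ?F = "endo_ring Q W"
  note F = endo_subring[OF T W(1)]
  have TW: "T \<subseteq> W" using smodD(4)[OF W(1) _ W(2)] Tc by fastforce
  have FW: "?F \<subseteq> W"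
  proof
    fix q assume q: "q \<in> ?F"
    have "q \<otimes> \<one> \<in> W" using endo_ringD(2)[OF q W(2)] .
    then show "q \<in> W" unfolding r_one[OF endo_ringD(1)[OF q]] .
  qed
  have FE: "?F \<subseteq> E" using FW W(3) by blast
  have Fc: "\<And>a. a \<in> ?F \<Longrightarrow> a \<in> carrier Q" using endo_ringD(1) by metis
  \<comment> \<open>Since 1 lies in \<open>W\<close>, this is an ideal of the ring
    \<open>E(W)\<close>. If it contains 1, then \<open>W\<close> lies in \<open>E(W)\<close> and is
    itself that ring; the bulk of the proof refutes that \<open>c\<close> is proper.\<close>
  define c where "c = {q \<in> carrier Q. \<forall>y\<in>W. q \<otimes> y \<in> ?F}"
  have cF: "c \<subseteq> ?F" using W(2) by (auto simp: c_def dest: bspec[of _ _ \<one>])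
  have Wc: "\<And>w. w \<in> W \<Longrightarrow> w \<in> carrier Q" using smodD(1)[OF W(1)] .
  have "\<one> \<in> c"
  proof (rule ccontr)
    assume one: "\<one> \<notin> c"
    have nc: "n \<subseteq> c"
    proof
      fix a assume a: "a \<in> n"
      have "a \<otimes> y \<in> ?F" if "y \<in> W" for y
      proof -
        have "y \<otimes> a \<in> n" using n_ops(5)[of y a] W(3) that a by blast
        then have "a \<otimes> y \<in> T" using nT m_comm[OF Wc[OF that] Tc[OF nT[OF a]]] by simp
        then show ?thesis using F(2) by blast
      qed
      then show "a \<in> c" using Tc[OF nT[OF a]] by (simp add: c_def)
    qed
    have c_smod: "smod Q ?F c"
      unfolding smod_def
    proof (intro conjI ballI)
      show "c \<subseteq> carrier Q" by (auto simp: c_def)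
      show "\<zero> \<in> c" using subringE(2)[OF F(1)] Wc by (auto simp: c_def)
      show "a \<oplus> b \<in> c" if "a \<in> c" "b \<in> c" for a b
        using that subringE(7)[OF F(1)] Wc by (auto simp: c_def l_distr)
      show "t \<otimes> a \<in> c" if "t \<in> ?F" "a \<in> c" for t a
        using that subringE(6)[OF F(1)] Wc Fc by (auto simp: c_def m_assoc)
    qed
    obtain P where P: "smod Q ?F P" "c \<subseteq> P" "P \<subseteq> ?F" "P \<inter> {\<one>} = {}"
       "\<And>a b. a \<in> ?F \<Longrightarrow> b \<in> ?F \<Longrightarrow> a \<otimes> b \<in> P \<Longrightarrow> a \<in> P \<or> b \<in> P"
      by (rule exists_prime_subring[OF F(1) c_smod cF, of "{\<one>}"]) (use one subringE(3)[OF F(1)] in auto)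
    have PT: "P \<inter> T \<subseteq> n"
    proof
      fix a assume a: "a \<in> P \<inter> T"
      show "a \<in> n"
      proof (rule ccontr)
        assume "a \<notin> n"
        then obtain b where b: "b \<in> T" "a \<otimes> b = \<one>" using unitT a by blast
        then have "b \<otimes> a \<in> P" using smodD(4)[OF P(1)] F(2) a by blast
        then show False using P(4) b m_comm[of a b] Tc a by auto
      qed
    qed
    have S: "n \<subseteq> E" "?F - P \<subseteq> E" "\<one> \<in> ?F - P" "n \<inter> (?F - P) = {}"
      using nE FE P(2,4) nc subringE(3)[OF F(1)] by blast+
    have S_mult: "a \<otimes> b \<in> ?F - P" if "a \<in> ?F - P" "b \<in> ?F - P" for a b
      using that P(5) subringE(6)[OF F(1)] by blast
    \<comment> \<open>Lying over done by hand: \<open>B\<close> is a prime of \<open>E\<close> that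
      contains \<open>n\<close> and avoids the multiplicative set \<open>?F - P\<close>, so it meets
      \<open>E(W)\<close> only in elements of \<open>P\<close>. The converse inclusion comes from
      the quadratic equations.\<close>
    obtain B where B: "smod Q E B" "n \<subseteq> B" "B \<subseteq> E" "B \<inter> (?F - P) = {}"
       "\<And>a b. a \<in> E \<Longrightarrow> b \<in> E \<Longrightarrow> a \<otimes> b \<in> B \<Longrightarrow> a \<in> B \<or> b \<in> B"
      by (rule exists_prime_subring[OF E(1) E(3) S(1,2,3) _ S(4)]) (erule S_mult, assumption, rule that)
    have PB: "P \<subseteq> B"
    proof
      fix y assume y: "y \<in> P"
      then have yE: "y \<in> E" and yF: "y \<in> ?F" using P(3) FE by blast+
      obtain p q where pq: "p \<in> T" "q \<in> T" "y \<otimes> y = p \<oplus> q \<otimes> y" using quadratic_E[OF yE] by blast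
      note c = Ec[OF yE] Tc[OF pq(1)] Tc[OF pq(2)]
      have qF: "y \<ominus> q \<in> ?F" using yF F(2) pq(2) subringE(5,7)[OF F(1)] by (auto simp: minus_eq)
      \<comment> \<open>The constant term \<open>p\<close> of the equation of \<open>y\<close> lies
        in \<open>P\<close> and in \<open>T\<close>, hence in \<open>n\<close> and in
        \<open>B\<close>. So \<open>B\<close> contains \<open>y\<close> or \<open>y - q\<close>; in
        the second case \<open>y - q\<close> lies in \<open>P\<close>, which puts \<open>q\<close>
        into \<open>n\<close>.\<close>
      have eq: "y \<otimes> (y \<ominus> q) = p"
      proof -
        have "y \<otimes> (y \<ominus> q) = y \<otimes> y \<ominus> q \<otimes> y" using c by algebra
        also have "\<dots> = p" unfolding pq(3) using c by algebra
        finally show ?thesis .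
      qed
      have "(y \<ominus> q) \<otimes> y \<in> P" using smodD(4)[OF P(1) qF y] .
      then have "p \<in> P" using eq m_comm[of y "y \<ominus> q"] c by simp
      then have "y \<otimes> (y \<ominus> q) \<in> B" using eq PT pq(1) B(2) by auto
      then have "y \<in> B \<or> y \<ominus> q \<in> B" using B(5)[OF yE] qF FE by blast
      then show "y \<in> B"
      proof
        assume yq: "y \<ominus> q \<in> B"
        then have "y \<ominus> q \<in> P" using B(4) qF by blast
        then have "y \<ominus> (y \<ominus> q) \<in> P" using smod_minus(2)[OF P(1) F(1) _ y] by blast
        moreover have "y \<ominus> (y \<ominus> q) = q" using c by algebra
        ultimately have "q \<in> n" using PT pq(2) by auto
        then have "(y \<ominus> q) \<oplus> q \<in> B" using yq B(2) smodD(3)[OF B(1)] by blast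
        moreover have "(y \<ominus> q) \<oplus> q = y" using c by algebra
        ultimately show "y \<in> B" by simp
      qed
    qed
    have "\<one> \<notin> B" using B(4) P(4) subringE(3)[OF F(1)] by blast
    moreover have "invertible_frac Q W" using invertible_between[OF W(1) _ W(3)] TW nT by blast
    ultimately obtain x q where xq: "x \<in> W" "q \<in> carrier Q" "\<And>y. y \<in> W \<Longrightarrow> q \<otimes> y \<in> ?F" "q \<otimes> x \<notin> B"
      using invertibleE[OF _ smod_subset[OF B(1)]] by blast
    \<comment> \<open>Every admissible \<open>q\<close> lies in \<open>c\<close>, so in
      \<open>B\<close>, which is an ideal of \<open>E\<close>, and \<open>E\<close> contains
      \<open>W\<close>: all products \<open>qx\<close> stay in the proper ideal \<open>B\<close>,
      against invertibility.\<close>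
    have "q \<in> c" using xq(2,3) by (auto simp: c_def)
    then have "q \<in> B" using P(2) PB by blast
    then have "x \<otimes> q \<in> B" using smodD(4)[OF B(1)] xq(1) W(3) by blast
    then show False using xq m_comm[OF Wc[OF xq(1)] xq(2)] by simp
  qed
  then have "\<one> \<otimes> u \<in> ?F" using uv unfolding c_def by blast
  then have "u \<in> ?F" using Wc uv by simp
  then show ?thesis using endo_ringD(2)[OF _ uv(2)] by metis
qed

end

section \<open>The residue algebra of the endomorphism ring\<close>

context local_overring
begin

abbreviation "RE \<equiv> Q\<lparr>carrier := E\<rparr>"
abbreviation "A \<equiv> RE Quot n"
definition proj :: "'a \<Rightarrow> 'a set" where "proj t = n +>\<^bsub>RE\<^esub> t"

lemma n_ideal: "ideal n RE"
  by (rule smod_ideal[OF E(1) E(3)]) (use nE in blast)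

lemma A_cring: "cring A"
  by (rule ideal.quotient_is_cring[OF n_ideal subring_cring[OF E(1)]])

lemma proj_closed: "t \<in> E \<Longrightarrow> proj t \<in> carrier A"
  and proj_add: "t \<in> E \<Longrightarrow> s \<in> E \<Longrightarrow> proj (t \<oplus> s) = proj t \<oplus>\<^bsub>A\<^esub> proj s"
  and proj_mult: "t \<in> E \<Longrightarrow> s \<in> E \<Longrightarrow> proj (t \<otimes> s) = proj t \<otimes>\<^bsub>A\<^esub> proj s"
  and proj_one: "proj \<one> = \<one>\<^bsub>A\<^esub>"
proof -
  note h = ideal.rcos_ring_hom[OF n_ideal]
  show "t \<in> E \<Longrightarrow> proj t \<in> carrier A"
    using ring_hom_closed[OF h, of t] by (simp add: proj_def)
  show "t \<in> E \<Longrightarrow> s \<in> E \<Longrightarrow> proj (t \<oplus> s) = proj t \<oplus>\<^bsub>A\<^esub> proj s"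
    using ring_hom_add[OF h, of t s] by (simp add: proj_def)
  show "t \<in> E \<Longrightarrow> s \<in> E \<Longrightarrow> proj (t \<otimes> s) = proj t \<otimes>\<^bsub>A\<^esub> proj s"
    using ring_hom_mult[OF h, of t s] by (simp add: proj_def)
  show "proj \<one> = \<one>\<^bsub>A\<^esub>" using ring_hom_one[OF h] by (simp add: proj_def)
qed

lemma proj_surj: "X \<in> carrier A \<Longrightarrow> \<exists>t\<in>E. X = proj t"
  unfolding FactRing_def A_RCOSETS_def' proj_def by auto

lemma proj_zero_iff: "t \<in> E \<Longrightarrow> proj t = \<zero>\<^bsub>A\<^esub> \<longleftrightarrow> t \<in> n"
proof -
  assume t: "t \<in> E"
  interpret E: cring RE by (rule subring_cring[OF E(1)])
  interpret n: ideal n RE by (rule n_ideal)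
  have "proj t = n \<longleftrightarrow> t \<in> n"
    unfolding proj_def using n.a_rcos_const[of t] n.rcos_const_imp_mem[of t] t by auto
  then show ?thesis by (simp add: FactRing_def)
qed

lemma proj_zero: "proj \<zero> = \<zero>\<^bsub>A\<^esub>" using proj_zero_iff[OF E_ops(1)] n_ops(1) by blast

lemma proj_minus: "t \<in> E \<Longrightarrow> s \<in> E \<Longrightarrow> proj (t \<ominus> s) = proj t \<ominus>\<^bsub>A\<^esub> proj s"
proof -
  assume ts: "t \<in> E" "s \<in> E"
  note d = E_diff[OF ts]
  have "(t \<ominus> s) \<oplus> s = t" using Ec[OF ts(1)] Ec[OF ts(2)] by algebra
  then have eq: "proj t = proj (t \<ominus> s) \<oplus>\<^bsub>A\<^esub> proj s" using proj_add[OF d ts(2)] by simp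
  interpret A: cring A by (rule A_cring)
  show ?thesis using eq proj_closed[OF d] proj_closed[OF ts(2)] by (simp add: A.minus_eq A.a_assoc A.r_neg)
qed

lemma proj_eq_iff: "t \<in> E \<Longrightarrow> s \<in> E \<Longrightarrow> proj t = proj s \<longleftrightarrow> t \<ominus> s \<in> n"
proof -
  assume ts: "t \<in> E" "s \<in> E"
  interpret A: cring A by (rule A_cring)
  have "proj t = proj s \<longleftrightarrow> proj t \<ominus>\<^bsub>A\<^esub> proj s = \<zero>\<^bsub>A\<^esub>" using proj_closed ts by simp
  then show ?thesis using proj_minus[OF ts] proj_zero_iff[OF E_diff[OF ts]] by simp
qed

definition lift :: "'a set set \<Rightarrow> 'a set" where "lift W = {t \<in> E. proj t \<in> W}"

lemma lift_smod:
  assumes W: "smod A (proj ` T) W"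
  shows "smod Q T (lift W)" "n \<subseteq> lift W" "lift W \<subseteq> E"
proof -
  show "lift W \<subseteq> E" by (auto simp: lift_def)
  show "n \<subseteq> lift W"
  proof
    fix a assume a: "a \<in> n"
    then have "proj a = \<zero>\<^bsub>A\<^esub>" using proj_zero_iff[OF nE] by simp
    then show "a \<in> lift W" using nE[OF a] smodD(2)[OF W] by (simp add: lift_def)
  qed
  show "smod Q T (lift W)" unfolding smod_def
  proof (intro conjI ballI)
    show "lift W \<subseteq> carrier Q" using Ec by (auto simp: lift_def)
    show "\<zero> \<in> lift W" using E_ops(1) proj_zero smodD(2)[OF W] by (simp add: lift_def)
    show "a \<oplus> b \<in> lift W" if "a \<in> lift W" "b \<in> lift W" for a b
      using that E_ops(5) proj_add smodD(3)[OF W] by (simp add: lift_def)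
    show "t \<otimes> a \<in> lift W" if "t \<in> T" "a \<in> lift W" for t a
      using that E_ops(4) proj_mult smodD(4)[OF W] TE by (simp add: lift_def)
  qed
qed

lemma proj_subring: "subring (proj ` T) A"
proof -
  interpret A: cring A by (rule A_cring)
  have m: "\<ominus>\<^bsub>A\<^esub> proj t = proj (\<ominus> t)" if "t \<in> T" for t
  proof -
    have "\<ominus>\<^bsub>A\<^esub> proj t = proj \<zero> \<ominus>\<^bsub>A\<^esub> proj t" using proj_closed[OF TE[OF that]] proj_zero
      by (simp add: A.minus_eq)
    also have "\<dots> = proj (\<ominus> t)" using proj_minus[OF E_ops(1) TE[OF that]] Tc[OF that] by (simp add: minus_eq)
    finally show ?thesis .
  qed
  show ?thesis
  proof (rule ring.subringI[OF A.ring_axioms])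
    show "proj ` T \<subseteq> carrier A" using proj_closed TE by blast
    show "\<one>\<^bsub>A\<^esub> \<in> proj ` T" using proj_one T_ops by (metis imageI)
    show "\<ominus>\<^bsub>A\<^esub> h \<in> proj ` T" if "h \<in> proj ` T" for h
      using that m T_ops(3) by auto
    show "a \<otimes>\<^bsub>A\<^esub> b \<in> proj ` T" if "a \<in> proj ` T" "b \<in> proj ` T" for a b
    proof -
      obtain s t where "s \<in> T" "t \<in> T" "a = proj s" "b = proj t" using \<open>a \<in> proj ` T\<close> \<open>b \<in> proj ` T\<close> by blast
      then show ?thesis using proj_mult[of s t] TE T_ops(4)[of s t] by (metis imageI)
    qed
    show "a \<oplus>\<^bsub>A\<^esub> b \<in> proj ` T" if "a \<in> proj ` T" "b \<in> proj ` T" for a b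
    proof -
      obtain s t where "s \<in> T" "t \<in> T" "a = proj s" "b = proj t" using \<open>a \<in> proj ` T\<close> \<open>b \<in> proj ` T\<close> by blast
      then show ?thesis using proj_add[of s t] TE T_ops(5)[of s t] by (metis imageI)
    qed
  qed
qed

lemma proj_in_image: "t \<in> E \<Longrightarrow> proj t \<in> proj ` T \<Longrightarrow> t \<in> T"
proof -
  assume t: "t \<in> E" "proj t \<in> proj ` T"
  then obtain s where s: "s \<in> T" "proj t = proj s" by blast
  then have "t \<ominus> s \<in> T" using proj_eq_iff[OF t(1) TE] nT by blast
  then have "t \<ominus> s \<oplus> s \<in> T" using T_ops s by blast
  moreover have "t \<ominus> s \<oplus> s = t" using Ec[OF t(1)] Tc[OF s(1)] by algebra
  ultimately show ?thesis by simp
qed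

text \<open>Subspaces of the algebra lift to modules between \<open>n\<close> and \<open>E\<close>,
  to which stability applies: those containing 1 are rings by
  \<open>intermediate_module_closed\<close>. If the endomorphism ring of a lifted module
  \<open>V\<close> lies in the local ring \<open>T\<close>, invertibility provides a product
  \<open>qx\<close> that is a unit of \<open>T\<close>, and then \<open>V = Tx\<close>.\<close>

lemma residue_algebra: "quadratic_algebra A (proj ` T)"
proof -
  interpret A: cring A by (rule A_cring)
  show ?thesis
  proof (rule quadratic_algebra.intro[OF A_cring], rule quadratic_algebra_axioms.intro)
    show "subring (proj ` T) A" by (rule proj_subring)
    show "\<one>\<^bsub>A\<^esub> \<noteq> \<zero>\<^bsub>A\<^esub>" using proj_zero_iff[OF E_ops(2)] one_notin proj_one by simp
    show "\<exists>b\<in>proj ` T. a \<otimes>\<^bsub>A\<^esub> b = \<one>\<^bsub>A\<^esub>" if a: "a \<in> proj ` T" "a \<noteq> \<zero>\<^bsub>A\<^esub>" for a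
    proof -
      obtain t where t: "t \<in> T" "a = proj t" using a by blast
      then have "t \<notin> n" using proj_zero_iff[OF TE] a by blast
      then obtain s where s: "s \<in> T" "t \<otimes> s = \<one>" using unitT t by blast
      then have "a \<otimes>\<^bsub>A\<^esub> proj s = \<one>\<^bsub>A\<^esub>" using proj_mult[OF TE TE, of t s] t proj_one by simp
      then show ?thesis using s by blast
    qed
    show "u \<otimes>\<^bsub>A\<^esub> v \<in> W" if W: "smod A (proj ` T) W" "\<one>\<^bsub>A\<^esub> \<in> W" "u \<in> W" "v \<in> W" for W u v
    proof -
      obtain s where s: "s \<in> E" "u = proj s" using proj_surj smodD(1)[OF W(1,3)] by blast
      obtain t where t: "t \<in> E" "v = proj t" using proj_surj smodD(1)[OF W(1,4)] by blast
      have "s \<otimes> t \<in> lift W"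
        by (rule intermediate_module_closed[OF lift_smod(1)[OF W(1)] _ lift_smod(3)[OF W(1)]])
          (use W s t E_ops(2) proj_one in \<open>auto simp: lift_def\<close>)
      then show ?thesis using proj_mult[OF s(1) t(1)] s t by (simp add: lift_def)
    qed
    show "\<exists>x\<in>W. \<forall>w\<in>W. \<exists>a\<in>proj ` T. w = a \<otimes>\<^bsub>A\<^esub> x"
      if W: "smod A (proj ` T) W" "c \<in> W" "d \<in> W" "a \<in> carrier A" "b \<in> carrier A"
        "\<one>\<^bsub>A\<^esub> = a \<otimes>\<^bsub>A\<^esub> c \<oplus>\<^bsub>A\<^esub> b \<otimes>\<^bsub>A\<^esub> d"
        "\<And>q. q \<in> carrier A \<Longrightarrow> (\<And>w. w \<in> W \<Longrightarrow> q \<otimes>\<^bsub>A\<^esub> w \<in> W) \<Longrightarrow> q \<in> proj ` T" for W a b c d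
    proof -
      let ?V = "lift W"
      note V = lift_smod[OF W(1)]
      have F: "endo_ring Q ?V \<subseteq> T"
      proof
        fix q assume q: "q \<in> endo_ring Q ?V"
        note qc = endo_ringD(1)[OF q]
        obtain a' where a': "a' \<in> E" "a = proj a'" using proj_surj W(4) by blast
        obtain b' where b': "b' \<in> E" "b = proj b'" using proj_surj W(5) by blast
        obtain c' where c': "c' \<in> E" "c = proj c'" using proj_surj smodD(1)[OF W(1,2)] by blast
        obtain d' where d': "d' \<in> E" "d = proj d'" using proj_surj smodD(1)[OF W(1,3)] by blast
        have ac: "a' \<otimes> c' \<in> E" "b' \<otimes> d' \<in> E" using E_ops(4) a' b' c' d' by blast+
        have s: "a' \<otimes> c' \<oplus> b' \<otimes> d' \<in> E" using E_ops(5) ac by blast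
        have "proj (a' \<otimes> c' \<oplus> b' \<otimes> d') = proj \<one>"
          unfolding proj_add[OF ac] proj_mult[OF a'(1) c'(1)] proj_mult[OF b'(1) d'(1)] proj_one
          using W(6) a' b' c' d' by simp
        then have z: "\<one> \<ominus> (a' \<otimes> c' \<oplus> b' \<otimes> d') \<in> n" (is "?z \<in> n")
          using proj_eq_iff[OF E_ops(2) s] by simp
        note car = qc Ec[OF a'(1)] Ec[OF b'(1)] Ec[OF c'(1)] Ec[OF d'(1)]
        \<comment> \<open>An endomorphism of the lifted module lies a priori only in
          \<open>Q\<close>. The relation \<open>1 = a' c' + b' d' + z\<close> with \<open>z\<close>
          in \<open>n\<close> brings it into \<open>E\<close>, where its residue class is defined
          and the assumption on scalars applies.\<close>
        have "q = a' \<otimes> (q \<otimes> c') \<oplus> b' \<otimes> (q \<otimes> d') \<oplus> q \<otimes> ?z"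
          using car by algebra
        moreover have "q \<otimes> c' \<in> E" "q \<otimes> d' \<in> E" "q \<otimes> ?z \<in> E"
          using endo_ringD(2)[OF q] V(2,3) c' d' W(2,3) z by (auto simp: lift_def)
        ultimately have qE: "q \<in> E" using E_ops(4,5) a'(1) b'(1) by metis
        have "proj q \<in> proj ` T"
        proof (rule W(7)[OF proj_closed[OF qE]])
          fix w assume w: "w \<in> W"
          obtain t where t: "t \<in> E" "w = proj t" using proj_surj smodD(1)[OF W(1) w] by blast
          have "q \<otimes> t \<in> ?V" using endo_ringD(2)[OF q] t w by (auto simp: lift_def)
          then show "proj q \<otimes>\<^bsub>A\<^esub> w \<in> W" using proj_mult[OF qE t(1)] t by (simp add: lift_def)
        qed
        then show "q \<in> T" by (rule proj_in_image[OF qE])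
      qed
      obtain x q where xq: "x \<in> ?V" "q \<in> carrier Q" "\<And>y. y \<in> ?V \<Longrightarrow> q \<otimes> y \<in> endo_ring Q ?V" "q \<otimes> x \<notin> n"
        using invertibleE[OF invertible_between[OF V] smod_subset[OF n_smod] one_notin] by blast
      have xE: "x \<in> E" using xq(1) by (simp add: lift_def)
      obtain u where u: "u \<in> T" "q \<otimes> x \<otimes> u = \<one>" using unitT[OF _ xq(4)] F xq(1,3) by blast
      show ?thesis
      proof (rule bexI[of _ "proj x"], rule ballI)
        show "proj x \<in> W" using xq(1) by (simp add: lift_def)
        fix w assume w: "w \<in> W"
        obtain t where t: "t \<in> E" "w = proj t" using proj_surj smodD(1)[OF W(1) w] by blast
        then have tV: "t \<in> ?V" using w by (simp add: lift_def)
        have k: "u \<otimes> (q \<otimes> t) \<in> T" using T_ops(4)[OF u(1)] F xq(3)[OF tV] by blast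
        have "t = (q \<otimes> x \<otimes> u) \<otimes> t" using u(2) Ec[OF t(1)] by simp
        also have "\<dots> = (u \<otimes> (q \<otimes> t)) \<otimes> x" using xq(2) Ec[OF xE] Tc[OF u(1)] Ec[OF t(1)] by algebra
        finally have "proj t = proj (u \<otimes> (q \<otimes> t)) \<otimes>\<^bsub>A\<^esub> proj x" using proj_mult[OF TE[OF k] xE] by metis
        then have "w = proj (u \<otimes> (q \<otimes> t)) \<otimes>\<^bsub>A\<^esub> proj x" using t by simp
        then show "\<exists>a\<in>proj ` T. w = a \<otimes>\<^bsub>A\<^esub> proj x" using k by blast
      qed
    qed
  qed
qed

text \<open>A unit modulo \<open>n\<close> becomes a true unit, as \<open>1 + n\<close> consists of
  units of \<open>T\<close>: \<open>q x t b = 1\<close> for some \<open>t\<close> in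
  \<open>E\<close> and \<open>b\<close> in \<open>T\<close>. Hence \<open>w = x (t b (q w))\<close>
  for \<open>w\<close> in \<open>n\<close>, and the cofactor of \<open>x\<close> lies in
  \<open>E\<close>.\<close>

lemma principal_if_unit:
  assumes "x \<in> n" "q \<in> carrier Q" "\<And>y. y \<in> n \<Longrightarrow> q \<otimes> y \<in> E" "s \<in> carrier A" "proj (q \<otimes> x) \<otimes>\<^bsub>A\<^esub> s = \<one>\<^bsub>A\<^esub>"
  shows "n = (\<lambda>t. x \<otimes> t) ` E"
proof
  have xE: "x \<in> E" and xc: "x \<in> carrier Q" using nE nc assms(1) by blast+
  show "(\<lambda>t. x \<otimes> t) ` E \<subseteq> n" using n_ops(5)[of _ x] assms(1) m_comm[OF xc] Ec by fastforce
  obtain t where t: "t \<in> E" "s = proj t" using proj_surj assms(4) by blast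
  have qx: "q \<otimes> x \<in> E" using assms(1,3) by blast
  have "proj (q \<otimes> x \<otimes> t) = proj \<one>" using proj_mult[OF qx t(1)] assms(5) t proj_one by simp
  then have "q \<otimes> x \<otimes> t \<ominus> \<one> \<in> n" (is "?z \<in> n") using proj_eq_iff[OF E_ops(4)[OF qx t(1)] E_ops(2)] by simp
  then obtain b where b: "b \<in> T" "(\<one> \<oplus> ?z) \<otimes> b = \<one>" using one_plus_unit by blast
  note car = assms(2) xc Ec[OF t(1)] Tc[OF b(1)]
  have "\<one> \<oplus> ?z = q \<otimes> x \<otimes> t" using car by algebra
  then have one: "q \<otimes> x \<otimes> t \<otimes> b = \<one>" using b by simp
  show "n \<subseteq> (\<lambda>t. x \<otimes> t) ` E"
  proof
    fix w assume w: "w \<in> n"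
    have "w = (q \<otimes> x \<otimes> t \<otimes> b) \<otimes> w" using one nc[OF w] by simp
    also have "\<dots> = x \<otimes> (t \<otimes> b \<otimes> (q \<otimes> w))" using car nc[OF w] by algebra
    finally show "w \<in> (\<lambda>t. x \<otimes> t) ` E"
      using E_ops(4)[OF E_ops(4)[OF t(1) TE[OF b(1)]] assms(3)[OF w]] by blast
  qed
qed

end

section \<open>A generator of the maximal ideal over its endomorphism ring\<close>

context local_overring
begin

text \<open>Write \<open>y = r + z\<close> with \<open>z z\<close> in \<open>n\<close>. Then
  \<open>r\<close> is a unit of \<open>T\<close>, for otherwise \<open>y y\<close> would lie in
  \<open>n\<close>, and \<open>(r + z)(r - z) = r r - z z\<close> makes
  \<open>(r - z) / (r r)\<close> an inverse modulo \<open>n\<close>.\<close>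

lemma unit_if_square_notin:
  assumes dec: "\<And>t. t \<in> E \<Longrightarrow> \<exists>r\<in>T. (t \<ominus> r) \<otimes> (t \<ominus> r) \<in> n"
    and y: "y \<in> E" "y \<otimes> y \<notin> n"
  shows "\<exists>s\<in>E. y \<otimes> s = \<one>"
proof -
  obtain r where r: "r \<in> T" "(y \<ominus> r) \<otimes> (y \<ominus> r) \<in> n" using dec y by blast
  note c = Ec[OF y(1)] Tc[OF r(1)]
  define z where "z = y \<ominus> r"
  have z: "z \<in> E" using y(1) TE[OF r(1)] E_diff by (simp add: z_def)
  note zc = Ec[OF z]
  have yz: "y = r \<oplus> z" unfolding z_def using c by algebra
  have "r \<notin> n"
  proof
    assume rn: "r \<in> n"
    have "y \<otimes> y = (r \<otimes> r \<oplus> z \<otimes> r \<oplus> z \<otimes> r) \<oplus> z \<otimes> z" unfolding yz using c zc by algebra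
    also have "\<dots> \<in> n" using r(2) rn n_ops(2) n_ops(5)[OF z rn] n_ops(5)[OF TE[OF r(1)] rn]
      by (simp add: z_def)
    finally show False using y by simp
  qed
  then obtain b where b: "b \<in> T" "r \<otimes> b = \<one>" using unitT r by blast
  note bc = Tc[OF b(1)]
  define s where "s = (r \<ominus> z) \<otimes> (b \<otimes> b)"
  have s: "s \<in> E" using E_diff[OF TE[OF r(1)] z] E_ops(4) TE[OF b(1)] by (simp add: s_def)
  have "y \<otimes> s \<ominus> \<one> = (r \<otimes> b) \<otimes> (r \<otimes> b) \<ominus> \<one> \<ominus> (b \<otimes> b) \<otimes> (z \<otimes> z)" unfolding yz s_def using c zc bc by algebra
  also have "\<dots> = \<ominus> ((b \<otimes> b) \<otimes> (z \<otimes> z))" unfolding b(2) using bc zc by algebra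
  also have "\<dots> \<in> n" using n_ops(3)[OF n_ops(5)[OF TE[OF T_ops(4)[OF b(1) b(1)]]]] r(2) by (simp add: z_def)
  finally have "y \<otimes> s \<ominus> \<one> \<in> n" (is "?d \<in> n") .
  then obtain d where d: "d \<in> T" "(\<one> \<oplus> ?d) \<otimes> d = \<one>" using one_plus_unit by blast
  have "\<one> \<oplus> ?d = y \<otimes> s" using c(1) Ec[OF s] by algebra
  then have "y \<otimes> (s \<otimes> d) = \<one>" using d c Ec[OF s] Tc[OF d(1)] by (simp add: m_assoc)
  then show ?thesis using E_ops(4)[OF s TE[OF d(1)]] by blast
qed

text \<open>Invertibility is tested against the set of all elements with square in \<open>n\<close>,
  which \<open>prod\<close> makes additively closed. A product \<open>qx\<close> outside it is a
  unit of \<open>E\<close> by \<open>unit_if_square_notin\<close>.\<close>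

lemma nilpotent_principal:
  assumes dec: "\<And>t. t \<in> E \<Longrightarrow> \<exists>r\<in>T. (t \<ominus> r) \<otimes> (t \<ominus> r) \<in> n"
    and prod: "\<And>z w. z \<in> E \<Longrightarrow> w \<in> E \<Longrightarrow> z \<otimes> z \<in> n \<Longrightarrow> w \<otimes> w \<in> n \<Longrightarrow> z \<otimes> w \<in> n"
  obtains x where "x \<in> n" "n = (\<lambda>t. x \<otimes> t) ` E"
proof -
  let ?N = "{t \<in> E. t \<otimes> t \<in> n}"
  have "s \<oplus> t \<in> ?N" if "s \<in> ?N" "t \<in> ?N" for s t
  proof -
    have c: "s \<in> carrier Q" "t \<in> carrier Q" using that Ec by auto
    have "(s \<oplus> t) \<otimes> (s \<oplus> t) = s \<otimes> s \<oplus> t \<otimes> t \<oplus> (s \<otimes> t \<oplus> s \<otimes> t)" using c by algebra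
    moreover have "s \<otimes> t \<in> n" using prod that by blast
    ultimately show ?thesis using that n_ops(2) E_ops(5) by simp
  qed
  then have N: "smod Q {} ?N" unfolding smod_def using Ec E_ops(1) n_ops(1) by auto
  obtain x q where xq: "x \<in> n" "q \<in> carrier Q" "\<And>y. y \<in> n \<Longrightarrow> q \<otimes> y \<in> E" "q \<otimes> x \<notin> ?N"
    using invertibleE[OF invertible_between[OF n_smod subset_refl] N] one_notin nE by auto
  define y where "y = q \<otimes> x"
  have y: "y \<in> E" "y \<otimes> y \<notin> n" using xq unfolding y_def by auto
  obtain s where s: "s \<in> E" "y \<otimes> s = \<one>" using unit_if_square_notin[OF dec y] by blast
  then have "proj (q \<otimes> x) \<otimes>\<^bsub>A\<^esub> proj s = \<one>\<^bsub>A\<^esub>" using proj_mult[OF y(1) s(1)] proj_one y_def by simp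
  then show ?thesis using that[OF xq(1) principal_if_unit[OF xq(1,2,3) proj_closed[OF s(1)]]] by blast
qed

text \<open>In the split case the residue algebra has two maximal ideals, and a single product
  \<open>qx\<close> outside \<open>n\<close> may vanish in one component. Two products are taken,
  one nonzero along \<open>1 - e\<close> and one along \<open>e\<close>, and glued to
  \<open>x = f x1 + e x2\<close> and \<open>q = f q1 + e q2\<close>.\<close>

lemma idempotent_principal:
  assumes e: "e \<in> E" "e \<notin> T" "e \<otimes> e \<ominus> e \<in> n"
    and gen: "\<And>t. t \<in> E \<Longrightarrow> \<exists>p\<in>T. \<exists>q\<in>T. t = p \<oplus> q \<otimes> e"
  obtains x where "x \<in> n" "n = (\<lambda>t. x \<otimes> t) ` E"
proof -
  note ec = Ec[OF e(1)]
  define f where "f = \<one> \<ominus> e"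
  have f: "f \<in> E" using E_diff[OF E_ops(2) e(1)] by (simp add: f_def)
  note fc = Ec[OF f]
  have ef_notin: "e \<notin> n" "f \<notin> n"
  proof -
    show "e \<notin> n" using e nT by blast
    have "e = \<one> \<ominus> f" unfolding f_def using ec by algebra
    then show "f \<notin> n" using e(2) nT T_ops by (metis minus_eq)
  qed
  have N: "smod Q {} {t \<in> E. t \<otimes> g \<in> n}" if g: "g \<in> E" for g
  proof -
    have "(s \<oplus> t) \<otimes> g \<in> n" if "s \<in> E" "t \<in> E" "s \<otimes> g \<in> n" "t \<otimes> g \<in> n" for s t
      using that n_ops(2) l_distr[OF Ec Ec Ec, of s t g] g by simp
    then show ?thesis unfolding smod_def using Ec[OF g] Ec E_ops(1,5) n_ops(1) by auto
  qed
  note inv = invertibleE[OF invertible_between[OF n_smod subset_refl]]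
  have n_sub: "n \<subseteq> E" using nE by blast
  have one_notin': "\<one> \<notin> {t \<in> E. t \<otimes> f \<in> n}" "\<one> \<notin> {t \<in> E. t \<otimes> e \<in> n}"
    using ef_notin ec fc by auto
  obtain x1 q1 where xq1: "x1 \<in> n" "q1 \<in> carrier Q" "\<And>y. y \<in> n \<Longrightarrow> q1 \<otimes> y \<in> E" "q1 \<otimes> x1 \<notin> {t \<in> E. t \<otimes> f \<in> n}"
    using inv[OF n_sub N[OF f] one_notin'(1)] by blast
  obtain x2 q2 where xq2: "x2 \<in> n" "q2 \<in> carrier Q" "\<And>y. y \<in> n \<Longrightarrow> q2 \<otimes> y \<in> E" "q2 \<otimes> x2 \<notin> {t \<in> E. t \<otimes> e \<in> n}"
    using inv[OF n_sub N[OF e(1)] one_notin'(2)] by blast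
  obtain p r where pr: "p \<in> T" "r \<in> T" "q1 \<otimes> x1 = p \<oplus> r \<otimes> e" using gen xq1 by blast
  obtain p' r' where pr': "p' \<in> T" "r' \<in> T" "q2 \<otimes> x2 = p' \<oplus> r' \<otimes> e" using gen xq2 by blast
  define x where "x = f \<otimes> x1 \<oplus> e \<otimes> x2"
  define q where "q = f \<otimes> q1 \<oplus> e \<otimes> q2"
  define w where "w = q1 \<otimes> x2 \<oplus> q2 \<otimes> x1"
  note c = ec fc nc[OF xq1(1)] nc[OF xq2(1)] xq1(2) xq2(2)
  have w: "w \<in> E" using xq1 xq2 E_ops(5) by (simp add: w_def)
  have x: "x \<in> n" using n_ops(2) n_ops(5) f e(1) xq1(1) xq2(1) by (simp add: x_def)
  have q: "q \<in> carrier Q" using c by (simp add: q_def)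
  have qE: "q \<otimes> y \<in> E" if y: "y \<in> n" for y
  proof -
    have "q \<otimes> y = f \<otimes> (q1 \<otimes> y) \<oplus> e \<otimes> (q2 \<otimes> y)" unfolding q_def using c nc[OF y] by algebra
    then show ?thesis using E_ops(4,5) f e(1) xq1(3)[OF y] xq2(3)[OF y] by simp
  qed
  have u1: "p \<oplus> r \<otimes> e \<in> E" and u2: "p' \<oplus> r' \<otimes> e \<in> E" using pr pr' xq1(1,3) xq2(1,3) by metis+
  have qx: "q \<otimes> x = (p \<oplus> r \<otimes> e) \<otimes> (f \<otimes> f) \<oplus> (p' \<oplus> r' \<otimes> e) \<otimes> (e \<otimes> e) \<oplus> w \<otimes> (e \<otimes> f)"
    unfolding pr(3)[symmetric] pr'(3)[symmetric] x_def q_def w_def using c by algebra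
  interpret Z: quadratic_algebra A "proj ` T" by (rule residue_algebra)
  have ee: "proj e \<otimes>\<^bsub>A\<^esub> proj e = proj e"
    using e proj_mult[OF e(1) e(1)] proj_eq_iff[OF E_ops(4)[OF e(1) e(1)] e(1)] by simp
  have pf: "proj f = \<one>\<^bsub>A\<^esub> \<ominus>\<^bsub>A\<^esub> proj e" unfolding f_def using proj_minus[OF E_ops(2) e(1)] proj_one by simp
  have pu1: "proj (p \<oplus> r \<otimes> e) = proj p \<oplus>\<^bsub>A\<^esub> proj r \<otimes>\<^bsub>A\<^esub> proj e"
    using proj_add[OF TE[OF pr(1)] E_ops(4)[OF TE[OF pr(2)] e(1)]] proj_mult[OF TE[OF pr(2)] e(1)] by simp
  have pu2: "proj (p' \<oplus> r' \<otimes> e) = proj p' \<oplus>\<^bsub>A\<^esub> proj r' \<otimes>\<^bsub>A\<^esub> proj e"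
    using proj_add[OF TE[OF pr'(1)] E_ops(4)[OF TE[OF pr'(2)] e(1)]] proj_mult[OF TE[OF pr'(2)] e(1)]
    by simp
  have ne1: "(proj p \<oplus>\<^bsub>A\<^esub> proj r \<otimes>\<^bsub>A\<^esub> proj e) \<otimes>\<^bsub>A\<^esub> (\<one>\<^bsub>A\<^esub> \<ominus>\<^bsub>A\<^esub> proj e) \<noteq> \<zero>\<^bsub>A\<^esub>"
    unfolding pu1[symmetric] pf[symmetric] proj_mult[OF u1 f, symmetric]
    using proj_zero_iff[OF E_ops(4)[OF u1 f]] xq1(4) u1 pr(3) by simp
  have ne2: "(proj p' \<oplus>\<^bsub>A\<^esub> proj r' \<otimes>\<^bsub>A\<^esub> proj e) \<otimes>\<^bsub>A\<^esub> proj e \<noteq> \<zero>\<^bsub>A\<^esub>"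
    unfolding pu2[symmetric] proj_mult[OF u2 e(1), symmetric]
    using proj_zero_iff[OF E_ops(4)[OF u2 e(1)]] xq2(4) u2 pr'(3) by simp
  have ffE: "f \<otimes> f \<in> E" "e \<otimes> e \<in> E" "e \<otimes> f \<in> E" using E_ops(4) f e(1) by blast+
  have prE: "(p \<oplus> r \<otimes> e) \<otimes> (f \<otimes> f) \<in> E" "(p' \<oplus> r' \<otimes> e) \<otimes> (e \<otimes> e) \<in> E" "w \<otimes> (e \<otimes> f) \<in> E"
    using E_ops(4) u1 u2 w ffE by blast+
  have pqx: "proj (q \<otimes> x) = (proj p \<oplus>\<^bsub>A\<^esub> proj r \<otimes>\<^bsub>A\<^esub> proj e) \<otimes>\<^bsub>A\<^esub> ((\<one>\<^bsub>A\<^esub> \<ominus>\<^bsub>A\<^esub> proj e) \<otimes>\<^bsub>A\<^esub> (\<one>\<^bsub>A\<^esub> \<ominus>\<^bsub>A\<^esub> proj e))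
     \<oplus>\<^bsub>A\<^esub> (proj p' \<oplus>\<^bsub>A\<^esub> proj r' \<otimes>\<^bsub>A\<^esub> proj e) \<otimes>\<^bsub>A\<^esub> (proj e \<otimes>\<^bsub>A\<^esub> proj e)
     \<oplus>\<^bsub>A\<^esub> proj w \<otimes>\<^bsub>A\<^esub> (proj e \<otimes>\<^bsub>A\<^esub> (\<one>\<^bsub>A\<^esub> \<ominus>\<^bsub>A\<^esub> proj e))"
    unfolding qx proj_add[OF E_ops(5)[OF prE(1,2)] prE(3)] proj_add[OF prE(1,2)]
      proj_mult[OF u1 ffE(1)] proj_mult[OF u2 ffE(2)] proj_mult[OF w ffE(3)]
      proj_mult[OF f f] proj_mult[OF e(1) e(1)] proj_mult[OF e(1) f] pu1 pu2 pf ..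
  obtain s where "s \<in> carrier A" "proj (q \<otimes> x) \<otimes>\<^bsub>A\<^esub> s = \<one>\<^bsub>A\<^esub>"
    using Z.idempotent_unit[OF proj_closed[OF e(1)] ee imageI[OF pr(1)] imageI[OF pr(2)]
        imageI[OF pr'(1)] imageI[OF pr'(2)] proj_closed[OF w] ne1 ne2] unfolding pqx by blast
  then show ?thesis using that[OF x principal_if_unit[OF x q qE]] by blast
qed

lemma endo_ring_dichotomy:
  obtains (nilp) x where "x \<in> n" "n = (\<lambda>t. x \<otimes> t) ` E"
      "\<And>t. t \<in> E \<Longrightarrow> \<exists>r\<in>T. (t \<ominus> r) \<otimes> (t \<ominus> r) \<in> n"
      "\<And>z w. z \<in> E \<Longrightarrow> w \<in> E \<Longrightarrow> z \<otimes> z \<in> n \<Longrightarrow> w \<otimes> w \<in> n \<Longrightarrow> z \<otimes> w \<in> n"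
  | (red) x y where "x \<in> n" "n = (\<lambda>t. x \<otimes> t) ` E"
      "y \<in> E" "\<And>t. t \<in> E \<Longrightarrow> \<exists>p\<in>T. \<exists>q\<in>T. t = p \<oplus> q \<otimes> y"
      "\<And>a. a \<in> E \<Longrightarrow> a \<otimes> a \<in> n \<Longrightarrow> a \<in> n"
proof -
  interpret Z: quadratic_algebra A "proj ` T" by (rule residue_algebra)
  have sq: "proj z \<otimes>\<^bsub>A\<^esub> proj z = \<zero>\<^bsub>A\<^esub> \<longleftrightarrow> z \<otimes> z \<in> n" if "z \<in> E" for z
    using proj_mult[OF that that] proj_zero_iff[OF E_ops(4)[OF that that]] by simp
  show ?thesis
  proof (rule Z.square_zero_or_reduced, goal_cases)
    case 1
    have dec: "\<exists>r\<in>T. (t \<ominus> r) \<otimes> (t \<ominus> r) \<in> n" if t: "t \<in> E" for t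
    proof -
      obtain r where r: "r \<in> T" "(proj t \<ominus>\<^bsub>A\<^esub> proj r) \<otimes>\<^bsub>A\<^esub> (proj t \<ominus>\<^bsub>A\<^esub> proj r) = \<zero>\<^bsub>A\<^esub>"
        using 1[OF proj_closed[OF t]] by blast
      then have "(t \<ominus> r) \<otimes> (t \<ominus> r) \<in> n"
        using sq[OF E_diff[OF t TE[OF r(1)]]] proj_minus[OF t TE[OF r(1)]] by simp
      then show ?thesis using r by blast
    qed
    have prod: "z \<otimes> w \<in> n" if zw: "z \<in> E" "w \<in> E" "z \<otimes> z \<in> n" "w \<otimes> w \<in> n" for z w
    proof -
      have "proj z \<otimes>\<^bsub>A\<^esub> proj w = \<zero>\<^bsub>A\<^esub>"
        by (rule Z.square_zero_prod) (use sq zw proj_closed in auto)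
      then show ?thesis using proj_mult[OF zw(1,2)] proj_zero_iff[OF E_ops(4)[OF zw(1,2)]] by simp
    qed
    show ?case by (rule nilpotent_principal[OF dec prod]) (auto intro: nilp dec prod)
  next
    case (2 Y)
    obtain y where y: "y \<in> E" "Y = proj y" using proj_surj 2(1) by blast
    have gen: "\<exists>p\<in>T. \<exists>q\<in>T. t = p \<oplus> q \<otimes> y" if t: "t \<in> E" for t
    proof -
      obtain p q where pq: "p \<in> T" "q \<in> T" "proj t = proj p \<oplus>\<^bsub>A\<^esub> proj q \<otimes>\<^bsub>A\<^esub> proj y"
        using 2(2)[OF proj_closed[OF t]] y(2) by blast
      have qy: "q \<otimes> y \<in> E" using E_ops(4) TE[OF pq(2)] y(1) by blast
      have pqy: "p \<oplus> q \<otimes> y \<in> E" using E_ops(5) TE[OF pq(1)] qy by blast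
      have "proj t = proj (p \<oplus> q \<otimes> y)"
        using pq(3) proj_add[OF TE[OF pq(1)] qy] proj_mult[OF TE[OF pq(2)] y(1)] by simp
      then have d: "t \<ominus> (p \<oplus> q \<otimes> y) \<in> n" (is "?d \<in> n") using proj_eq_iff[OF t pqy] by simp
      \<comment> \<open>The error of the lifted relation lies in \<open>n\<close>, hence in
        \<open>T\<close>, and is absorbed into \<open>p\<close>: \<open>E = T + Ty\<close> holds
        exactly and not only modulo \<open>n\<close>.\<close>
      have "t = (p \<oplus> ?d) \<oplus> q \<otimes> y" using Ec[OF t] Tc[OF pq(1)] Tc[OF pq(2)] Ec[OF y(1)] by algebra
      moreover have "p \<oplus> ?d \<in> T" using T_ops(5) pq(1) nT[OF d] by blast
      ultimately show ?thesis using pq(2) by blast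
    qed
    have reduced: "a \<in> n" if a: "a \<in> E" "a \<otimes> a \<in> n" for a
      using 2(3)[OF proj_closed[OF a(1)]] sq[OF a(1)] a(2) proj_zero_iff[OF a(1)] by simp
    have ex: "\<exists>x. x \<in> n \<and> n = (\<lambda>t. x \<otimes> t) ` E"
    proof (cases "\<forall>a\<in>carrier A. a \<noteq> \<zero>\<^bsub>A\<^esub> \<longrightarrow> (\<exists>b\<in>carrier A. a \<otimes>\<^bsub>A\<^esub> b = \<one>\<^bsub>A\<^esub>)")
      case True
      obtain x q where xq: "x \<in> n" "q \<in> carrier Q" "\<And>y. y \<in> n \<Longrightarrow> q \<otimes> y \<in> E" "q \<otimes> x \<notin> n"
        using invertibleE[OF invertible_between[OF n_smod subset_refl] smod_subset[OF n_smod] one_notin] nE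
        by blast
      have "q \<otimes> x \<in> E" using xq by blast
      then obtain s where "s \<in> carrier A" "proj (q \<otimes> x) \<otimes>\<^bsub>A\<^esub> s = \<one>\<^bsub>A\<^esub>"
        using True proj_closed proj_zero_iff xq(4) by meson
      then show ?thesis using principal_if_unit[OF xq(1,2,3)] xq(1) by blast
    next
      case False
      then have Y: "proj y \<otimes>\<^bsub>A\<^esub> proj y = proj y" "proj y \<notin> proj ` T" using 2(4) y by auto
      have "y \<otimes> y \<ominus> y \<in> n"
        using Y(1) proj_mult[OF y(1) y(1)] proj_eq_iff[OF E_ops(4)[OF y(1) y(1)] y(1)] by simp
      moreover have "y \<notin> T" using Y(2) by blast
      ultimately show ?thesis using idempotent_principal[OF y(1) _ _ gen] by blast
    qed
    then show ?case using red[OF _ _ y(1) gen reduced] by blast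
  qed
qed

end

section \<open>The chain of endomorphism rings\<close>

context fraction_setting
begin

text \<open>Since powers of \<open>x\<close> clear all denominators and \<open>T/xT\<close> is
  reduced, \<open>T\<close> is integrally closed in \<open>Q\<close>; being \<open>R + Rz\<close>,
  it is then a finite integral closure of \<open>R\<close>. Infinite integral closure is used by
  refuting the existence of such a \<open>T\<close>.\<close>

definition normal_simple :: "'a set \<Rightarrow> bool" where
  "normal_simple T \<longleftrightarrow> subring T Q \<and> R \<subseteq> T \<and> (\<exists>z\<in>T. \<forall>t\<in>T. \<exists>p\<in>R. \<exists>q\<in>R. t = p \<oplus> q \<otimes> z) \<and>
     (\<exists>x\<in>T. (\<exists>w\<in>carrier Q. x \<otimes> w = \<one>) \<and> (\<forall>q\<in>carrier Q. \<exists>N::nat. x [^] N \<otimes> q \<in> T) \<and>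
       (\<forall>a\<in>T. a \<otimes> a \<in> (\<lambda>t. x \<otimes> t) ` T \<longrightarrow> a \<in> (\<lambda>t. x \<otimes> t) ` T))"

lemma nonunit_power:
  assumes x: "x \<in> nonunits Q R"
  obtains k :: nat and b where "b \<in> R" "x [^] k = m \<otimes> b" "\<And>N::nat. x [^] (k * N) = b [^] N \<otimes> m [^] N"
proof -
  obtain k :: nat and b where b: "b \<in> R" "x [^] k = m \<otimes> b" using rad[OF x] by blast
  have xc: "x \<in> carrier Q" using x Rc by (auto simp: nonunits_def)
  have "x [^] (k * N) = b [^] N \<otimes> m [^] N" for N :: nat
    using b Rc xc by (simp add: nat_pow_pow[symmetric] nat_pow_distrib m_comm)
  then show ?thesis using that b by blast
qed

lemma nonunit_absorbs:
  assumes x: "x \<in> nonunits Q R" and q: "q \<in> carrier Q"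
  shows "\<exists>N::nat. x [^] N \<otimes> q \<in> R"
proof -
  obtain k :: nat and b where b: "b \<in> R" "\<And>N::nat. x [^] (k * N) = b [^] N \<otimes> m [^] N"
    using nonunit_power[OF x] by metis
  obtain N :: nat where "m [^] N \<otimes> q \<in> R" using frac q by blast
  then have "b [^] N \<otimes> (m [^] N \<otimes> q) \<in> R" using subringE(6)[OF R subring_pow[OF R b(1)]] by blast
  moreover have "b [^] N \<otimes> (m [^] N \<otimes> q) = x [^] (k * N) \<otimes> q" using b Rc q by (simp add: m_assoc)
  ultimately show ?thesis by metis
qed

lemma bounded_nonunit:
  assumes x: "x \<in> nonunits Q R" and T: "bounded_overring T"
  obtains N :: nat where "\<And>t. t \<in> T \<Longrightarrow> x [^] N \<otimes> t \<in> R"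
proof -
  obtain k :: nat and b where b: "b \<in> R" "\<And>N::nat. x [^] (k * N) = b [^] N \<otimes> m [^] N"
    using nonunit_power[OF x] by metis
  obtain N :: nat where N: "\<And>t. t \<in> T \<Longrightarrow> m [^] N \<otimes> t \<in> R" using T by (auto simp: bounded_overring_def)
  have Tc: "\<And>t. t \<in> T \<Longrightarrow> t \<in> carrier Q" using T subringE(1) by (fastforce simp: bounded_overring_def)
  have "x [^] (k * N) \<otimes> t \<in> R" if t: "t \<in> T" for t
  proof -
    have "b [^] N \<otimes> (m [^] N \<otimes> t) \<in> R" using N[OF t] subringE(6)[OF R subring_pow[OF R b(1)]] by blast
    moreover have "b [^] N \<otimes> (m [^] N \<otimes> t) = x [^] (k * N) \<otimes> t" using b Rc Tc[OF t] by (simp add: m_assoc)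
    ultimately show ?thesis by simp
  qed
  then show ?thesis using that by blast
qed

text \<open>Nakayama's lemma by iteration: the assumption gives \<open>T = R + Rz + x^j T\<close>
  for all \<open>j\<close>, and for \<open>j = N\<close> the last summand lies in \<open>R\<close>
  because the denominators of \<open>T\<close> are bounded.\<close>

lemma generated_mod_bounded:
  assumes x: "x \<in> nonunits Q R" and T: "bounded_overring T" and z: "z \<in> T"
    and gen: "\<And>t. t \<in> T \<Longrightarrow> \<exists>p\<in>R. \<exists>q\<in>R. \<exists>s\<in>T. t = p \<oplus> q \<otimes> z \<oplus> x \<otimes> s"
    and t: "t \<in> T"
  shows "\<exists>p\<in>R. \<exists>q\<in>R. t = p \<oplus> q \<otimes> z"
proof -
  have sub: "subring T Q" using T by (simp add: bounded_overring_def)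
  note Tc = subsetD[OF subringE(1)[OF sub]]
  have xR: "x \<in> R" using x by (simp add: nonunits_def)
  note xc = Rc[OF xR]
  have ind: "\<exists>p\<in>R. \<exists>q\<in>R. \<exists>s\<in>T. t = p \<oplus> q \<otimes> z \<oplus> x [^] j \<otimes> s" for j :: nat
  proof (induction j)
    case 0
    show ?case
      by (rule bexI[of _ \<zero>], rule bexI[of _ \<zero>], rule bexI[of _ t])
        (use t Tc[OF t] Tc[OF z] subringE(2)[OF R] in auto)
  next
    case (Suc j)
    then obtain p q s where s: "p \<in> R" "q \<in> R" "s \<in> T" "t = p \<oplus> q \<otimes> z \<oplus> x [^] j \<otimes> s" by blast
    obtain p' q' s' where s': "p' \<in> R" "q' \<in> R" "s' \<in> T" "s = p' \<oplus> q' \<otimes> z \<oplus> x \<otimes> s'" using gen[OF s(3)]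
      by blast
    have xj: "x [^] j \<in> R" by (rule subring_pow[OF R xR])
    note c = Rc[OF s(1)] Rc[OF s(2)] Rc[OF s'(1)] Rc[OF s'(2)] Tc[OF s'(3)] Tc[OF z] xc Rc[OF xj]
    have "t = (p \<oplus> x [^] j \<otimes> p') \<oplus> (q \<oplus> x [^] j \<otimes> q') \<otimes> z \<oplus> x [^] (Suc j) \<otimes> s'"
      unfolding s(4) s'(4) nat_pow_Suc using c by algebra
    moreover have "p \<oplus> x [^] j \<otimes> p' \<in> R" "q \<oplus> x [^] j \<otimes> q' \<in> R" using s s' xj subringE(6,7)[OF R] by blast+
    ultimately show ?case using s'(3) by blast
  qed
  obtain N :: nat where N: "\<And>t. t \<in> T \<Longrightarrow> x [^] N \<otimes> t \<in> R" using bounded_nonunit[OF x T] by blast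
  obtain p q s where s: "p \<in> R" "q \<in> R" "s \<in> T" "t = p \<oplus> q \<otimes> z \<oplus> x [^] N \<otimes> s" using ind by blast
  have "t = (p \<oplus> x [^] N \<otimes> s) \<oplus> q \<otimes> z"
    unfolding s(4) using Rc[OF s(1)] Rc[OF s(2)] Tc[OF z] Rc[OF N[OF s(3)]] by algebra
  moreover have "p \<oplus> x [^] N \<otimes> s \<in> R" using s N subringE(7)[OF R] by blast
  ultimately show ?thesis using s(2) by blast
qed

text \<open>The invariant of the chain: \<open>T\<close> is local with the residue field of
  \<open>R\<close>, and products of two nonunits lie in \<open>xT\<close>. The latter is inherited
  because two elements of \<open>E\<close> with squares in \<open>n\<close> have their product in
  \<open>n = xE\<close>.\<close>

definition chain_member :: "'a \<Rightarrow> 'a set \<Rightarrow> bool" where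
  "chain_member x T \<longleftrightarrow> bounded_overring T \<and> x \<in> nonunits Q T \<and> m \<in> nonunits Q T \<and>
     (\<forall>a\<in>nonunits Q T. \<forall>b\<in>nonunits Q T. a \<oplus> b \<in> nonunits Q T \<and> a \<otimes> b \<in> (\<lambda>t. x \<otimes> t) ` T) \<and>
     (\<forall>t\<in>T. \<exists>r\<in>R. t \<ominus> r \<in> nonunits Q T)"

lemma local_overring_if_chain_member: "chain_member x T \<Longrightarrow> local_overring Q R m T"
  by unfold_locales (auto simp: chain_member_def)

lemma local_overring_R: "local_overring Q R m R"
proof unfold_locales
  have "\<And>t. t \<in> R \<Longrightarrow> m [^] (0::nat) \<otimes> t \<in> R" using Rc by simp
  then show "bounded_overring R" using R unfolding bounded_overring_def by blast
qed (use m R_local in auto)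

end

context local_overring
begin

lemma chain_member_E:
  assumes dec: "\<And>t. t \<in> E \<Longrightarrow> \<exists>r\<in>T. (t \<ominus> r) \<otimes> (t \<ominus> r) \<in> n"
    and prod: "\<And>z w. z \<in> E \<Longrightarrow> w \<in> E \<Longrightarrow> z \<otimes> z \<in> n \<Longrightarrow> w \<otimes> w \<in> n \<Longrightarrow> z \<otimes> w \<in> n"
    and x: "x \<in> n" "n = (\<lambda>t. x \<otimes> t) ` E"
    and res: "\<And>t. t \<in> T \<Longrightarrow> \<exists>r\<in>R. t \<ominus> r \<in> n"
  shows "chain_member x E"
proof -
  \<comment> \<open>This identifies the nonunits of \<open>E\<close> with the elements whose class
    in the residue algebra squares to zero; since such classes multiply to zero, \<open>E\<close> is
    local.\<close>
  have sq: "nonunits Q E = {z \<in> E. z \<otimes> z \<in> n}"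
  proof
    show "nonunits Q E \<subseteq> {z \<in> E. z \<otimes> z \<in> n}"
      using unit_if_square_notin[OF dec] by (fastforce simp: nonunits_def)
    show "{z \<in> E. z \<otimes> z \<in> n} \<subseteq> nonunits Q E"
    proof
      fix z assume z: "z \<in> {z \<in> E. z \<otimes> z \<in> n}"
      have "z \<otimes> s \<noteq> \<one>" if s: "s \<in> E" for s
      proof
        assume a: "z \<otimes> s = \<one>"
        have c: "z \<in> carrier Q" "s \<in> carrier Q" using z s Ec by auto
        have "\<one> = (z \<otimes> s) \<otimes> (z \<otimes> s)" using a by simp
        also have "\<dots> = (s \<otimes> s) \<otimes> (z \<otimes> z)" using c by algebra
        also have "\<dots> \<in> n" using n_ops(5)[OF E_ops(4)[OF s s]] z by blast
        finally show False using one_notin by simp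
      qed
      then show "z \<in> nonunits Q E" using z by (auto simp: nonunits_def)
    qed
  qed
  have nN: "a \<in> nonunits Q E" if "a \<in> n" for a
    using that sq nE n_ops(5) by blast
  show ?thesis unfolding chain_member_def
  proof (intro conjI ballI)
    show "bounded_overring E" by (rule E_bounded)
    show "x \<in> nonunits Q E" "m \<in> nonunits Q E" using nN x mT by blast+
    fix a b assume ab: "a \<in> nonunits Q E" "b \<in> nonunits Q E"
    then have ab': "a \<in> E" "b \<in> E" "a \<otimes> a \<in> n" "b \<otimes> b \<in> n" using sq by blast+
    then have p: "a \<otimes> b \<in> n" using prod by blast
    then show "a \<otimes> b \<in> (\<lambda>t. x \<otimes> t) ` E" using x(2) by blast
    have "(a \<oplus> b) \<otimes> (a \<oplus> b) = a \<otimes> a \<oplus> b \<otimes> b \<oplus> (a \<otimes> b \<oplus> a \<otimes> b)"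
      using Ec[OF ab'(1)] Ec[OF ab'(2)] by algebra
    then have "(a \<oplus> b) \<otimes> (a \<oplus> b) \<in> n" using n_ops(2) ab' p by simp
    then show "a \<oplus> b \<in> nonunits Q E" using sq E_ops(5) ab' by blast
  next
    fix t assume t: "t \<in> E"
    obtain r where r: "r \<in> T" "(t \<ominus> r) \<otimes> (t \<ominus> r) \<in> n" using dec t by blast
    obtain r' where r': "r' \<in> R" "r \<ominus> r' \<in> n" using res r by blast
    define z where "z = t \<ominus> r"
    define d where "d = r \<ominus> r'"
    have z: "z \<in> E" "z \<otimes> z \<in> n" "d \<in> n" using t TE[OF r(1)] E_diff r r' by (auto simp: z_def d_def)
    note c = Ec[OF t] Tc[OF r(1)] Rc[OF r'(1)] Ec[OF z(1)] nc[OF z(3)]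
    have eq: "t \<ominus> r' = z \<oplus> d" unfolding z_def d_def using c by algebra
    have "(z \<oplus> d) \<otimes> (z \<oplus> d) = z \<otimes> z \<oplus> (z \<otimes> d \<oplus> z \<otimes> d \<oplus> d \<otimes> d)" using c by algebra
    also have "\<dots> \<in> n" using n_ops(2) n_ops(5)[OF z(1) z(3)] n_ops(5)[OF nE[OF z(3)] z(3)] z(2) by simp
    finally have "z \<oplus> d \<in> nonunits Q E" using sq E_ops(5)[OF z(1) nE[OF z(3)]] by blast
    then show "\<exists>r\<in>R. t \<ominus> r \<in> nonunits Q E" using eq r' by metis
  qed
qed

end

context fraction_setting
begin

lemma normal_simpleI:
  assumes x: "x \<in> nonunits Q R" and T: "bounded_overring T" and z: "z \<in> T"
    and gen: "\<And>t. t \<in> T \<Longrightarrow> \<exists>p\<in>R. \<exists>q\<in>R. \<exists>s\<in>T. t = p \<oplus> q \<otimes> z \<oplus> x \<otimes> s"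
    and u: "u \<in> T" "\<exists>w\<in>carrier Q. u \<otimes> w = \<one>" "u [^] (k::nat) = x \<otimes> t" "t \<in> T"
    and red: "\<And>a. a \<in> T \<Longrightarrow> a \<otimes> a \<in> (\<lambda>t. u \<otimes> t) ` T \<Longrightarrow> a \<in> (\<lambda>t. u \<otimes> t) ` T"
  shows "normal_simple T"
proof -
  have sub: "subring T Q" "R \<subseteq> T" using T by (auto simp: bounded_overring_def)
  note Tc = subsetD[OF subringE(1)[OF sub(1)]]
  have xc: "x \<in> carrier Q" using x Rc by (auto simp: nonunits_def)
  have "\<exists>N::nat. u [^] N \<otimes> q \<in> T" if q: "q \<in> carrier Q" for q
  proof -
    obtain N :: nat where N: "x [^] N \<otimes> q \<in> R" using nonunit_absorbs[OF x q] by blast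
    have "u [^] (k * N) = (x \<otimes> t) [^] N" using u(3) Tc[OF u(1)] by (simp add: nat_pow_pow[symmetric])
    also have "\<dots> = t [^] N \<otimes> x [^] N" using xc Tc[OF u(4)] by (simp add: nat_pow_distrib m_comm)
    finally have "u [^] (k * N) \<otimes> q = t [^] N \<otimes> (x [^] N \<otimes> q)" using xc Tc[OF u(4)] q by (simp add: m_assoc)
    moreover have "t [^] N \<otimes> (x [^] N \<otimes> q) \<in> T"
      using subringE(6)[OF sub(1) subring_pow[OF sub(1) u(4)]] N sub(2) by blast
    ultimately show ?thesis by metis
  qed
  moreover have "\<exists>z\<in>T. \<forall>t\<in>T. \<exists>p\<in>R. \<exists>q\<in>R. t = p \<oplus> q \<otimes> z"
    using generated_mod_bounded[OF x T z gen] z by blast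
  ultimately show ?thesis unfolding normal_simple_def using sub u(1,2) red by blast
qed

text \<open>The dichotomy yields some generator \<open>x1\<close> of \<open>n\<close> over
  \<open>E\<close>; the point is to keep the \<open>x\<close> of the earlier stages. With
  \<open>x = x1 u\<close>, either the inverse of \<open>u\<close> is an endomorphism of
  \<open>n\<close> and \<open>x\<close> generates as well, or \<open>u\<close> generates
  \<open>n\<close> already over \<open>T\<close>, and then \<open>T\<close> is a ring as in
  \<open>normal_simple\<close>. In the reduced alternative of the dichotomy \<open>E\<close> would
  be such a ring.\<close>

lemma chain_member_step:
  assumes nf: "\<And>T. \<not> normal_simple T" and x: "x \<in> nonunits Q R" and xu: "\<exists>w\<in>carrier Q. x \<otimes> w = \<one>"
    and g: "chain_member x T"
  shows "nonunits Q T = (\<lambda>t. x \<otimes> t) ` endo_ring Q (nonunits Q T)"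
      "chain_member x (endo_ring Q (nonunits Q T))"
proof -
  interpret L: local_overring Q R m T by (rule local_overring_if_chain_member[OF g])
  have res: "\<And>t. t \<in> T \<Longrightarrow> \<exists>r\<in>R. t \<ominus> r \<in> L.n" and xn: "x \<in> L.n"
    and prod: "\<And>a b. a \<in> L.n \<Longrightarrow> b \<in> L.n \<Longrightarrow> a \<otimes> b \<in> (\<lambda>t. x \<otimes> t) ` T"
    using g by (auto simp: chain_member_def)
  note xc = L.nc[OF xn]
  obtain w where w: "w \<in> carrier Q" "x \<otimes> w = \<one>" using xu by blast
  have *: "L.n = (\<lambda>t. x \<otimes> t) ` L.E" if x1: "x1 \<in> L.n" "L.n = (\<lambda>t. x1 \<otimes> t) ` L.E" for x1
  proof -
    note x1c = L.nc[OF x1(1)]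
    obtain u where u: "u \<in> L.E" "x = x1 \<otimes> u" using xn x1(2) by blast
    note uc = L.Ec[OF u(1)]
    have x1w: "x1 \<otimes> (u \<otimes> w) = \<one>" "u \<otimes> (x1 \<otimes> w) = \<one>" using u w x1c uc by (simp_all add: m_ac)
    \<comment> \<open>\<open>x1 a\<close> lies in \<open>xT\<close>, which is \<open>x1 u T\<close>,
      and \<open>x1\<close> cancels because it is a unit of \<open>Q\<close>.\<close>
    have nu: "\<exists>t\<in>T. a = u \<otimes> t" if a: "a \<in> L.n" for a
    proof -
      obtain t where t: "t \<in> T" "x1 \<otimes> a = x \<otimes> t" using prod[OF x1(1) a] by blast
      note c = x1c uc w(1) L.nc[OF a] L.Tc[OF t(1)]
      have "a = (x1 \<otimes> (u \<otimes> w)) \<otimes> a" using x1w c by simp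
      also have "\<dots> = (u \<otimes> w) \<otimes> (x1 \<otimes> a)" using c by algebra
      also have "\<dots> = (x1 \<otimes> (u \<otimes> w)) \<otimes> (u \<otimes> t)" unfolding t(2) u(2) using c by algebra
      finally show ?thesis using x1w c t by auto
    qed
    show ?thesis
    proof (cases "\<exists>t\<in>T. t \<notin> L.n \<and> u \<otimes> t \<in> L.n")
      case False
      define v where "v = x1 \<otimes> w"
      have v: "v \<in> carrier Q" "u \<otimes> v = \<one>" using x1w x1c w by (auto simp: v_def)
      have "v \<otimes> a \<in> L.n" if a: "a \<in> L.n" for a
      proof -
        obtain t where t: "t \<in> T" "a = u \<otimes> t" using nu[OF a] by blast
        have "v \<otimes> a = (u \<otimes> v) \<otimes> t" unfolding t(2) using v(1) uc L.Tc[OF t(1)] by algebra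
        then show ?thesis using v t False a L.Tc by auto
      qed
      then have vE: "v \<in> L.E" using v by (simp add: endo_ring_def)
      have x1v: "x1 = x \<otimes> v" unfolding u(2) using x1c uc v by (simp add: m_assoc)
      show ?thesis
      proof
        show "(\<lambda>t. x \<otimes> t) ` L.E \<subseteq> L.n" using L.n_ops(5)[OF _ xn] m_comm[OF xc L.Ec] by auto
        show "L.n \<subseteq> (\<lambda>t. x \<otimes> t) ` L.E"
        proof
          fix a assume "a \<in> L.n"
          then obtain e where e: "e \<in> L.E" "a = x1 \<otimes> e" using x1(2) by blast
          then have "a = x \<otimes> (v \<otimes> e)" unfolding x1v using xc v L.Ec[OF e(1)] by (simp add: m_assoc)
          then show "a \<in> (\<lambda>t. x \<otimes> t) ` L.E" using L.E_ops(4)[OF vE e(1)] by blast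
        qed
      qed
    next
      case True
      then obtain t s where t: "t \<in> T" "t \<notin> L.n" "u \<otimes> t \<in> L.n" "s \<in> T" "t \<otimes> s = \<one>" using L.unitT by blast
      have un: "u \<in> L.n"
      proof -
        have "s \<otimes> (u \<otimes> t) = (t \<otimes> s) \<otimes> u" using uc L.Tc[OF t(1)] L.Tc[OF t(4)] by algebra
        then have "s \<otimes> (u \<otimes> t) = u" using t uc by simp
        then show ?thesis using L.n_ops(5)[OF L.TE[OF t(4)] t(3)] by simp
      qed
      note uT = L.nT[OF un]
      have n_eq: "L.n = (\<lambda>t. u \<otimes> t) ` T"
      proof
        show "L.n \<subseteq> (\<lambda>t. u \<otimes> t) ` T" using nu by blast
        show "(\<lambda>t. u \<otimes> t) ` T \<subseteq> L.n" using L.n_ops(5)[OF L.TE un] m_comm[OF uc L.Tc] by auto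
      qed
      obtain k where k: "k \<in> T" "u [^] (2::nat) = x \<otimes> k" using prod[OF un un] uc
        by (auto simp: numeral_2_eq_2)
      \<comment> \<open>Two steps of expansion in \<open>u\<close> give
        \<open>T = R + Ru + u u T\<close>, and \<open>u u\<close> lies in \<open>xT\<close>: this is
        the form of generation that \<open>normal_simpleI\<close> accepts.\<close>
      have gen: "\<exists>p\<in>R. \<exists>q\<in>R. \<exists>s\<in>T. t = p \<oplus> q \<otimes> u \<oplus> x \<otimes> s" if tT: "t \<in> T" for t
      proof -
        obtain r where r: "r \<in> R" "t \<ominus> r \<in> L.n" using res[OF tT] by blast
        obtain t1 where t1: "t1 \<in> T" "t \<ominus> r = u \<otimes> t1" using nu[OF r(2)] by blast
        obtain r1 where r1: "r1 \<in> R" "t1 \<ominus> r1 \<in> L.n" using res[OF t1(1)] by blast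
        obtain t2 where t2: "t2 \<in> T" "t1 \<ominus> r1 = u \<otimes> t2" using nu[OF r1(2)] by blast
        note c = L.Tc[OF tT] Rc[OF r(1)] L.Tc[OF t1(1)] Rc[OF r1(1)] L.Tc[OF t2(1)] uc xc L.Tc[OF k(1)]
        have "t = r \<oplus> (t \<ominus> r)" using c by algebra
        also have "\<dots> = r \<oplus> u \<otimes> (r1 \<oplus> (t1 \<ominus> r1))" unfolding t1(2) using c by algebra
        also have "\<dots> = r \<oplus> r1 \<otimes> u \<oplus> (u \<otimes> u) \<otimes> t2" unfolding t2(2) using c by algebra
        also have "u \<otimes> u = x \<otimes> k" using k(2) uc by (simp add: numeral_2_eq_2)
        also have "(x \<otimes> k) \<otimes> t2 = x \<otimes> (k \<otimes> t2)" using c by algebra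
        finally show ?thesis using r(1) r1(1) L.T_ops(4)[OF k(1) t2(1)] by blast
      qed
      have "normal_simple T"
      proof (rule normal_simpleI[OF x L.bT uT gen uT _ k(2,1)])
        show "\<exists>w\<in>carrier Q. u \<otimes> w = \<one>" using x1w(2) x1c w(1) by blast
        fix a assume a: "a \<in> T" "a \<otimes> a \<in> (\<lambda>t. u \<otimes> t) ` T"
        show "a \<in> (\<lambda>t. u \<otimes> t) ` T"
        proof (rule ccontr)
          assume na: "a \<notin> (\<lambda>t. u \<otimes> t) ` T"
          then obtain b where b: "b \<in> T" "a \<otimes> b = \<one>" using L.unitT a n_eq by blast
          have "b \<otimes> (a \<otimes> a) \<in> L.n" using L.n_ops(5)[OF L.TE[OF b(1)]] a n_eq by blast
          moreover have "b \<otimes> (a \<otimes> a) = (a \<otimes> b) \<otimes> a" using L.Tc[OF a(1)] L.Tc[OF b(1)] by algebra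
          ultimately show False using b L.Tc[OF a(1)] n_eq na by simp
        qed
      qed
      then show ?thesis using nf by blast
    qed
  qed
  show eq: "L.n = (\<lambda>t. x \<otimes> t) ` L.E" by (rule L.endo_ring_dichotomy) (rule *, assumption+)+
  show "chain_member x L.E"
  proof (rule L.endo_ring_dichotomy, goal_cases)
    case (1 x1)
    then show ?case using L.chain_member_E[OF _ _ xn eq res] by blast
  next
    case (2 x1 y)
    have "normal_simple L.E"
    proof (rule normal_simpleI[OF x L.E_bounded 2(3) _ L.nE[OF xn] xu, of 1 \<one>])
      show "x [^] (1::nat) = x \<otimes> \<one>" "\<one> \<in> L.E" using xc L.E_ops by simp_all
      show "a \<in> (\<lambda>t. x \<otimes> t) ` L.E" if "a \<in> L.E" "a \<otimes> a \<in> (\<lambda>t. x \<otimes> t) ` L.E" for a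
        using 2(5) that eq by simp
      fix t assume t: "t \<in> L.E"
      obtain p q where pq: "p \<in> T" "q \<in> T" "t = p \<oplus> q \<otimes> y" using 2(4) t by blast
      obtain r where r: "r \<in> R" "p \<ominus> r \<in> L.n" using res pq by blast
      obtain r' where r': "r' \<in> R" "q \<ominus> r' \<in> L.n" using res pq by blast
      have "(p \<ominus> r) \<oplus> y \<otimes> (q \<ominus> r') \<in> L.n" using L.n_ops(2) r(2) L.n_ops(5)[OF 2(3) r'(2)] by blast
      then obtain s where s: "s \<in> L.E" "(p \<ominus> r) \<oplus> y \<otimes> (q \<ominus> r') = x \<otimes> s" using eq by blast
      note c = L.Tc[OF pq(1)] L.Tc[OF pq(2)] Rc[OF r(1)] Rc[OF r'(1)] L.Ec[OF 2(3)]
      have "t = r \<oplus> r' \<otimes> y \<oplus> ((p \<ominus> r) \<oplus> y \<otimes> (q \<ominus> r'))" unfolding pq(3) using c by algebra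
      then show "\<exists>p\<in>R. \<exists>q\<in>R. \<exists>s\<in>L.E. t = p \<oplus> q \<otimes> y \<oplus> x \<otimes> s" using s r(1) r'(1) by metis
    qed
    then show ?case using nf by blast
  qed
qed

text \<open>Were the endomorphism ring of the maximal ideal equal to \<open>R\<close>, that ideal
  would be \<open>xR\<close>, and \<open>R\<close>, with a reduced quotient by \<open>x\<close>,
  would be a ring as in \<open>normal_simple\<close>. So the chain moves at its first step, which
  later makes \<open>B\<close> larger than \<open>R\<close>.\<close>

lemma chain_start:
  assumes nf: "\<And>T. \<not> normal_simple T"
  obtains x where "x \<in> nonunits Q R" "\<exists>w\<in>carrier Q. x \<otimes> w = \<one>"
    "nonunits Q R = (\<lambda>t. x \<otimes> t) ` endo_ring Q (nonunits Q R)" "chain_member x (endo_ring Q (nonunits Q R))"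
    "endo_ring Q (nonunits Q R) \<noteq> R"
proof -
  interpret L: local_overring Q R m R by (rule local_overring_R)
  have xu: "\<exists>w\<in>carrier Q. x \<otimes> w = \<one>" if x: "x \<in> L.n" "L.n = (\<lambda>t. x \<otimes> t) ` L.E" for x
  proof -
    obtain t where t: "t \<in> L.E" "m = x \<otimes> t" using m x(2) by blast
    obtain w where w: "w \<in> carrier Q" "m \<otimes> w = \<one>" using m_unit by blast
    have "x \<otimes> (t \<otimes> w) = \<one>" using w t L.nc[OF x(1)] L.Ec[OF t(1)] by (simp add: m_assoc)
    then show ?thesis using w t L.Ec by blast
  qed
  have res: "\<exists>r\<in>R. t \<ominus> r \<in> L.n" if "t \<in> R" for t
  proof -
    have "t \<ominus> t = \<zero>" using Rc[OF that] by algebra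
    then show ?thesis using L.n_ops(1) that by metis
  qed
  have red: False if x: "x \<in> L.n" "L.n = (\<lambda>t. x \<otimes> t) ` L.E" "y \<in> L.E" "\<And>t. t \<in> L.E \<Longrightarrow>
    \<exists>p\<in>R. \<exists>q\<in>R. t = p \<oplus> q \<otimes> y"
      "\<And>a. a \<in> L.E \<Longrightarrow> a \<otimes> a \<in> L.n \<Longrightarrow> a \<in> L.n" for x y
  proof -
    note xc = L.nc[OF x(1)]
    have "normal_simple L.E"
    proof (rule normal_simpleI[OF x(1) L.E_bounded x(3) _ L.nE[OF x(1)] xu[OF x(1,2)], of 1 \<one>])
      show "x [^] (1::nat) = x \<otimes> \<one>" "\<one> \<in> L.E" using xc L.E_ops by simp_all
      show "a \<in> (\<lambda>t. x \<otimes> t) ` L.E" if "a \<in> L.E" "a \<otimes> a \<in> (\<lambda>t. x \<otimes> t) ` L.E" for a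
        using x(5) that unfolding x(2)[symmetric] by blast
      fix t assume t: "t \<in> L.E"
      obtain p q where pq: "p \<in> R" "q \<in> R" "t = p \<oplus> q \<otimes> y" using x(4) t by blast
      then have "t = p \<oplus> q \<otimes> y \<oplus> x \<otimes> \<zero>" using L.Ec[OF t] xc by simp
      then show "\<exists>p\<in>R. \<exists>q\<in>R. \<exists>s\<in>L.E. t = p \<oplus> q \<otimes> y \<oplus> x \<otimes> s" using pq L.E_ops(1) by blast
    qed
    then show False using nf by blast
  qed
  show ?thesis
  proof (rule L.endo_ring_dichotomy, goal_cases)
    case (1 x)
    have ER: "L.E \<noteq> R"
    proof
      assume e: "L.E = R"
      show False
      proof (rule red[OF 1(1,2) L.E_ops(2)])
        show "\<exists>p\<in>R. \<exists>q\<in>R. t = p \<oplus> q \<otimes> \<one>" if "t \<in> L.E" for t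
          by (rule bexI[of _ t], rule bexI[of _ \<zero>]) (use that e L.Ec L.T_ops in auto)
        show "a \<in> L.n" if a: "a \<in> L.E" "a \<otimes> a \<in> L.n" for a
        proof (rule ccontr)
          assume "a \<notin> L.n"
          then obtain b where b: "b \<in> R" "a \<otimes> b = \<one>" using L.unitT a e by blast
          have "b \<otimes> (a \<otimes> a) \<in> L.n" using L.n_ops(5)[OF L.TE[OF b(1)] a(2)] .
          moreover have "b \<otimes> (a \<otimes> a) = (a \<otimes> b) \<otimes> a" using L.Ec[OF a(1)] Rc[OF b(1)] by algebra
          ultimately show False using b L.Ec[OF a(1)] \<open>a \<notin> L.n\<close> by simp
        qed
      qed
    qed
    show ?case by (rule that[OF 1(1) xu[OF 1(1,2)] 1(2) L.chain_member_E[OF 1(3,4,1,2) res] ER])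
  next
    case (2 x y)
    then show ?case using red by blast
  qed
qed

end

section \<open>Quadratic relations and the union of the chain\<close>

lemma (in cring) geometric_sum_in_subring:
  assumes F: "subring F R" and a: "a \<in> F"
  obtains s where "s \<in> F" "(\<one> \<ominus> a) \<otimes> s = \<one> \<ominus> a [^] (j::nat)"
proof -
  note Fc = subsetD[OF subringE(1)[OF F]]
  have "\<exists>s\<in>F. (\<one> \<ominus> a) \<otimes> s = \<one> \<ominus> a [^] j"
  proof (induction j)
    case 0
    have "(\<one> \<ominus> a) \<otimes> \<zero> = \<one> \<ominus> a [^] (0::nat)" using Fc[OF a] by (simp add: minus_eq r_neg)
    then show ?case using subringE(2)[OF F] by blast
  next
    case (Suc j)
    then obtain s where s: "s \<in> F" "(\<one> \<ominus> a) \<otimes> s = \<one> \<ominus> a [^] j" by blast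
    have aj: "a [^] j \<in> F" by (rule subring_pow[OF F a])
    have "(\<one> \<ominus> a) \<otimes> (s \<oplus> a [^] j) = (\<one> \<ominus> a) \<otimes> s \<oplus> (\<one> \<ominus> a) \<otimes> a [^] j"
      using Fc[OF a] Fc[OF s(1)] Fc[OF aj] by algebra
    also have "\<dots> = \<one> \<ominus> a [^] j \<otimes> a" unfolding s(2) using Fc[OF a] Fc[OF aj] by algebra
    finally have "(\<one> \<ominus> a) \<otimes> (s \<oplus> a [^] j) = \<one> \<ominus> a [^] (Suc j)" by simp
    then show ?case using subringE(7)[OF F s(1) aj] by blast
  qed
  then show ?thesis using that by blast
qed

context fraction_setting
begin

text \<open>Put \<open>I = R + Ry + Rz\<close>. Invertibility, tested against the maximal ideal of
  \<open>T\<close>, gives a unit \<open>q\<close> of \<open>T\<close> with \<open>qI\<close> inside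
  \<open>E(I)\<close>. The ring \<open>E(I)\<close> is not known to be local, so the inverse of
  \<open>q\<close> has to be found in it explicitly; then \<open>y = q^-1 (qy)\<close> lies in
  \<open>E(I)\<close> and \<open>yz\<close> in \<open>I\<close>.\<close>

lemma chain_member_quadratic:
  assumes x: "x \<in> nonunits Q R" and g: "chain_member x T" and yz: "y \<in> T" "z \<in> T"
  shows "\<exists>r\<in>R. \<exists>p\<in>R. \<exists>q\<in>R. y \<otimes> z = r \<oplus> p \<otimes> y \<oplus> q \<otimes> z"
proof -
  interpret L: local_overring Q R m T by (rule local_overring_if_chain_member[OF g])
  interpret LR: local_overring Q R m R by (rule local_overring_R)
  have res: "\<And>t. t \<in> T \<Longrightarrow> \<exists>r\<in>R. t \<ominus> r \<in> L.n" and xn: "x \<in> L.n"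
    and prod: "\<And>a b. a \<in> L.n \<Longrightarrow> b \<in> L.n \<Longrightarrow> a \<otimes> b \<in> (\<lambda>t. x \<otimes> t) ` T"
    using g by (auto simp: chain_member_def)
  have yzc: "y \<in> carrier Q" "z \<in> carrier Q" using yz L.Tc by auto
  define I where "I = {r \<oplus> p \<otimes> y \<oplus> q \<otimes> z | r p q. r \<in> R \<and> p \<in> R \<and> q \<in> R}"
  have Ismod: "smod Q R I" unfolding I_def by (rule smod_span3[OF R yzc])
  have mem: "r \<in> R \<Longrightarrow> r \<in> I" "y \<in> I" "z \<in> I" for r using span3_mem[OF R yzc] unfolding I_def by blast+
  have IT: "I \<subseteq> T"
  proof
    fix w assume "w \<in> I"
    then obtain r p q where "r \<in> R" "p \<in> R" "q \<in> R" "w = r \<oplus> p \<otimes> y \<oplus> q \<otimes> z" unfolding I_def by blast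
    then show "w \<in> T" using yz L.RT L.T_ops(4,5) by (simp add: subsetD)
  qed
  obtain b :: nat where b: "\<And>t. t \<in> T \<Longrightarrow> m [^] b \<otimes> t \<in> R" using L.bT by (auto simp: bounded_overring_def)
  have m1: "m [^] (1::nat) \<in> I" using mem(1) mR by simp
  have bI: "m [^] b \<otimes> w \<in> R" if "w \<in> I" for w using b IT that by blast
  have inv: "invertible_frac Q I" by (rule stable[OF Ismod m1 bI])
  note F = endo_subring[OF R Ismod]
  let ?F = "endo_ring Q I"
  note Fc = subsetD[OF subringE(1)[OF F(1)]]
  have FI: "?F \<subseteq> I"
  proof
    fix q assume q: "q \<in> ?F"
    have "q \<otimes> \<one> \<in> I" using endo_ringD(2)[OF q mem(1)[OF subringE(3)[OF R]]] .
    then show "q \<in> I" unfolding r_one[OF endo_ringD(1)[OF q]] .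
  qed
  \<comment> \<open>A nonunit of \<open>R\<close> stays a nonunit of \<open>T\<close> because a
    power of it is divisible by \<open>m\<close>, which is a nonunit of \<open>T\<close>.\<close>
  have nRT: "a \<in> L.n" if a: "a \<in> LR.n" for a
  proof (rule ccontr)
    assume "a \<notin> L.n"
    moreover have aT: "a \<in> T" using LR.nT[OF a] L.RT by blast
    ultimately obtain c where c: "c \<in> T" "a \<otimes> c = \<one>" using L.unitT by blast
    obtain k :: nat and d where d: "d \<in> R" "a [^] k = m \<otimes> d" using rad[OF a] by blast
    have dT: "d \<in> T" using d L.RT by blast
    have "\<one> = (a \<otimes> c) [^] k" using c by simp
    also have "\<dots> = (d \<otimes> c [^] k) \<otimes> m"
      using d L.Tc[OF aT] L.Tc[OF c(1)] L.Tc[OF dT] by (simp add: nat_pow_distrib m_ac)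
    also have "\<dots> \<in> L.n" using L.n_ops(5)[OF L.TE[OF L.T_ops(4)[OF dT subring_pow[OF L.T c(1)]]] L.mT] .
    finally show False using L.one_notin by simp
  qed
  obtain w q where wq: "w \<in> I" "q \<in> carrier Q" "\<And>y. y \<in> I \<Longrightarrow> q \<otimes> y \<in> ?F" "q \<otimes> w \<notin> L.n"
    using L.invertibleE[OF inv smod_subset[OF L.n_smod] L.one_notin] by blast
  have qF: "q \<in> ?F" using wq(3)[OF mem(1)[OF subringE(3)[OF R]]] r_one[OF wq(2)] by metis
  have qT: "q \<in> T" using qF FI IT by blast
  have qn: "q \<notin> L.n"
  proof
    assume "q \<in> L.n"
    then have "w \<otimes> q \<in> L.n" using L.n_ops(5)[OF L.TE] wq(1) IT by blast
    then show False using wq(4) m_comm[OF smodD(1)[OF Ismod wq(1)] wq(2)] by metis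
  qed
  obtain r where r: "r \<in> R" "q \<ominus> r \<in> L.n" using res[OF qT] by blast
  have "r \<notin> LR.n"
  proof
    assume "r \<in> LR.n"
    then have "(q \<ominus> r) \<oplus> r \<in> L.n" using nRT r L.n_ops(2) by blast
    moreover have "(q \<ominus> r) \<oplus> r = q" using wq(2) Rc[OF r(1)] by algebra
    ultimately show False using qn by simp
  qed
  then obtain s where s: "s \<in> R" "r \<otimes> s = \<one>" using LR.unitT r by blast
  \<comment> \<open>As \<open>T\<close> has the residue field of \<open>R\<close>, \<open>q\<close>
    agrees modulo nonunits of \<open>T\<close> with a unit \<open>r\<close> of \<open>R\<close>; so
    \<open>qs = 1 - v\<close>, where \<open>v\<close> is a nonunit of \<open>T\<close> lying in
    \<open>E(I)\<close>.\<close>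
  define v where "v = \<one> \<ominus> q \<otimes> s"
  note c = wq(2) Rc[OF r(1)] Rc[OF s(1)]
  have vF: "v \<in> ?F" using F(1,2) qF s(1) subringE(3,5,6,7)[OF F(1)] by (auto simp: v_def minus_eq)
  have "v = \<ominus> (s \<otimes> (q \<ominus> r))"
  proof -
    have "v = (r \<otimes> s) \<ominus> q \<otimes> s" using s by (simp add: v_def)
    also have "\<dots> = \<ominus> (s \<otimes> (q \<ominus> r))" using c by algebra
    finally show ?thesis .
  qed
  then have vn: "v \<in> L.n" using L.n_ops(3) L.n_ops(5)[OF _ r(2)] L.TE s(1) L.RT by auto
  note vc = Fc[OF vF]
  obtain t where t: "t \<in> T" "v \<otimes> v = x \<otimes> t" using prod[OF vn vn] by blast
  have xR: "x \<in> R" using x by (simp add: nonunits_def)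
  obtain N :: nat where N: "\<And>t. t \<in> T \<Longrightarrow> x [^] N \<otimes> t \<in> R" using bounded_nonunit[OF x L.bT] by blast
  \<comment> \<open>\<open>v v = xt\<close> turns this power into \<open>x^(N+1) t^(N+1)\<close>:
    \<open>N\<close> factors \<open>x\<close> clear the denominator of \<open>t^(N+1)\<close> and
    one is left over, so the power is a nonunit of \<open>R\<close>. Then \<open>1 - v^j\<close> is
    a unit of \<open>R\<close>, and the geometric sum in \<open>v\<close>, which lies in
    \<open>E(I)\<close>, yields an inverse of \<open>1 - v\<close> there.\<close>
  let ?j = "2 * Suc N"
  have vj: "v [^] ?j \<in> LR.n"
  proof -
    have "v [^] ?j = (v \<otimes> v) [^] Suc N" using nat_pow_pow[OF vc, of 2 "Suc N"] vc
      by (simp add: numeral_2_eq_2)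
    also have "\<dots> = (x [^] N \<otimes> t [^] Suc N) \<otimes> x"
      unfolding t(2) using Rc[OF xR] L.Tc[OF t(1)] by (simp add: nat_pow_distrib m_ac)
    also have "\<dots> \<in> LR.n" by (rule nonunits_absorb[OF R x N[OF subring_pow[OF L.T t(1)]]])
    finally show ?thesis .
  qed
  obtain \<sigma> where \<sigma>: "\<sigma> \<in> ?F" "(\<one> \<ominus> v) \<otimes> \<sigma> = \<one> \<ominus> v [^] ?j" using geometric_sum_in_subring[OF F(1) vF]
    by blast
  obtain \<tau> where \<tau>: "\<tau> \<in> R" "(\<one> \<oplus> (\<ominus> (v [^] ?j))) \<otimes> \<tau> = \<one>" using LR.one_plus_unit[OF LR.n_ops(3)[OF vj]]
    by blast
  define g where "g = s \<otimes> \<sigma> \<otimes> \<tau>"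
  have gF: "g \<in> ?F" unfolding g_def
    by (rule subringE(6)[OF F(1) subringE(6)[OF F(1) subsetD[OF F(2) s(1)] \<sigma>(1)] subsetD[OF F(2) \<tau>(1)]])
  have gq: "g \<otimes> q = \<one>"
  proof -
    have "q \<otimes> s = \<one> \<ominus> v" unfolding v_def using c by algebra
    have "g \<otimes> q = ((q \<otimes> s) \<otimes> \<sigma>) \<otimes> \<tau>" unfolding g_def using c Fc[OF \<sigma>(1)] Rc[OF \<tau>(1)] by algebra
    also have "\<dots> = (\<one> \<ominus> v [^] ?j) \<otimes> \<tau>" unfolding \<open>q \<otimes> s = \<one> \<ominus> v\<close> \<sigma>(2) ..
    also have "\<dots> = \<one>" using \<tau>(2) by (simp add: minus_eq)
    finally show ?thesis .
  qed
  have "y = g \<otimes> (q \<otimes> y)" using gq Fc[OF gF] wq(2) yzc by (simp add: m_assoc[symmetric])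
  then have "y \<in> ?F" using subringE(6)[OF F(1) gF wq(3)[OF mem(2)]] by simp
  then have "y \<otimes> z \<in> I" using endo_ringD(2)[OF _ mem(3)] by metis
  then show ?thesis unfolding I_def by blast
qed

primrec chain :: "nat \<Rightarrow> 'a set" where
  "chain 0 = R"
| "chain (Suc i) = endo_ring Q (nonunits Q (chain i))"

text \<open>Each maximal ideal in the chain being \<open>x\<close> times the next ring gives both
  the expansion \<open>b = r + xc\<close> and the alternative that \<open>b\<close> is a multiple of
  \<open>x\<close> or a unit. Thus \<open>x\<close> acts in \<open>B\<close> like a uniformiser, up
  to the intersection of the ideals \<open>x^j B\<close>. No stage inverts \<open>x\<close>, so
  \<open>B\<close> does not either.\<close>

lemma divisible_overring:
  assumes nf: "\<And>T. \<not> normal_simple T"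
  obtains x B where "x \<in> nonunits Q R" "\<exists>w\<in>carrier Q. x \<otimes> w = \<one>" "subring B Q" "R \<subset> B"
    "\<And>b. b \<in> B \<Longrightarrow> \<exists>r\<in>R. \<exists>c\<in>B. b = r \<oplus> x \<otimes> c"
    "\<And>y z. y \<in> B \<Longrightarrow> z \<in> B \<Longrightarrow> \<exists>r\<in>R. \<exists>p\<in>R. \<exists>q\<in>R. y \<otimes> z = r \<oplus> p \<otimes> y \<oplus> q \<otimes> z"
    "\<And>b. b \<in> B \<Longrightarrow> (\<exists>c\<in>B. b = x \<otimes> c) \<or> (\<exists>c\<in>B. b \<otimes> c = \<one>)"
    "\<And>c. c \<in> B \<Longrightarrow> x \<otimes> c \<noteq> \<one>"
proof -
  obtain x where x: "x \<in> nonunits Q R" "\<exists>w\<in>carrier Q. x \<otimes> w = \<one>"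
    "nonunits Q R = (\<lambda>t. x \<otimes> t) ` endo_ring Q (nonunits Q R)" "chain_member x (endo_ring Q (nonunits Q R))"
    "endo_ring Q (nonunits Q R) \<noteq> R" by (rule chain_start[OF nf])
  have g: "chain_member x (chain (Suc i))" for i
  proof (induction i)
    case (Suc i)
    then show ?case using chain_member_step(2)[OF nf x(1,2)] by simp
  qed (use x in simp)
  have bo: "bounded_overring (chain i)" for i
    by (cases i) (use g local_overring.bT[OF local_overring_R] in \<open>auto simp: chain_member_def simp del: chain.simps(2)\<close>)
  have loc: "local_overring Q R m (chain i)" for i
    by (cases i) (use local_overring_R local_overring_if_chain_member[OF g] in \<open>auto simp del: chain.simps(2)\<close>)
  have n_eq: "nonunits Q (chain i) = (\<lambda>t. x \<otimes> t) ` chain (Suc i)" for i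
    by (cases i) (use x(3) chain_member_step(1)[OF nf x(1,2) g] in auto)
  have endo_ring_dichotomy: "chain i \<subseteq> chain (Suc i)" for i using local_overring.TE[OF loc[of i]] by auto
  have mono: "i \<le> j \<Longrightarrow> chain i \<subseteq> chain j" for i j using lift_Suc_mono_le[of chain i j] endo_ring_dichotomy
    by blast
  have res: "\<exists>r\<in>R. t \<ominus> r \<in> nonunits Q (chain i)" if "t \<in> chain i" for t i
  proof (cases i)
    case 0
    then have tR: "t \<in> R" using that by simp
    have "t \<ominus> t = \<zero>" using Rc[OF tR] by algebra
    moreover have "\<zero> \<in> nonunits Q (chain i)" by (rule smodD(2)[OF local_overring.n_smod[OF loc]])
    ultimately show ?thesis using tR by metis
  next
    case (Suc k)
    then show ?thesis using g[of k] that unfolding chain_member_def by blast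
  qed
  define B where "B = (\<Union>i. chain i)"
  have sub: "subring (chain i) Q" "R \<subseteq> chain i" for i using bo[of i] by (auto simp: bounded_overring_def)
  have two: "\<exists>i. a \<in> chain (Suc i) \<and> b \<in> chain (Suc i)" if "a \<in> B" "b \<in> B" for a b
  proof -
    obtain i j where "a \<in> chain i" "b \<in> chain j" using \<open>a \<in> B\<close> \<open>b \<in> B\<close> by (auto simp: B_def)
    then have "a \<in> chain (Suc (max i j))" "b \<in> chain (Suc (max i j))"
      using mono[OF le_SucI[OF max.cobounded1[of i j]]] mono[OF le_SucI[OF max.cobounded2[of j i]]]
      by blast+
    then show ?thesis by blast
  qed
  have chB: "a \<in> chain i \<Longrightarrow> a \<in> B" for a i by (auto simp: B_def)
  have Bc: "B \<subseteq> carrier Q" using subringE(1)[OF sub(1)] by (auto simp: B_def simp del: chain.simps(2))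
  show ?thesis
  proof (rule that[OF x(1,2)])
    show "subring B Q"
    proof (rule ring.subringI[OF ring_axioms Bc])
      show "\<one> \<in> B" using subringE(3)[OF R] chB[of \<one> 0] by simp
      show "\<ominus> h \<in> B" if h: "h \<in> B" for h
      proof -
        obtain i where "h \<in> chain i" using h by (auto simp: B_def)
        then show ?thesis using subringE(5)[OF sub(1)] chB by blast
      qed
      show "a \<otimes> b \<in> B" "a \<oplus> b \<in> B" if ab: "a \<in> B" "b \<in> B" for a b
        using two[OF ab] subringE(6,7)[OF sub(1)] chB by blast+
    qed
    show "R \<subset> B"
    proof -
      have "R \<subseteq> chain 1" "chain 1 \<noteq> R" "chain 1 \<subseteq> B"
        using sub(2)[of 1] x(5) chB[of _ 1] by (simp_all add: subset_iff)
      then show ?thesis by blast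
    qed
    show "\<exists>r\<in>R. \<exists>p\<in>R. \<exists>q\<in>R. y \<otimes> z = r \<oplus> p \<otimes> y \<oplus> q \<otimes> z" if "y \<in> B" "z \<in> B" for y z
      using two[OF that] chain_member_quadratic[OF x(1) g] by blast
    fix b assume b: "b \<in> B"
    then obtain i where i: "b \<in> chain i" using B_def by blast
    show "\<exists>r\<in>R. \<exists>c\<in>B. b = r \<oplus> x \<otimes> c"
    proof -
      obtain r where r: "r \<in> R" "b \<ominus> r \<in> nonunits Q (chain i)" using res[OF i] by blast
      obtain c where c: "c \<in> chain (Suc i)" "b \<ominus> r = x \<otimes> c" using r(2) unfolding n_eq by blast
      have "b = r \<oplus> (b \<ominus> r)" using Rc[OF r(1)] subsetD[OF Bc b] by algebra
      then show ?thesis using r c chB[OF c(1)] by metis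
    qed
    show "(\<exists>c\<in>B. b = x \<otimes> c) \<or> (\<exists>c\<in>B. b \<otimes> c = \<one>)"
    proof (cases "b \<in> nonunits Q (chain i)")
      case True
      then obtain c where "c \<in> chain (Suc i)" "b = x \<otimes> c" unfolding n_eq by blast
      then show ?thesis using chB by blast
    next
      case False
      then obtain c where "c \<in> chain i" "b \<otimes> c = \<one>" using i by (auto simp: nonunits_def)
      then show ?thesis using chB by blast
    qed
    show "x \<otimes> b \<noteq> \<one>"
    proof -
      obtain i where "b \<in> chain (Suc i)" using two[OF b b] by blast
      moreover have "x \<in> nonunits Q (chain (Suc i))" using g[of i]
        by (simp add: chain_member_def del: chain.simps)
      ultimately show ?thesis by (auto simp: nonunits_def)
    qed
  qed
qed

end

section \<open>Adic completions\<close>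

text \<open>An abstract description of the \<open>x\<close>-adic completion, so that a single \<open>C\<close> serves \<open>R\<close> and \<open>R/J\<close>.\<close>
locale adic_hom = R: cring R + C: cring C for R (structure) and C (structure) +
  fixes \<phi> x
  assumes hom: "\<phi> \<in> ring_hom R C" and x: "x \<in> carrier R"
    and dense: "\<And>c i. c \<in> carrier C \<Longrightarrow> \<exists>r\<in>carrier R. \<exists>d\<in>carrier C. c = \<phi> r \<oplus>\<^bsub>C\<^esub> \<phi> x [^]\<^bsub>C\<^esub> (i::nat) \<otimes>\<^bsub>C\<^esub> d"
    and exact: "\<And>r d i. r \<in> carrier R \<Longrightarrow> d \<in> carrier C \<Longrightarrow> \<phi> r = \<phi> x [^]\<^bsub>C\<^esub> (i::nat) \<otimes>\<^bsub>C\<^esub> d \<Longrightarrow>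
        \<exists>s\<in>carrier R. r = x [^]\<^bsub>R\<^esub> i \<otimes>\<^bsub>R\<^esub> s"
    and separated: "\<And>c. c \<in> carrier C \<Longrightarrow> (\<And>i. \<exists>d\<in>carrier C. c = \<phi> x [^]\<^bsub>C\<^esub> (i::nat) \<otimes>\<^bsub>C\<^esub> d) \<Longrightarrow> c = \<zero>\<^bsub>C\<^esub>"
    and complete: "\<And>f. (\<And>i. f i \<in> carrier R) \<Longrightarrow> (\<And>i. \<exists>s\<in>carrier R. f (Suc i) = f i \<oplus>\<^bsub>R\<^esub> x [^]\<^bsub>R\<^esub> (i::nat) \<otimes>\<^bsub>R\<^esub> s) \<Longrightarrow>
        \<exists>c\<in>carrier C. \<forall>i. \<exists>d\<in>carrier C. c = \<phi> (f i) \<oplus>\<^bsub>C\<^esub> \<phi> x [^]\<^bsub>C\<^esub> i \<otimes>\<^bsub>C\<^esub> d"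
begin

sublocale ring_hom_cring R C \<phi>
  by unfold_locales (rule hom)

abbreviation X :: "nat \<Rightarrow> 'c" where "X i \<equiv> \<phi> x [^]\<^bsub>C\<^esub> i"

lemma X_closed [simp]: "X i \<in> carrier C" using x by simp
lemma phi_pow: "\<phi> (x [^]\<^bsub>R\<^esub> i) = X i" for i :: nat using x by simp
lemma xpow [simp]: "x [^]\<^bsub>R\<^esub> (i::nat) \<in> carrier R" using x by simp

lemma dense_le:
  assumes "c \<in> carrier C"
  obtains r d where "r \<in> carrier R" "d \<in> carrier C" "c = \<phi> r \<oplus>\<^bsub>C\<^esub> X i \<otimes>\<^bsub>C\<^esub> d"
  using dense[OF assms] by blast

end

text \<open>The ideal \<open>L j\<close> stands for \<open>R \<inter> x\<^sup>jB\<close>.\<close>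
locale graded_adic_hom = adic_hom R C \<phi> x for R (structure) and C (structure) and \<phi> x +
  fixes L :: "nat \<Rightarrow> 'a set"
  assumes L_ideal: "\<And>j. ideal (L j) R" and L_0: "L 0 = carrier R" and L_Suc: "\<And>j. L (Suc j) \<subseteq> L j"
    and xL: "\<And>j. x [^]\<^bsub>R\<^esub> j \<in> L j"
    and L_mult: "\<And>r s i j. r \<in> L i \<Longrightarrow> s \<in> L j \<Longrightarrow> r \<otimes>\<^bsub>R\<^esub> s \<in> L (i + j)"
    and L_mult_notin: "\<And>r s i j. r \<in> L i \<Longrightarrow> r \<notin> L (Suc i) \<Longrightarrow> s \<in> L j \<Longrightarrow> s \<notin> L (Suc j) \<Longrightarrow>
        r \<otimes>\<^bsub>R\<^esub> s \<notin> L (Suc (i + j))"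
    and L_div: "\<And>r s i k. r \<in> L i \<Longrightarrow> r \<notin> L (Suc i) \<Longrightarrow> s \<in> L (i + k) \<Longrightarrow>
        \<exists>t\<in>carrier R. s \<ominus>\<^bsub>R\<^esub> r \<otimes>\<^bsub>R\<^esub> (x [^]\<^bsub>R\<^esub> k \<otimes>\<^bsub>R\<^esub> t) \<in> L (Suc (i + k))"
    and L_square: "\<And>r s j. r \<in> L j \<Longrightarrow> s \<in> L j \<Longrightarrow> \<exists>t\<in>carrier R. r \<otimes>\<^bsub>R\<^esub> s = x [^]\<^bsub>R\<^esub> j \<otimes>\<^bsub>R\<^esub> t"
    and L_nonzero: "\<exists>f j. (\<forall>i. f i \<in> L i \<and> (\<exists>s\<in>carrier R. f (Suc i) = f i \<oplus>\<^bsub>R\<^esub> x [^]\<^bsub>R\<^esub> i \<otimes>\<^bsub>R\<^esub> s)) \<and>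
        (\<forall>t\<in>carrier R. f j \<noteq> x [^]\<^bsub>R\<^esub> j \<otimes>\<^bsub>R\<^esub> t)"
    and one_L: "\<one>\<^bsub>R\<^esub> \<notin> L 1" and x_L: "x \<notin> L 2"
begin

lemma Lc: "r \<in> L j \<Longrightarrow> r \<in> carrier R" using ideal.Icarr[OF L_ideal] .
lemma L_add: "r \<in> L j \<Longrightarrow> s \<in> L j \<Longrightarrow> r \<oplus>\<^bsub>R\<^esub> s \<in> L j"
  using additive_subgroup.a_closed[OF ideal.axioms(1)[OF L_ideal]] .
lemma L_absorb: "r \<in> L j \<Longrightarrow> s \<in> carrier R \<Longrightarrow> s \<otimes>\<^bsub>R\<^esub> r \<in> L j" using ideal.I_l_closed[OF L_ideal] .

text \<open>The kernel of the map from \<open>C\<close> to \<open>R\<close> modulo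
  \<open>L j\<close>, that is, the closure of the image of \<open>L j\<close>. For
  \<open>L j = R \<inter> x^j B\<close> the target is \<open>B/x^j B\<close>, so the
  \<open>V j\<close> stand in for the powers of \<open>x\<close> in the completion of
  \<open>B\<close>.\<close>

definition V :: "nat \<Rightarrow> 'c set" where
  "V j = {c \<in> carrier C. \<exists>r\<in>L j. \<exists>d\<in>carrier C. c = \<phi> r \<oplus>\<^bsub>C\<^esub> X j \<otimes>\<^bsub>C\<^esub> d}"

text \<open>Two approximations of one element modulo \<open>X j\<close> differ, by
  \<open>exact\<close>, by a multiple of \<open>x^j\<close>, which belongs to \<open>L j\<close>. So
  any approximation at a level \<open>i\<close>, at least \<open>j\<close>, decides membership, and
  the assumptions on \<open>L\<close> pass to \<open>V\<close>.\<close>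

lemma V_iff:
  assumes r: "r \<in> carrier R" and d: "d \<in> carrier C" and ij: "j \<le> i"
  shows "\<phi> r \<oplus>\<^bsub>C\<^esub> X i \<otimes>\<^bsub>C\<^esub> d \<in> V j \<longleftrightarrow> r \<in> L j"
proof -
  have Xi: "X i = X j \<otimes>\<^bsub>C\<^esub> X (i - j)" using ij x by (simp add: C.nat_pow_mult)
  have rc: "\<phi> r \<in> carrier C" using r by simp
  show ?thesis
  proof
    assume "r \<in> L j"
    moreover have "\<phi> r \<oplus>\<^bsub>C\<^esub> X i \<otimes>\<^bsub>C\<^esub> d = \<phi> r \<oplus>\<^bsub>C\<^esub> X j \<otimes>\<^bsub>C\<^esub> (X (i - j) \<otimes>\<^bsub>C\<^esub> d)"
      unfolding Xi using rc d by (simp add: C.m_assoc)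
    moreover have "X (i - j) \<otimes>\<^bsub>C\<^esub> d \<in> carrier C" "\<phi> r \<oplus>\<^bsub>C\<^esub> X i \<otimes>\<^bsub>C\<^esub> d \<in> carrier C" using d rc by simp_all
    ultimately show "\<phi> r \<oplus>\<^bsub>C\<^esub> X i \<otimes>\<^bsub>C\<^esub> d \<in> V j" unfolding V_def by blast
  next
    assume "\<phi> r \<oplus>\<^bsub>C\<^esub> X i \<otimes>\<^bsub>C\<^esub> d \<in> V j"
    then obtain s e where s: "s \<in> L j" "e \<in> carrier C" "\<phi> r \<oplus>\<^bsub>C\<^esub> X i \<otimes>\<^bsub>C\<^esub> d = \<phi> s \<oplus>\<^bsub>C\<^esub> X j \<otimes>\<^bsub>C\<^esub> e"
      unfolding V_def by blast
    have sc: "\<phi> s \<in> carrier C" "s \<in> carrier R" using Lc[OF s(1)] by simp_all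
    have Xc: "X j \<in> carrier C" "X (i - j) \<in> carrier C" by simp_all
    have "\<phi> (r \<ominus>\<^bsub>R\<^esub> s) = \<phi> r \<ominus>\<^bsub>C\<^esub> \<phi> s" using r sc by (simp add: R.minus_eq C.minus_eq)
    also have "\<dots> = (\<phi> r \<oplus>\<^bsub>C\<^esub> X i \<otimes>\<^bsub>C\<^esub> d) \<ominus>\<^bsub>C\<^esub> X i \<otimes>\<^bsub>C\<^esub> d \<ominus>\<^bsub>C\<^esub> \<phi> s" unfolding Xi using rc sc d Xc by algebra
    also have "\<dots> = X j \<otimes>\<^bsub>C\<^esub> (e \<ominus>\<^bsub>C\<^esub> X (i - j) \<otimes>\<^bsub>C\<^esub> d)"
      unfolding s(3) unfolding Xi using rc sc d Xc s(2) by algebra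
    finally obtain t where t: "t \<in> carrier R" "r \<ominus>\<^bsub>R\<^esub> s = x [^]\<^bsub>R\<^esub> j \<otimes>\<^bsub>R\<^esub> t"
      using exact[of "r \<ominus>\<^bsub>R\<^esub> s"] r sc s(2) d by (metis C.m_closed C.minus_closed R.minus_closed X_closed)
    have "r = (r \<ominus>\<^bsub>R\<^esub> s) \<oplus>\<^bsub>R\<^esub> s" using r sc(2) by algebra
    also have "\<dots> = t \<otimes>\<^bsub>R\<^esub> x [^]\<^bsub>R\<^esub> j \<oplus>\<^bsub>R\<^esub> s" unfolding t(2) using t(1) by (simp add: R.m_comm)
    also have "\<dots> \<in> L j" using L_add L_absorb xL t(1) s(1) by blast
    finally show "r \<in> L j" .
  qed
qed

lemma V_iff':
  "c \<in> carrier C \<Longrightarrow> r \<in> carrier R \<Longrightarrow> d \<in> carrier C \<Longrightarrow> c = \<phi> r \<oplus>\<^bsub>C\<^esub> X i \<otimes>\<^bsub>C\<^esub> d \<Longrightarrow> j \<le> i \<Longrightarrow> c \<in> V j \<longleftrightarrow> r \<in> L j"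
  using V_iff by blast

lemma Vc: "c \<in> V j \<Longrightarrow> c \<in> carrier C" by (simp add: V_def)

lemma V_0: "V 0 = carrier C"
  using dense_le[where i = 0] L_0 unfolding V_def by blast

lemma V_Suc: "V (Suc j) \<subseteq> V j"
proof
  fix c assume c: "c \<in> V (Suc j)"
  then obtain r d where r: "r \<in> L (Suc j)" "d \<in> carrier C" "c = \<phi> r \<oplus>\<^bsub>C\<^esub> X (Suc j) \<otimes>\<^bsub>C\<^esub> d"
    unfolding V_def by blast
  then show "c \<in> V j" using V_iff'[OF Vc[OF c] Lc[OF r(1)] r(2,3), of j] L_Suc by auto
qed

lemma V_mono: "i \<le> j \<Longrightarrow> V j \<subseteq> V i" using lift_Suc_antimono_le[of V i j] V_Suc by blast

lemma X_V: "X k \<otimes>\<^bsub>C\<^esub> d \<in> V k" if "d \<in> carrier C" for d k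
proof -
  have z: "\<zero>\<^bsub>R\<^esub> \<in> L k" by (rule additive_subgroup.zero_closed[OF ideal.axioms(1)[OF L_ideal]])
  show ?thesis using V_iff[of "\<zero>\<^bsub>R\<^esub>" d k k] z that by simp
qed

lemma V_add: "c \<in> V j \<Longrightarrow> d \<in> V j \<Longrightarrow> c \<oplus>\<^bsub>C\<^esub> d \<in> V j"
proof -
  assume c: "c \<in> V j" and d: "d \<in> V j"
  obtain r e where r: "r \<in> L j" "e \<in> carrier C" "c = \<phi> r \<oplus>\<^bsub>C\<^esub> X j \<otimes>\<^bsub>C\<^esub> e" using c unfolding V_def by blast
  obtain s f where s: "s \<in> L j" "f \<in> carrier C" "d = \<phi> s \<oplus>\<^bsub>C\<^esub> X j \<otimes>\<^bsub>C\<^esub> f" using d unfolding V_def by blast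
  have rs: "\<phi> r \<in> carrier C" "\<phi> s \<in> carrier C" using Lc r(1) s(1) by simp_all
  have Xj: "X j \<in> carrier C" by simp
  have "c \<oplus>\<^bsub>C\<^esub> d = (\<phi> r \<oplus>\<^bsub>C\<^esub> \<phi> s) \<oplus>\<^bsub>C\<^esub> X j \<otimes>\<^bsub>C\<^esub> (e \<oplus>\<^bsub>C\<^esub> f)"
    unfolding r(3) s(3) using rs r(2) s(2) Xj by algebra
  also have "\<phi> r \<oplus>\<^bsub>C\<^esub> \<phi> s = \<phi> (r \<oplus>\<^bsub>R\<^esub> s)" using Lc r(1) s(1) by simp
  finally show ?thesis unfolding V_def
    using L_add[OF r(1) s(1)] r(2) s(2) Vc[OF c] Vc[OF d] by blast
qed

lemma V_mult: "c \<in> V i \<Longrightarrow> d \<in> V j \<Longrightarrow> c \<otimes>\<^bsub>C\<^esub> d \<in> V (i + j)"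
  and V_mult_notin: "c \<in> V i \<Longrightarrow> c \<notin> V (Suc i) \<Longrightarrow> d \<in> V j \<Longrightarrow> d \<notin> V (Suc j) \<Longrightarrow> c \<otimes>\<^bsub>C\<^esub> d \<notin> V (Suc (i + j))"
proof -
  assume c: "c \<in> V i" and d: "d \<in> V j"
  \<comment> \<open>One approximation at this level decides membership for all levels up to
    \<open>Suc (i + j)\<close>, which covers both claims.\<close>
  let ?n = "Suc (i + j)"
  obtain r e where r: "r \<in> carrier R" "e \<in> carrier C" "c = \<phi> r \<oplus>\<^bsub>C\<^esub> X ?n \<otimes>\<^bsub>C\<^esub> e" by (rule dense_le[OF Vc[OF c]])
  obtain s f where s: "s \<in> carrier R" "f \<in> carrier C" "d = \<phi> s \<oplus>\<^bsub>C\<^esub> X ?n \<otimes>\<^bsub>C\<^esub> f" by (rule dense_le[OF Vc[OF d]])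
  have rs: "\<phi> r \<in> carrier C" "\<phi> s \<in> carrier C" using r(1) s(1) by simp_all
  have Xn: "X ?n \<in> carrier C" by (rule X_closed)
  define g where "g = \<phi> r \<otimes>\<^bsub>C\<^esub> f \<oplus>\<^bsub>C\<^esub> \<phi> s \<otimes>\<^bsub>C\<^esub> e \<oplus>\<^bsub>C\<^esub> X ?n \<otimes>\<^bsub>C\<^esub> e \<otimes>\<^bsub>C\<^esub> f"
  have g: "g \<in> carrier C" using rs r(2) s(2) Xn by (simp add: g_def)
  have "c \<otimes>\<^bsub>C\<^esub> d = \<phi> r \<otimes>\<^bsub>C\<^esub> \<phi> s \<oplus>\<^bsub>C\<^esub> X ?n \<otimes>\<^bsub>C\<^esub> g"
    unfolding r(3) s(3) g_def using rs r(2) s(2) Xn by algebra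
  also have "\<phi> r \<otimes>\<^bsub>C\<^esub> \<phi> s = \<phi> (r \<otimes>\<^bsub>R\<^esub> s)" using r(1) s(1) by simp
  finally have cd: "c \<otimes>\<^bsub>C\<^esub> d = \<phi> (r \<otimes>\<^bsub>R\<^esub> s) \<oplus>\<^bsub>C\<^esub> X ?n \<otimes>\<^bsub>C\<^esub> g" .
  have cdc: "c \<otimes>\<^bsub>C\<^esub> d \<in> carrier C" using Vc c d by simp
  have rsc: "r \<otimes>\<^bsub>R\<^esub> s \<in> carrier R" using r s by simp
  have iff: "c \<in> V l \<longleftrightarrow> r \<in> L l" "d \<in> V l \<longleftrightarrow> s \<in> L l" "c \<otimes>\<^bsub>C\<^esub> d \<in> V l \<longleftrightarrow> r \<otimes>\<^bsub>R\<^esub> s \<in> L l" if "l \<le> ?n" for l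
    using V_iff'[OF Vc[OF c] r that] V_iff'[OF Vc[OF d] s that] V_iff'[OF cdc rsc g cd that] by auto
  show "c \<otimes>\<^bsub>C\<^esub> d \<in> V (i + j)" using iff(1)[of i] iff(2)[of j] iff(3)[of "i + j"] L_mult c d by simp
  show "c \<notin> V (Suc i) \<Longrightarrow> d \<notin> V (Suc j) \<Longrightarrow> c \<otimes>\<^bsub>C\<^esub> d \<notin> V (Suc (i + j))"
    using iff(1)[of i] iff(2)[of j] iff(1)[of "Suc i"] iff(2)[of "Suc j"] iff(3)[of ?n] L_mult_notin c d
    by simp
qed

lemma V_absorb: "c \<in> V j \<Longrightarrow> d \<in> carrier C \<Longrightarrow> d \<otimes>\<^bsub>C\<^esub> c \<in> V j"
  using V_mult[of d 0 c j] V_0 by simp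

lemma V_minus: "c \<in> V j \<Longrightarrow> d \<in> V j \<Longrightarrow> c \<ominus>\<^bsub>C\<^esub> d \<in> V j"
proof -
  assume c: "c \<in> V j" and d: "d \<in> V j"
  have "(\<ominus>\<^bsub>C\<^esub> \<one>\<^bsub>C\<^esub>) \<otimes>\<^bsub>C\<^esub> d \<in> V j" using V_absorb[OF d] by simp
  then have "c \<oplus>\<^bsub>C\<^esub> (\<ominus>\<^bsub>C\<^esub> \<one>\<^bsub>C\<^esub>) \<otimes>\<^bsub>C\<^esub> d \<in> V j" using V_add[OF c] by blast
  moreover have "c \<oplus>\<^bsub>C\<^esub> (\<ominus>\<^bsub>C\<^esub> \<one>\<^bsub>C\<^esub>) \<otimes>\<^bsub>C\<^esub> d = c \<ominus>\<^bsub>C\<^esub> d" using Vc[OF c] Vc[OF d] by algebra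
  ultimately show ?thesis by simp
qed

lemma V_zero: "\<zero>\<^bsub>C\<^esub> \<in> V j" using X_V[of "\<zero>\<^bsub>C\<^esub>" j] by simp

lemma V_ideal: "ideal (V j) C"
proof (rule idealI[OF C.ring_axioms])
  show "subgroup (V j) (add_monoid C)"
  proof (rule C.add.subgroupI)
    show "V j \<subseteq> carrier C" "V j \<noteq> {}" using Vc V_zero by auto
    fix a b assume a: "a \<in> V j"
    show "\<ominus>\<^bsub>C\<^esub> a \<in> V j" using V_minus[OF V_zero a] Vc[OF a] by (simp add: C.minus_eq)
    show "b \<in> V j \<Longrightarrow> a \<oplus>\<^bsub>C\<^esub> b \<in> V j" using V_add a by blast
  qed
  show "x \<otimes>\<^bsub>C\<^esub> a \<in> V j" "a \<otimes>\<^bsub>C\<^esub> x \<in> V j" if "a \<in> V j" "x \<in> carrier C" for a x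
    using V_absorb[OF that] C.m_comm[OF that(2) Vc[OF that(1)]] by simp_all
qed

lemma V_div_step:
  assumes c: "c \<in> V i" "c \<notin> V (Suc i)" and d: "d \<in> V (i + k)"
  shows "\<exists>t\<in>carrier R. d \<ominus>\<^bsub>C\<^esub> c \<otimes>\<^bsub>C\<^esub> \<phi> (x [^]\<^bsub>R\<^esub> k \<otimes>\<^bsub>R\<^esub> t) \<in> V (Suc (i + k))"
proof -
  let ?n = "Suc (i + k)"
  obtain r e where r: "r \<in> carrier R" "e \<in> carrier C" "c = \<phi> r \<oplus>\<^bsub>C\<^esub> X ?n \<otimes>\<^bsub>C\<^esub> e"
    by (rule dense_le[OF Vc[OF c(1)]])
  obtain s f where s: "s \<in> carrier R" "f \<in> carrier C" "d = \<phi> s \<oplus>\<^bsub>C\<^esub> X ?n \<otimes>\<^bsub>C\<^esub> f" by (rule dense_le[OF Vc[OF d]])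
  have iff: "c \<in> V l \<longleftrightarrow> r \<in> L l" "d \<in> V l \<longleftrightarrow> s \<in> L l" if "l \<le> ?n" for l
    using V_iff'[OF Vc[OF c(1)] r that] V_iff'[OF Vc[OF d] s that] by auto
  have "r \<in> L i" "r \<notin> L (Suc i)" "s \<in> L (i + k)" using iff[of i] iff[of "Suc i"] iff[of "i + k"] c d by auto
  then obtain t where t: "t \<in> carrier R" "s \<ominus>\<^bsub>R\<^esub> r \<otimes>\<^bsub>R\<^esub> (x [^]\<^bsub>R\<^esub> k \<otimes>\<^bsub>R\<^esub> t) \<in> L ?n"
    using L_div by blast
  define y where "y = x [^]\<^bsub>R\<^esub> k \<otimes>\<^bsub>R\<^esub> t"
  have y: "y \<in> carrier R" using t by (simp add: y_def)
  have cc: "\<phi> r \<in> carrier C" "\<phi> s \<in> carrier C" "\<phi> y \<in> carrier C" using r s y by simp_all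
  have Xn: "X ?n \<in> carrier C" by (rule X_closed)
  have e1: "d \<ominus>\<^bsub>C\<^esub> c \<otimes>\<^bsub>C\<^esub> \<phi> y = (\<phi> s \<ominus>\<^bsub>C\<^esub> \<phi> r \<otimes>\<^bsub>C\<^esub> \<phi> y) \<oplus>\<^bsub>C\<^esub> X ?n \<otimes>\<^bsub>C\<^esub> (f \<ominus>\<^bsub>C\<^esub> e \<otimes>\<^bsub>C\<^esub> \<phi> y)"
    unfolding r(3) s(3) using cc r(2) s(2) Xn by algebra
  have e2: "\<phi> s \<ominus>\<^bsub>C\<^esub> \<phi> r \<otimes>\<^bsub>C\<^esub> \<phi> y = \<phi> (s \<ominus>\<^bsub>R\<^esub> r \<otimes>\<^bsub>R\<^esub> y)"
    using r s y by (simp add: R.minus_eq C.minus_eq)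
  have "d \<ominus>\<^bsub>C\<^esub> c \<otimes>\<^bsub>C\<^esub> \<phi> y \<in> V ?n"
    unfolding e1 e2 using V_iff[of "s \<ominus>\<^bsub>R\<^esub> r \<otimes>\<^bsub>R\<^esub> y" "f \<ominus>\<^bsub>C\<^esub> e \<otimes>\<^bsub>C\<^esub> \<phi> y" ?n ?n] t(2) r s y cc by (simp add: y_def)
  then show ?thesis using t(1) y_def by blast
qed

text \<open>Successive approximation: each use of \<open>V_div_step\<close> corrects the quotient by
  a multiple of \<open>x^k\<close>, so the quotients form a coherent sequence with a limit
  \<open>e\<close> in \<open>C\<close>. The remainder lies in all \<open>V (i + k)\<close>, so the
  division is exact modulo \<open>P\<close>.\<close>

lemma V_div:
  assumes c: "c \<in> V i" "c \<notin> V (Suc i)" and d: "d \<in> V i"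
  shows "\<exists>e\<in>carrier C. \<forall>k. d \<ominus>\<^bsub>C\<^esub> c \<otimes>\<^bsub>C\<^esub> e \<in> V (i + k)"
proof -
  have "\<exists>f. \<forall>k. (f k \<in> carrier R \<and> d \<ominus>\<^bsub>C\<^esub> c \<otimes>\<^bsub>C\<^esub> \<phi> (f k) \<in> V (i + k)) \<and>
      (\<exists>t\<in>carrier R. f (Suc k) = f k \<oplus>\<^bsub>R\<^esub> x [^]\<^bsub>R\<^esub> k \<otimes>\<^bsub>R\<^esub> t)"
  proof (rule dependent_nat_choice)
    have "d \<ominus>\<^bsub>C\<^esub> c \<otimes>\<^bsub>C\<^esub> \<phi> \<zero>\<^bsub>R\<^esub> = d" using Vc[OF c(1)] Vc[OF d] by (simp add: C.minus_eq)
    then show "\<exists>y. y \<in> carrier R \<and> d \<ominus>\<^bsub>C\<^esub> c \<otimes>\<^bsub>C\<^esub> \<phi> y \<in> V (i + 0)" using d by (intro exI[of _ "\<zero>\<^bsub>R\<^esub>"]) simp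
  next
    fix y k assume y: "y \<in> carrier R \<and> d \<ominus>\<^bsub>C\<^esub> c \<otimes>\<^bsub>C\<^esub> \<phi> y \<in> V (i + k)"
    then obtain t where t: "t \<in> carrier R"
       "(d \<ominus>\<^bsub>C\<^esub> c \<otimes>\<^bsub>C\<^esub> \<phi> y) \<ominus>\<^bsub>C\<^esub> c \<otimes>\<^bsub>C\<^esub> \<phi> (x [^]\<^bsub>R\<^esub> k \<otimes>\<^bsub>R\<^esub> t) \<in> V (Suc (i + k))" using V_div_step[OF c] by blast
    have cc: "\<phi> y \<in> carrier C" "\<phi> (x [^]\<^bsub>R\<^esub> k \<otimes>\<^bsub>R\<^esub> t) \<in> carrier C" using t y by simp_all
    have "(d \<ominus>\<^bsub>C\<^esub> c \<otimes>\<^bsub>C\<^esub> \<phi> y) \<ominus>\<^bsub>C\<^esub> c \<otimes>\<^bsub>C\<^esub> \<phi> (x [^]\<^bsub>R\<^esub> k \<otimes>\<^bsub>R\<^esub> t) =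
       d \<ominus>\<^bsub>C\<^esub> c \<otimes>\<^bsub>C\<^esub> (\<phi> y \<oplus>\<^bsub>C\<^esub> \<phi> (x [^]\<^bsub>R\<^esub> k \<otimes>\<^bsub>R\<^esub> t))" using cc Vc[OF c(1)] Vc[OF d] by algebra
    also have "\<phi> y \<oplus>\<^bsub>C\<^esub> \<phi> (x [^]\<^bsub>R\<^esub> k \<otimes>\<^bsub>R\<^esub> t) = \<phi> (y \<oplus>\<^bsub>R\<^esub> x [^]\<^bsub>R\<^esub> k \<otimes>\<^bsub>R\<^esub> t)" using t y by simp
    finally show "\<exists>z. (z \<in> carrier R \<and> d \<ominus>\<^bsub>C\<^esub> c \<otimes>\<^bsub>C\<^esub> \<phi> z \<in> V (i + Suc k)) \<and>
        (\<exists>t\<in>carrier R. z = y \<oplus>\<^bsub>R\<^esub> x [^]\<^bsub>R\<^esub> k \<otimes>\<^bsub>R\<^esub> t)"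
      using t y by (intro exI[of _ "y \<oplus>\<^bsub>R\<^esub> x [^]\<^bsub>R\<^esub> k \<otimes>\<^bsub>R\<^esub> t"]) (simp del: hom_add hom_mult, blast)
  qed
  then obtain f where f: "\<And>k. f k \<in> carrier R" "\<And>k. d \<ominus>\<^bsub>C\<^esub> c \<otimes>\<^bsub>C\<^esub> \<phi> (f k) \<in> V (i + k)"
     "\<And>k. \<exists>t\<in>carrier R. f (Suc k) = f k \<oplus>\<^bsub>R\<^esub> x [^]\<^bsub>R\<^esub> k \<otimes>\<^bsub>R\<^esub> t" by blast
  obtain e where e: "e \<in> carrier C" "\<And>k. \<exists>g\<in>carrier C. e = \<phi> (f k) \<oplus>\<^bsub>C\<^esub> X k \<otimes>\<^bsub>C\<^esub> g" using complete[OF f(1,3)]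
    by blast
  have "d \<ominus>\<^bsub>C\<^esub> c \<otimes>\<^bsub>C\<^esub> e \<in> V (i + k)" for k
  proof -
    obtain g where g: "g \<in> carrier C" "e = \<phi> (f k) \<oplus>\<^bsub>C\<^esub> X k \<otimes>\<^bsub>C\<^esub> g" using e(2) by blast
    have cc: "\<phi> (f k) \<in> carrier C" "X k \<in> carrier C" using f(1) by simp_all
    have "d \<ominus>\<^bsub>C\<^esub> c \<otimes>\<^bsub>C\<^esub> e = (d \<ominus>\<^bsub>C\<^esub> c \<otimes>\<^bsub>C\<^esub> \<phi> (f k)) \<ominus>\<^bsub>C\<^esub> c \<otimes>\<^bsub>C\<^esub> (X k \<otimes>\<^bsub>C\<^esub> g)"
      unfolding g(2) using cc g(1) Vc[OF c(1)] Vc[OF d] by algebra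
    then show ?thesis using V_minus[OF f(2) V_mult[OF c(1) X_V[OF g(1)]]] by simp
  qed
  then show ?thesis using e(1) by blast
qed

definition P :: "'c set" where "P = (\<Inter>j. V j)"

lemma P_ideal: "ideal P C"
  unfolding P_def using C.i_Intersect[of "range V"] V_ideal by auto

lemma level:
  assumes "c \<in> carrier C" "c \<notin> P"
  obtains j where "c \<in> V j" "c \<notin> V (Suc j)"
proof -
  obtain k where k: "c \<notin> V k" using assms(2) by (auto simp: P_def)
  define n where "n = (LEAST k. c \<notin> V k)"
  have n: "c \<notin> V n" unfolding n_def by (rule LeastI[of _ k]) (rule k)
  then obtain j where j: "n = Suc j" using V_0 assms(1) by (cases n) auto
  have "c \<in> V j" using not_less_Least[of j "\<lambda>k. c \<notin> V k"] j n_def by simp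
  then show ?thesis using that n j by blast
qed

lemma one_V: "\<one>\<^bsub>C\<^esub> \<notin> V 1"
proof -
  have eq: "\<one>\<^bsub>C\<^esub> = \<phi> \<one>\<^bsub>R\<^esub> \<oplus>\<^bsub>C\<^esub> X 1 \<otimes>\<^bsub>C\<^esub> \<zero>\<^bsub>C\<^esub>" using x by simp
  show ?thesis using V_iff'[OF C.one_closed R.one_closed C.zero_closed eq order_refl] one_L by simp
qed

lemma P_prime: "primeideal P C"
proof (rule primeidealI[OF P_ideal C.cring_axioms])
  show "carrier C \<noteq> P" using one_V C.one_closed unfolding P_def by blast
  fix a b assume ab: "a \<in> carrier C" "b \<in> carrier C" "a \<otimes>\<^bsub>C\<^esub> b \<in> P"
  show "a \<in> P \<or> b \<in> P"
  proof (rule ccontr)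
    assume n: "\<not> (a \<in> P \<or> b \<in> P)"
    obtain i where i: "a \<in> V i" "a \<notin> V (Suc i)" using level ab(1) n by blast
    obtain j where j: "b \<in> V j" "b \<notin> V (Suc j)" using level ab(2) n by blast
    show False using V_mult_notin[OF i j] ab(3) unfolding P_def by blast
  qed
qed

text \<open>By \<open>L_square\<close>, approximations \<open>r\<close> and \<open>s\<close> in
  \<open>L i\<close> of two elements of \<open>P\<close> multiply into \<open>x^i R\<close>. The
  product of the elements is therefore divisible by every \<open>X i\<close>, and \<open>C\<close>
  is separated.\<close>

lemma P_square: "ideal_prod C P P = {\<zero>\<^bsub>C\<^esub>}"
proof -
  have z: "\<zero>\<^bsub>C\<^esub> \<in> P" using V_zero by (simp add: P_def)
  have prod: "c \<otimes>\<^bsub>C\<^esub> d = \<zero>\<^bsub>C\<^esub>" if cd: "c \<in> P" "d \<in> P" for c d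
  proof (rule separated)
    have V: "c \<in> V i" "d \<in> V i" for i using cd by (auto simp: P_def)
    show "c \<otimes>\<^bsub>C\<^esub> d \<in> carrier C" using Vc V by blast
    fix i
    obtain r e where r: "r \<in> L i" "e \<in> carrier C" "c = \<phi> r \<oplus>\<^bsub>C\<^esub> X i \<otimes>\<^bsub>C\<^esub> e" using V(1)[of i] unfolding V_def
      by blast
    obtain s f where s: "s \<in> L i" "f \<in> carrier C" "d = \<phi> s \<oplus>\<^bsub>C\<^esub> X i \<otimes>\<^bsub>C\<^esub> f" using V(2)[of i] unfolding V_def
      by blast
    obtain t where t: "t \<in> carrier R" "r \<otimes>\<^bsub>R\<^esub> s = x [^]\<^bsub>R\<^esub> i \<otimes>\<^bsub>R\<^esub> t" using L_square r(1) s(1) by blast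
    have rs: "\<phi> r \<in> carrier C" "\<phi> s \<in> carrier C" "\<phi> t \<in> carrier C" "X i \<in> carrier C" using Lc r(1) s(1) t(1)
      by simp_all
    have p: "\<phi> r \<otimes>\<^bsub>C\<^esub> \<phi> s = X i \<otimes>\<^bsub>C\<^esub> \<phi> t"
    proof -
      have "\<phi> r \<otimes>\<^bsub>C\<^esub> \<phi> s = \<phi> (r \<otimes>\<^bsub>R\<^esub> s)" using Lc r(1) s(1) by simp
      also have "\<dots> = X i \<otimes>\<^bsub>C\<^esub> \<phi> t" unfolding t(2) using t(1) phi_pow by simp
      finally show ?thesis .
    qed
    have "c \<otimes>\<^bsub>C\<^esub> d = \<phi> r \<otimes>\<^bsub>C\<^esub> \<phi> s \<oplus>\<^bsub>C\<^esub> X i \<otimes>\<^bsub>C\<^esub> (\<phi> r \<otimes>\<^bsub>C\<^esub> f \<oplus>\<^bsub>C\<^esub> \<phi> s \<otimes>\<^bsub>C\<^esub> e \<oplus>\<^bsub>C\<^esub> X i \<otimes>\<^bsub>C\<^esub> e \<otimes>\<^bsub>C\<^esub> f)"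
      unfolding r(3) s(3) using rs r(2) s(2) by algebra
    also have "\<dots> = X i \<otimes>\<^bsub>C\<^esub> (\<phi> t \<oplus>\<^bsub>C\<^esub> (\<phi> r \<otimes>\<^bsub>C\<^esub> f \<oplus>\<^bsub>C\<^esub> \<phi> s \<otimes>\<^bsub>C\<^esub> e \<oplus>\<^bsub>C\<^esub> X i \<otimes>\<^bsub>C\<^esub> e \<otimes>\<^bsub>C\<^esub> f))"
      unfolding p using rs r(2) s(2) by algebra
    finally show "\<exists>g\<in>carrier C. c \<otimes>\<^bsub>C\<^esub> d = X i \<otimes>\<^bsub>C\<^esub> g"
      using rs r(2) s(2) C.m_closed C.a_closed by blast
  qed
  have "c = \<zero>\<^bsub>C\<^esub>" if "c \<in> ideal_prod C P P" for c
    using that by (induction rule: ideal_prod.induct) (use prod in auto)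
  moreover have "\<zero>\<^bsub>C\<^esub> \<in> ideal_prod C P P" using ideal_prod.prod[OF z z, of C] by simp
  ultimately show ?thesis by blast
qed

text \<open>The limit of the sequence from \<open>L_nonzero\<close> lies in every
  \<open>V i\<close>; it is nonzero because its approximation at level \<open>j\<close> is not
  divisible by \<open>x^j\<close>.\<close>

lemma P_nonzero: "P \<noteq> {\<zero>\<^bsub>C\<^esub>}"
proof -
  obtain f j where f: "\<And>i. f i \<in> L i" "\<And>i. \<exists>s\<in>carrier R. f (Suc i) = f i \<oplus>\<^bsub>R\<^esub> x [^]\<^bsub>R\<^esub> i \<otimes>\<^bsub>R\<^esub> s"
    "\<And>t. t \<in> carrier R \<Longrightarrow> f j \<noteq> x [^]\<^bsub>R\<^esub> j \<otimes>\<^bsub>R\<^esub> t" using L_nonzero by blast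
  obtain c where c: "c \<in> carrier C" "\<And>i. \<exists>d\<in>carrier C. c = \<phi> (f i) \<oplus>\<^bsub>C\<^esub> X i \<otimes>\<^bsub>C\<^esub> d"
    using complete[OF Lc[OF f(1)] f(2)] by blast
  have "c \<in> P" unfolding P_def V_def using c f(1) by blast
  moreover have "c \<noteq> \<zero>\<^bsub>C\<^esub>"
  proof
    assume z: "c = \<zero>\<^bsub>C\<^esub>"
    obtain d where d: "d \<in> carrier C" "c = \<phi> (f j) \<oplus>\<^bsub>C\<^esub> X j \<otimes>\<^bsub>C\<^esub> d" using c(2) by blast
    have fc: "\<phi> (f j) \<in> carrier C" "X j \<in> carrier C" using Lc[OF f(1)] by simp_all
    have "\<phi> (f j) = c \<ominus>\<^bsub>C\<^esub> X j \<otimes>\<^bsub>C\<^esub> d" unfolding d(2) using fc d(1) by algebra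
    also have "\<dots> = X j \<otimes>\<^bsub>C\<^esub> (\<ominus>\<^bsub>C\<^esub> d)" unfolding z using fc d(1) by algebra
    finally show False using exact[OF Lc[OF f(1)], of "\<ominus>\<^bsub>C\<^esub> d" j j] d(1) f(3) by auto
  qed
  ultimately show ?thesis by blast
qed

lemma P_quot_DVR: "DVR (C Quot P)"
proof -
  interpret P: primeideal P C by (rule P_prime)
  \<comment> \<open>The value of a coset is the last level containing it. Since \<open>P\<close> is
    contained in every \<open>V j\<close>, a coset lies in \<open>V j\<close> as soon as one
    representative does, so no representative has to be chosen.\<close>
  define v where "v Z = (LEAST j. \<not> Z \<subseteq> V (Suc j))" for Z
  let ?Q = "C Quot P"
  have PV: "P \<subseteq> V j" for j by (auto simp: P_def)
  have elt: "\<exists>c\<in>carrier C. Z = P +>\<^bsub>C\<^esub> c" if "Z \<in> carrier ?Q" for Z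
    using that unfolding FactRing_def A_RCOSETS_def' by auto
  have zero_iff: "P +>\<^bsub>C\<^esub> c = \<zero>\<^bsub>?Q\<^esub> \<longleftrightarrow> c \<in> P" if "c \<in> carrier C" for c
    using P.a_rcos_const[of c] P.rcos_const_imp_mem[of c] that by (auto simp: FactRing_def)
  have sub_iff: "P +>\<^bsub>C\<^esub> c \<subseteq> V j \<longleftrightarrow> c \<in> V j" if c: "c \<in> carrier C" for c j
  proof
    assume "P +>\<^bsub>C\<^esub> c \<subseteq> V j" then show "c \<in> V j" using P.a_rcos_self[OF c] by blast
  next
    assume "c \<in> V j" then show "P +>\<^bsub>C\<^esub> c \<subseteq> V j" unfolding a_r_coset_def' using V_add PV by blast
  qed
  have v_eq: "v (P +>\<^bsub>C\<^esub> c) = j" if "c \<in> V j" "c \<notin> V (Suc j)" for c j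
    unfolding v_def
  proof (rule Least_equality)
    show "\<not> P +>\<^bsub>C\<^esub> c \<subseteq> V (Suc j)" using sub_iff Vc that by blast
    fix i assume i: "\<not> P +>\<^bsub>C\<^esub> c \<subseteq> V (Suc i)"
    show "j \<le> i"
    proof (rule ccontr)
      assume "\<not> j \<le> i"
      then have "V j \<subseteq> V (Suc i)" by (intro V_mono) simp
      then show False using i sub_iff[OF Vc[OF that(1)]] that by blast
    qed
  qed
  have rep: "\<exists>c j. Z = P +>\<^bsub>C\<^esub> c \<and> c \<in> V j \<and> c \<notin> V (Suc j) \<and> v Z = j" if Z: "Z \<in> carrier ?Q - {\<zero>\<^bsub>?Q\<^esub>}" for Z
  proof -
    obtain c where c: "c \<in> carrier C" "Z = P +>\<^bsub>C\<^esub> c" using elt Z by blast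
    then have "c \<notin> P" using zero_iff Z by blast
    then obtain j where "c \<in> V j" "c \<notin> V (Suc j)" using level c by blast
    then show ?thesis using c v_eq by blast
  qed
  have mult: "(P +>\<^bsub>C\<^esub> c) \<otimes>\<^bsub>?Q\<^esub> (P +>\<^bsub>C\<^esub> d) = P +>\<^bsub>C\<^esub> (c \<otimes>\<^bsub>C\<^esub> d)"
    and add: "(P +>\<^bsub>C\<^esub> c) \<oplus>\<^bsub>?Q\<^esub> (P +>\<^bsub>C\<^esub> d) = P +>\<^bsub>C\<^esub> (c \<oplus>\<^bsub>C\<^esub> d)" if "c \<in> carrier C" "d \<in> carrier C" for c d
    using P.rcoset_mult_add[OF that] P.a_rcos_sum[OF that] by (simp_all add: FactRing_def)
  have cong: "P +>\<^bsub>C\<^esub> c = P +>\<^bsub>C\<^esub> d" if "c \<in> carrier C" "d \<in> carrier C" "c \<ominus>\<^bsub>C\<^esub> d \<in> P" for c d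
    using C.quotient_eq_iff_same_a_r_cos[OF P_ideal that(1,2)] that(3) by simp
  have closed: "P +>\<^bsub>C\<^esub> c \<in> carrier ?Q" if "c \<in> carrier C" for c
    using that unfolding FactRing_def A_RCOSETS_def' by auto
  show ?thesis unfolding DVR_def
  proof (intro conjI exI[of _ v] ballI impI)
    show "domain ?Q" by (rule P.quotient_is_domain)
    show "\<exists>t\<in>carrier ?Q - {\<zero>\<^bsub>?Q\<^esub>}. v t = 1"
    proof
      have xc: "\<phi> x \<in> carrier C" using x by simp
      have eq: "\<phi> x = \<phi> x \<oplus>\<^bsub>C\<^esub> X 2 \<otimes>\<^bsub>C\<^esub> \<zero>\<^bsub>C\<^esub>" using xc by simp
      have "\<phi> x \<in> V 1" "\<phi> x \<notin> V (Suc 1)"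
        using V_iff'[OF xc x _ eq, of 1] V_iff'[OF xc x _ eq, of 2] xL[of 1] x_L x
        by (simp_all add: numeral_2_eq_2)
      then show "v (P +>\<^bsub>C\<^esub> \<phi> x) = 1" "P +>\<^bsub>C\<^esub> \<phi> x \<in> carrier ?Q - {\<zero>\<^bsub>?Q\<^esub>}"
        using v_eq closed[OF xc] zero_iff[OF xc] PV by auto
    qed
    fix a b assume a: "a \<in> carrier ?Q - {\<zero>\<^bsub>?Q\<^esub>}" and b: "b \<in> carrier ?Q - {\<zero>\<^bsub>?Q\<^esub>}"
    obtain c i where c: "a = P +>\<^bsub>C\<^esub> c" "c \<in> V i" "c \<notin> V (Suc i)" "v a = i" using rep[OF a] by blast
    obtain d j where d: "b = P +>\<^bsub>C\<^esub> d" "d \<in> V j" "d \<notin> V (Suc j)" "v b = j" using rep[OF b] by blast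
    note cc = Vc[OF c(2)] and dc = Vc[OF d(2)]
    show "v (a \<otimes>\<^bsub>?Q\<^esub> b) = v a + v b"
      unfolding c(4) d(4) unfolding c(1) d(1) mult[OF cc dc]
      by (rule v_eq[OF V_mult[OF c(2) d(2)] V_mult_notin[OF c(2,3) d(2,3)]])
    show "min (v a) (v b) \<le> v (a \<oplus>\<^bsub>?Q\<^esub> b)" if nz: "a \<oplus>\<^bsub>?Q\<^esub> b \<noteq> \<zero>\<^bsub>?Q\<^esub>"
    proof -
      have s: "a \<oplus>\<^bsub>?Q\<^esub> b = P +>\<^bsub>C\<^esub> (c \<oplus>\<^bsub>C\<^esub> d)" unfolding c(1) d(1) by (rule add[OF cc dc])
      have sc: "c \<oplus>\<^bsub>C\<^esub> d \<in> carrier C" using cc dc by simp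
      then have "c \<oplus>\<^bsub>C\<^esub> d \<notin> P" using nz s zero_iff by simp
      then obtain k where k: "c \<oplus>\<^bsub>C\<^esub> d \<in> V k" "c \<oplus>\<^bsub>C\<^esub> d \<notin> V (Suc k)" using level sc by blast
      have "c \<in> V (min i j)" "d \<in> V (min i j)" using V_mono[of "min i j" i] V_mono[of "min i j" j] c d
        by auto
      then have m: "c \<oplus>\<^bsub>C\<^esub> d \<in> V (min i j)" by (rule V_add)
      have "min i j \<le> k"
      proof (rule ccontr)
        assume "\<not> min i j \<le> k"
        then have "Suc k \<le> min i j" by linarith
        then have "V (min i j) \<subseteq> V (Suc k)" by (rule V_mono)
        then show False using m k by blast
      qed
      then show ?thesis using v_eq[OF k] s c(4) d(4) by simp
    qed
    show "(\<exists>e\<in>carrier ?Q. b = a \<otimes>\<^bsub>?Q\<^esub> e) \<longleftrightarrow> v a \<le> v b"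
    proof
      assume "\<exists>e\<in>carrier ?Q. b = a \<otimes>\<^bsub>?Q\<^esub> e"
      then obtain e where e: "e \<in> carrier C" "b = a \<otimes>\<^bsub>?Q\<^esub> (P +>\<^bsub>C\<^esub> e)" using elt by blast
      have "P +>\<^bsub>C\<^esub> d = P +>\<^bsub>C\<^esub> (c \<otimes>\<^bsub>C\<^esub> e)" using e(2) mult[OF cc e(1)] c(1) d(1) by simp
      moreover have "c \<otimes>\<^bsub>C\<^esub> e \<in> V i" using V_mult[of c i e 0] V_0 e(1) c(2) by simp
      ultimately have "d \<in> V i" using sub_iff[OF dc] sub_iff[of "c \<otimes>\<^bsub>C\<^esub> e"] cc e(1) by simp
      then have "i \<le> j" using V_mono[of "Suc j" i] d(3) by (cases "i \<le> j") auto
      then show "v a \<le> v b" using c d by simp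
    next
      assume "v a \<le> v b"
      then have "d \<in> V i" using V_mono[of i j] c(4) d(2,4) by auto
      then obtain e where e: "e \<in> carrier C" "\<And>k. d \<ominus>\<^bsub>C\<^esub> c \<otimes>\<^bsub>C\<^esub> e \<in> V (i + k)" using V_div[OF c(2,3)] by blast
      have "d \<ominus>\<^bsub>C\<^esub> c \<otimes>\<^bsub>C\<^esub> e \<in> V k" for k using e(2)[of k] V_mono[of k "i + k"] by auto
      then have "P +>\<^bsub>C\<^esub> d = P +>\<^bsub>C\<^esub> (c \<otimes>\<^bsub>C\<^esub> e)" using cong[OF dc C.m_closed[OF cc e(1)]] by (simp add: P_def)
      then have "b = a \<otimes>\<^bsub>?Q\<^esub> (P +>\<^bsub>C\<^esub> e)" using mult[OF cc e(1)] c(1) d(1) by simp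
      then show "\<exists>e\<in>carrier ?Q. b = a \<otimes>\<^bsub>?Q\<^esub> e" using closed[OF e(1)] by blast
    qed
  qed
qed

end

text \<open>Expanding \<open>(a - is)(b - is') = 0\<close> gives
  \<open>ab = i(s' a + s b - i s s')\<close>. The identity records, with an explicit cofactor, that
  changing the coefficients by multiples of \<open>z\<close> changes the right-hand side by a
  multiple of \<open>z\<close>.\<close>

lemma (in cring) product_difference:
  assumes c: "i \<in> carrier R" "a \<in> carrier R" "b \<in> carrier R" "s \<in> carrier R" "s' \<in> carrier R"
    "z \<in> carrier R" "d \<in> carrier R" "d' \<in> carrier R"
  shows "i \<otimes> ((s' \<oplus> z \<otimes> d') \<otimes> a \<oplus> (s \<oplus> z \<otimes> d) \<otimes> b \<ominus> i \<otimes> (s \<oplus> z \<otimes> d) \<otimes> (s' \<oplus> z \<otimes> d')) \<ominus>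
      i \<otimes> (s' \<otimes> a \<oplus> s \<otimes> b \<ominus> i \<otimes> s \<otimes> s') =
    z \<otimes> (i \<otimes> (d' \<otimes> a \<oplus> d \<otimes> b \<ominus> i \<otimes> s \<otimes> d' \<ominus> i \<otimes> d \<otimes> s' \<ominus> i \<otimes> d \<otimes> (z \<otimes> d')))"
proof -
  define u where "u = z \<otimes> d"
  define u' where "u' = z \<otimes> d'"
  have u: "u \<in> carrier R" "u' \<in> carrier R" using c by (simp_all add: u_def u'_def)
  define w where "w = i \<otimes> s \<otimes> u' \<oplus> (i \<otimes> u \<otimes> s' \<oplus> i \<otimes> u \<otimes> u')"
  have w: "w \<in> carrier R" using c u by (simp add: w_def)
  have e1: "(s' \<oplus> u') \<otimes> a = s' \<otimes> a \<oplus> u' \<otimes> a" "(s \<oplus> u) \<otimes> b = s \<otimes> b \<oplus> u \<otimes> b"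
    using c u by (simp_all add: l_distr)
  have e2: "i \<otimes> (s \<oplus> u) \<otimes> (s' \<oplus> u') = i \<otimes> s \<otimes> s' \<oplus> w"
    unfolding w_def using c(1,4,5) u by algebra
  have cancel: "i \<otimes> (p1 \<oplus> w1 \<oplus> (p2 \<oplus> w2) \<ominus> (p3 \<oplus> w)) \<ominus> i \<otimes> (p1 \<oplus> p2 \<ominus> p3) = i \<otimes> (w1 \<oplus> w2 \<ominus> w)"
    if "p1 \<in> carrier R" "p2 \<in> carrier R" "p3 \<in> carrier R" "w1 \<in> carrier R" "w2 \<in> carrier R"
      for p1 p2 p3 w1 w2
    using that w c(1) by algebra
  have "i \<otimes> ((s' \<oplus> u') \<otimes> a \<oplus> (s \<oplus> u) \<otimes> b \<ominus> i \<otimes> (s \<oplus> u) \<otimes> (s' \<oplus> u')) \<ominus> i \<otimes> (s' \<otimes> a \<oplus> s \<otimes> b \<ominus> i \<otimes> s \<otimes> s') =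
     i \<otimes> (u' \<otimes> a \<oplus> u \<otimes> b \<ominus> w)"
    unfolding e1 e2 by (rule cancel) (use c u in simp_all)
  also have "u' \<otimes> a \<oplus> u \<otimes> b \<ominus> w = u' \<otimes> a \<oplus> u \<otimes> b \<ominus> i \<otimes> s \<otimes> u' \<ominus> i \<otimes> u \<otimes> s' \<ominus> i \<otimes> u \<otimes> u'"
    unfolding w_def using c(1-5) u by (simp add: minus_eq minus_add a_assoc)
  also have "i \<otimes> (u' \<otimes> a \<oplus> u \<otimes> b \<ominus> i \<otimes> s \<otimes> u' \<ominus> i \<otimes> u \<otimes> s' \<ominus> i \<otimes> u \<otimes> u') = z \<otimes> (i \<otimes> (d' \<otimes> a \<oplus> d \<otimes> b
    \<ominus> i \<otimes> s \<otimes> d' \<ominus> i \<otimes> d \<otimes> s' \<ominus> i \<otimes> d \<otimes> u'))"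
    unfolding u_def using c u(2) unfolding u'_def by algebra
  finally show ?thesis unfolding u_def u'_def .
qed

section \<open>From a square-zero prime to stability and unbounded denominators\<close>

context adic_hom
begin

lemma X_add: "X (i + j) = X i \<otimes>\<^bsub>C\<^esub> X j" using x by (simp add: C.nat_pow_mult)

lemma ideal_prod_zero:
  assumes "ideal_prod C P P = {\<zero>\<^bsub>C\<^esub>}" "p \<in> P" "q \<in> P"
  shows "p \<otimes>\<^bsub>C\<^esub> q = \<zero>\<^bsub>C\<^esub>"
  using ideal_prod.prod[OF assms(2,3), of C] assms(1) by auto

text \<open>An element \<open>p\<close> of \<open>P\<close> outside \<open>X j C\<close> is
  approximated to second order, \<open>p = r + Zc + Z Z d'\<close> with
  \<open>Z = X (k + j)\<close>. From \<open>p p = 0\<close> it follows that the square of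
  \<open>r + zc\<close> is divisible by \<open>z z\<close>, so \<open>r/z\<close> is a root of a
  monic quadratic over \<open>R\<close>, while \<open>r\<close> is not divisible by
  \<open>x^j\<close>: the denominators of these fractions grow with \<open>k\<close>.\<close>

lemma quadratic_approximants:
  assumes P: "ideal P C" "P \<noteq> {\<zero>\<^bsub>C\<^esub>}" "ideal_prod C P P = {\<zero>\<^bsub>C\<^esub>}"
  obtains j where "\<And>k. \<exists>r\<in>carrier R. \<exists>b\<in>carrier R. \<exists>e\<in>carrier R.
     r \<otimes> r = x [^] (k + j) \<otimes> b \<otimes> r \<oplus> x [^] (k + j) \<otimes> x [^] (k + j) \<otimes> e \<and> (\<forall>s\<in>carrier R. r \<noteq> x [^] (j::nat) \<otimes> s)"
proof -
  have "\<zero>\<^bsub>C\<^esub> \<in> P" by (rule additive_subgroup.zero_closed[OF ideal.axioms(1)[OF P(1)]])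
  then obtain p where p: "p \<in> P" "p \<noteq> \<zero>\<^bsub>C\<^esub>" using P(2) by blast
  have pc: "p \<in> carrier C" using ideal.Icarr[OF P(1) p(1)] .
  obtain j where j: "\<And>d. d \<in> carrier C \<Longrightarrow> p \<noteq> X j \<otimes>\<^bsub>C\<^esub> d" using separated[OF pc] p(2) by blast
  have "\<exists>r\<in>carrier R. \<exists>b\<in>carrier R. \<exists>e\<in>carrier R.
     r \<otimes> r = x [^] (k + j) \<otimes> b \<otimes> r \<oplus> x [^] (k + j) \<otimes> x [^] (k + j) \<otimes> e \<and> (\<forall>s\<in>carrier R. r \<noteq> x [^] j \<otimes> s)" for k
  proof -
    define Z where "Z = X (k + j)"
    define z where "z = x [^] (k + j)"
    have Z: "Z \<in> carrier C" "z \<in> carrier R" "\<phi> z = Z" using phi_pow by (simp_all add: Z_def z_def)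
    obtain r d where r: "r \<in> carrier R" "d \<in> carrier C" "p = \<phi> r \<oplus>\<^bsub>C\<^esub> Z \<otimes>\<^bsub>C\<^esub> d" unfolding Z_def
      by (rule dense_le[OF pc])
    \<comment> \<open>The cross term \<open>2 Z r d\<close> still has its coefficient
      \<open>d\<close> in \<open>C\<close>; replacing \<open>d\<close> by an element of
      \<open>R\<close> modulo \<open>Z\<close> costs only a multiple of \<open>Z Z\<close>.\<close>
    obtain c d' where c: "c \<in> carrier R" "d' \<in> carrier C" "d = \<phi> c \<oplus>\<^bsub>C\<^esub> Z \<otimes>\<^bsub>C\<^esub> d'" unfolding Z_def
      by (rule dense_le[OF r(2)])
    define R' where "R' = \<phi> r"
    define C' where "C' = \<phi> c"
    have cc: "R' \<in> carrier C" "C' \<in> carrier C" using r c by (simp_all add: R'_def C'_def)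
    define S where "S = R' \<oplus>\<^bsub>C\<^esub> Z \<otimes>\<^bsub>C\<^esub> C'"
    define Y where "Y = Z \<otimes>\<^bsub>C\<^esub> Z \<otimes>\<^bsub>C\<^esub> d'"
    define g where "g = \<ominus>\<^bsub>C\<^esub> ((S \<oplus>\<^bsub>C\<^esub> S \<oplus>\<^bsub>C\<^esub> Y) \<otimes>\<^bsub>C\<^esub> d')"
    have SY: "S \<in> carrier C" "Y \<in> carrier C" using cc Z(1) c(2) by (simp_all add: S_def Y_def)
    have gc: "g \<in> carrier C" using SY c(2) by (simp add: g_def)
    have pp: "p \<otimes>\<^bsub>C\<^esub> p = \<zero>\<^bsub>C\<^esub>" by (rule ideal_prod_zero[OF P(3) p(1) p(1)])
    have pSY: "p = S \<oplus>\<^bsub>C\<^esub> Y"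
      unfolding r(3) c(3) R'_def[symmetric] C'_def[symmetric] S_def Y_def using cc Z(1) c(2) by algebra
    have "S \<otimes>\<^bsub>C\<^esub> S = p \<otimes>\<^bsub>C\<^esub> p \<ominus>\<^bsub>C\<^esub> (S \<oplus>\<^bsub>C\<^esub> S \<oplus>\<^bsub>C\<^esub> Y) \<otimes>\<^bsub>C\<^esub> Y" unfolding pSY using SY by algebra
    moreover have "(S \<oplus>\<^bsub>C\<^esub> S \<oplus>\<^bsub>C\<^esub> Y) \<otimes>\<^bsub>C\<^esub> Y = \<ominus>\<^bsub>C\<^esub> (Z \<otimes>\<^bsub>C\<^esub> Z \<otimes>\<^bsub>C\<^esub> g)"
    proof -
      have "S \<oplus>\<^bsub>C\<^esub> S \<oplus>\<^bsub>C\<^esub> Y \<in> carrier C" using SY by simp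
      then show ?thesis unfolding g_def using Z(1) c(2) by (simp add: Y_def C.m_ac C.r_minus)
    qed
    ultimately have "S \<otimes>\<^bsub>C\<^esub> S = p \<otimes>\<^bsub>C\<^esub> p \<oplus>\<^bsub>C\<^esub> Z \<otimes>\<^bsub>C\<^esub> Z \<otimes>\<^bsub>C\<^esub> g"
      using Z(1) gc by (simp add: C.minus_eq)
    moreover have "S \<otimes>\<^bsub>C\<^esub> S = R' \<otimes>\<^bsub>C\<^esub> R' \<oplus>\<^bsub>C\<^esub> Z \<otimes>\<^bsub>C\<^esub> (C' \<oplus>\<^bsub>C\<^esub> C') \<otimes>\<^bsub>C\<^esub> R' \<oplus>\<^bsub>C\<^esub> Z \<otimes>\<^bsub>C\<^esub> Z \<otimes>\<^bsub>C\<^esub> (C' \<otimes>\<^bsub>C\<^esub> C')"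
      unfolding S_def using cc Z(1) by algebra
    ultimately have "R' \<otimes>\<^bsub>C\<^esub> R' \<oplus>\<^bsub>C\<^esub> Z \<otimes>\<^bsub>C\<^esub> (C' \<oplus>\<^bsub>C\<^esub> C') \<otimes>\<^bsub>C\<^esub> R' \<oplus>\<^bsub>C\<^esub> Z \<otimes>\<^bsub>C\<^esub> Z \<otimes>\<^bsub>C\<^esub> (C' \<otimes>\<^bsub>C\<^esub> C') = p \<otimes>\<^bsub>C\<^esub> p \<oplus>\<^bsub>C\<^esub> Z \<otimes>\<^bsub>C\<^esub> Z \<otimes>\<^bsub>C\<^esub> g"
      by simp
    also have "\<dots> = Z \<otimes>\<^bsub>C\<^esub> Z \<otimes>\<^bsub>C\<^esub> g" unfolding pp using Z(1) gc by simp
    finally have "\<phi> (r \<otimes> r \<oplus> z \<otimes> (c \<oplus> c) \<otimes> r \<oplus> z \<otimes> z \<otimes> (c \<otimes> c)) = X ((k + j) + (k + j)) \<otimes>\<^bsub>C\<^esub> g"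
      unfolding R'_def C'_def Z(3)[symmetric] X_add[of "k + j" "k + j"] Z_def[symmetric]
      using r(1) c(1) Z(2) by simp
    then obtain t where t: "t \<in> carrier R"
      "r \<otimes> r \<oplus> z \<otimes> (c \<oplus> c) \<otimes> r \<oplus> z \<otimes> z \<otimes> (c \<otimes> c) = x [^] ((k + j) + (k + j)) \<otimes> t"
      using exact[OF _ gc, of "r \<otimes> r \<oplus> z \<otimes> (c \<oplus> c) \<otimes> r \<oplus> z \<otimes> z \<otimes> (c \<otimes> c)" "(k + j) + (k + j)"] r(1) c(1)
      Z(2) by auto
    have zz: "x [^] ((k + j) + (k + j)) = z \<otimes> z" using x by (simp add: z_def R.nat_pow_mult)
    note t2 = t(2)[unfolded zz]
    have "r \<otimes> r = (r \<otimes> r \<oplus> z \<otimes> (c \<oplus> c) \<otimes> r \<oplus> z \<otimes> z \<otimes> (c \<otimes> c)) \<ominus> z \<otimes> (c \<oplus> c) \<otimes> r \<ominus> z \<otimes> z \<otimes> (c \<otimes> c)"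
      using r(1) c(1) Z(2) by algebra
    also have "\<dots> = z \<otimes> (\<ominus> (c \<oplus> c)) \<otimes> r \<oplus> z \<otimes> z \<otimes> (t \<ominus> c \<otimes> c)"
      unfolding t2 using r(1) c(1) Z(2) t(1) by algebra
    finally have eq: "r \<otimes> r = z \<otimes> (\<ominus> (c \<oplus> c)) \<otimes> r \<oplus> z \<otimes> z \<otimes> (t \<ominus> c \<otimes> c)" .
    have "r \<noteq> x [^] j \<otimes> s" if s: "s \<in> carrier R" for s
    proof
      assume "r = x [^] j \<otimes> s"
      then have "\<phi> r = X j \<otimes>\<^bsub>C\<^esub> \<phi> s" using s phi_pow by simp
      then have "p = X j \<otimes>\<^bsub>C\<^esub> (\<phi> s \<oplus>\<^bsub>C\<^esub> X k \<otimes>\<^bsub>C\<^esub> d)"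
        unfolding r(3) Z_def X_add using s r(2) by (simp add: C.r_distr C.m_ac)
      then show False using j s r(2) by simp
    qed
    then show ?thesis using eq r(1) c(1) t(1) unfolding z_def
      by (intro bexI[of _ r] bexI[of _ "\<ominus> (c \<oplus> c)"] bexI[of _ "t \<ominus> c \<otimes> c"]) auto
  qed
  then show ?thesis using that by blast
qed

text \<open>The identities found in \<open>C\<close> have coefficients in \<open>C\<close>. They
  descend to \<open>R\<close> by approximating the coefficients modulo a power of \<open>x\<close>
  so high that the error is a multiple of \<open>i\<close>; that some power of \<open>x\<close> is a
  multiple of \<open>i\<close> is therefore proved before the identity for products.\<close>

lemma stable_generator:
  assumes P: "primeideal P C" "ideal_prod C P P = {\<zero>\<^bsub>C\<^esub>}" "DVR (C Quot P)"
    and nzd: "\<And>y. y \<in> carrier R \<Longrightarrow> x \<otimes> y = \<zero> \<Longrightarrow> y = \<zero>"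
    and jac: "\<And>t. t \<in> carrier R \<Longrightarrow> \<exists>u\<in>carrier R. (\<one> \<ominus> x \<otimes> t) \<otimes> u = \<one>"
    and I: "ideal I R" "x [^] (n::nat) \<in> I"
  obtains i where "i \<in> I" "\<exists>k::nat. \<exists>c\<in>carrier R. x [^] k = i \<otimes> c"
    "\<And>a b. a \<in> I \<Longrightarrow> b \<in> I \<Longrightarrow> \<exists>c\<in>I. a \<otimes> b = i \<otimes> c"
proof -
  interpret P: primeideal P C by (rule P(1))
  note Ic = ideal.Icarr[OF I(1)]
  have one: "\<one>\<^bsub>C\<^esub> \<notin> P" using P.one_imp_carrier P.I_notcarr by blast
  \<comment> \<open>If \<open>\<phi> x\<close> lay in \<open>P\<close>, its square would vanish, so
    \<open>x x\<close> would be divisible by \<open>x^3\<close>; as \<open>1 - xs\<close> is a unit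
    and \<open>x\<close> cancels, this gives \<open>x = 0\<close>, hence
    \<open>1 = 0\<close>.\<close>
  have xP: "\<phi> x \<notin> P"
  proof
    assume a: "\<phi> x \<in> P"
    have "\<phi> (x \<otimes> x) = \<phi> x \<otimes>\<^bsub>C\<^esub> \<phi> x" using x by simp
    also have "\<dots> = \<zero>\<^bsub>C\<^esub>" by (rule ideal_prod_zero[OF P(2) a a])
    also have "\<dots> = X 3 \<otimes>\<^bsub>C\<^esub> \<zero>\<^bsub>C\<^esub>" by (rule C.r_null[OF X_closed, symmetric])
    finally obtain s where s: "s \<in> carrier R" "x \<otimes> x = x [^] (3::nat) \<otimes> s" using exact[of "x \<otimes> x" "\<zero>\<^bsub>C\<^esub>" 3] x
      by auto
    obtain u where u: "u \<in> carrier R" "(\<one> \<ominus> x \<otimes> s) \<otimes> u = \<one>" using jac s by blast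
    have "x [^] (3::nat) = x \<otimes> x \<otimes> x" using x by (simp add: numeral_3_eq_3)
    then have s2: "x \<otimes> x = x \<otimes> x \<otimes> x \<otimes> s" using s by simp
    have "x \<otimes> x = (x \<otimes> x) \<otimes> ((\<one> \<ominus> x \<otimes> s) \<otimes> u)" using u x by simp
    also have "\<dots> = (x \<otimes> x \<ominus> x \<otimes> x \<otimes> x \<otimes> s) \<otimes> u" using x s(1) u(1) by algebra
    also have "\<dots> = \<zero>" unfolding s2[symmetric] using x u(1) by algebra
    finally have "x = \<zero>" using nzd x by blast
    then have "\<one> = \<zero>" using nzd[of \<one>] x by simp
    then have "\<phi> \<one> = \<phi> \<zero>" by simp
    then have "\<one>\<^bsub>C\<^esub> = \<zero>\<^bsub>C\<^esub>" by simp
    then show False using one P.zero_closed additive_subgroup.zero_closed[OF P.is_additive_subgroup] by simp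
  qed
  have XP: "X k \<notin> P" for k :: nat
  proof (induction k)
    case 0 then show ?case using one by simp
  next
    case (Suc k)
    then show ?case using P.I_prime[of "X k" "\<phi> x"] xP x by auto
  qed
  obtain v :: "'c set \<Rightarrow> nat" where vv: "\<forall>a\<in>carrier (C Quot P) - {\<zero>\<^bsub>C Quot P\<^esub>}. \<forall>b\<in>carrier (C Quot P) - {\<zero>\<^bsub>C Quot P\<^esub>}.
      (\<exists>c\<in>carrier (C Quot P). b = a \<otimes>\<^bsub>C Quot P\<^esub> c) \<longleftrightarrow> v a \<le> v b"
    using P(3) unfolding DVR_def by (elim conjE exE) (rule that)
  note v = vv[rule_format]
  have elt: "\<exists>c\<in>carrier C. Z = P +>\<^bsub>C\<^esub> c" if "Z \<in> carrier (C Quot P)" for Z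
    using that unfolding FactRing_def A_RCOSETS_def' by auto
  have closed: "P +>\<^bsub>C\<^esub> c \<in> carrier (C Quot P) - {\<zero>\<^bsub>C Quot P\<^esub>}" if "c \<in> carrier C" "c \<notin> P" for c
    using that P.rcos_const_imp_mem[of c] unfolding FactRing_def A_RCOSETS_def' by auto
  define S where "S = {i \<in> I. \<phi> i \<notin> P}"
  have "x [^] n \<in> S" using I(2) XP phi_pow by (simp add: S_def)
  then obtain i where i: "i \<in> S" "\<And>a. a \<in> S \<Longrightarrow> v (P +>\<^bsub>C\<^esub> \<phi> i) \<le> v (P +>\<^bsub>C\<^esub> \<phi> a)"
    using ex_has_least_nat[of "\<lambda>i. i \<in> S" "x [^] n" "\<lambda>i. v (P +>\<^bsub>C\<^esub> \<phi> i)"] by blast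
  have iI: "i \<in> I" "\<phi> i \<notin> P" using i(1) by (auto simp: S_def)
  note ic = Ic[OF iI(1)]
  have phii: "\<phi> i \<in> carrier C" using ic by simp
  have div: "\<exists>e\<in>carrier C. \<exists>p\<in>P. \<phi> a = \<phi> i \<otimes>\<^bsub>C\<^esub> e \<oplus>\<^bsub>C\<^esub> p" if a: "a \<in> I" for a
  proof (cases "\<phi> a \<in> P")
    case True
    have "\<phi> a = \<phi> i \<otimes>\<^bsub>C\<^esub> \<zero>\<^bsub>C\<^esub> \<oplus>\<^bsub>C\<^esub> \<phi> a" using ic Ic[OF a] by simp
    then show ?thesis using True by blast
  next
    case False
    have ac: "\<phi> a \<in> carrier C" using Ic[OF a] by simp
    have "v (P +>\<^bsub>C\<^esub> \<phi> i) \<le> v (P +>\<^bsub>C\<^esub> \<phi> a)" using i(2) a False by (simp add: S_def)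
    then obtain Z where Z: "Z \<in> carrier (C Quot P)" "P +>\<^bsub>C\<^esub> \<phi> a = (P +>\<^bsub>C\<^esub> \<phi> i) \<otimes>\<^bsub>C Quot P\<^esub> Z"
      using v[OF closed[OF phii iI(2)] closed[OF ac False]] by blast
    obtain e where e: "e \<in> carrier C" "Z = P +>\<^bsub>C\<^esub> e" using elt Z(1) by blast
    have "P +>\<^bsub>C\<^esub> \<phi> a = P +>\<^bsub>C\<^esub> (\<phi> i \<otimes>\<^bsub>C\<^esub> e)"
      using Z(2) e P.rcoset_mult_add[OF phii e(1)] by (simp add: FactRing_def)
    then have "\<phi> a \<ominus>\<^bsub>C\<^esub> \<phi> i \<otimes>\<^bsub>C\<^esub> e \<in> P"
      using C.quotient_eq_iff_same_a_r_cos[OF P.is_ideal ac] phii e(1) by simp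
    moreover have "\<phi> a = \<phi> i \<otimes>\<^bsub>C\<^esub> e \<oplus>\<^bsub>C\<^esub> (\<phi> a \<ominus>\<^bsub>C\<^esub> \<phi> i \<otimes>\<^bsub>C\<^esub> e)" using ac phii e(1) by algebra
    ultimately show ?thesis using e(1) by blast
  qed
  \<comment> \<open>The error \<open>p\<close> in \<open>X n = i e + p\<close> has square zero, so
    doubling the exponent removes it.\<close>
  have "\<exists>c\<in>carrier R. x [^] (n + n) = i \<otimes> c"
  proof -
    obtain e p where e: "e \<in> carrier C" "p \<in> P" "\<phi> (x [^] n) = \<phi> i \<otimes>\<^bsub>C\<^esub> e \<oplus>\<^bsub>C\<^esub> p" using div[OF I(2)] by blast
    note pc = P.Icarr[OF e(2)]
    have Xn: "X n = \<phi> i \<otimes>\<^bsub>C\<^esub> e \<oplus>\<^bsub>C\<^esub> p" using e(3) phi_pow by simp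
    have pp: "p \<otimes>\<^bsub>C\<^esub> p = \<zero>\<^bsub>C\<^esub>" by (rule ideal_prod_zero[OF P(2) e(2) e(2)])
    define g where "g = e \<otimes>\<^bsub>C\<^esub> (X n \<oplus>\<^bsub>C\<^esub> p)"
    have g: "g \<in> carrier C" using e(1) pc by (simp add: g_def)
    have "X (n + n) = \<phi> i \<otimes>\<^bsub>C\<^esub> g \<oplus>\<^bsub>C\<^esub> p \<otimes>\<^bsub>C\<^esub> p"
      unfolding X_add g_def unfolding Xn using phii e(1) pc by algebra
    then have ig: "X (n + n) = \<phi> i \<otimes>\<^bsub>C\<^esub> g" using pp phii g by simp
    \<comment> \<open>One level beyond \<open>n + n\<close>: the error of the approximation is then
      a multiple of \<open>x\<close> times \<open>x^(2n)\<close>, and the factor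
      \<open>1 - xt\<close> it produces is a unit.\<close>
    obtain s d where s: "s \<in> carrier R" "d \<in> carrier C" "g = \<phi> s \<oplus>\<^bsub>C\<^esub> X (Suc (n + n)) \<otimes>\<^bsub>C\<^esub> d"
      by (rule dense_le[OF g])
    have sc: "\<phi> s \<in> carrier C" "X (Suc (n + n)) \<in> carrier C" using s(1) X_closed by blast+
    have "\<phi> (x [^] (n + n) \<ominus> i \<otimes> s) = X (n + n) \<ominus>\<^bsub>C\<^esub> \<phi> i \<otimes>\<^bsub>C\<^esub> \<phi> s"
      using phi_pow[of "n + n"] ic s(1) xpow[of "n + n"] by (simp add: R.minus_eq C.minus_eq)
    also have "\<dots> = X (Suc (n + n)) \<otimes>\<^bsub>C\<^esub> (\<phi> i \<otimes>\<^bsub>C\<^esub> d)"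
      unfolding ig s(3) using phii sc s(2) by algebra
    finally obtain t where t: "t \<in> carrier R" "x [^] (n + n) \<ominus> i \<otimes> s = x [^] (Suc (n + n)) \<otimes> t"
      using exact[of "x [^] (n + n) \<ominus> i \<otimes> s" "\<phi> i \<otimes>\<^bsub>C\<^esub> d" "Suc (n + n)"] ic s(1,2) phii xpow[of "n + n"]
      by auto
    obtain u where u: "u \<in> carrier R" "(\<one> \<ominus> x \<otimes> t) \<otimes> u = \<one>" using jac t(1) by blast
    define y where "y = x [^] (n + n)"
    have y: "y \<in> carrier R" by (simp add: y_def)
    have t2: "y \<ominus> i \<otimes> s = y \<otimes> x \<otimes> t" using t(2) by (simp add: y_def)
    have "y = y \<otimes> ((\<one> \<ominus> x \<otimes> t) \<otimes> u)" using u(2) y by simp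
    also have "\<dots> = (y \<ominus> y \<otimes> x \<otimes> t) \<otimes> u" using y x t(1) u(1) by algebra
    also have "\<dots> = i \<otimes> (s \<otimes> u)" unfolding t2[symmetric] using y ic s(1) u(1) by algebra
    finally show ?thesis using s(1) u(1) y_def by auto
  qed
  then obtain c0 where c0: "c0 \<in> carrier R" "x [^] (n + n) = i \<otimes> c0" by blast
  have prod: "\<exists>c\<in>I. a \<otimes> b = i \<otimes> c" if a: "a \<in> I" and b: "b \<in> I" for a b
  proof -
    \<comment> \<open>Of this power of \<open>x\<close>, the factor \<open>x^(2n)\<close> is a
      multiple of \<open>i\<close> and the remaining \<open>x^n\<close> belongs to \<open>I\<close>,
      so an error divisible by it lies in \<open>iI\<close> and not just in
      \<open>iR\<close>.\<close>
    let ?N = "(n + n) + n"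
    obtain e p where e: "e \<in> carrier C" "p \<in> P" "\<phi> a = \<phi> i \<otimes>\<^bsub>C\<^esub> e \<oplus>\<^bsub>C\<^esub> p" using div[OF a] by blast
    obtain f q where f: "f \<in> carrier C" "q \<in> P" "\<phi> b = \<phi> i \<otimes>\<^bsub>C\<^esub> f \<oplus>\<^bsub>C\<^esub> q" using div[OF b] by blast
    note pq = P.Icarr[OF e(2)] P.Icarr[OF f(2)]
    have pq0: "p \<otimes>\<^bsub>C\<^esub> q = \<zero>\<^bsub>C\<^esub>" by (rule ideal_prod_zero[OF P(2) e(2) f(2)])
    have ac: "a \<in> carrier R" "b \<in> carrier R" "\<phi> a \<in> carrier C" "\<phi> b \<in> carrier C" using Ic a b by simp_all
    have "\<phi> a \<otimes>\<^bsub>C\<^esub> \<phi> b = \<phi> i \<otimes>\<^bsub>C\<^esub> (f \<otimes>\<^bsub>C\<^esub> \<phi> a \<oplus>\<^bsub>C\<^esub> e \<otimes>\<^bsub>C\<^esub> \<phi> b \<ominus>\<^bsub>C\<^esub> \<phi> i \<otimes>\<^bsub>C\<^esub> e \<otimes>\<^bsub>C\<^esub> f) \<oplus>\<^bsub>C\<^esub> p \<otimes>\<^bsub>C\<^esub> q"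
      unfolding e(3) f(3) using phii e(1) f(1) pq by algebra
    then have ab: "\<phi> a \<otimes>\<^bsub>C\<^esub> \<phi> b = \<phi> i \<otimes>\<^bsub>C\<^esub> (f \<otimes>\<^bsub>C\<^esub> \<phi> a \<oplus>\<^bsub>C\<^esub> e \<otimes>\<^bsub>C\<^esub> \<phi> b \<ominus>\<^bsub>C\<^esub> \<phi> i \<otimes>\<^bsub>C\<^esub> e \<otimes>\<^bsub>C\<^esub> f)"
      unfolding pq0 using phii e(1) f(1) ac by simp
    obtain s d where s: "s \<in> carrier R" "d \<in> carrier C" "e = \<phi> s \<oplus>\<^bsub>C\<^esub> X ?N \<otimes>\<^bsub>C\<^esub> d" by (rule dense_le[OF e(1)])
    obtain s' d' where s': "s' \<in> carrier R" "d' \<in> carrier C" "f = \<phi> s' \<oplus>\<^bsub>C\<^esub> X ?N \<otimes>\<^bsub>C\<^esub> d'"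
      by (rule dense_le[OF f(1)])
    define w where "w = s' \<otimes> a \<oplus> s \<otimes> b \<ominus> i \<otimes> s \<otimes> s'"
    have wI: "w \<in> I"
    proof -
      have "s' \<otimes> a \<in> I" "s \<otimes> b \<in> I" using ideal.I_l_closed[OF I(1)] a b s s' by blast+
      moreover have "\<ominus> (i \<otimes> s \<otimes> s') \<in> I"
        using ideal.I_r_closed[OF I(1) ideal.I_r_closed[OF I(1) iI(1) s(1)] s'(1)]
          additive_subgroup.a_inv_closed[OF ideal.axioms(1)[OF I(1)]] by blast
      ultimately show ?thesis unfolding w_def R.minus_eq
        using additive_subgroup.a_closed[OF ideal.axioms(1)[OF I(1)]] by blast
    qed
    have sc: "\<phi> s \<in> carrier C" "\<phi> s' \<in> carrier C" "X ?N \<in> carrier C" using s(1) s'(1) X_closed by blast+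
    define h where "h = \<phi> i \<otimes>\<^bsub>C\<^esub> (d' \<otimes>\<^bsub>C\<^esub> \<phi> a \<oplus>\<^bsub>C\<^esub> d \<otimes>\<^bsub>C\<^esub> \<phi> b \<ominus>\<^bsub>C\<^esub> \<phi> i \<otimes>\<^bsub>C\<^esub> \<phi> s \<otimes>\<^bsub>C\<^esub> d' \<ominus>\<^bsub>C\<^esub> \<phi> i \<otimes>\<^bsub>C\<^esub> d \<otimes>\<^bsub>C\<^esub> \<phi> s'
      \<ominus>\<^bsub>C\<^esub> \<phi> i \<otimes>\<^bsub>C\<^esub> d \<otimes>\<^bsub>C\<^esub> (X ?N \<otimes>\<^bsub>C\<^esub> d'))"
    have h: "h \<in> carrier C" using phii ac sc s(2) s'(2) by (simp add: h_def)
    have "\<phi> (a \<otimes> b \<ominus> i \<otimes> w) = \<phi> a \<otimes>\<^bsub>C\<^esub> \<phi> b \<ominus>\<^bsub>C\<^esub> \<phi> i \<otimes>\<^bsub>C\<^esub> (\<phi> s' \<otimes>\<^bsub>C\<^esub> \<phi> a \<oplus>\<^bsub>C\<^esub> \<phi> s \<otimes>\<^bsub>C\<^esub> \<phi> b \<ominus>\<^bsub>C\<^esub> \<phi> i \<otimes>\<^bsub>C\<^esub> \<phi> s \<otimes>\<^bsub>C\<^esub> \<phi> s')"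
      unfolding w_def using ac s(1) s'(1) ic by (simp add: R.minus_eq C.minus_eq)
    also have "\<dots> = X ?N \<otimes>\<^bsub>C\<^esub> h"
      unfolding ab h_def s(3) s'(3) by (rule C.product_difference[OF phii ac(3,4) sc s(2) s'(2)])
    finally obtain t where t: "t \<in> carrier R" "a \<otimes> b \<ominus> i \<otimes> w = x [^] ?N \<otimes> t"
      using exact[of "a \<otimes> b \<ominus> i \<otimes> w" h ?N] h ac ic Ic[OF wI] by auto
    have "x [^] ?N = (i \<otimes> c0) \<otimes> x [^] n" using c0 x R.nat_pow_mult[of x "n + n" n] by simp
    then have "a \<otimes> b \<ominus> i \<otimes> w = i \<otimes> ((c0 \<otimes> t) \<otimes> x [^] n)" unfolding t(2) using ic c0(1) t(1)
      by (simp add: R.m_ac)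
    moreover have "(c0 \<otimes> t) \<otimes> x [^] n \<in> I" using ideal.I_l_closed[OF I(1) I(2)] c0(1) t(1) by simp
    then have wc: "w \<oplus> (c0 \<otimes> t) \<otimes> x [^] n \<in> I"
      using additive_subgroup.a_closed[OF ideal.axioms(1)[OF I(1)] wI] by blast
    have "a \<otimes> b = i \<otimes> w \<oplus> (a \<otimes> b \<ominus> i \<otimes> w)" using ac(1,2) ic Ic[OF wI] by algebra
    ultimately have "a \<otimes> b = i \<otimes> (w \<oplus> (c0 \<otimes> t) \<otimes> x [^] n)" using ic Ic[OF wI] c0(1) t(1)
      by (simp add: R.r_distr)
    then show ?thesis using wc by blast
  qed
  show ?thesis using that[OF iI(1) _ prod] c0 by blast
qed

end

section \<open>The total ring of quotients\<close>

context cring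
begin

lemma nzdD: "s \<in> nzd R \<Longrightarrow> s \<in> carrier R" "s \<in> nzd R \<Longrightarrow> x \<in> carrier R \<Longrightarrow> s \<otimes> x = \<zero> \<Longrightarrow> x = \<zero>"
  by (auto simp: nzd_def)

lemma nzd_one [simp]: "\<one> \<in> nzd R" by (auto simp: nzd_def)

lemma nzd_mult: "s \<in> nzd R \<Longrightarrow> t \<in> nzd R \<Longrightarrow> s \<otimes> t \<in> nzd R"
proof -
  assume s: "s \<in> nzd R" and t: "t \<in> nzd R"
  have "x = \<zero>" if x: "x \<in> carrier R" "s \<otimes> t \<otimes> x = \<zero>" for x
  proof (rule nzdD(2)[OF t x(1)])
    have "s \<otimes> (t \<otimes> x) = \<zero>" using x nzdD(1)[OF s] nzdD(1)[OF t] by (simp add: m_assoc)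
    then show "t \<otimes> x = \<zero>" using nzdD(2)[OF s] nzdD(1)[OF t] x(1) by blast
  qed
  then show ?thesis using nzdD(1)[OF s] nzdD(1)[OF t] by (simp add: nzd_def)
qed

lemma nzd_cancel:
  assumes "s \<in> nzd R" "x \<in> carrier R" "y \<in> carrier R" "s \<otimes> x = s \<otimes> y"
  shows "x = y"
proof -
  note sc = nzdD(1)[OF assms(1)]
  have "s \<otimes> (x \<ominus> y) = s \<otimes> x \<ominus> s \<otimes> y" using sc assms(2,3) by algebra
  then have "s \<otimes> (x \<ominus> y) = \<zero>" using assms(2-4) sc by simp
  then have "x \<ominus> y = \<zero>" using nzdD(2)[OF assms(1)] assms(2,3) by simp
  then show ?thesis using assms(2,3) by simp
qed

lemma nzd_factor: "s \<in> carrier R \<Longrightarrow> t \<in> carrier R \<Longrightarrow> s \<otimes> t \<in> nzd R \<Longrightarrow> s \<in> nzd R"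
proof -
  assume a: "s \<in> carrier R" "t \<in> carrier R" "s \<otimes> t \<in> nzd R"
  have "x = \<zero>" if x: "x \<in> carrier R" "s \<otimes> x = \<zero>" for x
  proof -
    have "(s \<otimes> t) \<otimes> x = t \<otimes> (s \<otimes> x)" using a(1,2) x(1) by algebra
    then show ?thesis using nzdD(2)[OF a(3) x(1)] x a by simp
  qed
  then show ?thesis unfolding nzd_def using a(1) by blast
qed

lemma nzd_pow: "s \<in> nzd R \<Longrightarrow> s [^] (n::nat) \<in> nzd R"
  by (induction n) (auto intro: nzd_mult)

lemma frac_rel_equiv: "equiv (carrier R \<times> nzd R) (frac_rel R)"
proof (rule equivI)
  show "frac_rel R \<subseteq> (carrier R \<times> nzd R) \<times> (carrier R \<times> nzd R)" by (auto simp: frac_rel_def)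
  show "refl_on (carrier R \<times> nzd R) (frac_rel R)" by (auto simp: refl_on_def frac_rel_def)
  show "sym (frac_rel R)" by (auto simp: sym_def frac_rel_def)
  have "a \<otimes> u = c \<otimes> s" if h: "a \<in> carrier R" "b \<in> carrier R" "c \<in> carrier R" "s \<in> nzd R" "t \<in> nzd R"
    "u \<in> nzd R"
     "a \<otimes> t = b \<otimes> s" "b \<otimes> u = c \<otimes> t" for a b c s t u
  proof (rule nzd_cancel[OF h(5)])
    note c = h(1-3) nzdD(1)[OF h(4)] nzdD(1)[OF h(5)] nzdD(1)[OF h(6)]
    show "a \<otimes> u \<in> carrier R" "c \<otimes> s \<in> carrier R" using c by simp_all
    have "t \<otimes> (a \<otimes> u) = (a \<otimes> t) \<otimes> u" using c by algebra
    also have "\<dots> = (b \<otimes> u) \<otimes> s" unfolding h(7) using c by algebra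
    also have "\<dots> = t \<otimes> (c \<otimes> s)" unfolding h(8) using c by algebra
    finally show "t \<otimes> (a \<otimes> u) = t \<otimes> (c \<otimes> s)" .
  qed
  then show "trans (frac_rel R)" unfolding trans_def frac_rel_def by fast
qed

lemma frac_class_eq_iff:
  assumes "a \<in> carrier R" "s \<in> nzd R" "b \<in> carrier R" "t \<in> nzd R"
  shows "frac_class R a s = frac_class R b t \<longleftrightarrow> a \<otimes> t = b \<otimes> s"
proof -
  have "frac_class R a s = frac_class R b t \<longleftrightarrow> ((a, s), (b, t)) \<in> frac_rel R"
    unfolding frac_class_def by (rule eq_equiv_class_iff[OF frac_rel_equiv]) (use assms in auto)
  then show ?thesis using assms by (simp add: frac_rel_def)
qed

lemma mem_frac_class_iff:
  "(b, t) \<in> frac_class R a s \<longleftrightarrow> a \<in> carrier R \<and> b \<in> carrier R \<and> s \<in> nzd R \<and> t \<in> nzd R \<and> a \<otimes> t = b \<otimes> s"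
  by (auto simp: frac_class_def frac_rel_def)

lemma frac_class_self: "a \<in> carrier R \<Longrightarrow> s \<in> nzd R \<Longrightarrow> (a, s) \<in> frac_class R a s"
  by (simp add: mem_frac_class_iff)

text \<open>The union in \<open>qmult\<close> runs over all representatives; since their products
  all define the same class, it is the union of one set and hence that class.\<close>

lemma qmult_frac:
  assumes h: "a \<in> carrier R" "s \<in> nzd R" "b \<in> carrier R" "t \<in> nzd R"
  shows "qmult R (frac_class R a s) (frac_class R b t) = frac_class R (a \<otimes> b) (s \<otimes> t)"
proof -
  have "frac_class R (a' \<otimes> b') (s' \<otimes> t') = frac_class R (a \<otimes> b) (s \<otimes> t)"
    if "(a', s') \<in> frac_class R a s" "(b', t') \<in> frac_class R b t" for a' s' b' t'
  proof -
    have h': "a' \<in> carrier R" "s' \<in> nzd R" "b' \<in> carrier R" "t' \<in> nzd R" "a \<otimes> s' = a' \<otimes> s" "b \<otimes> t' = b' \<otimes> t"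
      using that by (auto simp: mem_frac_class_iff)
    note c = h(1,3) h'(1,3) nzdD(1)[OF h(2)] nzdD(1)[OF h(4)] nzdD(1)[OF h'(2)] nzdD(1)[OF h'(4)]
    have "(a' \<otimes> b') \<otimes> (s \<otimes> t) = (a' \<otimes> s) \<otimes> (b' \<otimes> t)" using c by algebra
    also have "\<dots> = (a \<otimes> b) \<otimes> (s' \<otimes> t')" unfolding h'(5,6)[symmetric] using c by algebra
    finally show ?thesis using frac_class_eq_iff nzd_mult c h h' by simp
  qed
  then have "z \<in> {frac_class R (a' \<otimes> b') (s' \<otimes> t') | a' s' b' t'. (a', s') \<in> frac_class R a s \<and> (b', t') \<in> frac_class R b t}
      \<longleftrightarrow> z = frac_class R (a \<otimes> b) (s \<otimes> t)" for z using frac_class_self[OF h(1,2)] frac_class_self[OF h(3,4)] by blast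
  then have "{frac_class R (a' \<otimes> b') (s' \<otimes> t') | a' s' b' t'. (a', s') \<in> frac_class R a s \<and> (b', t') \<in> frac_class R b t}
      = {frac_class R (a \<otimes> b) (s \<otimes> t)}" unfolding set_eq_iff singleton_iff by (rule allI)
  then show ?thesis unfolding qmult_def by simp
qed

lemma qadd_frac:
  assumes h: "a \<in> carrier R" "s \<in> nzd R" "b \<in> carrier R" "t \<in> nzd R"
  shows "qadd R (frac_class R a s) (frac_class R b t) = frac_class R (a \<otimes> t \<oplus> b \<otimes> s) (s \<otimes> t)"
proof -
  have "frac_class R (a' \<otimes> t' \<oplus> b' \<otimes> s') (s' \<otimes> t') = frac_class R (a \<otimes> t \<oplus> b \<otimes> s) (s \<otimes> t)"
    if "(a', s') \<in> frac_class R a s" "(b', t') \<in> frac_class R b t" for a' s' b' t'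
  proof -
    have h': "a' \<in> carrier R" "s' \<in> nzd R" "b' \<in> carrier R" "t' \<in> nzd R" "a \<otimes> s' = a' \<otimes> s" "b \<otimes> t' = b' \<otimes> t"
      using that by (auto simp: mem_frac_class_iff)
    note c = h(1,3) h'(1,3) nzdD(1)[OF h(2)] nzdD(1)[OF h(4)] nzdD(1)[OF h'(2)] nzdD(1)[OF h'(4)]
    have "(a' \<otimes> t' \<oplus> b' \<otimes> s') \<otimes> (s \<otimes> t) = (a' \<otimes> s) \<otimes> (t \<otimes> t') \<oplus> (b' \<otimes> t) \<otimes> (s \<otimes> s')" using c by algebra
    also have "\<dots> = (a \<otimes> t \<oplus> b \<otimes> s) \<otimes> (s' \<otimes> t')" unfolding h'(5,6)[symmetric] using c by algebra
    finally show ?thesis using frac_class_eq_iff nzd_mult c h h' by simp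
  qed
  then have "z \<in> {frac_class R (a' \<otimes> t' \<oplus> b' \<otimes> s') (s' \<otimes> t') | a' s' b' t'. (a', s') \<in> frac_class R a s \<and> (b', t') \<in> frac_class R b t}
      \<longleftrightarrow> z = frac_class R (a \<otimes> t \<oplus> b \<otimes> s) (s \<otimes> t)" for z using frac_class_self[OF h(1,2)] frac_class_self[OF h(3,4)] by blast
  then have "{frac_class R (a' \<otimes> t' \<oplus> b' \<otimes> s') (s' \<otimes> t') | a' s' b' t'. (a', s') \<in> frac_class R a s \<and> (b', t') \<in> frac_class R b t}
      = {frac_class R (a \<otimes> t \<oplus> b \<otimes> s) (s \<otimes> t)}" unfolding set_eq_iff singleton_iff by (rule allI)
  then show ?thesis unfolding qadd_def by simp
qed

lemma frac_class_closed: "a \<in> carrier R \<Longrightarrow> s \<in> nzd R \<Longrightarrow> frac_class R a s \<in> qcarrier R"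
  unfolding qcarrier_def frac_class_def by (rule quotientI) simp

lemma qcarrierE:
  assumes "q \<in> qcarrier R"
  obtains a s where "a \<in> carrier R" "s \<in> nzd R" "q = frac_class R a s"
  using assms unfolding qcarrier_def frac_class_def by (auto elim!: quotientE)

lemma Qring_simps: "carrier (Qring R) = qcarrier R" "x \<otimes>\<^bsub>Qring R\<^esub> y = qmult R x y" "x \<oplus>\<^bsub>Qring R\<^esub> y = qadd R x y"
  "\<one>\<^bsub>Qring R\<^esub> = frac_class R \<one> \<one>" "\<zero>\<^bsub>Qring R\<^esub> = frac_class R \<zero> \<one>"
  by (simp_all add: Qring_def)

lemma Qring_cring: "cring (Qring R)"
proof (rule cringI)
  have m: "s \<otimes> t \<in> nzd R" "s \<in> carrier R" if "s \<in> nzd R" "t \<in> nzd R" for s t using that nzd_mult nzdD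
    by auto
  show "abelian_group (Qring R)"
  proof (rule abelian_groupI)
    fix x y z assume "x \<in> carrier (Qring R)" "y \<in> carrier (Qring R)" "z \<in> carrier (Qring R)"
    then obtain a s b t c u where h: "a \<in> carrier R" "s \<in> nzd R" "x = frac_class R a s"
      "b \<in> carrier R" "t \<in> nzd R" "y = frac_class R b t" "c \<in> carrier R" "u \<in> nzd R" "z = frac_class R c u"
      unfolding Qring_simps by (metis qcarrierE)
    note cc = h(1,4,7) nzdD(1)[OF h(2)] nzdD(1)[OF h(5)] nzdD(1)[OF h(8)]
    show "x \<oplus>\<^bsub>Qring R\<^esub> y \<in> carrier (Qring R)"
      unfolding Qring_simps h(3,6) using h cc by (simp add: qadd_frac frac_class_closed nzd_mult)
    show "x \<oplus>\<^bsub>Qring R\<^esub> y \<oplus>\<^bsub>Qring R\<^esub> z = x \<oplus>\<^bsub>Qring R\<^esub> (y \<oplus>\<^bsub>Qring R\<^esub> z)"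
    proof -
      have "((a \<otimes> t \<oplus> b \<otimes> s) \<otimes> u \<oplus> c \<otimes> (s \<otimes> t)) = (a \<otimes> (t \<otimes> u) \<oplus> (b \<otimes> u \<oplus> c \<otimes> t) \<otimes> s)"
        "s \<otimes> t \<otimes> u = s \<otimes> (t \<otimes> u)"
        using cc by algebra+
      then show ?thesis unfolding Qring_simps h(3,6,9) using h cc by (simp add: qadd_frac nzd_mult)
    qed
    show "x \<oplus>\<^bsub>Qring R\<^esub> y = y \<oplus>\<^bsub>Qring R\<^esub> x"
      unfolding Qring_simps h(3,6) using h cc by (simp add: qadd_frac m_comm[of s t] a_comm)
    show "\<zero>\<^bsub>Qring R\<^esub> \<oplus>\<^bsub>Qring R\<^esub> x = x"
      unfolding Qring_simps h(3) using h cc by (simp add: qadd_frac)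
    have "a \<otimes> s \<oplus> (\<ominus> a) \<otimes> s = \<zero>" using cc by algebra
    moreover have "(\<ominus> a) \<otimes> s \<oplus> a \<otimes> s = \<zero>" using cc by algebra
    ultimately have "qadd R (frac_class R (\<ominus> a) s) (frac_class R a s) = frac_class R \<zero> \<one>"
      using h cc by (simp add: qadd_frac frac_class_eq_iff nzd_mult)
    then show "\<exists>y\<in>carrier (Qring R). y \<oplus>\<^bsub>Qring R\<^esub> x = \<zero>\<^bsub>Qring R\<^esub>"
      unfolding Qring_simps h(3) using frac_class_closed[of "\<ominus> a" s] h cc by blast
  qed (simp add: Qring_simps frac_class_closed)
  show "Group.comm_monoid (Qring R)"
  proof (rule comm_monoidI)
    fix x y z assume "x \<in> carrier (Qring R)" "y \<in> carrier (Qring R)" "z \<in> carrier (Qring R)"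
    then obtain a s b t c u where h: "a \<in> carrier R" "s \<in> nzd R" "x = frac_class R a s"
      "b \<in> carrier R" "t \<in> nzd R" "y = frac_class R b t" "c \<in> carrier R" "u \<in> nzd R" "z = frac_class R c u"
      unfolding Qring_simps by (metis qcarrierE)
    note cc = h(1,4,7) nzdD(1)[OF h(2)] nzdD(1)[OF h(5)] nzdD(1)[OF h(8)]
    show "x \<otimes>\<^bsub>Qring R\<^esub> y \<in> carrier (Qring R)"
      unfolding Qring_simps h(3,6) using h cc by (simp add: qmult_frac frac_class_closed nzd_mult)
    show "x \<otimes>\<^bsub>Qring R\<^esub> y \<otimes>\<^bsub>Qring R\<^esub> z = x \<otimes>\<^bsub>Qring R\<^esub> (y \<otimes>\<^bsub>Qring R\<^esub> z)"
      unfolding Qring_simps h(3,6,9) using h cc by (simp add: qmult_frac nzd_mult m_assoc)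
    show "x \<otimes>\<^bsub>Qring R\<^esub> y = y \<otimes>\<^bsub>Qring R\<^esub> x"
      unfolding Qring_simps h(3,6) using h cc by (simp add: qmult_frac m_comm)
    show "\<one>\<^bsub>Qring R\<^esub> \<otimes>\<^bsub>Qring R\<^esub> x = x"
      unfolding Qring_simps h(3) using h cc by (simp add: qmult_frac)
  qed (simp add: Qring_simps frac_class_closed)
  fix x y z assume "x \<in> carrier (Qring R)" "y \<in> carrier (Qring R)" "z \<in> carrier (Qring R)"
  then obtain a s b t c u where h: "a \<in> carrier R" "s \<in> nzd R" "x = frac_class R a s"
    "b \<in> carrier R" "t \<in> nzd R" "y = frac_class R b t" "c \<in> carrier R" "u \<in> nzd R" "z = frac_class R c u"
    unfolding Qring_simps by (metis qcarrierE)
  note cc = h(1,4,7) nzdD(1)[OF h(2)] nzdD(1)[OF h(5)] nzdD(1)[OF h(8)]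
  have "((a \<otimes> t \<oplus> b \<otimes> s) \<otimes> c) \<otimes> ((s \<otimes> u) \<otimes> (t \<otimes> u)) = ((a \<otimes> c) \<otimes> (t \<otimes> u)
    \<oplus> (b \<otimes> c) \<otimes> (s \<otimes> u)) \<otimes> ((s \<otimes> t) \<otimes> u)"
    using cc by algebra
  then show "(x \<oplus>\<^bsub>Qring R\<^esub> y) \<otimes>\<^bsub>Qring R\<^esub> z = x \<otimes>\<^bsub>Qring R\<^esub> z \<oplus>\<^bsub>Qring R\<^esub> y \<otimes>\<^bsub>Qring R\<^esub> z"
    unfolding Qring_simps h(3,6,9) using h cc by (simp add: qmult_frac qadd_frac frac_class_eq_iff nzd_mult)
qed

lemma qemb_hom: "qemb R \<in> ring_hom R (Qring R)"
  by (rule ring_hom_memI) (auto simp: qemb_def Qring_simps frac_class_closed qmult_frac qadd_frac)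

lemma qemb_inj: "a \<in> carrier R \<Longrightarrow> b \<in> carrier R \<Longrightarrow> qemb R a = qemb R b \<longleftrightarrow> a = b"
  by (simp add: qemb_def frac_class_eq_iff)

lemma qemb_inverse:
  assumes "s \<in> nzd R"
  shows "\<exists>w\<in>carrier (Qring R). qemb R s \<otimes>\<^bsub>Qring R\<^esub> w = \<one>\<^bsub>Qring R\<^esub>"
proof
  show "frac_class R \<one> s \<in> carrier (Qring R)" using assms by (simp add: Qring_simps frac_class_closed)
  show "qemb R s \<otimes>\<^bsub>Qring R\<^esub> frac_class R \<one> s = \<one>\<^bsub>Qring R\<^esub>"
    using assms nzdD(1)[OF assms] by (simp add: qemb_def Qring_simps qmult_frac frac_class_eq_iff nzd_mult)
qed

lemma qemb_denominator:
  assumes "q \<in> carrier (Qring R)"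
  obtains a s where "a \<in> carrier R" "s \<in> nzd R" "qemb R s \<otimes>\<^bsub>Qring R\<^esub> q = qemb R a"
proof -
  obtain a s where h: "a \<in> carrier R" "s \<in> nzd R" "q = frac_class R a s"
    using assms unfolding Qring_simps by (rule qcarrierE)
  have "qemb R s \<otimes>\<^bsub>Qring R\<^esub> q = qemb R a"
    unfolding h(3) using h nzdD(1)[OF h(2)]
    by (simp add: qemb_def Qring_simps qmult_frac frac_class_eq_iff m_comm)
  then show ?thesis using that h by blast
qed

end

section \<open>Integrality and stability over the total ring of quotients\<close>

context cring
begin

lemma finsum_mem:
  assumes N: "smod R {} N" and f: "\<And>a. a \<in> S \<Longrightarrow> f a \<in> N"
  shows "(\<Oplus>a\<in>S. f a) \<in> N"
proof (cases "finite S")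
  case True
  then show ?thesis using f
  proof (induction S rule: finite_induct)
    case empty
    then show ?case using smodD(2)[OF N] by simp
  next
    case (insert a S)
    have fc: "f \<in> S \<rightarrow> carrier R" "f a \<in> carrier R" using insert.prems smodD(1)[OF N] by auto
    have "(\<Oplus>a\<in>insert a S. f a) = f a \<oplus> (\<Oplus>a\<in>S. f a)" by (rule finsum_insert[OF insert.hyps fc])
    then show ?case using insert smodD(3)[OF N] by simp
  qed
next
  \<comment> \<open>A sum over an infinite index set is zero by convention.\<close>
  case False
  then show ?thesis using smodD(2)[OF N] by (simp add: finsum_infinite)
qed

text \<open>Since \<open>n\<close> is at most \<open>2^n\<close>, the ideal \<open>H\<close>
  contains \<open>a^(2^n)\<close>, and \<open>red\<close> removes one squaring at a time.\<close>

lemma reduced_power: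
  assumes T: "subring T R" and H: "smod R T H" "H \<subseteq> T"
    and red: "\<And>a. a \<in> T \<Longrightarrow> a \<otimes> a \<in> H \<Longrightarrow> a \<in> H"
    and a: "a \<in> T" "a [^] (n::nat) \<in> H" "n > 0"
  shows "a \<in> H"
proof -
  note Tc = subsetD[OF subringE(1)[OF T]]
  have ac: "a \<in> carrier R" using Tc a by blast
  have "a [^] ((2::nat) ^ k) \<in> H \<Longrightarrow> a \<in> H" for k
  proof (induction k)
    case (Suc k)
    have "a [^] ((2::nat) ^ Suc k) = a [^] ((2::nat) ^ k) \<otimes> a [^] ((2::nat) ^ k)"
      using ac by (simp add: nat_pow_mult mult_2)
    then show ?case using Suc red[OF subring_pow[OF T a(1)]] by simp
  qed (use ac in simp)
  moreover have "a [^] ((2::nat) ^ n) \<in> H"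
  proof -
    have "n \<le> 2 ^ n" by simp
    then obtain l where l: "2 ^ n = l + n" by (metis add.commute le_add_diff_inverse)
    have "a [^] ((2::nat) ^ n) = a [^] l \<otimes> a [^] n" unfolding l using ac by (simp add: nat_pow_mult)
    then show ?thesis using smodD(4)[OF H(1) subring_pow[OF T a(1)] a(2)] by simp
  qed
  ultimately show ?thesis by blast
qed

text \<open>Clear denominators minimally, \<open>a = u\<^sup>Nx \<in> T\<close>: an integral equation for \<open>x\<close> makes \<open>a\<close> nilpotent
  modulo \<open>uT\<close>, so \<open>a \<in> uT\<close> and \<open>N\<close> was not minimal.\<close>
lemma integrally_closed:
  assumes T: "subring T R" and u: "u \<in> T" "\<exists>w\<in>carrier R. u \<otimes> w = \<one>"
    and frac: "\<And>q. q \<in> carrier R \<Longrightarrow> \<exists>N::nat. u [^] N \<otimes> q \<in> T"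
    and red: "\<And>a. a \<in> T \<Longrightarrow> a \<otimes> a \<in> (\<lambda>t. u \<otimes> t) ` T \<Longrightarrow> a \<in> (\<lambda>t. u \<otimes> t) ` T"
    and x: "x \<in> carrier R" and c: "\<And>i. i < n \<Longrightarrow> c i \<in> T"
    and eq: "x [^] (n::nat) \<oplus> (\<Oplus>i\<in>{..<n}. c i \<otimes> x [^] i) = \<zero>"
  shows "x \<in> T"
proof (rule ccontr)
  assume xT: "x \<notin> T"
  note Tc = subsetD[OF subringE(1)[OF T]]
  note uc = Tc[OF u(1)]
  let ?H = "(\<lambda>t. u \<otimes> t) ` T"
  have H: "smod R T ?H" unfolding smod_def
  proof (intro conjI ballI)
    show "?H \<subseteq> carrier R" using uc Tc by auto
    have "\<zero> = u \<otimes> \<zero>" using uc by simp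
    then show "\<zero> \<in> ?H" using subringE(2)[OF T] by blast
    fix a b assume "a \<in> ?H" "b \<in> ?H"
    then obtain s t where st: "s \<in> T" "t \<in> T" "a = u \<otimes> s" "b = u \<otimes> t" by blast
    then have "a \<oplus> b = u \<otimes> (s \<oplus> t)" using uc Tc by (simp add: r_distr)
    then show "a \<oplus> b \<in> ?H" using st subringE(7)[OF T] by blast
  next
    fix t a assume "t \<in> T" "a \<in> ?H"
    then obtain s where st: "s \<in> T" "t \<in> T" "a = u \<otimes> s" by blast
    then have "t \<otimes> a = u \<otimes> (t \<otimes> s)" using uc Tc by (simp add: m_lcomm)
    then show "t \<otimes> a \<in> ?H" using st subringE(6)[OF T] by blast
  qed
  have HT: "?H \<subseteq> T" using u(1) subringE(6)[OF T] by auto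
  have n0: "n > 0"
  proof (rule ccontr)
    assume "\<not> n > 0"
    then have "\<one> = \<zero>" using eq by simp
    then have "carrier R = {\<zero>}" by (rule one_zeroD)
    then have "x = \<zero>" using x by blast
    then show False using xT subringE(2)[OF T] by simp
  qed
  define N where "N = (LEAST N::nat. u [^] N \<otimes> x \<in> T)"
  have N: "u [^] N \<otimes> x \<in> T" unfolding N_def using frac[OF x] by (rule LeastI_ex)
  obtain M where M: "N = Suc M" using N xT x by (cases N) auto
  have M_notin: "u [^] M \<otimes> x \<notin> T" using not_less_Least[of M "\<lambda>N. u [^] N \<otimes> x \<in> T"] M N_def by simp
  define a where "a = u [^] N \<otimes> x"
  have aT: "a \<in> T" using N by (simp add: a_def)
  have aH: "a \<notin> ?H"
  proof
    assume "a \<in> ?H"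
    then obtain t where t: "t \<in> T" "a = u \<otimes> t" by blast
    obtain w where w: "w \<in> carrier R" "u \<otimes> w = \<one>" using u(2) by blast
    have "u \<otimes> (u [^] M \<otimes> x) = u \<otimes> t" using t(2) uc x by (simp add: a_def M m_ac)
    then have "w \<otimes> (u \<otimes> (u [^] M \<otimes> x)) = w \<otimes> (u \<otimes> t)" by simp
    then have "u [^] M \<otimes> x = t"
      using w uc x Tc[OF t(1)] m_comm[OF uc w(1)] by (simp add: m_assoc[symmetric])
    then show False using M_notin t(1) by simp
  qed
  have pw: "u [^] (N * i) \<otimes> x [^] i = a [^] i" for i :: nat
    using uc x by (simp add: a_def nat_pow_distrib nat_pow_pow)
  \<comment> \<open>The exponent splits as \<open>N(n - i) + Ni\<close>, and \<open>N(n - i)\<close>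
    is positive because \<open>i < n\<close> and \<open>N = Suc M\<close>; the spare factor
    \<open>u\<close> puts every term below the leading one into \<open>uT\<close>.\<close>
  have summand: "u [^] (N * n) \<otimes> (c i \<otimes> x [^] i) \<in> ?H" if i: "i < n" for i
  proof -
    have "N * n = Suc (M + N * (n - Suc i)) + N * i"
    proof -
      have "n = Suc (n - Suc i) + i" using i by simp
      then have "N * n = N * Suc (n - Suc i) + N * i" by (metis add_mult_distrib2)
      then show ?thesis using M by simp
    qed
    then have "u [^] (N * n) = u \<otimes> u [^] (M + N * (n - Suc i)) \<otimes> u [^] (N * i)"
      using uc by (simp add: nat_pow_mult[symmetric] m_ac)
    then have "u [^] (N * n) \<otimes> (c i \<otimes> x [^] i) =
      u \<otimes> (c i \<otimes> (u [^] (M + N * (n - Suc i)) \<otimes> (u [^] (N * i) \<otimes> x [^] i)))"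
      using uc x Tc[OF c[OF i]] by (simp add: m_ac)
    then have "u [^] (N * n) \<otimes> (c i \<otimes> x [^] i) = u \<otimes> (c i \<otimes> (u [^] (M + N * (n - Suc i)) \<otimes> a [^] i))"
      unfolding pw .
    moreover have "c i \<otimes> (u [^] (M + N * (n - Suc i)) \<otimes> a [^] i) \<in> T"
      using subringE(6)[OF T c[OF i] subringE(6)[OF T subring_pow[OF T u(1)] subring_pow[OF T aT]]] .
    ultimately show ?thesis by blast
  qed
  have cx: "(\<lambda>i. c i \<otimes> x [^] i) \<in> {..<n} \<rightarrow> carrier R" using c Tc x by auto
  define S where "S = (\<Oplus>i\<in>{..<n}. c i \<otimes> x [^] i)"
  have Sc: "S \<in> carrier R" unfolding S_def by (rule finsum_closed[OF cx])
  have "u [^] (N * n) \<otimes> S = (\<Oplus>i\<in>{..<n}. u [^] (N * n) \<otimes> (c i \<otimes> x [^] i))"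
    unfolding S_def by (rule finsum_rdistr) (use uc cx in auto)
  also have "\<dots> \<in> ?H" by (rule finsum_mem[OF smod_subset[OF H empty_subsetI]]) (use summand in auto)
  finally have SH: "u [^] (N * n) \<otimes> S \<in> ?H" .
  have "x [^] n = \<ominus> S" using eq Sc x unfolding S_def[symmetric]
    by (simp add: minus_equality[symmetric] a_comm)
  then have "a [^] n = \<ominus> (u [^] (N * n) \<otimes> S)" unfolding pw[symmetric] using uc Sc by (simp add: r_minus)
  then have "a [^] n \<in> ?H" using smod_minus(1)[OF H T SH] by simp
  then show False using aH reduced_power[OF T H HT red aT _ n0] by blast
qed

end

text \<open>The dimension hypothesis enters through \<open>rad\<close> and \<open>nzd_div\<close>.
  The latter makes powers of \<open>m\<close> universal denominators and puts one into each regular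
  ideal. Both the given ring and its quotient by \<open>J\<close> are instances.\<close>

locale local_one_dim = cring R for R (structure) +
  fixes m
  assumes m_nonunit: "m \<in> nonunits R (carrier R)" and m_nzd: "m \<in> nzd R"
    and local: "\<And>a b. a \<in> nonunits R (carrier R) \<Longrightarrow> b \<in> nonunits R (carrier R) \<Longrightarrow>
        a \<oplus> b \<in> nonunits R (carrier R)"
    and rad: "\<And>a. a \<in> nonunits R (carrier R) \<Longrightarrow> \<exists>k::nat. \<exists>b\<in>carrier R. a [^] k = m \<otimes> b"
    and nzd_div: "\<And>b. b \<in> nzd R \<Longrightarrow> \<exists>k::nat. \<exists>c\<in>carrier R. m [^] k = b \<otimes> c"
begin

abbreviation "Q \<equiv> Qring R"
abbreviation "\<iota> \<equiv> qemb R"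
abbreviation "R0 \<equiv> qemb R ` carrier R"

lemma mc [simp]: "m \<in> carrier R" using m_nonunit by (simp add: nonunits_def)

sublocale Q: cring Q by (rule Qring_cring)
sublocale i: ring_hom_cring R Q \<iota> by unfold_locales (rule qemb_hom)

lemma R0_subring: "subring R0 Q"
proof (rule ring.subringI[OF Q.ring_axioms])
  show "R0 \<subseteq> carrier Q" by auto
  show "\<one>\<^bsub>Q\<^esub> \<in> R0" using i.hom_one by (metis image_eqI one_closed)
  show "\<ominus>\<^bsub>Q\<^esub> h \<in> R0" if "h \<in> R0" for h
    using that i.hom_a_inv by (auto intro!: image_eqI[of _ _ "\<ominus> x" for x])
  show "a \<otimes>\<^bsub>Q\<^esub> b \<in> R0" "a \<oplus>\<^bsub>Q\<^esub> b \<in> R0" if "a \<in> R0" "b \<in> R0" for a b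
  proof -
    obtain r s where rs: "r \<in> carrier R" "s \<in> carrier R" "a = \<iota> r" "b = \<iota> s" using \<open>a \<in> R0\<close> \<open>b \<in> R0\<close> by blast
    then have "a \<otimes>\<^bsub>Q\<^esub> b = \<iota> (r \<otimes> s)" "a \<oplus>\<^bsub>Q\<^esub> b = \<iota> (r \<oplus> s)" by simp_all
    then show "a \<otimes>\<^bsub>Q\<^esub> b \<in> R0" "a \<oplus>\<^bsub>Q\<^esub> b \<in> R0" using rs by blast+
  qed
qed

lemma R0_mult: "a \<in> R0 \<Longrightarrow> b \<in> R0 \<Longrightarrow> a \<otimes>\<^bsub>Q\<^esub> b \<in> R0" using subringE(6)[OF R0_subring] .

lemma nonunits_R0: "nonunits Q R0 = \<iota> ` nonunits R (carrier R)"
proof -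
  have u: "\<iota> a \<otimes>\<^bsub>Q\<^esub> \<iota> b = \<one>\<^bsub>Q\<^esub> \<longleftrightarrow> a \<otimes> b = \<one>" if "a \<in> carrier R" "b \<in> carrier R" for a b
    using that qemb_inj[of "a \<otimes> b" \<one>] by simp
  show ?thesis
  proof
    show "nonunits Q R0 \<subseteq> \<iota> ` nonunits R (carrier R)"
    proof
      fix q assume q: "q \<in> nonunits Q R0"
      then obtain a where a: "a \<in> carrier R" "q = \<iota> a" by (auto simp: nonunits_def)
      have "a \<otimes> s \<noteq> \<one>" if "s \<in> carrier R" for s using q a u[OF a(1) that] that by (auto simp: nonunits_def)
      then show "q \<in> \<iota> ` nonunits R (carrier R)" using a by (auto simp: nonunits_def)
    qed
    show "\<iota> ` nonunits R (carrier R) \<subseteq> nonunits Q R0" using u by (auto simp: nonunits_def)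
  qed
qed

lemma m_denominator:
  assumes q: "q \<in> carrier Q"
  shows "\<exists>k::nat. \<iota> m [^]\<^bsub>Q\<^esub> k \<otimes>\<^bsub>Q\<^esub> q \<in> R0"
proof -
  obtain a s where h: "a \<in> carrier R" "s \<in> nzd R" "\<iota> s \<otimes>\<^bsub>Q\<^esub> q = \<iota> a" by (rule qemb_denominator[OF q])
  obtain k :: nat and c where k: "c \<in> carrier R" "m [^] k = s \<otimes> c" using nzd_div[OF h(2)] by blast
  have "\<iota> m [^]\<^bsub>Q\<^esub> k = \<iota> s \<otimes>\<^bsub>Q\<^esub> \<iota> c" using k nzdD(1)[OF h(2)] by (simp add: i.hom_pow[symmetric])
  then have "\<iota> m [^]\<^bsub>Q\<^esub> k \<otimes>\<^bsub>Q\<^esub> q = \<iota> c \<otimes>\<^bsub>Q\<^esub> (\<iota> s \<otimes>\<^bsub>Q\<^esub> q)"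
    using k(1) nzdD(1)[OF h(2)] q by (simp add: Q.m_ac)
  also have "\<dots> \<in> R0" unfolding h(3) using R0_mult h(1) k(1) by blast
  finally show ?thesis by blast
qed

lemma m_pow_inverse:
  obtains w where "w \<in> carrier Q" "\<iota> m [^]\<^bsub>Q\<^esub> (k::nat) \<otimes>\<^bsub>Q\<^esub> w = \<one>\<^bsub>Q\<^esub>"
  using qemb_inverse[OF nzd_pow[OF m_nzd, of k]] by auto

lemma regular_ideal_pow:
  assumes "regular_ideal R I"
  obtains k :: nat where "m [^] k \<in> I"
proof -
  obtain b where b: "b \<in> I" "b \<in> nzd R" and I: "ideal I R" using assms by (auto simp: regular_ideal_def)
  obtain k :: nat and c where "c \<in> carrier R" "m [^] k = b \<otimes> c" using nzd_div b by blast
  then show ?thesis using that ideal.I_r_closed[OF I b(1)] by metis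
qed

text \<open>A dual basis in disguise: the coordinates of the section \<open>s\<close> are linear
  maps from \<open>I\<close> to \<open>E(I)\<close>, and such a map is multiplication by the
  fraction \<open>s(y)(x)/y\<close>, where \<open>y = m^k\<close>. It carries \<open>I\<close> into
  \<open>E(I)\<close> because \<open>z s(y)(x) = y s(z)(x)\<close>, and expanding \<open>y\<close>
  and dividing by it writes 1 as a sum of the required products.\<close>

lemma projective_invertible:
  assumes I: "smod Q R0 I" "I \<subseteq> R0" and k: "\<iota> m [^]\<^bsub>Q\<^esub> (k::nat) \<in> I"
    and st: "stable_frac Q I"
  shows "invertible_frac Q I"
  unfolding invertible_frac_def
proof (intro allI impI)
  fix N assume N: "smod Q {} N" and qN: "\<forall>x\<in>I. \<forall>q\<in>carrier Q. (\<forall>y\<in>I. q \<otimes>\<^bsub>Q\<^esub> y \<in> endo_ring Q I) \<longrightarrow> q \<otimes>\<^bsub>Q\<^esub> x \<in> N"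
  let ?E = "endo_ring Q I" and ?y = "\<iota> m [^]\<^bsub>Q\<^esub> k"
  note Ic = smodD(1)[OF I(1)]
  have RE: "R0 \<subseteq> ?E" by (rule Q.endo_subring(2)[OF R0_subring I(1)])
  obtain s where s: "(\<forall>y\<in>I. (\<forall>x\<in>I. s y x \<in> ?E) \<and> finite {x\<in>I. s y x \<noteq> \<zero>\<^bsub>Q\<^esub>}) \<and>
        (\<forall>y\<in>I. \<forall>z\<in>I. \<forall>x\<in>I. s (y \<oplus>\<^bsub>Q\<^esub> z) x = s y x \<oplus>\<^bsub>Q\<^esub> s z x) \<and>
        (\<forall>e\<in>?E. \<forall>y\<in>I. \<forall>x\<in>I. s (e \<otimes>\<^bsub>Q\<^esub> y) x = e \<otimes>\<^bsub>Q\<^esub> s y x) \<and>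
        (\<forall>y\<in>I. y = (\<Oplus>\<^bsub>Q\<^esub> x\<in>{x\<in>I. s y x \<noteq> \<zero>\<^bsub>Q\<^esub>}. s y x \<otimes>\<^bsub>Q\<^esub> x))"
    using st unfolding stable_frac_def projective_over_def by (rule exE)
  note s1 = s[THEN conjunct1, rule_format, THEN conjunct1, rule_format]
  note s2 = s[THEN conjunct1, rule_format, THEN conjunct2]
  note s3 = s[THEN conjunct2, THEN conjunct2, THEN conjunct1, rule_format]
  note s4 = s[THEN conjunct2, THEN conjunct2, THEN conjunct2, rule_format]
  obtain w where w: "w \<in> carrier Q" "?y \<otimes>\<^bsub>Q\<^esub> w = \<one>\<^bsub>Q\<^esub>" by (rule m_pow_inverse)
  have yc: "?y \<in> carrier Q" by simp
  let ?X = "{x \<in> I. s ?y x \<noteq> \<zero>\<^bsub>Q\<^esub>}"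
  have sc: "s ?y x \<in> carrier Q" if "x \<in> I" for x using s1[OF k that] endo_ringD(1) by metis
  have qE: "(w \<otimes>\<^bsub>Q\<^esub> s ?y x) \<otimes>\<^bsub>Q\<^esub> z \<in> ?E" if x: "x \<in> I" and z: "z \<in> I" for x z
  proof -
    \<comment> \<open>Elements of \<open>I\<close> may be moved through \<open>s\<close> as scalars
      since they lie in \<open>R0\<close>, hence in \<open>E(I)\<close>.\<close>
    have "s (z \<otimes>\<^bsub>Q\<^esub> ?y) x = z \<otimes>\<^bsub>Q\<^esub> s ?y x" using s3[OF _ k x] z I(2) RE by blast
    moreover have "s (?y \<otimes>\<^bsub>Q\<^esub> z) x = ?y \<otimes>\<^bsub>Q\<^esub> s z x" using s3[OF _ z x] k I(2) RE by blast
    ultimately have e: "z \<otimes>\<^bsub>Q\<^esub> s ?y x = ?y \<otimes>\<^bsub>Q\<^esub> s z x" using Q.m_comm[OF yc Ic[OF z]] by simp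
    have szc: "s z x \<in> carrier Q" using s1[OF z x] endo_ringD(1) by metis
    have "(w \<otimes>\<^bsub>Q\<^esub> s ?y x) \<otimes>\<^bsub>Q\<^esub> z = w \<otimes>\<^bsub>Q\<^esub> (z \<otimes>\<^bsub>Q\<^esub> s ?y x)" using w(1) sc[OF x] Ic[OF z] by (simp add: Q.m_ac)
    also have "\<dots> = (?y \<otimes>\<^bsub>Q\<^esub> w) \<otimes>\<^bsub>Q\<^esub> s z x" unfolding e using w(1) szc yc by (simp add: Q.m_ac)
    also have "\<dots> = s z x" unfolding w(2) using szc by simp
    finally show ?thesis using s1[OF z x] by simp
  qed
  have mem: "w \<otimes>\<^bsub>Q\<^esub> (s ?y x \<otimes>\<^bsub>Q\<^esub> x) \<in> N" if x: "x \<in> ?X" for x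
  proof -
    have xI: "x \<in> I" using x by blast
    have "(w \<otimes>\<^bsub>Q\<^esub> s ?y x) \<otimes>\<^bsub>Q\<^esub> x \<in> N" using qN xI qE[OF xI] w(1) sc[OF xI] by simp
    then show ?thesis using w(1) sc[OF xI] Ic[OF xI] by (simp add: Q.m_assoc)
  qed
  have "\<one>\<^bsub>Q\<^esub> = w \<otimes>\<^bsub>Q\<^esub> ?y" using w Q.m_comm[OF yc w(1)] by simp
  also have "\<dots> = w \<otimes>\<^bsub>Q\<^esub> (\<Oplus>\<^bsub>Q\<^esub> x\<in>?X. s ?y x \<otimes>\<^bsub>Q\<^esub> x)" using s4[OF k] by (rule arg_cong)
  also have "\<dots> = (\<Oplus>\<^bsub>Q\<^esub> x\<in>?X. w \<otimes>\<^bsub>Q\<^esub> (s ?y x \<otimes>\<^bsub>Q\<^esub> x))"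
    by (rule Q.finsum_rdistr) (use s2[OF k] w(1) sc Ic in auto)
  also have "\<dots> \<in> N" by (rule Q.finsum_mem[OF N mem])
  finally show "\<one>\<^bsub>Q\<^esub> \<in> N" .
qed

text \<open>\<open>stable_ring\<close> speaks of ideals of \<open>R\<close> only. Multiplying
  \<open>W\<close> by the unit \<open>m^b\<close> of \<open>Q\<close> gives such an ideal with the
  same endomorphism ring, and invertibility is unaffected by the scaling.\<close>

lemma invertible_if_stable:
  assumes st: "stable_ring R" and W: "smod Q R0 W" "\<iota> m [^]\<^bsub>Q\<^esub> (a::nat) \<in> W"
    and b: "\<And>w. w \<in> W \<Longrightarrow> \<iota> m [^]\<^bsub>Q\<^esub> (b::nat) \<otimes>\<^bsub>Q\<^esub> w \<in> R0"
  shows "invertible_frac Q W"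
proof -
  let ?u = "\<iota> m [^]\<^bsub>Q\<^esub> b"
  have uc: "?u \<in> carrier Q" by simp
  note Wc = smodD(1)[OF W(1)]
  obtain v where v: "v \<in> carrier Q" "?u \<otimes>\<^bsub>Q\<^esub> v = \<one>\<^bsub>Q\<^esub>" by (rule m_pow_inverse)
  have cancel: "v \<otimes>\<^bsub>Q\<^esub> (?u \<otimes>\<^bsub>Q\<^esub> z) = z" if "z \<in> carrier Q" for z
  proof -
    have "v \<otimes>\<^bsub>Q\<^esub> (?u \<otimes>\<^bsub>Q\<^esub> z) = (?u \<otimes>\<^bsub>Q\<^esub> v) \<otimes>\<^bsub>Q\<^esub> z" using that v(1) uc by (simp add: Q.m_ac)
    then show ?thesis using v that by simp
  qed
  define I where "I = (\<lambda>w. ?u \<otimes>\<^bsub>Q\<^esub> w) ` W"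
  have IR: "I \<subseteq> R0" using b by (auto simp: I_def)
  have Ismod: "smod Q R0 I" unfolding smod_def
  proof (intro conjI ballI)
    show "I \<subseteq> carrier Q" using uc Wc by (auto simp: I_def)
    have "\<zero>\<^bsub>Q\<^esub> = ?u \<otimes>\<^bsub>Q\<^esub> \<zero>\<^bsub>Q\<^esub>" using uc by simp
    then show "\<zero>\<^bsub>Q\<^esub> \<in> I" unfolding I_def using smodD(2)[OF W(1)] by blast
    fix x y assume "x \<in> I" "y \<in> I"
    then obtain s t where "s \<in> W" "t \<in> W" "x = ?u \<otimes>\<^bsub>Q\<^esub> s" "y = ?u \<otimes>\<^bsub>Q\<^esub> t" unfolding I_def by blast
    moreover from this have "x \<oplus>\<^bsub>Q\<^esub> y = ?u \<otimes>\<^bsub>Q\<^esub> (s \<oplus>\<^bsub>Q\<^esub> t)" using uc Wc by (simp add: Q.r_distr)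
    ultimately show "x \<oplus>\<^bsub>Q\<^esub> y \<in> I" unfolding I_def using smodD(3)[OF W(1)] by blast
  next
    fix t x assume "t \<in> R0" "x \<in> I"
    then obtain s where st: "t \<in> R0" "t \<in> carrier Q" "s \<in> W" "x = ?u \<otimes>\<^bsub>Q\<^esub> s" unfolding I_def by auto
    then have "t \<otimes>\<^bsub>Q\<^esub> x = ?u \<otimes>\<^bsub>Q\<^esub> (t \<otimes>\<^bsub>Q\<^esub> s)" using uc Wc by (simp add: Q.m_lcomm)
    then show "t \<otimes>\<^bsub>Q\<^esub> x \<in> I" unfolding I_def using smodD(4)[OF W(1) st(1,3)] by blast
  qed
  have Ipow: "\<iota> m [^]\<^bsub>Q\<^esub> (b + a) \<in> I"
    unfolding I_def using W(2) by (auto simp: Q.nat_pow_mult[symmetric])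
  define J where "J = {r \<in> carrier R. \<iota> r \<in> I}"
  have IJ: "\<iota> ` J = I" using IR by (auto simp: J_def)
  have z: "\<iota> \<zero> \<in> I" using smodD(2)[OF Ismod] by simp
  have "ideal J R"
  proof (rule idealI[OF ring_axioms])
    show "subgroup J (add_monoid R)"
    proof (rule add.subgroupI)
      show "J \<subseteq> carrier R" "J \<noteq> {}" using z by (auto simp: J_def)
      show "\<ominus> a \<in> J" if "a \<in> J" for a
        using that Q.smod_minus(1)[OF Ismod R0_subring] by (simp add: J_def)
      show "a \<oplus> b \<in> J" if "a \<in> J" "b \<in> J" for a b using that smodD(3)[OF Ismod] by (simp add: J_def)
    qed
    show "x \<otimes> a \<in> J" "a \<otimes> x \<in> J" if "a \<in> J" "x \<in> carrier R" for a x
    proof -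
      have "\<iota> x \<otimes>\<^bsub>Q\<^esub> \<iota> a \<in> I" using smodD(4)[OF Ismod] that by (simp add: J_def)
      then have "\<iota> (x \<otimes> a) \<in> I" using that by (simp add: J_def)
      then show "x \<otimes> a \<in> J" "a \<otimes> x \<in> J" using that m_comm[of a x] by (auto simp: J_def)
    qed
  qed
  moreover have "m [^] (b + a) \<in> J" using Ipow by (simp add: J_def)
  ultimately have "regular_ideal R J" unfolding regular_ideal_def using nzd_pow[OF m_nzd] by blast
  then have sf: "stable_frac Q I" using st IJ by (auto simp: stable_ring_def)
  have inv: "invertible_frac Q I" by (rule projective_invertible[OF Ismod IR Ipow sf])
  have EI: "endo_ring Q I = endo_ring Q W"
  proof -
    have "q \<otimes>\<^bsub>Q\<^esub> (?u \<otimes>\<^bsub>Q\<^esub> w) \<in> I \<longleftrightarrow> q \<otimes>\<^bsub>Q\<^esub> w \<in> W" if q: "q \<in> carrier Q" and w: "w \<in> W" for q w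
    proof -
      have e: "q \<otimes>\<^bsub>Q\<^esub> (?u \<otimes>\<^bsub>Q\<^esub> w) = ?u \<otimes>\<^bsub>Q\<^esub> (q \<otimes>\<^bsub>Q\<^esub> w)" using q uc Wc[OF w] by (simp add: Q.m_lcomm)
      show ?thesis unfolding e I_def
      proof
        assume "?u \<otimes>\<^bsub>Q\<^esub> (q \<otimes>\<^bsub>Q\<^esub> w) \<in> (\<lambda>w. ?u \<otimes>\<^bsub>Q\<^esub> w) ` W"
        then obtain z where z: "z \<in> W" "?u \<otimes>\<^bsub>Q\<^esub> (q \<otimes>\<^bsub>Q\<^esub> w) = ?u \<otimes>\<^bsub>Q\<^esub> z" by blast
        have "q \<otimes>\<^bsub>Q\<^esub> w = v \<otimes>\<^bsub>Q\<^esub> (?u \<otimes>\<^bsub>Q\<^esub> (q \<otimes>\<^bsub>Q\<^esub> w))" using cancel q Wc[OF w] by simp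
        also have "\<dots> = z" unfolding z(2) by (rule cancel[OF Wc[OF z(1)]])
        finally show "q \<otimes>\<^bsub>Q\<^esub> w \<in> W" using z(1) by simp
      qed (rule imageI)
    qed
    then show ?thesis by (auto simp: endo_ring_def I_def)
  qed
  show ?thesis unfolding invertible_frac_def
  proof (intro allI impI)
    fix N assume N: "smod Q {} N" and qN: "\<forall>x\<in>W. \<forall>q\<in>carrier Q. (\<forall>y\<in>W. q \<otimes>\<^bsub>Q\<^esub> y \<in> endo_ring Q W) \<longrightarrow> q \<otimes>\<^bsub>Q\<^esub> x \<in> N"
    have "q \<otimes>\<^bsub>Q\<^esub> x \<in> N" if x: "x \<in> I" and q: "q \<in> carrier Q" "\<forall>y\<in>I. q \<otimes>\<^bsub>Q\<^esub> y \<in> endo_ring Q I" for x q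
    proof -
      obtain w where w: "w \<in> W" "x = ?u \<otimes>\<^bsub>Q\<^esub> w" using x by (auto simp: I_def)
      have "(q \<otimes>\<^bsub>Q\<^esub> ?u) \<otimes>\<^bsub>Q\<^esub> y \<in> endo_ring Q W" if y: "y \<in> W" for y
      proof -
        have "q \<otimes>\<^bsub>Q\<^esub> (?u \<otimes>\<^bsub>Q\<^esub> y) \<in> endo_ring Q I" using q(2) y by (simp add: I_def)
        then show ?thesis unfolding EI using q(1) uc Wc[OF y] by (simp add: Q.m_assoc)
      qed
      then have "(q \<otimes>\<^bsub>Q\<^esub> ?u) \<otimes>\<^bsub>Q\<^esub> w \<in> N" using qN w(1) q(1) uc by blast
      then show ?thesis using w q(1) uc Wc by (simp add: Q.m_assoc)
    qed
    then show "\<one>\<^bsub>Q\<^esub> \<in> N" using inv N unfolding invertible_frac_def by blast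
  qed
qed

lemma fraction_setting_if_stable:
  assumes "stable_ring R"
  shows "fraction_setting Q R0 (\<iota> m)"
proof (intro fraction_setting.intro fraction_setting_axioms.intro Q.cring_axioms)
  show "subring R0 Q" by (rule R0_subring)
  show "\<iota> m \<in> nonunits Q R0" unfolding nonunits_R0 using m_nonunit by blast
  show "\<exists>w\<in>carrier Q. \<iota> m \<otimes>\<^bsub>Q\<^esub> w = \<one>\<^bsub>Q\<^esub>" by (rule qemb_inverse[OF m_nzd])
  show "\<exists>n::nat. \<iota> m [^]\<^bsub>Q\<^esub> n \<otimes>\<^bsub>Q\<^esub> q \<in> R0" if "q \<in> carrier Q" for q by (rule m_denominator[OF that])
  have nc: "a \<in> nonunits R (carrier R) \<Longrightarrow> a \<in> carrier R" for a by (simp add: nonunits_def)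
  show "a \<oplus>\<^bsub>Q\<^esub> b \<in> nonunits Q R0" if ab: "a \<in> nonunits Q R0" "b \<in> nonunits Q R0" for a b
  proof -
    obtain r s where rs: "r \<in> nonunits R (carrier R)" "s \<in> nonunits R (carrier R)" "a = \<iota> r" "b = \<iota> s"
      using ab unfolding nonunits_R0 by blast
    then have "a \<oplus>\<^bsub>Q\<^esub> b = \<iota> (r \<oplus> s)" using nc by simp
    then show ?thesis unfolding nonunits_R0 using local[OF rs(1,2)] by blast
  qed
  show "\<exists>k::nat. \<exists>b\<in>R0. a [^]\<^bsub>Q\<^esub> k = \<iota> m \<otimes>\<^bsub>Q\<^esub> b" if a: "a \<in> nonunits Q R0" for a
  proof -
    obtain r where r: "r \<in> nonunits R (carrier R)" "a = \<iota> r" using a unfolding nonunits_R0 by blast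
    obtain k :: nat and b where b: "b \<in> carrier R" "r [^] k = m \<otimes> b" using rad[OF r(1)] by blast
    have "a [^]\<^bsub>Q\<^esub> k = \<iota> (r [^] k)" unfolding r(2) using nc[OF r(1)] by simp
    also have "\<dots> = \<iota> m \<otimes>\<^bsub>Q\<^esub> \<iota> b" unfolding b(2) using b(1) by simp
    finally show ?thesis using b(1) by blast
  qed
  show "invertible_frac Q W" if "smod Q R0 W" "\<iota> m [^]\<^bsub>Q\<^esub> a \<in> W" "\<And>w. w \<in> W \<Longrightarrow> \<iota> m [^]\<^bsub>Q\<^esub> b \<otimes>\<^bsub>Q\<^esub> w \<in> R0"
    for W and a b :: nat
    by (rule invertible_if_stable[OF assms that])
qed

end

section \<open>Finite integral closure and a criterion for stability\<close>

context local_one_dim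
begin

lemma quadratic_integral:
  assumes x: "x \<in> carrier Q" and ab: "a \<in> carrier R" "b \<in> carrier R"
    and eq: "x \<otimes>\<^bsub>Q\<^esub> x = \<iota> a \<oplus>\<^bsub>Q\<^esub> \<iota> b \<otimes>\<^bsub>Q\<^esub> x"
  shows "integral_over R x"
proof -
  define c where "c = (\<lambda>i::nat. if i = 0 then \<ominus> a else \<ominus> b)"
  have cc: "\<forall>i<2. c i \<in> carrier R" using ab by (simp add: c_def)
  have "{..<2} = {0, 1::nat}" by auto
  then have "(\<Oplus>\<^bsub>Q\<^esub> i\<in>{..<2}. \<iota> (c i) \<otimes>\<^bsub>Q\<^esub> x [^]\<^bsub>Q\<^esub> i) = \<iota> (c 0) \<otimes>\<^bsub>Q\<^esub> x [^]\<^bsub>Q\<^esub> (0::nat) \<oplus>\<^bsub>Q\<^esub> \<iota> (c 1) \<otimes>\<^bsub>Q\<^esub> x [^]\<^bsub>Q\<^esub> (1::nat)"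
    using x ab by (simp add: c_def)
  also have "\<dots> = \<ominus>\<^bsub>Q\<^esub> (\<iota> a \<oplus>\<^bsub>Q\<^esub> \<iota> b \<otimes>\<^bsub>Q\<^esub> x)"
    using x ab by (simp add: c_def Q.l_minus Q.minus_add)
  finally have "x [^]\<^bsub>Q\<^esub> (2::nat) \<oplus>\<^bsub>Q\<^esub> (\<Oplus>\<^bsub>Q\<^esub> i\<in>{..<2}. \<iota> (c i) \<otimes>\<^bsub>Q\<^esub> x [^]\<^bsub>Q\<^esub> i) = \<zero>\<^bsub>Q\<^esub>"
    using x ab eq by (simp add: numeral_2_eq_2 Q.r_neg)
  then show ?thesis unfolding integral_over_def using x cc by blast
qed

text \<open>\<open>integrally_closed\<close> puts the integral closure inside
  \<open>T = R + Rz\<close>, and 1 and \<open>z\<close> are themselves integral because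
  \<open>zz\<close> lies in \<open>R + Rz\<close>; so they generate it.\<close>

lemma finite_if_normal_simple:
  assumes fs: "fraction_setting Q R0 (\<iota> m)" and T: "fraction_setting.normal_simple Q R0 T"
  shows "finite_int_closure R"
proof -
  interpret F: fraction_setting Q R0 "\<iota> m" by (rule fs)
  note T' = T[unfolded F.normal_simple_def]
  have sub: "subring T Q" "R0 \<subseteq> T" using T'[THEN conjunct1] T'[THEN conjunct2, THEN conjunct1] .
  obtain z where zT: "z \<in> T" and zz: "\<forall>t\<in>T. \<exists>p\<in>R0. \<exists>q\<in>R0. t = p \<oplus>\<^bsub>Q\<^esub> q \<otimes>\<^bsub>Q\<^esub> z"
    using T'[THEN conjunct2, THEN conjunct2, THEN conjunct1] by (rule bexE) (rule that)
  note z = zT zz[rule_format]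
  obtain u where uT: "u \<in> T" and uu: "(\<exists>w\<in>carrier Q. u \<otimes>\<^bsub>Q\<^esub> w = \<one>\<^bsub>Q\<^esub>) \<and> (\<forall>q\<in>carrier Q. \<exists>N::nat. u [^]\<^bsub>Q\<^esub> N \<otimes>\<^bsub>Q\<^esub> q \<in> T) \<and>
    (\<forall>a\<in>T. a \<otimes>\<^bsub>Q\<^esub> a \<in> (\<lambda>t. u \<otimes>\<^bsub>Q\<^esub> t) ` T \<longrightarrow> a \<in> (\<lambda>t. u \<otimes>\<^bsub>Q\<^esub> t) ` T)"
    using T'[THEN conjunct2, THEN conjunct2, THEN conjunct2] by (rule bexE) (rule that)
  note u = uT uu[THEN conjunct1] uu[THEN conjunct2, THEN conjunct1, rule_format]
    uu[THEN conjunct2, THEN conjunct2, rule_format]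
  have zc: "z \<in> carrier Q" using z(1) subringE(1)[OF sub(1)] by blast
  have intT: "x \<in> T" if x: "x \<in> int_closure R" for x
  proof -
    obtain n :: nat and c where xc: "x \<in> carrier Q" and c: "\<And>i. i < n \<Longrightarrow> c i \<in> carrier R"
      and eq: "x [^]\<^bsub>Q\<^esub> n \<oplus>\<^bsub>Q\<^esub> (\<Oplus>\<^bsub>Q\<^esub> i\<in>{..<n}. \<iota> (c i) \<otimes>\<^bsub>Q\<^esub> x [^]\<^bsub>Q\<^esub> i) = \<zero>\<^bsub>Q\<^esub>"
      using x unfolding int_closure_def integral_over_def by blast
    have cT: "\<And>i. i < n \<Longrightarrow> \<iota> (c i) \<in> T" using c sub(2) by blast
    show ?thesis by (rule Q.integrally_closed[OF sub(1) u xc cT eq])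
  qed
  have int: "integral_over R y" if y: "y \<in> T" "y = \<one>\<^bsub>Q\<^esub> \<or> y = z" for y
    using y(2)
  proof
    assume "y = \<one>\<^bsub>Q\<^esub>"
    then show ?thesis using quadratic_integral[of y \<zero> \<one>] by simp
  next
    assume yz: "y = z"
    obtain p q where pq: "p \<in> R0" "q \<in> R0" "z \<otimes>\<^bsub>Q\<^esub> z = p \<oplus>\<^bsub>Q\<^esub> q \<otimes>\<^bsub>Q\<^esub> z"
      using z(2)[OF subringE(6)[OF sub(1) z(1,1)]] by blast
    then show ?thesis using quadratic_integral[OF zc] yz by auto
  qed
  have G: "{\<one>\<^bsub>Q\<^esub>, z} \<subseteq> int_closure R"
    using int z(1) subringE(3)[OF sub(1)] by (simp add: int_closure_def)
  have "\<exists>r\<in>{\<one>\<^bsub>Q\<^esub>, z} \<rightarrow> carrier R. x = (\<Oplus>\<^bsub>Q\<^esub> g\<in>{\<one>\<^bsub>Q\<^esub>, z}. \<iota> (r g) \<otimes>\<^bsub>Q\<^esub> g)" if x: "x \<in> int_closure R" for x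
  proof -
    obtain p q where pq: "p \<in> carrier R" "q \<in> carrier R" "x = \<iota> p \<oplus>\<^bsub>Q\<^esub> \<iota> q \<otimes>\<^bsub>Q\<^esub> z" using z(2)[OF intT[OF x]]
      by blast
    show ?thesis
    proof (cases "z = \<one>\<^bsub>Q\<^esub>")
      \<comment> \<open>Here \<open>{1, z}\<close> has a single element, so the sum has one term and
        the two coefficients are added.\<close>
      case True
      have "(\<Oplus>\<^bsub>Q\<^esub> g\<in>{\<one>\<^bsub>Q\<^esub>, z}. \<iota> (p \<oplus> q) \<otimes>\<^bsub>Q\<^esub> g) = x" using True pq by simp
      then show ?thesis using pq by (intro bexI[of _ "\<lambda>_. p \<oplus> q"]) auto
    next
      case False
      have "(\<Oplus>\<^bsub>Q\<^esub> g\<in>{\<one>\<^bsub>Q\<^esub>, z}. \<iota> (if g = z then q else p) \<otimes>\<^bsub>Q\<^esub> g) = x" using False pq zc by auto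
      then show ?thesis using pq by (intro bexI[of _ "\<lambda>g. if g = z then q else p"]) auto
    qed
  qed
  then show ?thesis unfolding finite_int_closure_def using G by (intro exI[of _ "{\<one>\<^bsub>Q\<^esub>, z}"]) blast
qed

text \<open>Finitely many generators have a common denominator \<open>m^k\<close>. The statement
  serves in contraposition, against the integral elements obtained from
  \<open>quadratic_approximants\<close>.\<close>

lemma bounded_if_finite:
  assumes "finite_int_closure R"
  obtains k :: nat where "\<And>q. integral_over R q \<Longrightarrow> \<iota> m [^]\<^bsub>Q\<^esub> k \<otimes>\<^bsub>Q\<^esub> q \<in> R0"
proof -
  obtain G where G: "finite G" "G \<subseteq> int_closure R"
     "\<And>x. x \<in> int_closure R \<Longrightarrow> \<exists>r\<in>G \<rightarrow> carrier R. x = (\<Oplus>\<^bsub>Q\<^esub> g\<in>G. \<iota> (r g) \<otimes>\<^bsub>Q\<^esub> g)"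
    using assms unfolding finite_int_closure_def by blast
  have Gc: "G \<subseteq> carrier Q" using G(2) by (auto simp: int_closure_def integral_over_def)
  have "\<exists>k::nat. \<forall>g\<in>G. \<iota> m [^]\<^bsub>Q\<^esub> k \<otimes>\<^bsub>Q\<^esub> g \<in> R0" using G(1) Gc
  proof (induction G rule: finite_induct)
    case empty then show ?case by simp
  next
    case (insert g G)
    obtain k :: nat where k: "\<And>h. h \<in> G \<Longrightarrow> \<iota> m [^]\<^bsub>Q\<^esub> k \<otimes>\<^bsub>Q\<^esub> h \<in> R0" using insert by blast
    have gc: "g \<in> carrier Q" using insert.prems by simp
    obtain l :: nat where l: "\<iota> m [^]\<^bsub>Q\<^esub> l \<otimes>\<^bsub>Q\<^esub> g \<in> R0" using m_denominator[OF gc] by blast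
    have mp: "\<iota> m [^]\<^bsub>Q\<^esub> j \<in> R0" for j :: nat by (rule Q.subring_pow[OF R0_subring]) simp
    have "\<iota> m [^]\<^bsub>Q\<^esub> (k + l) \<otimes>\<^bsub>Q\<^esub> h \<in> R0" if h: "h \<in> insert g G" for h
    proof -
      have hc: "h \<in> carrier Q" using h insert by auto
      have "\<iota> m [^]\<^bsub>Q\<^esub> (k + l) \<otimes>\<^bsub>Q\<^esub> h = \<iota> m [^]\<^bsub>Q\<^esub> l \<otimes>\<^bsub>Q\<^esub> (\<iota> m [^]\<^bsub>Q\<^esub> k \<otimes>\<^bsub>Q\<^esub> h)"
        "\<iota> m [^]\<^bsub>Q\<^esub> (k + l) \<otimes>\<^bsub>Q\<^esub> h = \<iota> m [^]\<^bsub>Q\<^esub> k \<otimes>\<^bsub>Q\<^esub> (\<iota> m [^]\<^bsub>Q\<^esub> l \<otimes>\<^bsub>Q\<^esub> h)"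
        using hc by (simp_all add: Q.nat_pow_mult[symmetric] Q.m_ac)
      then show ?thesis using h k l R0_mult mp by (metis insertE)
    qed
    then show ?case by blast
  qed
  then obtain k :: nat where k: "\<And>g. g \<in> G \<Longrightarrow> \<iota> m [^]\<^bsub>Q\<^esub> k \<otimes>\<^bsub>Q\<^esub> g \<in> R0" by blast
  have R0_smod: "smod Q {} R0" unfolding smod_def using subringE(1,2,7)[OF R0_subring] by blast
  have "\<iota> m [^]\<^bsub>Q\<^esub> k \<otimes>\<^bsub>Q\<^esub> q \<in> R0" if q: "integral_over R q" for q
  proof -
    obtain r where r: "r \<in> G \<rightarrow> carrier R" "q = (\<Oplus>\<^bsub>Q\<^esub> g\<in>G. \<iota> (r g) \<otimes>\<^bsub>Q\<^esub> g)"
      using G(3) q by (auto simp: int_closure_def)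
    have rc: "\<And>g. g \<in> G \<Longrightarrow> \<iota> (r g) \<in> carrier Q" "\<And>g. g \<in> G \<Longrightarrow> r g \<in> carrier R" using r(1) by auto
    have "\<iota> m [^]\<^bsub>Q\<^esub> k \<otimes>\<^bsub>Q\<^esub> q = (\<Oplus>\<^bsub>Q\<^esub> g\<in>G. \<iota> m [^]\<^bsub>Q\<^esub> k \<otimes>\<^bsub>Q\<^esub> (\<iota> (r g) \<otimes>\<^bsub>Q\<^esub> g))"
      unfolding r(2) by (rule Q.finsum_rdistr) (use G(1) rc Gc in auto)
    also have "\<dots> \<in> R0"
    proof (rule Q.finsum_mem[OF R0_smod])
      fix g assume g: "g \<in> G"
      have "\<iota> m [^]\<^bsub>Q\<^esub> k \<otimes>\<^bsub>Q\<^esub> (\<iota> (r g) \<otimes>\<^bsub>Q\<^esub> g) = \<iota> (r g) \<otimes>\<^bsub>Q\<^esub> (\<iota> m [^]\<^bsub>Q\<^esub> k \<otimes>\<^bsub>Q\<^esub> g)"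
        using rc[OF g] Gc g by (simp add: Q.m_lcomm subset_iff)
      then show "\<iota> m [^]\<^bsub>Q\<^esub> k \<otimes>\<^bsub>Q\<^esub> (\<iota> (r g) \<otimes>\<^bsub>Q\<^esub> g) \<in> R0"
        using R0_mult k[OF g] rc(2)[OF g] by auto
    qed
    finally show ?thesis .
  qed
  then show ?thesis using that by blast
qed

text \<open>The condition gives \<open>I I = i I\<close>, so division by \<open>i\<close> carries
  \<open>I\<close> into \<open>E(I)\<close> and \<open>I = i E(I)\<close> is free of rank one. The
  section that \<open>projective_over\<close> asks for places the coordinate \<open>y/i\<close> at
  the index \<open>\<iota> i\<close> and zero elsewhere.\<close>

lemma stable_ringI:
  assumes gen: "\<And>I. regular_ideal R I \<Longrightarrow> \<exists>i\<in>I. i \<in> nzd R \<and> (\<forall>a\<in>I. \<forall>b\<in>I. \<exists>c\<in>I. a \<otimes> b = i \<otimes> c)"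
  shows "stable_ring R"
  unfolding stable_ring_def
proof (intro allI impI)
  fix I assume reg: "regular_ideal R I"
  then have Ic: "I \<subseteq> carrier R" by (auto simp: regular_ideal_def ideal.Icarr)
  obtain i where i: "i \<in> I" "i \<in> nzd R" "\<And>a b. a \<in> I \<Longrightarrow> b \<in> I \<Longrightarrow> \<exists>c\<in>I. a \<otimes> b = i \<otimes> c" using gen[OF reg]
    by blast
  obtain w where w: "w \<in> carrier Q" "\<iota> i \<otimes>\<^bsub>Q\<^esub> w = \<one>\<^bsub>Q\<^esub>" using qemb_inverse[OF i(2)] by blast
  have ic: "i \<in> carrier R" "\<iota> i \<in> carrier Q" using i(1) Ic by auto
  let ?I = "\<iota> ` I" and ?E = "endo_ring Q (\<iota> ` I)"
  have IQ: "y \<in> carrier Q" if "y \<in> ?I" for y using that Ic by auto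
  have ne: "\<one>\<^bsub>Q\<^esub> \<noteq> \<zero>\<^bsub>Q\<^esub>"
  proof
    assume "\<one>\<^bsub>Q\<^esub> = \<zero>\<^bsub>Q\<^esub>"
    then have "\<iota> \<one> = \<iota> \<zero>" by simp
    then have one: "\<one> = \<zero>" using qemb_inj by blast
    then have "m \<otimes> \<one> = \<one>" using one_zeroD[OF one] m_closed[OF mc one_closed] by (metis singletonD)
    then show False using m_nonunit by (auto simp: nonunits_def)
  qed
  have wE: "y \<otimes>\<^bsub>Q\<^esub> w \<in> ?E" if y: "y \<in> ?I" for y
  proof -
    have "(y \<otimes>\<^bsub>Q\<^esub> w) \<otimes>\<^bsub>Q\<^esub> z \<in> ?I" if z: "z \<in> ?I" for z
    proof -
      obtain a b where ab: "a \<in> I" "b \<in> I" "y = \<iota> a" "z = \<iota> b" using y z by blast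
      obtain c where c: "c \<in> I" "a \<otimes> b = i \<otimes> c" using i(3) ab by blast
      have abc: "a \<in> carrier R" "b \<in> carrier R" "c \<in> carrier R" using ab c Ic by auto
      have "(y \<otimes>\<^bsub>Q\<^esub> w) \<otimes>\<^bsub>Q\<^esub> z = w \<otimes>\<^bsub>Q\<^esub> \<iota> (a \<otimes> b)" using ab abc w(1) by (simp add: Q.m_ac)
      also have "\<dots> = (\<iota> i \<otimes>\<^bsub>Q\<^esub> w) \<otimes>\<^bsub>Q\<^esub> \<iota> c" unfolding c(2) using abc ic w(1) by (simp add: Q.m_ac)
      also have "\<dots> = \<iota> c" using w abc by simp
      finally show ?thesis using c by simp
    qed
    then show ?thesis using w(1) IQ[OF y] by (simp add: endo_ring_def)
  qed
  define s where "s y x = (if x = \<iota> i then y \<otimes>\<^bsub>Q\<^esub> w else \<zero>\<^bsub>Q\<^esub>)" for y x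
  have iI: "\<iota> i \<in> ?I" using i(1) by blast
  have ws: "(y \<otimes>\<^bsub>Q\<^esub> w) \<otimes>\<^bsub>Q\<^esub> \<iota> i = y" if "y \<in> carrier Q" for y
  proof -
    have "(y \<otimes>\<^bsub>Q\<^esub> w) \<otimes>\<^bsub>Q\<^esub> \<iota> i = y \<otimes>\<^bsub>Q\<^esub> (\<iota> i \<otimes>\<^bsub>Q\<^esub> w)" using that ic w(1) by (simp add: Q.m_ac)
    then show ?thesis using w that by simp
  qed
  have zE: "\<zero>\<^bsub>Q\<^esub> \<in> ?E"
  proof -
    have "\<zero> \<in> I" using reg unfolding regular_ideal_def
      using additive_subgroup.zero_closed[OF ideal.axioms(1)] by blast
    then have "\<zero>\<^bsub>Q\<^esub> \<in> ?I" using i.hom_zero by (metis imageI)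
    then show ?thesis using IQ by (auto simp: endo_ring_def)
  qed
  have sub: "{x \<in> ?I. s y x \<noteq> \<zero>\<^bsub>Q\<^esub>} = (if y \<otimes>\<^bsub>Q\<^esub> w = \<zero>\<^bsub>Q\<^esub> then {} else {\<iota> i})" for y
    using iI by (auto simp: s_def)
  show "stable_frac Q ?I" unfolding stable_frac_def projective_over_def
  proof (intro exI[of _ s] conjI ballI)
    show "s y x \<in> ?E" if "y \<in> ?I" for y x using wE[OF that] zE by (simp add: s_def)
    show "finite {x \<in> ?I. s y x \<noteq> \<zero>\<^bsub>Q\<^esub>}" for y unfolding sub by simp
    show "s (y \<oplus>\<^bsub>Q\<^esub> z) x = s y x \<oplus>\<^bsub>Q\<^esub> s z x" if "y \<in> ?I" "z \<in> ?I" for y z x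
      using IQ[OF that(1)] IQ[OF that(2)] w(1) by (simp add: s_def Q.l_distr)
    show "s (e \<otimes>\<^bsub>Q\<^esub> y) x = e \<otimes>\<^bsub>Q\<^esub> s y x" if "e \<in> ?E" "y \<in> ?I" for e y x
      using endo_ringD(1)[OF that(1)] IQ[OF that(2)] w(1) by (simp add: s_def Q.m_assoc)
    fix y assume y: "y \<in> ?I"
    show "y = (\<Oplus>\<^bsub>Q\<^esub> x\<in>{x \<in> ?I. s y x \<noteq> \<zero>\<^bsub>Q\<^esub>}. s y x \<otimes>\<^bsub>Q\<^esub> x)"
    proof (cases "y \<otimes>\<^bsub>Q\<^esub> w = \<zero>\<^bsub>Q\<^esub>")
      case True
      then have "y = \<zero>\<^bsub>Q\<^esub>" using ws[OF IQ[OF y]] ic by simp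
      then show ?thesis unfolding sub using True by simp
    next
      case False
      then have "(\<Oplus>\<^bsub>Q\<^esub> x\<in>{x \<in> ?I. s y x \<noteq> \<zero>\<^bsub>Q\<^esub>}. s y x \<otimes>\<^bsub>Q\<^esub> x) = s y (\<iota> i) \<otimes>\<^bsub>Q\<^esub> \<iota> i"
        unfolding sub using IQ[OF y] w(1) ic by (simp add: s_def)
      then show ?thesis using ws[OF IQ[OF y]] by (simp add: s_def)
    qed
  qed
qed

end

section \<open>The square-zero prime ideal of the completion\<close>

text \<open>The generator of the maximal ideals in the chain may differ from \<open>m\<close>. Each
  of the two elements divides a power of the other, so they define the same topology and
  \<open>C\<close> is a completion for both. In this lemma \<open>y\<close> is the new element and
  \<open>x\<close> the old one.\<close>

lemma (in adic_hom) change_base: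
  assumes y: "y \<in> carrier R" and b: "b \<in> carrier R" "y [^] (l::nat) = x \<otimes> b"
    and c: "c \<in> carrier R" "x [^] (k::nat) = y \<otimes> c"
  shows "adic_hom R C \<phi> y"
proof -
  have py: "\<phi> (y [^] i) = \<phi> y [^]\<^bsub>C\<^esub> i" for i :: nat using y by simp
  have yl: "y [^] (l * i) = x [^] i \<otimes> b [^] i" for i :: nat
    using y b x by (simp add: R.nat_pow_pow[symmetric] R.nat_pow_distrib)
  have xk: "x [^] (k * i) = y [^] i \<otimes> c [^] i" for i :: nat
    using y c x by (simp add: R.nat_pow_pow[symmetric] R.nat_pow_distrib)
  have yc: "y [^] i \<in> carrier R" "c [^] i \<in> carrier R" "b [^] i \<in> carrier R" for i :: nat using y b c
    by simp_all
  have Xk: "X (k * i) = \<phi> (y [^] i) \<otimes>\<^bsub>C\<^esub> \<phi> (c [^] i)" for i :: nat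
    unfolding phi_pow[symmetric] xk using yc by simp
  show ?thesis
  proof (unfold_locales)
    show "\<phi> \<in> ring_hom R C" "y \<in> carrier R" by (rule hom, rule y)
    fix e and i :: nat assume e: "e \<in> carrier C"
    obtain r d where rd: "r \<in> carrier R" "d \<in> carrier C" "e = \<phi> r \<oplus>\<^bsub>C\<^esub> X (k * i) \<otimes>\<^bsub>C\<^esub> d"
      by (rule dense_le[OF e])
    have "e = \<phi> r \<oplus>\<^bsub>C\<^esub> \<phi> y [^]\<^bsub>C\<^esub> i \<otimes>\<^bsub>C\<^esub> (\<phi> (c [^] i) \<otimes>\<^bsub>C\<^esub> d)"
      unfolding rd(3) Xk py[symmetric] using yc rd(2) by (simp add: C.m_assoc)
    then show "\<exists>r\<in>carrier R. \<exists>d\<in>carrier C. e = \<phi> r \<oplus>\<^bsub>C\<^esub> \<phi> y [^]\<^bsub>C\<^esub> i \<otimes>\<^bsub>C\<^esub> d"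
      using rd(1,2) yc C.m_closed hom_closed by blast
  next
    fix r d and i :: nat assume r: "r \<in> carrier R" and d: "d \<in> carrier C" and eq: "\<phi> r = \<phi> y [^]\<^bsub>C\<^esub> i \<otimes>\<^bsub>C\<^esub> d"
    obtain s e where s: "s \<in> carrier R" "e \<in> carrier C" "d = \<phi> s \<oplus>\<^bsub>C\<^esub> X (k * i) \<otimes>\<^bsub>C\<^esub> e" by (rule dense_le[OF d])
    have ca: "\<phi> (y [^] i) \<in> carrier C" "\<phi> s \<in> carrier C" "X (k * i) \<in> carrier C" using yc s(1) X_closed
      by simp_all
    have "\<phi> (r \<ominus> y [^] i \<otimes> s) = \<phi> r \<ominus>\<^bsub>C\<^esub> \<phi> (y [^] i) \<otimes>\<^bsub>C\<^esub> \<phi> s" using r s(1) yc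
      by (simp add: R.minus_eq C.minus_eq)
    also have "\<dots> = X (k * i) \<otimes>\<^bsub>C\<^esub> (\<phi> (y [^] i) \<otimes>\<^bsub>C\<^esub> e)"
      unfolding eq py[symmetric] s(3) using ca s(2) by algebra
    finally obtain t where t: "t \<in> carrier R" "r \<ominus> y [^] i \<otimes> s = x [^] (k * i) \<otimes> t"
      using exact[of "r \<ominus> y [^] i \<otimes> s" "\<phi> (y [^] i) \<otimes>\<^bsub>C\<^esub> e" "k * i"] r s ca yc by auto
    have "r = y [^] i \<otimes> s \<oplus> (r \<ominus> y [^] i \<otimes> s)" using r s(1) yc(1) by algebra
    also have "\<dots> = y [^] i \<otimes> (s \<oplus> c [^] i \<otimes> t)" unfolding t(2) xk using yc s(1) t(1)
      by (simp add: R.r_distr R.m_assoc)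
    finally show "\<exists>s\<in>carrier R. r = y [^] i \<otimes> s" using s(1) t(1) yc by blast
  next
    fix e assume e: "e \<in> carrier C" "\<And>i::nat. \<exists>d\<in>carrier C. e = \<phi> y [^]\<^bsub>C\<^esub> i \<otimes>\<^bsub>C\<^esub> d"
    show "e = \<zero>\<^bsub>C\<^esub>"
    proof (rule separated[OF e(1)])
      fix i
      obtain d where d: "d \<in> carrier C" "e = \<phi> y [^]\<^bsub>C\<^esub> (l * i) \<otimes>\<^bsub>C\<^esub> d" using e(2) by blast
      have "e = X i \<otimes>\<^bsub>C\<^esub> (\<phi> (b [^] i) \<otimes>\<^bsub>C\<^esub> d)"
        unfolding d(2) py[symmetric] yl using yc d(1) by (simp add: phi_pow C.m_assoc)
      then show "\<exists>d\<in>carrier C. e = X i \<otimes>\<^bsub>C\<^esub> d" using d(1) yc by (metis C.m_closed hom_closed)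
    qed
  next
    fix f assume f: "\<And>i::nat. f i \<in> carrier R" and coh: "\<And>i. \<exists>s\<in>carrier R. f (Suc i) = f i \<oplus> y [^] i \<otimes> s"
    have far: "\<exists>s\<in>carrier R. f (i + p) = f i \<oplus> y [^] i \<otimes> s" for i p :: nat
    proof (induction p)
      case 0
      have "f (i + 0) = f i \<oplus> y [^] i \<otimes> \<zero>" using f yc by simp
      then show ?case by blast
    next
      case (Suc p)
      then obtain s where s: "s \<in> carrier R" "f (i + p) = f i \<oplus> y [^] i \<otimes> s" by blast
      obtain t where t: "t \<in> carrier R" "f (Suc (i + p)) = f (i + p) \<oplus> y [^] (i + p) \<otimes> t" using coh by blast
      have "f (i + Suc p) = f i \<oplus> y [^] i \<otimes> (s \<oplus> y [^] p \<otimes> t)"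
        using t s f[of i] y by (simp add: R.nat_pow_mult[symmetric] R.r_distr R.a_assoc R.m_assoc)
      then show ?case using s(1) t(1) yc by blast
    qed
    \<comment> \<open>\<open>y^(lj)\<close> is a multiple of \<open>x^j\<close>, so the subsequence
      is coherent for \<open>x\<close>. The extra summand \<open>j\<close> keeps the index growing
      even if \<open>l = 0\<close>.\<close>
    define g where "g j = f (l * j + j)" for j
    have gc: "g j \<in> carrier R" for j by (simp add: g_def f)
    have gcoh: "\<exists>s\<in>carrier R. g (Suc j) = g j \<oplus> x [^] j \<otimes> s" for j
    proof -
      have ix: "l * Suc j + Suc j = (l * j + j) + (l + 1)" by simp
      obtain s where s: "s \<in> carrier R" "g (Suc j) = g j \<oplus> y [^] (l * j + j) \<otimes> s"
        unfolding g_def ix using far by blast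
      have "y [^] (l * j + j) = x [^] j \<otimes> b [^] j \<otimes> y [^] j" using yl[of j] y
        by (simp add: R.nat_pow_mult[symmetric])
      then have "g (Suc j) = g j \<oplus> x [^] j \<otimes> (b [^] j \<otimes> y [^] j \<otimes> s)" using s yc by (simp add: R.m_assoc)
      then show ?thesis using s(1) yc by blast
    qed
    obtain e where e: "e \<in> carrier C" "\<And>j. \<exists>d\<in>carrier C. e = \<phi> (g j) \<oplus>\<^bsub>C\<^esub> X j \<otimes>\<^bsub>C\<^esub> d" using complete[OF gc gcoh]
      by blast
    have "\<exists>d\<in>carrier C. e = \<phi> (f i) \<oplus>\<^bsub>C\<^esub> \<phi> y [^]\<^bsub>C\<^esub> i \<otimes>\<^bsub>C\<^esub> d" for i
    proof -
      \<comment> \<open>\<open>X (k i)\<close> is a multiple of \<open>y^i\<close>; the extra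
        \<open>i\<close> makes the index of \<open>f\<close> in \<open>g ?j\<close> at least
        \<open>i\<close>, so that \<open>g ?j\<close> agrees with \<open>f i\<close> modulo
        \<open>y^i\<close>.\<close>
      let ?j = "k * i + i"
      obtain d where d: "d \<in> carrier C" "e = \<phi> (g ?j) \<oplus>\<^bsub>C\<^esub> X ?j \<otimes>\<^bsub>C\<^esub> d" using e(2) by blast
      have ix: "l * ?j + ?j = i + (l * ?j + k * i)" by simp
      obtain s where s: "s \<in> carrier R" "g ?j = f i \<oplus> y [^] i \<otimes> s" unfolding g_def ix using far by blast
      have Xj: "X ?j = \<phi> (y [^] i) \<otimes>\<^bsub>C\<^esub> (\<phi> (c [^] i) \<otimes>\<^bsub>C\<^esub> X i)"
        unfolding X_add Xk using yc by (simp add: C.m_assoc)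
      have "e = \<phi> (f i) \<oplus>\<^bsub>C\<^esub> \<phi> y [^]\<^bsub>C\<^esub> i \<otimes>\<^bsub>C\<^esub> (\<phi> s \<oplus>\<^bsub>C\<^esub> \<phi> (c [^] i) \<otimes>\<^bsub>C\<^esub> X i \<otimes>\<^bsub>C\<^esub> d)"
        unfolding d(2) Xj s(2) py[symmetric] using f yc s(1) d(1)
        by (simp add: C.r_distr C.a_assoc C.m_assoc)
      then show ?thesis using s(1) d(1) yc by (metis C.a_closed C.m_closed hom_closed X_closed)
    qed
    then show "\<exists>c\<in>carrier C. \<forall>i. \<exists>d\<in>carrier C. c = \<phi> (f i) \<oplus>\<^bsub>C\<^esub> \<phi> y [^]\<^bsub>C\<^esub> i \<otimes>\<^bsub>C\<^esub> d" using e(1) by blast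
  qed
qed

text \<open>What \<open>divisible_overring\<close> delivers, with elements of \<open>R\<close> in
  place of their images in \<open>Q\<close>. It isolates what is needed to show that the ideals
  \<open>R \<inter> x^j B\<close> satisfy \<open>graded_adic_hom\<close>.\<close>

locale divisible_quadratic = R: cring R + Q: cring Q for R (structure) and Q (structure) +
  fixes \<iota> x B
  assumes i_hom: "\<iota> \<in> ring_hom R Q" and inj: "\<And>a b. a \<in> carrier R \<Longrightarrow> b \<in> carrier R \<Longrightarrow> \<iota> a = \<iota> b \<Longrightarrow> a = b"
    and xR: "x \<in> carrier R" and x_unit: "\<exists>w\<in>carrier Q. \<iota> x \<otimes>\<^bsub>Q\<^esub> w = \<one>\<^bsub>Q\<^esub>"
    and absorbs: "\<And>q. q \<in> carrier Q \<Longrightarrow> \<exists>N::nat. \<iota> x [^]\<^bsub>Q\<^esub> N \<otimes>\<^bsub>Q\<^esub> q \<in> \<iota> ` carrier R"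
    and B: "subring B Q" and RB: "\<iota> ` carrier R \<subset> B"
    and B_div: "\<And>b. b \<in> B \<Longrightarrow> \<exists>r\<in>carrier R. \<exists>c\<in>B. b = \<iota> r \<oplus>\<^bsub>Q\<^esub> \<iota> x \<otimes>\<^bsub>Q\<^esub> c"
    and B_quad: "\<And>y z. y \<in> B \<Longrightarrow> z \<in> B \<Longrightarrow> \<exists>r\<in>carrier R. \<exists>p\<in>carrier R. \<exists>q\<in>carrier R.
        y \<otimes>\<^bsub>Q\<^esub> z = \<iota> r \<oplus>\<^bsub>Q\<^esub> \<iota> p \<otimes>\<^bsub>Q\<^esub> y \<oplus>\<^bsub>Q\<^esub> \<iota> q \<otimes>\<^bsub>Q\<^esub> z"
    and B_local: "\<And>b. b \<in> B \<Longrightarrow> (\<exists>c\<in>B. b = \<iota> x \<otimes>\<^bsub>Q\<^esub> c) \<or> (\<exists>c\<in>B. b \<otimes>\<^bsub>Q\<^esub> c = \<one>\<^bsub>Q\<^esub>)"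
    and x_nonunit: "\<And>c. c \<in> B \<Longrightarrow> \<iota> x \<otimes>\<^bsub>Q\<^esub> c \<noteq> \<one>\<^bsub>Q\<^esub>"
begin

sublocale i: ring_hom_cring R Q \<iota> by unfold_locales (rule i_hom)

abbreviation Z :: "nat \<Rightarrow> 'c" where "Z j \<equiv> \<iota> x [^]\<^bsub>Q\<^esub> j"

definition L :: "nat \<Rightarrow> 'a set" where
  "L j = {r \<in> carrier R. \<exists>c\<in>B. \<iota> r = Z j \<otimes>\<^bsub>Q\<^esub> c}"

lemma Bc: "b \<in> B \<Longrightarrow> b \<in> carrier Q" using subringE(1)[OF B] by blast
lemma iB: "r \<in> carrier R \<Longrightarrow> \<iota> r \<in> B" using RB by blast
lemmas B_ops = subringE(2,3)[OF B] subringE(5,6,7)[OF B]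
lemma Zc: "Z j \<in> carrier Q" using xR by simp
lemma Z_iota: "Z j = \<iota> (x [^] j)" using xR by simp
lemma Z_add: "Z (i + j) = Z i \<otimes>\<^bsub>Q\<^esub> Z j" using xR by (simp add: Q.nat_pow_mult)

lemma Z_cancel:
  assumes "a \<in> carrier Q" "b \<in> carrier Q" "Z j \<otimes>\<^bsub>Q\<^esub> a = Z j \<otimes>\<^bsub>Q\<^esub> b"
  shows "a = b"
proof -
  obtain w where w: "w \<in> carrier Q" "\<iota> x \<otimes>\<^bsub>Q\<^esub> w = \<one>\<^bsub>Q\<^esub>" using x_unit by blast
  have "Z j \<otimes>\<^bsub>Q\<^esub> w [^]\<^bsub>Q\<^esub> j = \<one>\<^bsub>Q\<^esub>" using w xR by (simp add: Q.nat_pow_distrib[symmetric])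
  then have c: "w [^]\<^bsub>Q\<^esub> j \<otimes>\<^bsub>Q\<^esub> (Z j \<otimes>\<^bsub>Q\<^esub> d) = d" if "d \<in> carrier Q" for d
    using w(1) Zc that Q.m_comm[of "w [^]\<^bsub>Q\<^esub> j" "Z j"] by (simp add: Q.m_assoc[symmetric])
  have "a = w [^]\<^bsub>Q\<^esub> j \<otimes>\<^bsub>Q\<^esub> (Z j \<otimes>\<^bsub>Q\<^esub> a)" by (rule c[OF assms(1), symmetric])
  also have "\<dots> = b" unfolding assms(3) by (rule c[OF assms(2)])
  finally show ?thesis .
qed

lemma LI: "r \<in> carrier R \<Longrightarrow> c \<in> B \<Longrightarrow> \<iota> r = Z j \<otimes>\<^bsub>Q\<^esub> c \<Longrightarrow> r \<in> L j" by (auto simp: L_def)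
lemma LE:
  assumes "r \<in> L j" obtains c where "c \<in> B" "c \<in> carrier Q" "\<iota> r = Z j \<otimes>\<^bsub>Q\<^esub> c" "r \<in> carrier R"
  using assms Bc by (auto simp: L_def)

lemma L_unit:
  assumes "r \<in> L j" "r \<notin> L (Suc j)"
  obtains c d where "c \<in> B" "d \<in> B" "c \<otimes>\<^bsub>Q\<^esub> d = \<one>\<^bsub>Q\<^esub>" "\<iota> r = Z j \<otimes>\<^bsub>Q\<^esub> c" "r \<in> carrier R"
proof -
  obtain c where c: "c \<in> B" "c \<in> carrier Q" "\<iota> r = Z j \<otimes>\<^bsub>Q\<^esub> c" "r \<in> carrier R" by (rule LE[OF assms(1)])
  have "\<not> (\<exists>d\<in>B. c = \<iota> x \<otimes>\<^bsub>Q\<^esub> d)"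
  proof
    assume "\<exists>d\<in>B. c = \<iota> x \<otimes>\<^bsub>Q\<^esub> d"
    then obtain d where d: "d \<in> B" "c = \<iota> x \<otimes>\<^bsub>Q\<^esub> d" by blast
    then have "\<iota> r = Z (Suc j) \<otimes>\<^bsub>Q\<^esub> d" using c(3) Bc xR by (simp add: Q.m_assoc)
    then show False using LI[OF c(4) d(1)] assms(2) by blast
  qed
  then show ?thesis using that B_local[OF c(1)] c by blast
qed

lemma L_sub: "L (Suc j) \<subseteq> L j"
proof
  fix r assume "r \<in> L (Suc j)"
  then obtain c where c: "c \<in> B" "c \<in> carrier Q" "\<iota> r = Z (Suc j) \<otimes>\<^bsub>Q\<^esub> c" "r \<in> carrier R" by (rule LE)
  have "\<iota> r = Z j \<otimes>\<^bsub>Q\<^esub> (\<iota> x \<otimes>\<^bsub>Q\<^esub> c)" using c xR by (simp add: Q.m_assoc)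
  then show "r \<in> L j" using LI[OF c(4)] B_ops(4)[OF iB[OF xR] c(1)] by blast
qed

lemma L_id: "ideal (L j) R"
proof (rule idealI[OF R.ring_axioms])
  show "subgroup (L j) (add_monoid R)"
  proof (rule R.add.subgroupI)
    show "L j \<subseteq> carrier R" by (auto simp: L_def)
    have "\<iota> \<zero> = Z j \<otimes>\<^bsub>Q\<^esub> \<zero>\<^bsub>Q\<^esub>" using Zc by simp
    then show "L j \<noteq> {}" using LI[OF R.zero_closed B_ops(1)] by blast
    fix a b assume a: "a \<in> L j"
    obtain c where c: "c \<in> B" "c \<in> carrier Q" "\<iota> a = Z j \<otimes>\<^bsub>Q\<^esub> c" "a \<in> carrier R" by (rule LE[OF a])
    have "\<iota> (\<ominus> a) = Z j \<otimes>\<^bsub>Q\<^esub> (\<ominus>\<^bsub>Q\<^esub> c)" using c Zc by (simp add: Q.r_minus)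
    then show "\<ominus> a \<in> L j" using LI B_ops(3)[OF c(1)] c(4) by blast
    assume b: "b \<in> L j"
    obtain d where d: "d \<in> B" "d \<in> carrier Q" "\<iota> b = Z j \<otimes>\<^bsub>Q\<^esub> d" "b \<in> carrier R" by (rule LE[OF b])
    have "\<iota> (a \<oplus> b) = Z j \<otimes>\<^bsub>Q\<^esub> (c \<oplus>\<^bsub>Q\<^esub> d)" using c d Zc by (simp add: Q.r_distr)
    then show "a \<oplus> b \<in> L j" using LI B_ops(5)[OF c(1) d(1)] c(4) d(4) by blast
  qed
  show "s \<otimes> a \<in> L j" "a \<otimes> s \<in> L j" if a: "a \<in> L j" and s: "s \<in> carrier R" for a s
  proof -
    obtain c where c: "c \<in> B" "c \<in> carrier Q" "\<iota> a = Z j \<otimes>\<^bsub>Q\<^esub> c" "a \<in> carrier R" by (rule LE[OF a])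
    have "\<iota> (s \<otimes> a) = Z j \<otimes>\<^bsub>Q\<^esub> (\<iota> s \<otimes>\<^bsub>Q\<^esub> c)" using c Zc s by (simp add: Q.m_lcomm)
    then show "s \<otimes> a \<in> L j" using LI B_ops(4)[OF iB[OF s] c(1)] c(4) s by blast
    then show "a \<otimes> s \<in> L j" using R.m_comm[OF s c(4)] by simp
  qed
qed

text \<open>The leading coefficient \<open>c\<close> of \<open>r\<close> is a unit of
  \<open>B\<close>, being outside \<open>xB\<close>. Reducing \<open>d/c\<close> modulo
  \<open>xB\<close> to an element \<open>t\<close> of \<open>R\<close>, by \<open>B_div\<close>,
  matches the leading term of \<open>s\<close>.\<close>

lemma L_leading_quotient:
  assumes r: "r \<in> L i" "r \<notin> L (Suc i)" and s: "s \<in> L (i + k)"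
  shows "\<exists>t\<in>carrier R. s \<ominus> r \<otimes> (x [^] k \<otimes> t) \<in> L (Suc (i + k))"
proof -
  obtain c c' where c: "c \<in> B" "c' \<in> B" "c \<otimes>\<^bsub>Q\<^esub> c' = \<one>\<^bsub>Q\<^esub>" "\<iota> r = Z i \<otimes>\<^bsub>Q\<^esub> c" "r \<in> carrier R"
    by (rule L_unit[OF r])
  obtain d where d: "d \<in> B" "d \<in> carrier Q" "\<iota> s = Z (i + k) \<otimes>\<^bsub>Q\<^esub> d" "s \<in> carrier R" by (rule LE[OF s])
  obtain t e where t: "t \<in> carrier R" "e \<in> B" "c' \<otimes>\<^bsub>Q\<^esub> d = \<iota> t \<oplus>\<^bsub>Q\<^esub> \<iota> x \<otimes>\<^bsub>Q\<^esub> e" using B_div B_ops(4)[OF c(2) d(1)]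
    by blast
  have cc: "c \<in> carrier Q" "c' \<in> carrier Q" "e \<in> carrier Q" "\<iota> t \<in> carrier Q" "\<iota> x \<in> carrier Q"
    using Bc c t xR by auto
  define z where "z = Z (i + k)"
  have zc: "z \<in> carrier Q" using Zc by (simp add: z_def)
  have "d = (c \<otimes>\<^bsub>Q\<^esub> c') \<otimes>\<^bsub>Q\<^esub> d" using c(3) d by simp
  also have "\<dots> = c \<otimes>\<^bsub>Q\<^esub> (\<iota> t \<oplus>\<^bsub>Q\<^esub> \<iota> x \<otimes>\<^bsub>Q\<^esub> e)" unfolding t(3)[symmetric] using cc d by (simp add: Q.m_assoc)
  finally have dd: "d = c \<otimes>\<^bsub>Q\<^esub> (\<iota> t \<oplus>\<^bsub>Q\<^esub> \<iota> x \<otimes>\<^bsub>Q\<^esub> e)" .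
  have "\<iota> (s \<ominus> r \<otimes> (x [^] k \<otimes> t)) = \<iota> s \<ominus>\<^bsub>Q\<^esub> \<iota> r \<otimes>\<^bsub>Q\<^esub> (Z k \<otimes>\<^bsub>Q\<^esub> \<iota> t)"
    using d c(5) t(1) xR by (simp add: R.minus_eq Q.minus_eq)
  also have "\<iota> r \<otimes>\<^bsub>Q\<^esub> (Z k \<otimes>\<^bsub>Q\<^esub> \<iota> t) = z \<otimes>\<^bsub>Q\<^esub> c \<otimes>\<^bsub>Q\<^esub> \<iota> t"
    unfolding c(4) z_def Z_add using cc Zc by (simp add: Q.m_ac)
  also have "\<iota> s \<ominus>\<^bsub>Q\<^esub> z \<otimes>\<^bsub>Q\<^esub> c \<otimes>\<^bsub>Q\<^esub> \<iota> t = (z \<otimes>\<^bsub>Q\<^esub> \<iota> x) \<otimes>\<^bsub>Q\<^esub> (c \<otimes>\<^bsub>Q\<^esub> e)"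
    unfolding d(3) z_def[symmetric] dd using cc zc by algebra
  also have "z \<otimes>\<^bsub>Q\<^esub> \<iota> x = Z (Suc (i + k))" by (simp add: z_def)
  finally have "s \<ominus> r \<otimes> (x [^] k \<otimes> t) \<in> L (Suc (i + k))"
    using LI[OF _ B_ops(4)[OF c(1) t(2)]] d c(5) t(1) xR by simp
  then show ?thesis using t(1) by blast
qed

text \<open>With \<open>r = x^j y\<close> and \<open>s = x^j z\<close>, the relation
  \<open>yz = a + py + qz\<close> multiplied by \<open>x^(2j)\<close> becomes
  \<open>rs = x^j (x^j a + p r + q s)\<close>. This is the origin of the square-zero property of the
  prime.\<close>

lemma L_square_divisible:
  assumes r: "r \<in> L j" and s: "s \<in> L j"
  shows "\<exists>t\<in>carrier R. r \<otimes> s = x [^] j \<otimes> t"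
proof -
  obtain y where y: "y \<in> B" "y \<in> carrier Q" "\<iota> r = Z j \<otimes>\<^bsub>Q\<^esub> y" "r \<in> carrier R" by (rule LE[OF r])
  obtain z where z: "z \<in> B" "z \<in> carrier Q" "\<iota> s = Z j \<otimes>\<^bsub>Q\<^esub> z" "s \<in> carrier R" by (rule LE[OF s])
  obtain a p q where a: "a \<in> carrier R" "p \<in> carrier R" "q \<in> carrier R"
     "y \<otimes>\<^bsub>Q\<^esub> z = \<iota> a \<oplus>\<^bsub>Q\<^esub> \<iota> p \<otimes>\<^bsub>Q\<^esub> y \<oplus>\<^bsub>Q\<^esub> \<iota> q \<otimes>\<^bsub>Q\<^esub> z" using B_quad[OF y(1) z(1)] by blast
  have cc: "\<iota> a \<in> carrier Q" "\<iota> p \<in> carrier Q" "\<iota> q \<in> carrier Q" "Z j \<in> carrier Q" using a Zc by simp_all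
  define t where "t = x [^] j \<otimes> a \<oplus> p \<otimes> r \<oplus> q \<otimes> s"
  have t: "t \<in> carrier R" using a y z xR by (simp add: t_def)
  have "\<iota> (r \<otimes> s) = Z j \<otimes>\<^bsub>Q\<^esub> Z j \<otimes>\<^bsub>Q\<^esub> (y \<otimes>\<^bsub>Q\<^esub> z)" using y z Zc by (simp add: Q.m_ac)
  also have "\<dots> = Z j \<otimes>\<^bsub>Q\<^esub> (Z j \<otimes>\<^bsub>Q\<^esub> \<iota> a \<oplus>\<^bsub>Q\<^esub> \<iota> p \<otimes>\<^bsub>Q\<^esub> (Z j \<otimes>\<^bsub>Q\<^esub> y) \<oplus>\<^bsub>Q\<^esub> \<iota> q \<otimes>\<^bsub>Q\<^esub> (Z j \<otimes>\<^bsub>Q\<^esub> z))"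
    unfolding a(4) using cc y(2) z(2) by algebra
  also have "\<dots> = \<iota> (x [^] j \<otimes> t)"
    unfolding y(3)[symmetric] z(3)[symmetric] Z_iota t_def using a y z xR by simp
  finally show ?thesis using inj[of "r \<otimes> s" "x [^] j \<otimes> t"] y z t xR by auto
qed

text \<open>Take \<open>y\<close> in \<open>B\<close> outside \<open>R\<close> and expand it along
  \<open>B = R + x^n B\<close> as \<open>y = \<sigma> n + x^n z\<close>. The sequence
  \<open>\<sigma>\<close> tends to \<open>y\<close> in the topology of \<open>B\<close>, and with
  \<open>a = x^j y\<close> in \<open>R\<close> the differences \<open>a - x^j \<sigma> i\<close>
  become elements of \<open>R\<close> that lie ever deeper in the filtration. If the
  \<open>j\<close>-th one were divisible by \<open>x^j\<close>, then \<open>y\<close> would lie in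
  \<open>R\<close>.\<close>

lemma L_unbounded_sequence:
  "\<exists>f j. (\<forall>i. f i \<in> L i \<and> (\<exists>s\<in>carrier R. f (Suc i) = f i \<oplus> x [^] i \<otimes> s)) \<and>
    (\<forall>t\<in>carrier R. f j \<noteq> x [^] (j::nat) \<otimes> t)"
proof -
  obtain y where y: "y \<in> B" "y \<notin> \<iota> ` carrier R" using RB by blast
  note yc = Bc[OF y(1)]
  obtain j :: nat and a where a: "a \<in> carrier R" "Z j \<otimes>\<^bsub>Q\<^esub> y = \<iota> a" using absorbs[OF yc] by auto
  have "\<exists>\<sigma>. \<forall>n. (\<sigma> n \<in> carrier R \<and> (\<exists>z\<in>B. y = \<iota> (\<sigma> n) \<oplus>\<^bsub>Q\<^esub> Z n \<otimes>\<^bsub>Q\<^esub> z)) \<and>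
    (\<exists>r\<in>carrier R. \<sigma> (Suc n) = \<sigma> n \<oplus> x [^] n \<otimes> r)"
  proof (rule dependent_nat_choice)
    have "y = \<iota> \<zero> \<oplus>\<^bsub>Q\<^esub> Z 0 \<otimes>\<^bsub>Q\<^esub> y" using yc by simp
    then show "\<exists>s. s \<in> carrier R \<and> (\<exists>z\<in>B. y = \<iota> s \<oplus>\<^bsub>Q\<^esub> Z 0 \<otimes>\<^bsub>Q\<^esub> z)" using y(1) by blast
  next
    fix s and n :: nat assume "s \<in> carrier R \<and> (\<exists>z\<in>B. y = \<iota> s \<oplus>\<^bsub>Q\<^esub> Z n \<otimes>\<^bsub>Q\<^esub> z)"
    then obtain z where z: "s \<in> carrier R" "z \<in> B" "y = \<iota> s \<oplus>\<^bsub>Q\<^esub> Z n \<otimes>\<^bsub>Q\<^esub> z" by blast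
    obtain r c where r: "r \<in> carrier R" "c \<in> B" "z = \<iota> r \<oplus>\<^bsub>Q\<^esub> \<iota> x \<otimes>\<^bsub>Q\<^esub> c" using B_div[OF z(2)] by blast
    have cc: "\<iota> s \<in> carrier Q" "\<iota> r \<in> carrier Q" "\<iota> x \<in> carrier Q" "Z n \<in> carrier Q" "c \<in> carrier Q"
      using z r xR Zc Bc by simp_all
    have "\<iota> (s \<oplus> x [^] n \<otimes> r) = \<iota> s \<oplus>\<^bsub>Q\<^esub> Z n \<otimes>\<^bsub>Q\<^esub> \<iota> r" using z r xR by simp
    moreover have "y = (\<iota> s \<oplus>\<^bsub>Q\<^esub> Z n \<otimes>\<^bsub>Q\<^esub> \<iota> r) \<oplus>\<^bsub>Q\<^esub> (Z n \<otimes>\<^bsub>Q\<^esub> \<iota> x) \<otimes>\<^bsub>Q\<^esub> c" unfolding z(3) r(3) using cc by algebra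
    ultimately have "y = \<iota> (s \<oplus> x [^] n \<otimes> r) \<oplus>\<^bsub>Q\<^esub> Z (Suc n) \<otimes>\<^bsub>Q\<^esub> c" by simp
    then show "\<exists>s'. (s' \<in> carrier R \<and> (\<exists>z\<in>B. y = \<iota> s' \<oplus>\<^bsub>Q\<^esub> Z (Suc n) \<otimes>\<^bsub>Q\<^esub> z)) \<and>
      (\<exists>r\<in>carrier R. s' = s \<oplus> x [^] n \<otimes> r)"
      using z(1) r(1,2) xR by (intro exI[of _ "s \<oplus> x [^] n \<otimes> r"]) blast
  qed
  then obtain \<sigma> where \<sigma>: "\<And>n. \<sigma> n \<in> carrier R" "\<And>n. \<exists>z\<in>B. y = \<iota> (\<sigma> n) \<oplus>\<^bsub>Q\<^esub> Z n \<otimes>\<^bsub>Q\<^esub> z"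
     "\<And>n. \<exists>r\<in>carrier R. \<sigma> (Suc n) = \<sigma> n \<oplus> x [^] n \<otimes> r" by blast
  define f where "f i = a \<ominus> x [^] j \<otimes> \<sigma> i" for i
  have xj: "x [^] i \<in> carrier R" for i :: nat using xR by simp
  have f1: "f i \<in> L i" for i
  proof -
    obtain z where z: "z \<in> B" "y = \<iota> (\<sigma> i) \<oplus>\<^bsub>Q\<^esub> Z i \<otimes>\<^bsub>Q\<^esub> z" using \<sigma>(2) by blast
    have cc: "\<iota> (\<sigma> i) \<in> carrier Q" "Z i \<in> carrier Q" "Z j \<in> carrier Q" "z \<in> carrier Q" using \<sigma>(1) Zc Bc z
      by simp_all
    have "\<iota> (f i) = \<iota> a \<ominus>\<^bsub>Q\<^esub> Z j \<otimes>\<^bsub>Q\<^esub> \<iota> (\<sigma> i)" using a \<sigma>(1) xj Z_iota by (simp add: f_def R.minus_eq Q.minus_eq)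
    also have "\<dots> = Z i \<otimes>\<^bsub>Q\<^esub> (Z j \<otimes>\<^bsub>Q\<^esub> z)" unfolding a(2)[symmetric] z(2) using cc by algebra
    finally have eq: "\<iota> (f i) = Z i \<otimes>\<^bsub>Q\<^esub> (Z j \<otimes>\<^bsub>Q\<^esub> z)" .
    have "Z j \<otimes>\<^bsub>Q\<^esub> z \<in> B" using B_ops(4)[OF iB[OF xj[of j]] z(1)] unfolding Z_iota[symmetric] .
    moreover have "f i \<in> carrier R" using a(1) \<sigma>(1) xj by (simp add: f_def)
    ultimately show ?thesis using LI eq by blast
  qed
  have f2: "\<exists>s\<in>carrier R. f (Suc i) = f i \<oplus> x [^] i \<otimes> s" for i
  proof -
    obtain r where r: "r \<in> carrier R" "\<sigma> (Suc i) = \<sigma> i \<oplus> x [^] i \<otimes> r" using \<sigma>(3) by blast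
    have "f (Suc i) = f i \<oplus> x [^] i \<otimes> (\<ominus> (x [^] j \<otimes> r))"
      unfolding f_def r(2) using a(1) \<sigma>(1)[of i] xj[of i] xj[of j] r(1) by algebra
    then show ?thesis using r(1) xj by blast
  qed
  have f3: "f j \<noteq> x [^] j \<otimes> t" if t: "t \<in> carrier R" for t
  proof
    assume e: "f j = x [^] j \<otimes> t"
    have "a = f j \<oplus> x [^] j \<otimes> \<sigma> j" unfolding f_def using a(1) \<sigma>(1)[of j] xj[of j] by algebra
    also have "\<dots> = x [^] j \<otimes> (t \<oplus> \<sigma> j)" unfolding e using t \<sigma>(1)[of j] xj[of j] by algebra
    finally have "Z j \<otimes>\<^bsub>Q\<^esub> y = Z j \<otimes>\<^bsub>Q\<^esub> \<iota> (t \<oplus> \<sigma> j)" using a t \<sigma>(1) xj Z_iota by simp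
    then have "y = \<iota> (t \<oplus> \<sigma> j)" using Z_cancel[OF yc] t \<sigma>(1) by (metis R.a_closed i.hom_closed)
    then show False using y(2) t \<sigma>(1) by blast
  qed
  show ?thesis using f1 f2 f3 by blast
qed

lemma graded:
  assumes "adic_hom R C \<phi> x"
  shows "graded_adic_hom R C \<phi> x L"
proof -
  interpret A: adic_hom R C \<phi> x by (rule assms)
  have oneL: "False" if "\<iota> x \<otimes>\<^bsub>Q\<^esub> c = \<one>\<^bsub>Q\<^esub>" "c \<in> B" for c using x_nonunit that by blast
  show ?thesis
  proof (intro graded_adic_hom.intro assms graded_adic_hom_axioms.intro)
    show "ideal (L j) R" for j by (rule L_id)
    have "r \<in> L 0" if "r \<in> carrier R" for r using LI[OF that iB[OF that]] that by simp
    then show "L 0 = carrier R" by (auto simp: L_def)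
    show "L (Suc j) \<subseteq> L j" for j by (rule L_sub)
    show "x [^] j \<in> L j" for j
    proof (rule LI[OF _ B_ops(2)])
      show "\<iota> (x [^] j) = Z j \<otimes>\<^bsub>Q\<^esub> \<one>\<^bsub>Q\<^esub>" using Q.r_one[OF Zc[of j]] Z_iota[of j] by metis
    qed (use xR in simp)
    show "r \<otimes> s \<in> L (i + j)" if r: "r \<in> L i" and s: "s \<in> L j" for r s i j
    proof -
      obtain c where c: "c \<in> B" "c \<in> carrier Q" "\<iota> r = Z i \<otimes>\<^bsub>Q\<^esub> c" "r \<in> carrier R" by (rule LE[OF r])
      obtain d where d: "d \<in> B" "d \<in> carrier Q" "\<iota> s = Z j \<otimes>\<^bsub>Q\<^esub> d" "s \<in> carrier R" by (rule LE[OF s])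
      have "\<iota> (r \<otimes> s) = Z (i + j) \<otimes>\<^bsub>Q\<^esub> (c \<otimes>\<^bsub>Q\<^esub> d)" unfolding Z_add using c d Zc by (simp add: Q.m_ac)
      then show ?thesis using LI B_ops(4)[OF c(1) d(1)] c(4) d(4) by blast
    qed
    show "r \<otimes> s \<notin> L (Suc (i + j))" if r: "r \<in> L i" "r \<notin> L (Suc i)" and s: "s \<in> L j" "s \<notin> L (Suc j)"
      for r s i j
    proof
      assume "r \<otimes> s \<in> L (Suc (i + j))"
      then obtain e where e: "e \<in> B" "e \<in> carrier Q" "\<iota> (r \<otimes> s) = Z (Suc (i + j)) \<otimes>\<^bsub>Q\<^esub> e" by (rule LE)
      obtain c c' where c: "c \<in> B" "c' \<in> B" "c \<otimes>\<^bsub>Q\<^esub> c' = \<one>\<^bsub>Q\<^esub>" "\<iota> r = Z i \<otimes>\<^bsub>Q\<^esub> c" "r \<in> carrier R"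
        by (rule L_unit[OF r])
      obtain d d' where d: "d \<in> B" "d' \<in> B" "d \<otimes>\<^bsub>Q\<^esub> d' = \<one>\<^bsub>Q\<^esub>" "\<iota> s = Z j \<otimes>\<^bsub>Q\<^esub> d" "s \<in> carrier R"
        by (rule L_unit[OF s])
      have cc: "c \<in> carrier Q" "c' \<in> carrier Q" "d \<in> carrier Q" "d' \<in> carrier Q" "\<iota> x \<in> carrier Q"
        using Bc c d xR by auto
      have "Z (i + j) \<otimes>\<^bsub>Q\<^esub> (c \<otimes>\<^bsub>Q\<^esub> d) = \<iota> (r \<otimes> s)" unfolding Z_add using c d cc Zc by (simp add: Q.m_ac)
      also have "\<dots> = Z (i + j) \<otimes>\<^bsub>Q\<^esub> (\<iota> x \<otimes>\<^bsub>Q\<^esub> e)" unfolding e(3) using cc e(2) Zc by (simp add: Q.m_assoc)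
      finally have eq: "c \<otimes>\<^bsub>Q\<^esub> d = \<iota> x \<otimes>\<^bsub>Q\<^esub> e" by (rule Z_cancel[rotated 2]) (use cc e in simp_all)
      have "\<iota> x \<otimes>\<^bsub>Q\<^esub> (e \<otimes>\<^bsub>Q\<^esub> (c' \<otimes>\<^bsub>Q\<^esub> d')) = (\<iota> x \<otimes>\<^bsub>Q\<^esub> e) \<otimes>\<^bsub>Q\<^esub> (c' \<otimes>\<^bsub>Q\<^esub> d')" using cc e(2) by (simp add: Q.m_assoc)
      also have "\<dots> = (c \<otimes>\<^bsub>Q\<^esub> c') \<otimes>\<^bsub>Q\<^esub> (d \<otimes>\<^bsub>Q\<^esub> d')" unfolding eq[symmetric] using cc by (simp add: Q.m_ac)
      also have "\<dots> = \<one>\<^bsub>Q\<^esub>" unfolding c(3) d(3) by simp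
      finally show False using oneL B_ops(4)[OF e(1) B_ops(4)[OF c(2) d(2)]] by blast
    qed
    show "\<exists>t\<in>carrier R. s \<ominus> r \<otimes> (x [^] k \<otimes> t) \<in> L (Suc (i + k))"
      if "r \<in> L i" "r \<notin> L (Suc i)" "s \<in> L (i + k)" for r s i k by (rule L_leading_quotient[OF that])
    show "\<exists>t\<in>carrier R. r \<otimes> s = x [^] j \<otimes> t" if "r \<in> L j" "s \<in> L j" for r s j
      by (rule L_square_divisible[OF that])
    show "\<exists>f j. (\<forall>i. f i \<in> L i \<and> (\<exists>s\<in>carrier R. f (Suc i) = f i \<oplus> x [^] i \<otimes> s)) \<and>
      (\<forall>t\<in>carrier R. f j \<noteq> x [^] (j::nat) \<otimes> t)"
      by (rule L_unbounded_sequence)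
    show "\<one> \<notin> L 1"
    proof
      assume "\<one> \<in> L 1"
      then obtain c where "c \<in> B" "\<iota> \<one> = Z 1 \<otimes>\<^bsub>Q\<^esub> c" by (rule LE)
      then show False using oneL[of c] xR by simp
    qed
    show "x \<notin> L 2"
    proof
      assume "x \<in> L 2"
      then obtain c where c: "c \<in> B" "c \<in> carrier Q" "\<iota> x = Z 2 \<otimes>\<^bsub>Q\<^esub> c" by (rule LE)
      have "Z 1 \<otimes>\<^bsub>Q\<^esub> \<one>\<^bsub>Q\<^esub> = Z 1 \<otimes>\<^bsub>Q\<^esub> (\<iota> x \<otimes>\<^bsub>Q\<^esub> c)" using c xR by (simp add: numeral_2_eq_2 Q.m_assoc)
      then have "\<one>\<^bsub>Q\<^esub> = \<iota> x \<otimes>\<^bsub>Q\<^esub> c" by (rule Z_cancel[rotated 2]) (use c xR in simp_all)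
      then show False using oneL[of c] c(1) by simp
    qed
  qed
qed

end

section \<open>Krull dimension one\<close>

theorem (in local_one_dim) stable_iff_prime_of_completion:
  assumes C: "adic_hom R C \<phi> m"
  shows "stable_ring R \<and> \<not> finite_int_closure R \<longleftrightarrow>
    (\<exists>P. primeideal P C \<and> P \<noteq> {\<zero>\<^bsub>C\<^esub>} \<and> ideal_prod C P P = {\<zero>\<^bsub>C\<^esub>} \<and> DVR (C Quot P))"
proof
  assume a: "stable_ring R \<and> \<not> finite_int_closure R"
  have fs: "fraction_setting Q R0 (\<iota> m)" using fraction_setting_if_stable a by blast
  interpret F: fraction_setting Q R0 "\<iota> m" by (rule fs)
  have nf: "\<And>T. \<not> F.normal_simple T" using finite_if_normal_simple[OF fs] a by blast
  obtain x0 B where x0: "x0 \<in> nonunits Q R0" "\<exists>w\<in>carrier Q. x0 \<otimes>\<^bsub>Q\<^esub> w = \<one>\<^bsub>Q\<^esub>"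
    and B: "subring B Q" "R0 \<subset> B" "\<And>b. b \<in> B \<Longrightarrow> \<exists>r\<in>R0. \<exists>c\<in>B. b = r \<oplus>\<^bsub>Q\<^esub> x0 \<otimes>\<^bsub>Q\<^esub> c"
    "\<And>y z. y \<in> B \<Longrightarrow> z \<in> B \<Longrightarrow> \<exists>r\<in>R0. \<exists>p\<in>R0. \<exists>q\<in>R0. y \<otimes>\<^bsub>Q\<^esub> z = r \<oplus>\<^bsub>Q\<^esub> p \<otimes>\<^bsub>Q\<^esub> y \<oplus>\<^bsub>Q\<^esub> q \<otimes>\<^bsub>Q\<^esub> z"
    "\<And>b. b \<in> B \<Longrightarrow> (\<exists>c\<in>B. b = x0 \<otimes>\<^bsub>Q\<^esub> c) \<or> (\<exists>c\<in>B. b \<otimes>\<^bsub>Q\<^esub> c = \<one>\<^bsub>Q\<^esub>)"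
    "\<And>c. c \<in> B \<Longrightarrow> x0 \<otimes>\<^bsub>Q\<^esub> c \<noteq> \<one>\<^bsub>Q\<^esub>"
    by (rule F.divisible_overring[OF nf]) (rule that, assumption+)
  obtain x where x: "x \<in> nonunits R (carrier R)" "x0 = \<iota> x" using x0(1) unfolding nonunits_R0 by blast
  have xc: "x \<in> carrier R" using x by (simp add: nonunits_def)
  obtain w where w: "w \<in> carrier Q" "\<iota> x \<otimes>\<^bsub>Q\<^esub> w = \<one>\<^bsub>Q\<^esub>" using x0(2) x(2) by blast
  have "x \<in> nzd R"
  proof -
    have "y = \<zero>" if y: "y \<in> carrier R" "x \<otimes> y = \<zero>" for y
    proof -
      have "\<iota> y = w \<otimes>\<^bsub>Q\<^esub> (\<iota> x \<otimes>\<^bsub>Q\<^esub> \<iota> y)" using w xc y(1) Q.m_comm[of "\<iota> x" w]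
        by (simp add: Q.m_assoc[symmetric])
      also have "\<iota> x \<otimes>\<^bsub>Q\<^esub> \<iota> y = \<iota> \<zero>" using xc y by (metis i.hom_mult)
      also have "w \<otimes>\<^bsub>Q\<^esub> \<iota> \<zero> = \<iota> \<zero>" using w(1) by simp
      finally show ?thesis using qemb_inj[OF y(1) zero_closed] by blast
    qed
    then show ?thesis using xc by (simp add: nzd_def)
  qed
  then obtain k :: nat and c where c: "c \<in> carrier R" "m [^] k = x \<otimes> c" using nzd_div by blast
  obtain l :: nat and b where b: "b \<in> carrier R" "x [^] l = m \<otimes> b" using rad[OF x(1)] by blast
  have Cx: "adic_hom R C \<phi> x" by (rule adic_hom.change_base[OF C xc b c])
  have dq: "divisible_quadratic R Q \<iota> x B"
  proof (intro divisible_quadratic.intro divisible_quadratic_axioms.intro cring_axioms Q.cring_axioms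
    qemb_hom xc B(1,2))
    show "a = b" if "a \<in> carrier R" "b \<in> carrier R" "\<iota> a = \<iota> b" for a b using qemb_inj that by blast
    show "\<exists>w\<in>carrier Q. \<iota> x \<otimes>\<^bsub>Q\<^esub> w = \<one>\<^bsub>Q\<^esub>" using w by blast
    show "\<exists>N::nat. \<iota> x [^]\<^bsub>Q\<^esub> N \<otimes>\<^bsub>Q\<^esub> q \<in> R0" if "q \<in> carrier Q" for q
      using F.nonunit_absorbs[OF x0(1) that] x(2) by simp
    show "\<exists>r\<in>carrier R. \<exists>c\<in>B. b = \<iota> r \<oplus>\<^bsub>Q\<^esub> \<iota> x \<otimes>\<^bsub>Q\<^esub> c" if "b \<in> B" for b using B(3)[OF that] x(2) by blast
    show "\<exists>r\<in>carrier R. \<exists>p\<in>carrier R. \<exists>q\<in>carrier R. y \<otimes>\<^bsub>Q\<^esub> z = \<iota> r \<oplus>\<^bsub>Q\<^esub> \<iota> p \<otimes>\<^bsub>Q\<^esub> y \<oplus>\<^bsub>Q\<^esub> \<iota> q \<otimes>\<^bsub>Q\<^esub> z"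
      if "y \<in> B" "z \<in> B" for y z using B(4)[OF that] by blast
    show "(\<exists>c\<in>B. b = \<iota> x \<otimes>\<^bsub>Q\<^esub> c) \<or> (\<exists>c\<in>B. b \<otimes>\<^bsub>Q\<^esub> c = \<one>\<^bsub>Q\<^esub>)" if "b \<in> B" for b using B(5)[OF that] x(2) by simp
    show "\<iota> x \<otimes>\<^bsub>Q\<^esub> c \<noteq> \<one>\<^bsub>Q\<^esub>" if "c \<in> B" for c using B(6)[OF that] x(2) by simp
  qed
  interpret G: graded_adic_hom R C \<phi> x "divisible_quadratic.L R Q \<iota> x B"
    by (rule divisible_quadratic.graded[OF dq Cx])
  show "\<exists>P. primeideal P C \<and> P \<noteq> {\<zero>\<^bsub>C\<^esub>} \<and> ideal_prod C P P = {\<zero>\<^bsub>C\<^esub>} \<and> DVR (C Quot P)"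
    using G.P_prime G.P_nonzero G.P_square G.P_quot_DVR by blast
next
  assume "\<exists>P. primeideal P C \<and> P \<noteq> {\<zero>\<^bsub>C\<^esub>} \<and> ideal_prod C P P = {\<zero>\<^bsub>C\<^esub>} \<and> DVR (C Quot P)"
  then obtain P where P: "primeideal P C" "P \<noteq> {\<zero>\<^bsub>C\<^esub>}" "ideal_prod C P P = {\<zero>\<^bsub>C\<^esub>}" "DVR (C Quot P)" by blast
  interpret A: adic_hom R C \<phi> m by (rule C)
  have jac: "\<exists>u\<in>carrier R. (\<one> \<ominus> m \<otimes> t) \<otimes> u = \<one>" if t: "t \<in> carrier R" for t
  proof (rule ccontr)
    assume "\<not> ?thesis"
    then have "\<one> \<ominus> m \<otimes> t \<in> nonunits R (carrier R)" using t by (auto simp: nonunits_def)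
    moreover have "m \<otimes> t \<in> nonunits R (carrier R)"
      using nonunits_absorb[OF carrier_is_subring m_nonunit t] t by (simp add: m_comm)
    ultimately have "\<one> \<ominus> m \<otimes> t \<oplus> m \<otimes> t \<in> nonunits R (carrier R)" by (rule local)
    moreover have "\<one> \<ominus> m \<otimes> t \<oplus> m \<otimes> t = \<one>" using t mc by algebra
    ultimately show False by (auto simp: nonunits_def)
  qed
  have st: "stable_ring R"
  proof (rule stable_ringI)
    fix I assume reg: "regular_ideal R I"
    then have I: "ideal I R" by (simp add: regular_ideal_def)
    obtain n :: nat where n: "m [^] n \<in> I" by (rule regular_ideal_pow[OF reg])
    obtain i where i: "i \<in> I" "\<exists>k::nat. \<exists>c\<in>carrier R. m [^] k = i \<otimes> c" "\<And>a b. a \<in> I \<Longrightarrow> b \<in> I \<Longrightarrow>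
      \<exists>c\<in>I. a \<otimes> b = i \<otimes> c"
      using A.stable_generator[OF P(1,3,4) nzdD(2)[OF m_nzd] jac I n] by blast
    obtain k :: nat and c where "c \<in> carrier R" "m [^] k = i \<otimes> c" using i(2) by blast
    then have "i \<in> nzd R" using nzd_factor[OF ideal.Icarr[OF I i(1)]] nzd_pow[OF m_nzd, of k] by metis
    then show "\<exists>i\<in>I. i \<in> nzd R \<and> (\<forall>a\<in>I. \<forall>b\<in>I. \<exists>c\<in>I. a \<otimes> b = i \<otimes> c)" using i(1,3) by blast
  qed
  have "\<not> finite_int_closure R"
  proof
    assume "finite_int_closure R"
    then obtain k :: nat where k: "\<And>q. integral_over R q \<Longrightarrow> \<iota> m [^]\<^bsub>Q\<^esub> k \<otimes>\<^bsub>Q\<^esub> q \<in> R0"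
      using bounded_if_finite by metis
    obtain j :: nat where j: "\<And>k. \<exists>r\<in>carrier R. \<exists>b\<in>carrier R. \<exists>e\<in>carrier R.
       r \<otimes> r = m [^] (k + j) \<otimes> b \<otimes> r \<oplus> m [^] (k + j) \<otimes> m [^] (k + j) \<otimes> e \<and> (\<forall>s\<in>carrier R. r \<noteq> m [^] j \<otimes> s)"
      using A.quadratic_approximants[OF primeideal.axioms(1)[OF P(1)] P(2,3)] by blast
    define z where "z = m [^] (k + j)"
    have zc: "z \<in> carrier R" by (simp add: z_def)
    obtain r b e where r: "r \<in> carrier R" "b \<in> carrier R" "e \<in> carrier R"
      "r \<otimes> r = z \<otimes> b \<otimes> r \<oplus> z \<otimes> z \<otimes> e" "\<And>s. s \<in> carrier R \<Longrightarrow> r \<noteq> m [^] j \<otimes> s" unfolding z_def using j[of k]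
        by blast
    obtain w where w: "w \<in> carrier Q" "\<iota> z \<otimes>\<^bsub>Q\<^esub> w = \<one>\<^bsub>Q\<^esub>"
      using qemb_inverse[OF nzd_pow[OF m_nzd, of "k + j"]] unfolding z_def by blast
    \<comment> \<open>This is \<open>r/m^(k+j)\<close>. It will be integral over \<open>R\<close>,
      so \<open>m^k q\<close> lies in \<open>R\<close>; but \<open>m^k q\<close> is
      \<open>r/m^j\<close>, and \<open>r\<close> is not divisible by \<open>m^j\<close>.\<close>
    define q where "q = w \<otimes>\<^bsub>Q\<^esub> \<iota> r"
    have qc: "q \<in> carrier Q" using w r by (simp add: q_def)
    have zw: "\<iota> z \<otimes>\<^bsub>Q\<^esub> (w \<otimes>\<^bsub>Q\<^esub> d) = d" if "d \<in> carrier Q" for d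
      using w zc that by (simp add: Q.m_assoc[symmetric])
    have "q \<otimes>\<^bsub>Q\<^esub> q = w \<otimes>\<^bsub>Q\<^esub> w \<otimes>\<^bsub>Q\<^esub> \<iota> (r \<otimes> r)" unfolding q_def using w(1) r(1) by (simp add: Q.m_ac)
    also have "\<iota> (r \<otimes> r) = \<iota> z \<otimes>\<^bsub>Q\<^esub> (\<iota> b \<otimes>\<^bsub>Q\<^esub> \<iota> r) \<oplus>\<^bsub>Q\<^esub> \<iota> z \<otimes>\<^bsub>Q\<^esub> (\<iota> z \<otimes>\<^bsub>Q\<^esub> \<iota> e)"
      unfolding r(4) using r(1-3) zc by (simp add: Q.m_assoc)
    also have "w \<otimes>\<^bsub>Q\<^esub> w \<otimes>\<^bsub>Q\<^esub> (\<iota> z \<otimes>\<^bsub>Q\<^esub> (\<iota> b \<otimes>\<^bsub>Q\<^esub> \<iota> r) \<oplus>\<^bsub>Q\<^esub> \<iota> z \<otimes>\<^bsub>Q\<^esub> (\<iota> z \<otimes>\<^bsub>Q\<^esub> \<iota> e)) =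
       (\<iota> z \<otimes>\<^bsub>Q\<^esub> w) \<otimes>\<^bsub>Q\<^esub> (\<iota> b \<otimes>\<^bsub>Q\<^esub> q) \<oplus>\<^bsub>Q\<^esub> (\<iota> z \<otimes>\<^bsub>Q\<^esub> w) \<otimes>\<^bsub>Q\<^esub> ((\<iota> z \<otimes>\<^bsub>Q\<^esub> w) \<otimes>\<^bsub>Q\<^esub> \<iota> e)"
      unfolding q_def using w(1) r(1-3) zc by (simp add: Q.m_ac Q.r_distr)
    also have "\<dots> = \<iota> e \<oplus>\<^bsub>Q\<^esub> \<iota> b \<otimes>\<^bsub>Q\<^esub> q" unfolding w(2) using r(2,3) qc by (simp add: Q.a_comm)
    finally have "integral_over R q" using quadratic_integral[OF qc r(3,2)] by blast
    then obtain s where s: "s \<in> carrier R" "\<iota> m [^]\<^bsub>Q\<^esub> k \<otimes>\<^bsub>Q\<^esub> q = \<iota> s" using k by blast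
    have "\<iota> r = \<iota> z \<otimes>\<^bsub>Q\<^esub> q" unfolding q_def using zw r(1) by simp
    also have "\<dots> = \<iota> m [^]\<^bsub>Q\<^esub> j \<otimes>\<^bsub>Q\<^esub> (\<iota> m [^]\<^bsub>Q\<^esub> k \<otimes>\<^bsub>Q\<^esub> q)"
      unfolding z_def using qc by (simp add: Q.nat_pow_mult[symmetric] Q.m_ac)
    also have "\<dots> = \<iota> (m [^] j \<otimes> s)" unfolding s(2) using s(1) by simp
    finally have "r = m [^] j \<otimes> s" by (rule iffD1[OF qemb_inj, rotated 2]) (use r(1) s(1) in simp_all)
    then show False using r(5) s(1) by blast
  qed
  then show "stable_ring R \<and> \<not> finite_int_closure R" using st by blast
qed

section \<open>Powers of nonunits under the bound on chains of primes\<close>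

context cring
begin

text \<open>Otherwise some prime \<open>P \<noteq> M\<close> contains the nonzerodivisor \<open>b\<close>; then \<open>P\<close> is not a minimal prime,
  since the multiplicative set of all \<open>b\<^sup>ns\<close> with \<open>s \<notin> P\<close> omits zero.\<close>
lemma nonunit_power_divisible:
  assumes M: "ideal (nonunits R (carrier R)) R"
    and dim: "\<not> (\<exists>P0 P1 P2. primeideal P0 R \<and> primeideal P1 R \<and> primeideal P2 R \<and> P0 \<subset> P1 \<and> P1 \<subset> P2)"
    and a: "a \<in> nonunits R (carrier R)" and b: "b \<in> nzd R"
  shows "\<exists>k::nat. \<exists>c\<in>carrier R. a [^] k = b \<otimes> c"
proof (rule ccontr)
  assume neg: "\<not> ?thesis"
  let ?M = "nonunits R (carrier R)"
  have ac: "a \<in> carrier R" and bc: "b \<in> carrier R" using a b by (auto simp: nonunits_def nzd_def)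
  let ?S = "range (\<lambda>k::nat. a [^] k)"
  have disj: "PIdl b \<inter> ?S = {}"
  proof -
    have "a [^] k \<noteq> c \<otimes> b" if "c \<in> carrier R" for k :: nat and c using neg that m_comm[OF that bc] by metis
    then have "z \<notin> ?S" if "z \<in> PIdl b" for z using that unfolding cgenideal_def by auto metis
    then show ?thesis by blast
  qed
  obtain P where P: "primeideal P R" "PIdl b \<subseteq> P" "P \<inter> ?S = {}"
  proof (rule exists_prime_avoiding[OF cgenideal_ideal[OF bc], of ?S])
    show "?S \<subseteq> carrier R" using ac by auto
    show "\<one> \<in> ?S" by (rule range_eqI[of _ _ 0]) simp
    show "x \<otimes> y \<in> ?S" if "x \<in> ?S" "y \<in> ?S" for x y
      using that ac by (auto simp: nat_pow_mult)
    show "PIdl b \<inter> ?S = {}" by (rule disj)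
  qed (rule that)
  interpret P: primeideal P R by (rule P(1))
  have one: "\<one> \<notin> P" using P.one_imp_carrier P.I_notcarr by blast
  have Pz: "\<zero> \<in> P" by (rule additive_subgroup.zero_closed[OF P.is_additive_subgroup])
  have PM: "P \<subset> ?M"
  proof
    show "P \<subseteq> ?M"
    proof
      fix x assume x: "x \<in> P"
      then have "x \<otimes> s \<noteq> \<one>" if "s \<in> carrier R" for s using P.I_r_closed[OF x that] one by auto
      then show "x \<in> ?M" using P.Icarr[OF x] by (simp add: nonunits_def)
    qed
    have "a [^] (1::nat) \<notin> P" using P(3) by blast
    then show "P \<noteq> ?M" using a ac by auto
  qed
  have Mprime: "primeideal ?M R"
  proof (rule primeidealI[OF M cring_axioms])
    have "\<one> \<notin> ?M" by (auto simp: nonunits_def)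
    then show "carrier R \<noteq> ?M" by auto
    fix x y assume xy: "x \<in> carrier R" "y \<in> carrier R" "x \<otimes> y \<in> ?M"
    show "x \<in> ?M \<or> y \<in> ?M"
    proof (rule ccontr)
      assume "\<not> ?thesis"
      then obtain s t where st: "s \<in> carrier R" "x \<otimes> s = \<one>" "t \<in> carrier R" "y \<otimes> t = \<one>" using xy
        by (auto simp: nonunits_def)
      have "(x \<otimes> y) \<otimes> (s \<otimes> t) = (x \<otimes> s) \<otimes> (y \<otimes> t)" using xy(1,2) st(1,3) by algebra
      then have "(x \<otimes> y) \<otimes> (s \<otimes> t) = \<one>" using st by simp
      then show False using xy(3) st by (auto simp: nonunits_def)
    qed
  qed
  define U where "U = {b [^] (n::nat) \<otimes> s | n s. s \<in> carrier R - P}"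
  have U_mult: "x \<otimes> y \<in> U" if xy: "x \<in> U" "y \<in> U" for x y
  proof -
    obtain n s n' s' where h: "x = b [^] (n::nat) \<otimes> s" "s \<in> carrier R - P" "y = b [^] (n'::nat) \<otimes> s'"
      "s' \<in> carrier R - P"
      using xy unfolding U_def by blast
    have "x \<otimes> y = b [^] (n + n') \<otimes> (s \<otimes> s')" using h bc by (simp add: nat_pow_mult[symmetric] m_ac)
    moreover have "s \<otimes> s' \<in> carrier R - P" using h(2,4) P.I_prime by auto
    ultimately show ?thesis unfolding U_def by blast
  qed
  have sU: "s \<in> U" if "s \<in> carrier R - P" for s
  proof -
    have "s = b [^] (0::nat) \<otimes> s" using that by simp
    then show ?thesis unfolding U_def using that by blast
  qed
  have bU: "b \<in> U"
  proof -
    have "b = b [^] (1::nat) \<otimes> \<one>" using bc by simp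
    then show ?thesis unfolding U_def using one by blast
  qed
  have zU: "\<zero> \<notin> U"
  proof
    assume "\<zero> \<in> U"
    then obtain n s where h: "\<zero> = b [^] (n::nat) \<otimes> s" "s \<in> carrier R - P" unfolding U_def by blast
    then have "s = \<zero>" using nzdD(2)[OF nzd_pow[OF b, of n]] by (metis DiffD1)
    then show False using h(2) Pz by blast
  qed
  obtain P' where P': "primeideal P' R" "{\<zero>} \<subseteq> P'" "P' \<inter> U = {}"
  proof (rule exists_prime_avoiding[OF zeroideal, of U])
    show "U \<subseteq> carrier R" using bc by (auto simp: U_def)
    show "\<one> \<in> U" using sU one by simp
    show "x \<otimes> y \<in> U" if "x \<in> U" "y \<in> U" for x y by (rule U_mult[OF that])
    show "{\<zero>} \<inter> U = {}" using zU by simp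
  qed (rule that)
  interpret P': primeideal P' R by (rule P'(1))
  \<comment> \<open>\<open>P'\<close> misses everything outside \<open>P\<close> and also
    \<open>b\<close>, which lies in \<open>P\<close>: so \<open>P'\<close>, \<open>P\<close> and the
    maximal ideal form a strict chain of three primes.\<close>
  have "P' \<subseteq> P" using sU P'(3) P'.Icarr by blast
  moreover have "b \<in> P" using P(2) cgenideal_self[OF bc] by blast
  moreover have "b \<notin> P'" using bU P'(3) by blast
  ultimately have "P' \<subset> P" by blast
  then show False using dim P(1) P'(1) Mprime PM by blast
qed

lemma nonunits_ideal:
  assumes "\<And>a b. a \<in> nonunits R (carrier R) \<Longrightarrow> b \<in> nonunits R (carrier R) \<Longrightarrow> a \<oplus> b \<in> nonunits R (carrier R)"
    and "\<one> \<noteq> \<zero>"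
  shows "ideal (nonunits R (carrier R)) R"
proof -
  have "smod R (carrier R) (nonunits R (carrier R))"
    unfolding smod_def
  proof (intro conjI ballI)
    show "nonunits R (carrier R) \<subseteq> carrier R" by (auto simp: nonunits_def)
    show "\<zero> \<in> nonunits R (carrier R)" using assms(2) by (auto simp: nonunits_def)
    show "a \<oplus> b \<in> nonunits R (carrier R)" if "a \<in> nonunits R (carrier R)" "b \<in> nonunits R (carrier R)"
      for a b
      using assms(1) that .
    show "t \<otimes> a \<in> nonunits R (carrier R)" if "t \<in> carrier R" "a \<in> nonunits R (carrier R)" for t a
      by (rule nonunits_absorb[OF carrier_is_subring that(2,1)])
  qed
  then show ?thesis using smod_ideal[OF carrier_is_subring] by (simp add: nonunits_def)
qed

lemma local_one_dimI:
  assumes loc: "\<And>a b. a \<in> nonunits R (carrier R) \<Longrightarrow> b \<in> nonunits R (carrier R) \<Longrightarrow>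
      a \<oplus> b \<in> nonunits R (carrier R)"
    and nontriv: "\<one> \<noteq> \<zero>"
    and dim: "\<not> (\<exists>P0 P1 P2. primeideal P0 R \<and> primeideal P1 R \<and> primeideal P2 R \<and> P0 \<subset> P1 \<and> P1 \<subset> P2)"
    and m: "m \<in> nonunits R (carrier R)" "m \<in> nzd R"
  shows "local_one_dim R m"
proof (intro local_one_dim.intro local_one_dim_axioms.intro cring_axioms m loc)
  have M: "ideal (nonunits R (carrier R)) R" by (rule nonunits_ideal) (fact loc, rule nontriv)
  note d = nonunit_power_divisible[OF M dim]
  show "\<exists>k::nat. \<exists>b\<in>carrier R. a [^] k = m \<otimes> b" if "a \<in> nonunits R (carrier R)" for a
    using d[OF that m(2)] .
  show "\<exists>k::nat. \<exists>c\<in>carrier R. m [^] k = b \<otimes> c" if "b \<in> nzd R" for b using d[OF m(1) that] .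
qed

text \<open>A nonunit generates a proper ideal, which a maximal ideal contains, and by uniqueness
  this is \<open>M\<close>. The lemma translates the definition of a local ring into the additivity
  of nonunits on which the locales rest.\<close>

lemma maximal_ideal_nonunits:
  assumes uniq: "\<And>N. maximalideal N R \<Longrightarrow> N = M" and M: "maximalideal M R"
  shows "nonunits R (carrier R) = M"
proof
  interpret M: maximalideal M R by (rule M)
  have one: "\<one> \<notin> M" using M.one_imp_carrier M.I_notcarr by blast
  show "M \<subseteq> nonunits R (carrier R)"
  proof
    fix x assume x: "x \<in> M"
    then have "x \<otimes> s \<noteq> \<one>" if "s \<in> carrier R" for s using M.I_r_closed[OF x that] one by auto
    then show "x \<in> nonunits R (carrier R)" using M.Icarr[OF x] by (simp add: nonunits_def)
  qed
  show "nonunits R (carrier R) \<subseteq> M"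
  proof
    fix x assume x: "x \<in> nonunits R (carrier R)"
    then have xc: "x \<in> carrier R" by (simp add: nonunits_def)
    have "s \<otimes> x \<noteq> \<one>" if "s \<in> carrier R" for s
    proof -
      have "x \<otimes> s \<noteq> \<one>" using x that by (simp add: nonunits_def)
      then show ?thesis using m_comm[OF xc that] by metis
    qed
    then have "\<one> \<notin> PIdl x" unfolding cgenideal_def by auto metis
    then have disj: "PIdl x \<inter> {\<one>} = {}" by simp
    obtain N where N: "primeideal N R" "PIdl x \<subseteq> N" "N \<inter> {\<one>} = {}"
       "\<And>J. ideal J R \<Longrightarrow> N \<subseteq> J \<Longrightarrow> J \<inter> {\<one>} = {} \<Longrightarrow> J = N"
      by (rule exists_prime_avoiding[OF cgenideal_ideal[OF xc], of "{\<one>}"]) (use disj in \<open>auto intro: that\<close>)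
    have "maximalideal N R"
    proof (rule maximalidealI[OF primeideal.axioms(1)[OF N(1)]])
      show "carrier R \<noteq> N" using N(3) by auto
      fix J assume J: "ideal J R" "N \<subseteq> J" "J \<subseteq> carrier R"
      show "J = N \<or> J = carrier R"
      proof (cases "\<one> \<in> J")
        case True then show ?thesis using ideal.one_imp_carrier[OF J(1)] by blast
      next
        case False then show ?thesis using N(4)[OF J(1,2)] by simp
      qed
    qed
    then show "x \<in> M" using uniq N(2) cgenideal_self[OF xc] by blast
  qed
qed

end

section \<open>The adic completion as a projective limit\<close>

locale adic_completion_setting = cring R for R (structure) +
  fixes m
  assumes m_nzd: "m \<in> nzd R"
begin

abbreviation I :: "nat \<Rightarrow> 'a set" where "I i \<equiv> PIdl (m [^] i)"
abbreviation "C \<equiv> adic_completion R m"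

lemma mc [simp]: "m \<in> carrier R" using nzdD(1)[OF m_nzd] .
lemma mp [simp]: "m [^] (i::nat) \<in> carrier R" by simp
lemma I_ideal: "ideal (I i) R" by (rule cgenideal_ideal) simp

lemma coset_self: "a \<in> carrier R \<Longrightarrow> a \<in> I i +> a"
proof -
  interpret J: ideal "I i" R by (rule I_ideal)
  show "a \<in> carrier R \<Longrightarrow> a \<in> I i +> a" by (rule J.a_rcos_self)
qed

lemma coset_zero: "I i +> \<zero> = I i"
proof -
  interpret J: ideal "I i" R by (rule I_ideal)
  show ?thesis by (rule J.a_rcos_const[OF additive_subgroup.zero_closed[OF J.is_additive_subgroup]])
qed

lemma I_iff: "a \<in> I i \<longleftrightarrow> (\<exists>t\<in>carrier R. a = m [^] i \<otimes> t)"
  unfolding cgenideal_def using m_comm[OF mp] by auto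

text \<open>Representatives in \<open>R\<close> of a compatible family of cosets. Every element of
  \<open>C\<close> is \<open>cls\<close> of such a sequence, so the ring laws and approximations
  below are computed with sequences in \<open>R\<close>.\<close>

definition coherent :: "(nat \<Rightarrow> 'a) \<Rightarrow> bool" where
  "coherent a \<longleftrightarrow> (\<forall>i. a i \<in> carrier R \<and> (\<exists>s\<in>carrier R. a (Suc i) = a i \<oplus> m [^] i \<otimes> s))"

definition cls :: "(nat \<Rightarrow> 'a) \<Rightarrow> nat \<Rightarrow> 'a set" where "cls a = (\<lambda>i. I i +> a i)"

lemma coherentD: "coherent a \<Longrightarrow> a i \<in> carrier R" "coherent a \<Longrightarrow> \<exists>s\<in>carrier R. a (Suc i) = a i \<oplus> m [^] i \<otimes> s"
  by (auto simp: coherent_def)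

lemma coset_eq_iff: "a \<in> carrier R \<Longrightarrow> b \<in> carrier R \<Longrightarrow> I i +> a = I i +> b \<longleftrightarrow>
  (\<exists>t\<in>carrier R. a \<ominus> b = m [^] i \<otimes> t)"
  using quotient_eq_iff_same_a_r_cos[OF I_ideal, of a b i] I_iff by simp

lemma cls_eqI:
  assumes "\<And>i. a i \<in> carrier R" "\<And>i. b i \<in> carrier R" "\<And>i. \<exists>t\<in>carrier R. a i = b i \<oplus> m [^] i \<otimes> t"
  shows "cls a = cls b"
  unfolding cls_def
proof
  fix i
  obtain t where t: "t \<in> carrier R" "a i = b i \<oplus> m [^] i \<otimes> t" using assms(3) by blast
  have "a i \<ominus> b i = m [^] i \<otimes> t" unfolding t(2) using assms(2)[of i] t(1) mp[of i] by algebra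
  then show "I i +> a i = I i +> b i" using coset_eq_iff assms(1,2) t(1) by blast
qed

lemma cls_eqD: "cls a = cls b \<Longrightarrow> a i \<in> carrier R \<Longrightarrow> b i \<in> carrier R \<Longrightarrow> \<exists>t\<in>carrier R. a i \<ominus> b i = m [^] i \<otimes> t"
  by (drule fun_cong[of _ _ i]) (simp add: cls_def coset_eq_iff)

lemma cls_closed:
  assumes a: "coherent a" shows "cls a \<in> carrier C"
proof -
  have "I (Suc i) +> a (Suc i) \<subseteq> I i +> a i" for i
  proof
    fix z assume "z \<in> I (Suc i) +> a (Suc i)"
    then obtain h where h: "h \<in> I (Suc i)" "z = h \<oplus> a (Suc i)" unfolding a_r_coset_def' by blast
    obtain t where t: "t \<in> carrier R" "h = m [^] (Suc i) \<otimes> t" using h(1) unfolding I_iff by blast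
    obtain s where s: "s \<in> carrier R" "a (Suc i) = a i \<oplus> m [^] i \<otimes> s" using coherentD(2)[OF a] by blast
    have "z = m [^] i \<otimes> (m \<otimes> t \<oplus> s) \<oplus> a i"
      unfolding h(2) t(2) s(2) nat_pow_Suc using t(1) s(1) coherentD(1)[OF a, of i] mc mp[of i] by algebra
    moreover have "m [^] i \<otimes> (m \<otimes> t \<oplus> s) \<in> I i"
      unfolding I_iff by (rule bexI[of _ "m \<otimes> t \<oplus> s"]) (use t(1) s(1) in simp_all)
    ultimately show "z \<in> I i +> a i" unfolding a_r_coset_def' by blast
  qed
  moreover have "I i +> a i \<in> carrier (R Quot I i)" for i
    using coherentD(1)[OF a] unfolding FactRing_def A_RCOSETS_def' by auto
  ultimately show ?thesis unfolding adic_completion_def cls_def by simp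
qed

lemma carrierE:
  assumes "f \<in> carrier C"
  obtains a where "coherent a" "f = cls a"
proof -
  have f: "\<And>i. f i \<in> carrier (R Quot I i)" "\<And>i. f (Suc i) \<subseteq> f i" using assms
    by (auto simp: adic_completion_def)
  have "\<exists>a\<in>carrier R. f i = I i +> a" for i using f(1)[of i] unfolding FactRing_def A_RCOSETS_def' by auto
  then obtain a where a: "\<And>i. a i \<in> carrier R" "\<And>i. f i = I i +> a i" by metis
  have "\<exists>s\<in>carrier R. a (Suc i) = a i \<oplus> m [^] i \<otimes> s" for i
  proof -
    have "a (Suc i) \<in> f (Suc i)" unfolding a(2) by (rule coset_self[OF a(1)])
    then have "a (Suc i) \<in> I i +> a i" using f(2) a(2) by blast
    then obtain h where h: "h \<in> I i" "a (Suc i) = h \<oplus> a i" unfolding a_r_coset_def' by blast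
    obtain t where t: "t \<in> carrier R" "h = m [^] i \<otimes> t" using h(1) unfolding I_iff by blast
    have "a (Suc i) = a i \<oplus> m [^] i \<otimes> t" unfolding h(2) t(2) using t(1) a(1) by (simp add: a_comm)
    then show ?thesis using t(1) by blast
  qed
  then have "coherent a" using a(1) by (simp add: coherent_def)
  moreover have "f = cls a" unfolding cls_def using a(2) by blast
  ultimately show ?thesis using that by blast
qed

lemma coherent_ops:
  assumes a: "coherent a" and b: "coherent b"
  shows "coherent (\<lambda>i. a i \<oplus> b i)" "coherent (\<lambda>i. a i \<otimes> b i)" "coherent (\<lambda>i. \<ominus> a i)"
proof -
  have "(\<exists>s\<in>carrier R. a (Suc i) \<oplus> b (Suc i) = a i \<oplus> b i \<oplus> m [^] i \<otimes> s) \<and>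
    (\<exists>s\<in>carrier R. a (Suc i) \<otimes> b (Suc i) = a i \<otimes> b i \<oplus> m [^] i \<otimes> s) \<and>
    (\<exists>s\<in>carrier R. \<ominus> a (Suc i) = \<ominus> a i \<oplus> m [^] i \<otimes> s)" for i
  proof -
    obtain s where s: "s \<in> carrier R" "a (Suc i) = a i \<oplus> m [^] i \<otimes> s" using coherentD(2)[OF a] by blast
    obtain t where t: "t \<in> carrier R" "b (Suc i) = b i \<oplus> m [^] i \<otimes> t" using coherentD(2)[OF b] by blast
    note c = s(1) t(1) coherentD(1)[OF a, of i] coherentD(1)[OF b, of i] mp[of i]
    have "a (Suc i) \<oplus> b (Suc i) = a i \<oplus> b i \<oplus> m [^] i \<otimes> (s \<oplus> t)" unfolding s(2) t(2) using c by algebra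
    moreover have "a (Suc i) \<otimes> b (Suc i) = a i \<otimes> b i \<oplus> m [^] i \<otimes> (a i \<otimes> t \<oplus> s \<otimes> b i \<oplus> m [^] i \<otimes> s \<otimes> t)"
      unfolding s(2) t(2) using c by algebra
    moreover have "\<ominus> a (Suc i) = \<ominus> a i \<oplus> m [^] i \<otimes> (\<ominus> s)" unfolding s(2) using c by algebra
    moreover have "s \<oplus> t \<in> carrier R" "a i \<otimes> t \<oplus> s \<otimes> b i \<oplus> m [^] i \<otimes> s \<otimes> t \<in> carrier R" "\<ominus> s \<in> carrier R"
      using c by simp_all
    ultimately show ?thesis by blast
  qed
  then show "coherent (\<lambda>i. a i \<oplus> b i)" "coherent (\<lambda>i. a i \<otimes> b i)" "coherent (\<lambda>i. \<ominus> a i)"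
    unfolding coherent_def using coherentD(1)[OF a] coherentD(1)[OF b] by auto
qed

lemma coherent_const: "r \<in> carrier R \<Longrightarrow> coherent (\<lambda>_. r)"
  unfolding coherent_def by (intro allI conjI bexI[of _ \<zero>]) simp_all

lemma cls_add: "coherent a \<Longrightarrow> coherent b \<Longrightarrow> cls a \<oplus>\<^bsub>C\<^esub> cls b = cls (\<lambda>i. a i \<oplus> b i)"
  and cls_mult: "coherent a \<Longrightarrow> coherent b \<Longrightarrow> cls a \<otimes>\<^bsub>C\<^esub> cls b = cls (\<lambda>i. a i \<otimes> b i)"
  and cls_one: "\<one>\<^bsub>C\<^esub> = cls (\<lambda>_. \<one>)" and cls_zero: "\<zero>\<^bsub>C\<^esub> = cls (\<lambda>_. \<zero>)"
proof -
  show "cls a \<oplus>\<^bsub>C\<^esub> cls b = cls (\<lambda>i. a i \<oplus> b i)" if "coherent a" "coherent b"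
    using ring_hom_add[OF ideal.rcos_ring_hom[OF I_ideal] coherentD(1)[OF that(1)] coherentD(1)[OF that(2)]]
    by (simp add: adic_completion_def cls_def)
  show "cls a \<otimes>\<^bsub>C\<^esub> cls b = cls (\<lambda>i. a i \<otimes> b i)" if "coherent a" "coherent b"
    using ring_hom_mult[OF ideal.rcos_ring_hom[OF I_ideal] coherentD(1)[OF that(1)] coherentD(1)[OF
    that(2)]]
    by (simp add: adic_completion_def cls_def)
  show "\<one>\<^bsub>C\<^esub> = cls (\<lambda>_. \<one>)"
    using ring_hom_one[OF ideal.rcos_ring_hom[OF I_ideal]] by (simp add: adic_completion_def cls_def)
  show "\<zero>\<^bsub>C\<^esub> = cls (\<lambda>_. \<zero>)" by (simp add: adic_completion_def cls_def FactRing_def coset_zero)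
qed

lemma completion_cring: "cring C"
proof -
  note cl = coherent_ops
  show ?thesis
  proof (rule cringI)
    show "abelian_group C"
    proof (rule abelian_groupI)
      fix x y z assume "x \<in> carrier C" "y \<in> carrier C" "z \<in> carrier C"
      then obtain a b c where h: "coherent a" "x = cls a" "coherent b" "y = cls b" "coherent c" "z = cls c"
        by (metis carrierE)
      note hc = coherentD(1)[OF h(1)] coherentD(1)[OF h(3)] coherentD(1)[OF h(5)]
      show "x \<oplus>\<^bsub>C\<^esub> y \<in> carrier C" using h cls_add cl cls_closed by simp
      show "x \<oplus>\<^bsub>C\<^esub> y \<oplus>\<^bsub>C\<^esub> z = x \<oplus>\<^bsub>C\<^esub> (y \<oplus>\<^bsub>C\<^esub> z)" using h hc by (simp add: cls_add cl a_assoc)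
      show "x \<oplus>\<^bsub>C\<^esub> y = y \<oplus>\<^bsub>C\<^esub> x" using h hc by (simp add: cls_add a_comm)
      show "\<zero>\<^bsub>C\<^esub> \<oplus>\<^bsub>C\<^esub> x = x" using h hc coherent_const[OF zero_closed] by (simp add: cls_zero cls_add)
      have "cls (\<lambda>i. \<ominus> a i) \<oplus>\<^bsub>C\<^esub> x = \<zero>\<^bsub>C\<^esub>" using h hc by (simp add: cls_zero cls_add cl l_neg)
      then show "\<exists>y\<in>carrier C. y \<oplus>\<^bsub>C\<^esub> x = \<zero>\<^bsub>C\<^esub>" using cls_closed[OF cl(3)[OF h(1,1)]] by blast
    qed (use cls_zero cls_closed[OF coherent_const] in simp)
    show "Group.comm_monoid C"
    proof (rule comm_monoidI)
      fix x y z assume "x \<in> carrier C" "y \<in> carrier C" "z \<in> carrier C"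
      then obtain a b c where h: "coherent a" "x = cls a" "coherent b" "y = cls b" "coherent c" "z = cls c"
        by (metis carrierE)
      note hc = coherentD(1)[OF h(1)] coherentD(1)[OF h(3)] coherentD(1)[OF h(5)]
      show "x \<otimes>\<^bsub>C\<^esub> y \<in> carrier C" using h cls_mult cl cls_closed by simp
      show "x \<otimes>\<^bsub>C\<^esub> y \<otimes>\<^bsub>C\<^esub> z = x \<otimes>\<^bsub>C\<^esub> (y \<otimes>\<^bsub>C\<^esub> z)" using h hc by (simp add: cls_mult cl m_assoc)
      show "x \<otimes>\<^bsub>C\<^esub> y = y \<otimes>\<^bsub>C\<^esub> x" using h hc by (simp add: cls_mult m_comm)
      show "\<one>\<^bsub>C\<^esub> \<otimes>\<^bsub>C\<^esub> x = x" using h hc coherent_const[OF one_closed] by (simp add: cls_one cls_mult)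
    qed (use cls_one cls_closed[OF coherent_const] in simp)
    fix x y z assume "x \<in> carrier C" "y \<in> carrier C" "z \<in> carrier C"
    then obtain a b c where h: "coherent a" "x = cls a" "coherent b" "y = cls b" "coherent c" "z = cls c"
      by (metis carrierE)
    note hc = coherentD(1)[OF h(1)] coherentD(1)[OF h(3)] coherentD(1)[OF h(5)]
    show "(x \<oplus>\<^bsub>C\<^esub> y) \<otimes>\<^bsub>C\<^esub> z = x \<otimes>\<^bsub>C\<^esub> z \<oplus>\<^bsub>C\<^esub> y \<otimes>\<^bsub>C\<^esub> z"
      using h hc by (simp add: cls_mult cls_add cl l_distr)
  qed
qed

definition emb :: "'a \<Rightarrow> nat \<Rightarrow> 'a set" where "emb r = cls (\<lambda>_. r)"

lemma emb_hom: "emb \<in> ring_hom R C"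
  by (rule ring_hom_memI) (auto simp: emb_def cls_closed coherent_const cls_add cls_mult cls_one)

lemma emb_pow: "emb m [^]\<^bsub>C\<^esub> i = emb (m [^] i)" for i :: nat
proof -
  interpret h: ring_hom_cring R C emb
    by (intro ring_hom_cring.intro ring_hom_cring_axioms.intro cring_axioms completion_cring emb_hom)
  show ?thesis by (induction i) simp_all
qed

lemma coherent_tail:
  assumes a: "coherent a"
  shows "\<exists>t\<in>carrier R. a (i + j) = a i \<oplus> m [^] i \<otimes> t"
proof (induction j)
  case 0
  have "a (i + 0) = a i \<oplus> m [^] i \<otimes> \<zero>" using coherentD(1)[OF a] by simp
  then show ?case by blast
next
  case (Suc j)
  then obtain t where t: "t \<in> carrier R" "a (i + j) = a i \<oplus> m [^] i \<otimes> t" by blast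
  obtain s where s: "s \<in> carrier R" "a (Suc (i + j)) = a (i + j) \<oplus> m [^] (i + j) \<otimes> s"
    using coherentD(2)[OF a] by blast
  have "a (i + Suc j) = a i \<oplus> m [^] i \<otimes> (t \<oplus> m [^] j \<otimes> s)"
    using s t coherentD(1)[OF a] by (simp add: nat_pow_mult[symmetric] r_distr a_assoc m_assoc)
  then show ?case using s(1) t(1) by (metis a_closed m_closed mp)
qed

lemma pow_cancel: "a \<in> carrier R \<Longrightarrow> b \<in> carrier R \<Longrightarrow> m [^] (i::nat) \<otimes> a = m [^] i \<otimes> b \<Longrightarrow> a = b"
  using nzd_cancel[OF nzd_pow[OF m_nzd]] by blast

text \<open>The difference of \<open>a (i + j)\<close> and \<open>a i\<close> is
  \<open>m^i t j\<close>, and because \<open>m\<close> is a nonzerodivisor the \<open>t j\<close>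
  are again coherent. Their class is the cofactor \<open>d\<close>, so the kernel of the map from
  \<open>C\<close> to \<open>R/m^i R\<close> is \<open>m^i C\<close>.\<close>

lemma cls_approx:
  assumes a: "coherent a"
  shows "\<exists>d\<in>carrier C. cls a = emb (a i) \<oplus>\<^bsub>C\<^esub> emb m [^]\<^bsub>C\<^esub> i \<otimes>\<^bsub>C\<^esub> d"
proof -
  note ac = coherentD(1)[OF a]
  obtain t where t: "\<And>j. t j \<in> carrier R" "\<And>j. a (i + j) = a i \<oplus> m [^] i \<otimes> t j" using coherent_tail[OF a]
    by metis
  have ct: "coherent t" unfolding coherent_def
  proof (intro allI conjI t(1))
    fix j
    obtain s where s: "s \<in> carrier R" "a (Suc (i + j)) = a (i + j) \<oplus> m [^] (i + j) \<otimes> s"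
      using coherentD(2)[OF a] by blast
    have "a i \<oplus> m [^] i \<otimes> t (Suc j) = a i \<oplus> m [^] i \<otimes> (t j \<oplus> m [^] j \<otimes> s)"
      using t(2)[of "Suc j"] s(2) t(2)[of j] t(1) s(1) ac
      by (simp add: nat_pow_mult[symmetric] r_distr a_assoc m_assoc)
    then have "m [^] i \<otimes> t (Suc j) = m [^] i \<otimes> (t j \<oplus> m [^] j \<otimes> s)" using t(1) s(1) ac by simp
    then have "t (Suc j) = t j \<oplus> m [^] j \<otimes> s" by (rule pow_cancel[rotated 2]) (use t(1) s(1) in simp_all)
    then show "\<exists>s\<in>carrier R. t (Suc j) = t j \<oplus> m [^] j \<otimes> s" using s(1) by blast
  qed
  have c1: "coherent (\<lambda>j. m [^] i \<otimes> t j)" by (rule coherent_ops(2)[OF coherent_const ct]) simp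
  have "emb (a i) \<oplus>\<^bsub>C\<^esub> emb m [^]\<^bsub>C\<^esub> i \<otimes>\<^bsub>C\<^esub> cls t = cls (\<lambda>j. a i \<oplus> m [^] i \<otimes> t j)"
    unfolding emb_pow unfolding emb_def
    using cls_mult[OF coherent_const ct] cls_add[OF coherent_const c1] ac by simp
  also have "\<dots> = cls a"
  proof (rule cls_eqI)
    fix j
    show "a i \<oplus> m [^] i \<otimes> t j \<in> carrier R" "a j \<in> carrier R" using ac t(1) by simp_all
    \<comment> \<open>The sequence obtained is the shift \<open>a (i + j)\<close>; coherence makes
      it agree with \<open>a j\<close> modulo \<open>m^j\<close>, so both have the same
      class.\<close>
    show "\<exists>s\<in>carrier R. a i \<oplus> m [^] i \<otimes> t j = a j \<oplus> m [^] j \<otimes> s"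
      unfolding t(2)[symmetric] using coherent_tail[OF a, of j i] by (simp add: add.commute)
  qed
  finally show ?thesis using cls_closed[OF ct] by metis
qed

lemma emb_mult_component:
  assumes c: "coherent c" and d: "coherent d" and eq: "cls c = emb m [^]\<^bsub>C\<^esub> i \<otimes>\<^bsub>C\<^esub> cls d"
  shows "\<exists>s\<in>carrier R. c i = m [^] i \<otimes> s"
proof -
  have cd: "cls c = cls (\<lambda>j. m [^] i \<otimes> d j)"
    using eq unfolding emb_pow unfolding emb_def using cls_mult[OF coherent_const d] by simp
  note cc = coherentD(1)[OF c, of i] coherentD(1)[OF d, of i]
  obtain t where t: "t \<in> carrier R" "c i \<ominus> m [^] i \<otimes> d i = m [^] i \<otimes> t" using cls_eqD[OF cd] cc by fastforce
  have "c i = (c i \<ominus> m [^] i \<otimes> d i) \<oplus> m [^] i \<otimes> d i" using cc mp[of i] by algebra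
  also have "\<dots> = m [^] i \<otimes> (t \<oplus> d i)" unfolding t(2) using cc t(1) by (simp add: r_distr)
  finally show ?thesis using cc t(1) by blast
qed

lemma completion_adic_hom: "adic_hom R C emb m"
proof (intro adic_hom.intro adic_hom_axioms.intro cring_axioms completion_cring emb_hom mc)
  show "\<exists>r\<in>carrier R. \<exists>d\<in>carrier C. c = emb r \<oplus>\<^bsub>C\<^esub> emb m [^]\<^bsub>C\<^esub> i \<otimes>\<^bsub>C\<^esub> d" if "c \<in> carrier C" for c and i :: nat
    using that cls_approx coherentD(1) by (metis carrierE)
  show "\<exists>s\<in>carrier R. r = m [^] i \<otimes> s" if h: "r \<in> carrier R" "d \<in> carrier C" "emb r = emb m [^]\<^bsub>C\<^esub> i \<otimes>\<^bsub>C\<^esub> d"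
    for r d and i :: nat
  proof -
    obtain b where b: "coherent b" "d = cls b" using h(2) by (rule carrierE)
    show ?thesis using emb_mult_component[OF coherent_const[OF h(1)] b(1), of i] h(3) b(2)
      by (simp add: emb_def)
  qed
  show "c = \<zero>\<^bsub>C\<^esub>" if h: "c \<in> carrier C" "\<And>i::nat. \<exists>d\<in>carrier C. c = emb m [^]\<^bsub>C\<^esub> i \<otimes>\<^bsub>C\<^esub> d" for c
  proof -
    obtain a where a: "coherent a" "c = cls a" using h(1) by (rule carrierE)
    have "cls a = cls (\<lambda>_. \<zero>)"
    proof (rule cls_eqI)
      fix i :: nat
      obtain d where d: "d \<in> carrier C" "c = emb m [^]\<^bsub>C\<^esub> i \<otimes>\<^bsub>C\<^esub> d" using h(2)[of i] by (rule bexE)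
      obtain b where b: "coherent b" "d = cls b" using d(1) by (rule carrierE)
      have "\<exists>s\<in>carrier R. a i = m [^] i \<otimes> s"
        by (rule emb_mult_component[OF a(1) b(1)]) (use d(2) a(2) b(2) in simp)
      then show "\<exists>t\<in>carrier R. a i = \<zero> \<oplus> m [^] i \<otimes> t" by auto
    qed (use coherentD(1)[OF a(1)] in simp_all)
    then show ?thesis using a(2) cls_zero by simp
  qed
  show "\<exists>c\<in>carrier C. \<forall>i. \<exists>d\<in>carrier C. c = emb (f i) \<oplus>\<^bsub>C\<^esub> emb m [^]\<^bsub>C\<^esub> i \<otimes>\<^bsub>C\<^esub> d"
    if "\<And>i. f i \<in> carrier R" "\<And>i. \<exists>s\<in>carrier R. f (Suc i) = f i \<oplus> m [^] i \<otimes> s" for f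
  proof -
    have c: "coherent f" using that by (simp add: coherent_def)
    show ?thesis using cls_closed[OF c] cls_approx[OF c] by blast
  qed
qed

end

text \<open>Elements of \<open>J\<close> are divisible by all powers of \<open>x\<close>, so their
  images vanish in the separated ring \<open>C\<close> and \<open>\<phi>\<close> factors through the
  quotient; the value is independent of the representative picked by \<open>SOME\<close>. For
  \<open>complete\<close>, a congruence modulo \<open>J\<close> is absorbed into the multiple of
  \<open>x^i\<close>.\<close>

lemma (in adic_hom) adic_hom_quotient:
  assumes J: "ideal J R" and J_div: "\<And>j i. j \<in> J \<Longrightarrow> \<exists>s\<in>carrier R. j = x [^] (i::nat) \<otimes> s"
  shows "adic_hom (R Quot J) C (\<lambda>Z. \<phi> (SOME r. r \<in> Z)) (J +> x)"
proof -
  interpret J: ideal J R by (rule J)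
  let ?S = "R Quot J" and ?p = "\<lambda>r. J +> r" and ?f = "\<lambda>Z. \<phi> (SOME r. r \<in> Z)"
  interpret p: ring_hom_cring R ?S ?p by (rule J.rcos_ring_hom_cring[OF R.cring_axioms])
  have zero: "\<phi> j = \<zero>\<^bsub>C\<^esub>" if j: "j \<in> J" for j
  proof (rule separated)
    show "\<phi> j \<in> carrier C" using J.Icarr[OF j] by simp
    fix i :: nat
    obtain s where "s \<in> carrier R" "j = x [^] i \<otimes> s" using J_div[OF j, of i] by (rule bexE)
    then show "\<exists>d\<in>carrier C. \<phi> j = X i \<otimes>\<^bsub>C\<^esub> d" using phi_pow by (intro bexI[of _ "\<phi> s"]) simp_all
  qed
  have f: "?f (?p r) = \<phi> r" if r: "r \<in> carrier R" for r
  proof -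
    have "(SOME r'. r' \<in> J +> r) \<in> J +> r" using J.a_rcos_self[OF r] by (rule someI)
    then obtain j where j: "j \<in> J" "(SOME r'. r' \<in> J +> r) = j \<oplus> r" unfolding a_r_coset_def' by blast
    show ?thesis unfolding j(2) using zero[OF j(1)] J.Icarr[OF j(1)] r by simp
  qed
  have elt: "\<exists>r\<in>carrier R. Z = ?p r" if "Z \<in> carrier ?S" for Z
    using that unfolding FactRing_def A_RCOSETS_def' by auto
  have pow: "(?p x) [^]\<^bsub>?S\<^esub> i = ?p (x [^] i)" for i :: nat
    using x by (induction i) simp_all
  have fx: "?f (?p x) = \<phi> x" using f x by blast
  have congJ: "a \<ominus> b \<in> J" if "a \<in> carrier R" "b \<in> carrier R" "?p a = ?p b" for a b
    using R.quotient_eq_iff_same_a_r_cos[OF J that(1,2)] that(3) by simp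
  show ?thesis
  proof (intro adic_hom.intro adic_hom_axioms.intro p.S.cring_axioms C.cring_axioms)
    show "?f \<in> ring_hom ?S C"
    proof (rule ring_hom_memI)
      fix Y assume Y: "Y \<in> carrier ?S"
      obtain r where r: "r \<in> carrier R" "Y = ?p r" using elt[OF Y] by blast
      show "?f Y \<in> carrier C" unfolding r(2) f[OF r(1)] using r(1) by simp
      fix Z assume Z: "Z \<in> carrier ?S"
      obtain s where s: "s \<in> carrier R" "Z = ?p s" using elt[OF Z] by blast
      have "Y \<otimes>\<^bsub>?S\<^esub> Z = ?p (r \<otimes> s)" "Y \<oplus>\<^bsub>?S\<^esub> Z = ?p (r \<oplus> s)" using r s by simp_all
      then show "?f (Y \<otimes>\<^bsub>?S\<^esub> Z) = ?f Y \<otimes>\<^bsub>C\<^esub> ?f Z" "?f (Y \<oplus>\<^bsub>?S\<^esub> Z) = ?f Y \<oplus>\<^bsub>C\<^esub> ?f Z"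
        unfolding r(2) s(2) f[OF r(1)] f[OF s(1)] using f[of "r \<otimes> s"] f[of "r \<oplus> s"] r(1) s(1) by simp_all
    next
      have "\<one>\<^bsub>?S\<^esub> = ?p \<one>" by simp
      then show "?f \<one>\<^bsub>?S\<^esub> = \<one>\<^bsub>C\<^esub>" using f[OF R.one_closed] by simp
    qed
    show "?p x \<in> carrier ?S" using x by simp
    show "\<exists>r\<in>carrier ?S. \<exists>d\<in>carrier C. c = ?f r \<oplus>\<^bsub>C\<^esub> ?f (?p x) [^]\<^bsub>C\<^esub> i \<otimes>\<^bsub>C\<^esub> d" if c: "c \<in> carrier C"
      for c and i :: nat
    proof -
      obtain r d where r: "r \<in> carrier R" "d \<in> carrier C" "c = \<phi> r \<oplus>\<^bsub>C\<^esub> X i \<otimes>\<^bsub>C\<^esub> d" by (rule dense_le[OF c])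
      then have "c = ?f (?p r) \<oplus>\<^bsub>C\<^esub> ?f (?p x) [^]\<^bsub>C\<^esub> i \<otimes>\<^bsub>C\<^esub> d" unfolding f[OF r(1)] fx by blast
      then show ?thesis using p.hom_closed[OF r(1)] r(2) by blast
    qed
    show "\<exists>s\<in>carrier ?S. Z = (?p x) [^]\<^bsub>?S\<^esub> i \<otimes>\<^bsub>?S\<^esub> s"
      if Z: "Z \<in> carrier ?S" and d: "d \<in> carrier C" and eq: "?f Z = ?f (?p x) [^]\<^bsub>C\<^esub> i \<otimes>\<^bsub>C\<^esub> d"
        for Z d and i :: nat
    proof -
      obtain r where r: "r \<in> carrier R" "Z = ?p r" using elt[OF Z] by blast
      have "\<phi> r = X i \<otimes>\<^bsub>C\<^esub> d" using eq unfolding r(2) f[OF r(1)] fx .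
      then obtain s where s: "s \<in> carrier R" "r = x [^] i \<otimes> s" using exact[OF r(1) d] by blast
      have "Z = (?p x) [^]\<^bsub>?S\<^esub> i \<otimes>\<^bsub>?S\<^esub> ?p s" unfolding r(2) s(2) pow using s(1) by simp
      then show ?thesis using p.hom_closed[OF s(1)] by blast
    qed
    show "c = \<zero>\<^bsub>C\<^esub>" if c: "c \<in> carrier C" "\<And>i::nat. \<exists>d\<in>carrier C. c = ?f (?p x) [^]\<^bsub>C\<^esub> i \<otimes>\<^bsub>C\<^esub> d" for c
      using separated[OF c(1)] c(2) unfolding fx by blast
    show "\<exists>c\<in>carrier C. \<forall>i. \<exists>d\<in>carrier C. c = ?f (g i) \<oplus>\<^bsub>C\<^esub> ?f (?p x) [^]\<^bsub>C\<^esub> i \<otimes>\<^bsub>C\<^esub> d"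
      if g: "\<And>i. g i \<in> carrier ?S" and coh: "\<And>i. \<exists>s\<in>carrier ?S. g (Suc i) = g i \<oplus>\<^bsub>?S\<^esub> (?p x) [^]\<^bsub>?S\<^esub> i \<otimes>\<^bsub>?S\<^esub> s"
        for g
    proof -
      obtain r where r: "\<And>i. r i \<in> carrier R" "\<And>i. g i = ?p (r i)" using elt[OF g] by metis
      have rc: "\<exists>s\<in>carrier R. r (Suc i) = r i \<oplus> x [^] i \<otimes> s" for i
      proof -
        obtain Y where Y: "Y \<in> carrier ?S" "g (Suc i) = g i \<oplus>\<^bsub>?S\<^esub> (?p x) [^]\<^bsub>?S\<^esub> i \<otimes>\<^bsub>?S\<^esub> Y" using coh[of i]
          by (rule bexE)
        obtain s where s: "s \<in> carrier R" "Y = ?p s" using elt[OF Y(1)] by blast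
        have c: "r i \<oplus> x [^] i \<otimes> s \<in> carrier R" using r(1) s(1) by simp
        have "?p (r (Suc i)) = ?p (r i \<oplus> x [^] i \<otimes> s)"
          using Y(2) unfolding r(2) s(2) pow using r(1) s(1) by simp
        then have dJ: "r (Suc i) \<ominus> (r i \<oplus> x [^] i \<otimes> s) \<in> J" using congJ[OF r(1) c] by blast
        obtain t where t: "t \<in> carrier R" "r (Suc i) \<ominus> (r i \<oplus> x [^] i \<otimes> s) = x [^] i \<otimes> t"
          using J_div[OF dJ, of i] by (rule bexE)
        have "r (Suc i) = (r i \<oplus> x [^] i \<otimes> s) \<oplus> (r (Suc i) \<ominus> (r i \<oplus> x [^] i \<otimes> s))"
          using r(1)[of "Suc i"] c by algebra
        also have "\<dots> = r i \<oplus> x [^] i \<otimes> (s \<oplus> t)" unfolding t(2) using r(1) s(1) t(1)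
          by (simp add: R.r_distr R.a_assoc)
        finally show ?thesis using s(1) t(1) by blast
      qed
      show ?thesis unfolding r(2) f[OF r(1)] fx by (rule complete[OF r(1) rc])
    qed
  qed
qed

theorem theorem4p7:
  fixes R :: "'a ring" and M :: "'a set" and m :: 'a
  assumes "local_ring R" and "maximalideal M R" and "krull_dim_one R"
    and "M \<inter> nzd R \<noteq> {}"
    and "m \<in> M" and "m \<in> nzd R"
  defines "J \<equiv> (\<Inter>i\<in>{1..}. PIdl\<^bsub>R\<^esub> (m [^]\<^bsub>R\<^esub> (i::nat)))"
  shows "((stable_ring R \<and> \<not> finite_int_closure R)
           \<longleftrightarrow> (stable_ring (R Quot J) \<and> \<not> finite_int_closure (R Quot J)))
         \<and> ((stable_ring R \<and> \<not> finite_int_closure R)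
           \<longleftrightarrow> (\<exists>P. primeideal P (adic_completion R m) \<and> P \<noteq> {\<zero>\<^bsub>adic_completion R m\<^esub>} \<and>
                   ideal_prod (adic_completion R m) P P = {\<zero>\<^bsub>adic_completion R m\<^esub>} \<and>
                   DVR (adic_completion R m Quot P)))"
proof -
  interpret R: cring R using assms(1) by (simp add: local_ring_def)
  interpret M: maximalideal M R by (rule assms(2))
  let ?n = "nonunits R (carrier R)"
  have nM: "?n = M"
    using assms(1,2) R.maximal_ideal_nonunits[of M] unfolding local_ring_def by blast
  have one_M: "\<one>\<^bsub>R\<^esub> \<notin> M" using M.one_imp_carrier M.I_notcarr by blast
  have zero_M: "\<zero>\<^bsub>R\<^esub> \<in> M" by (rule additive_subgroup.zero_closed[OF M.is_additive_subgroup])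
  have add_M: "a \<oplus>\<^bsub>R\<^esub> b \<in> M" if "a \<in> M" "b \<in> M" for a b
    using additive_subgroup.a_closed[OF M.is_additive_subgroup that] .
  have dim: "\<not> (\<exists>P0 P1 P2. primeideal P0 R \<and> primeideal P1 R \<and> primeideal P2 R \<and> P0 \<subset> P1 \<and> P1 \<subset> P2)"
    using assms(3) unfolding krull_dim_one_def by (rule conjunct2)
  have L: "local_one_dim R m"
  proof (rule R.local_one_dimI[OF _ _ dim _ assms(6)])
    show "a \<oplus>\<^bsub>R\<^esub> b \<in> ?n" if "a \<in> ?n" "b \<in> ?n" for a b using that add_M unfolding nM by blast
    show "\<one>\<^bsub>R\<^esub> \<noteq> \<zero>\<^bsub>R\<^esub>" using one_M zero_M by metis
    show "m \<in> ?n" unfolding nM by (rule assms(5))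
  qed
  interpret A: adic_completion_setting R m
    by (intro adic_completion_setting.intro adic_completion_setting_axioms.intro R.cring_axioms assms(6))
  have J_iff: "r \<in> J \<longleftrightarrow> (\<forall>i\<ge>1. \<exists>s\<in>carrier R. r = m [^]\<^bsub>R\<^esub> (i::nat) \<otimes>\<^bsub>R\<^esub> s)" for r
    unfolding J_def using A.I_iff by auto
  have J: "ideal J R"
  proof -
    have "ideal (\<Inter> ((\<lambda>i::nat. PIdl\<^bsub>R\<^esub> (m [^]\<^bsub>R\<^esub> i)) ` {1..})) R"
      by (rule R.i_Intersect) (use A.I_ideal in auto)
    then show ?thesis by (simp add: J_def)
  qed
  interpret J: ideal J R by (rule J)
  let ?S = "R Quot J"
  let ?p = "\<lambda>r. J +>\<^bsub>R\<^esub> r"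
  \<comment> \<open>The exponent \<open>i = 0\<close>, outside the range of the intersection, is
    added because \<open>adic_hom_quotient\<close> asks for all exponents.\<close>
  have J_div: "\<exists>s\<in>carrier R. j = m [^]\<^bsub>R\<^esub> (i::nat) \<otimes>\<^bsub>R\<^esub> s" if "j \<in> J" for j i
  proof (cases "i \<ge> 1")
    case True then show ?thesis using that J_iff by blast
  next
    case False
    then have "i = 0" by simp
    then have "j = m [^]\<^bsub>R\<^esub> i \<otimes>\<^bsub>R\<^esub> j" using J.Icarr[OF that] by simp
    then show ?thesis using J.Icarr[OF that] by blast
  qed
  have JM: "J \<subseteq> M"
  proof
    fix j assume "j \<in> J"
    then obtain s where s: "s \<in> carrier R" "j = m [^]\<^bsub>R\<^esub> (1::nat) \<otimes>\<^bsub>R\<^esub> s" using J_div by blast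
    then show "j \<in> M" using M.I_r_closed[OF assms(5) s(1)] M.Icarr[OF assms(5)] by simp
  qed
  interpret p: ring_hom_cring R ?S ?p by (rule J.rcos_ring_hom_cring[OF R.cring_axioms])
  have elt: "\<exists>r\<in>carrier R. Z = ?p r" if "Z \<in> carrier ?S" for Z
    using that unfolding FactRing_def A_RCOSETS_def' by auto
  have cong: "?p a = ?p b \<longleftrightarrow> a \<ominus>\<^bsub>R\<^esub> b \<in> J" if "a \<in> carrier R" "b \<in> carrier R" for a b
    using R.quotient_eq_iff_same_a_r_cos[OF J that] by simp
  have zero: "?p a = \<zero>\<^bsub>?S\<^esub> \<longleftrightarrow> a \<in> J" if "a \<in> carrier R" for a
    using cong[OF that R.zero_closed] that by (simp add: R.minus_eq)
  have nonunit_iff: "?p a \<in> nonunits ?S (carrier ?S) \<longleftrightarrow> a \<in> M" if a: "a \<in> carrier R" for a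
  proof
    assume n: "?p a \<in> nonunits ?S (carrier ?S)"
    show "a \<in> M"
    proof (rule ccontr)
      assume "a \<notin> M"
      then obtain b where b: "b \<in> carrier R" "a \<otimes>\<^bsub>R\<^esub> b = \<one>\<^bsub>R\<^esub>" using a nM by (auto simp: nonunits_def)
      have "?p a \<otimes>\<^bsub>?S\<^esub> ?p b = ?p (a \<otimes>\<^bsub>R\<^esub> b)" using a b(1) by simp
      then show False using n b by (auto simp: nonunits_def)
    qed
  next
    assume aM: "a \<in> M"
    have "?p a \<otimes>\<^bsub>?S\<^esub> Z \<noteq> \<one>\<^bsub>?S\<^esub>" if Z: "Z \<in> carrier ?S" for Z
    proof
      assume e: "?p a \<otimes>\<^bsub>?S\<^esub> Z = \<one>\<^bsub>?S\<^esub>"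
      obtain b where b: "b \<in> carrier R" "Z = ?p b" using elt[OF Z] by blast
      have "?p (a \<otimes>\<^bsub>R\<^esub> b) = ?p \<one>\<^bsub>R\<^esub>" using e b a by simp
      then have "a \<otimes>\<^bsub>R\<^esub> b \<ominus>\<^bsub>R\<^esub> \<one>\<^bsub>R\<^esub> \<in> M" (is "?d \<in> M") using cong[of "a \<otimes>\<^bsub>R\<^esub> b" "\<one>\<^bsub>R\<^esub>"] a b JM by auto
      then have "a \<otimes>\<^bsub>R\<^esub> b \<oplus>\<^bsub>R\<^esub> (\<ominus>\<^bsub>R\<^esub> ?d) \<in> M"
        using add_M M.I_r_closed[OF aM b(1)] additive_subgroup.a_inv_closed[OF M.is_additive_subgroup]
        by blast
      moreover have "a \<otimes>\<^bsub>R\<^esub> b \<oplus>\<^bsub>R\<^esub> (\<ominus>\<^bsub>R\<^esub> ?d) = \<one>\<^bsub>R\<^esub>" using a b(1) by algebra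
      ultimately show False using one_M by simp
    qed
    then show "?p a \<in> nonunits ?S (carrier ?S)" using a by (simp add: nonunits_def)
  qed
  have mc: "m \<in> carrier R" by (rule A.mc)
  have LS: "local_one_dim ?S (?p m)"
  proof (rule p.S.local_one_dimI)
    show "Y \<oplus>\<^bsub>?S\<^esub> Z \<in> nonunits ?S (carrier ?S)"
      if Y: "Y \<in> nonunits ?S (carrier ?S)" and Z: "Z \<in> nonunits ?S (carrier ?S)" for Y Z
    proof -
      obtain a b where ab: "a \<in> carrier R" "Y = ?p a" "b \<in> carrier R" "Z = ?p b"
        using Y Z elt by (metis (no_types, lifting) mem_Collect_eq nonunits_def)
      have "a \<oplus>\<^bsub>R\<^esub> b \<in> M" using add_M nonunit_iff ab Y Z by blast
      then have "?p (a \<oplus>\<^bsub>R\<^esub> b) \<in> nonunits ?S (carrier ?S)" using nonunit_iff ab(1,3) by blast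
      then show ?thesis using ab by simp
    qed
    have "\<one>\<^bsub>R\<^esub> \<notin> J" using JM one_M by blast
    then show "\<one>\<^bsub>?S\<^esub> \<noteq> \<zero>\<^bsub>?S\<^esub>" using zero[OF R.one_closed] by simp
    show "?p m \<in> nonunits ?S (carrier ?S)" using nonunit_iff[OF mc] assms(5) by blast
    show "?p m \<in> nzd ?S" unfolding nzd_def
    proof (intro CollectI conjI ballI impI)
      show "?p m \<in> carrier ?S" using mc by simp
      fix Z assume Z: "Z \<in> carrier ?S" "?p m \<otimes>\<^bsub>?S\<^esub> Z = \<zero>\<^bsub>?S\<^esub>"
      obtain r where r: "r \<in> carrier R" "Z = ?p r" using elt[OF Z(1)] by blast
      have mr: "m \<otimes>\<^bsub>R\<^esub> r \<in> J" using Z(2) r zero[of "m \<otimes>\<^bsub>R\<^esub> r"] mc by simp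
      \<comment> \<open>If \<open>mr\<close> is divisible by \<open>m^(i+1)\<close>, cancelling
        \<open>m\<close> gives divisibility of \<open>r\<close> by \<open>m^i\<close>; so
        \<open>m\<close> stays a nonzerodivisor modulo \<open>J\<close>.\<close>
      have "\<exists>s\<in>carrier R. r = m [^]\<^bsub>R\<^esub> i \<otimes>\<^bsub>R\<^esub> s" for i :: nat
      proof -
        obtain s where s: "s \<in> carrier R" "m \<otimes>\<^bsub>R\<^esub> r = m [^]\<^bsub>R\<^esub> (Suc i) \<otimes>\<^bsub>R\<^esub> s" using J_div[OF mr] by blast
        have "m \<otimes>\<^bsub>R\<^esub> r = m \<otimes>\<^bsub>R\<^esub> (m [^]\<^bsub>R\<^esub> i \<otimes>\<^bsub>R\<^esub> s)" using s mc by (simp add: R.m_ac)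
        then have "r = m [^]\<^bsub>R\<^esub> i \<otimes>\<^bsub>R\<^esub> s"
          by (rule R.nzd_cancel[OF assms(6) r(1), rotated]) (use s(1) mc in simp)
        then show ?thesis using s(1) by blast
      qed
      then have "r \<in> J" using J_iff by blast
      then show "Z = \<zero>\<^bsub>?S\<^esub>" using r zero by blast
    qed
    show "\<not> (\<exists>P0 P1 P2. primeideal P0 ?S \<and> primeideal P1 ?S \<and> primeideal P2 ?S \<and> P0 \<subset> P1 \<and> P1 \<subset> P2)"
    proof
      assume "\<exists>P0 P1 P2. primeideal P0 ?S \<and> primeideal P1 ?S \<and> primeideal P2 ?S \<and> P0 \<subset> P1 \<and> P1 \<subset> P2"
      then obtain P0 P1 P2 where P: "primeideal P0 ?S" "primeideal P1 ?S" "primeideal P2 ?S" "P0 \<subset> P1"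
        "P1 \<subset> P2" by blast
      \<comment> \<open>Preimages of primes of the quotient are primes of \<open>R\<close>, and
        strict inclusions stay strict because the projection is onto.\<close>
      define v where "v P = {r \<in> carrier R. ?p r \<in> P}" for P
      have vp: "primeideal (v P) R" if "primeideal P ?S" for P
        unfolding v_def
        by (rule ring_hom_ring.primeideal_vimage[OF J.rcos_ring_hom_ring R.cring_axioms that])
      have vs: "v P \<subset> v P'" if sub: "P \<subset> P'" and P': "primeideal P' ?S" for P P'
      proof -
        obtain Z where Z: "Z \<in> P'" "Z \<notin> P" using sub by blast
        then have "Z \<in> carrier ?S" using ideal.Icarr[OF primeideal.axioms(1)[OF P']] by blast
        then obtain r where "r \<in> carrier R" "Z = ?p r" using elt by blast
        then have "r \<in> v P'" "r \<notin> v P" using Z by (auto simp: v_def)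
        moreover have "v P \<subseteq> v P'" using sub by (auto simp: v_def)
        ultimately show ?thesis by blast
      qed
      show False using dim vp[OF P(1)] vp[OF P(2)] vp[OF P(3)] vs[OF P(4,2)] vs[OF P(5,3)] by blast
    qed
  qed
  have CR: "adic_hom R (adic_completion R m) A.emb m" by (rule A.completion_adic_hom)
  note e1 = local_one_dim.stable_iff_prime_of_completion[OF L CR]
  note e2 = local_one_dim.stable_iff_prime_of_completion[OF LS adic_hom.adic_hom_quotient[OF CR J J_div]]
  show ?thesis using e1 e2 by blast
qed

end
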